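(* Assume that every (randomized) word RAM algorithm for 3XOR on $n$ input strings requires expected time $\Omega(n^2/f(n))$, where $f(n) = n^{o(1)}$. Then for every $0 < \gamma < 1$, every algorithm for Offline SetDisjointness that works on instances with $|C| = \Theta(n^{2-2\gamma})$, $|A| = |B| = \Theta(n\log n)$, $|S| = O(n^{1-\gamma})$ for all $S \in A \cup B$, and $q = \Theta(n^{1+\gamma}\log n)$ requires expected time $\Omega(n^2/f(n))$.
   Context: The 3XOR problem: given a set $X$ of $n$ binary strings of length $w$ (each fitting in a machine word), decide whether there exist $a, b, c \in X$ with $a \oplus b = c$, where $\oplus$ is bitwise XOR. Offline SetDisjointness: the input is a finite set $C$, finite families $A$ and $B$ of subsets of $C$, and $q \in \mathbb{N}$ pairs $(S, S') \in A \times B$; the task is to find all of the $q$ pairs $(S, S')$ with $S \cap S' \ne \emptyset$. The computational model is the (randomized) word RAM with constant-time arithmetic, shifts, bitwise Boolean operations, random memory access, and uniform random number generation. *)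

theory Defs
  imports "HOL-Probability.Probability"
begin

section \<open>The randomized word RAM\<close>

text \<open>
  A machine with word length \<open>w\<close> operates on words, i.e. natural numbers below \<open>2 ^ w\<close>. It has
  registers and random access memory; a program is a while program whose elementary steps all
  have unit cost.

  The memory is split into banks of \<open>2 ^ w\<close> cells. The bank is fixed in the instruction, so
  a program uses only constantly many banks: they are its (constantly many) arrays.

  \<open>Const r k\<close> loads the constant \<open>k w\<close>. Constants may depend on the word length but on nothing
  else, in particular not on the input (the ``weakly nonuniform'' word RAM in Hagerup's
  terminology). This is how a program can know \<open>w\<close>, and how it can hold a real constant such as
  an exponent \<open>\<gamma>\<close>, to the precision of a word.
\<close>

unbundle bit_operations_syntax

datatype binop = Add | Sub | Mul | Div | Mod | And | Or | Xor | Shl | Shr | Less | Eq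

fun binop_val :: "nat \<Rightarrow> binop \<Rightarrow> nat \<Rightarrow> nat \<Rightarrow> nat" where
  "binop_val w Add x y = (x + y) mod 2 ^ w"
| "binop_val w Sub x y = (x + (2 ^ w - y)) mod 2 ^ w"
| "binop_val w Mul x y = (x * y) mod 2 ^ w"
| "binop_val w Div x y = x div y"
| "binop_val w Mod x y = x mod y"
| "binop_val w And x y = x AND y"
| "binop_val w Or x y = x OR y"
| "binop_val w Xor x y = x XOR y"
| "binop_val w Shl x y = (x * 2 ^ y) mod 2 ^ w"
| "binop_val w Shr x y = x div 2 ^ y"
| "binop_val w Less x y = (if x < y then 1 else 0) mod 2 ^ w"
| "binop_val w Eq x y = (if x = y then 1 else 0) mod 2 ^ w"

datatype com =
    Skip
  | Const nat "nat \<Rightarrow> nat"    \<comment> \<open>target register, constant for each word length\<close>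
  | Op binop nat nat nat      \<comment> \<open>operation, target register, argument registers\<close>
  | Load nat nat nat          \<comment> \<open>target register, bank, address register\<close>
  | Store nat nat nat         \<comment> \<open>bank, address register, source register\<close>
  | Rand nat                  \<comment> \<open>target register\<close>
  | Seq com com
  | Cond nat com com          \<comment> \<open>first branch if the register is nonzero\<close>
  | While nat com             \<comment> \<open>loop as long as the register is nonzero\<close>

text \<open>
  The random number generator is an infinite tape of words, read from left to right by \<open>Rand\<close>.
\<close>

record state =
  regs :: "nat \<Rightarrow> nat"
  mem :: "nat \<Rightarrow> nat \<Rightarrow> nat"
  tape :: "nat stream"

text \<open>
  \<open>exec w c s t s'\<close>: with word length \<open>w\<close>, program \<open>c\<close> started in \<open>s\<close> halts in \<open>s'\<close> after
  exactly \<open>t\<close> steps.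
\<close>

inductive exec :: "nat \<Rightarrow> com \<Rightarrow> state \<Rightarrow> nat \<Rightarrow> state \<Rightarrow> bool" for w :: nat where
  exec_Skip: "exec w Skip s 1 s"
| exec_Const: "exec w (Const r k) s 1 (s\<lparr>regs := (regs s)(r := k w mod 2 ^ w)\<rparr>)"
| exec_Op: "exec w (Op f r a b) s 1
    (s\<lparr>regs := (regs s)(r := binop_val w f (regs s a) (regs s b))\<rparr>)"
| exec_Load: "exec w (Load r m a) s 1 (s\<lparr>regs := (regs s)(r := mem s m (regs s a))\<rparr>)"
| exec_Store: "exec w (Store m a r) s 1
    (s\<lparr>mem := (mem s)(m := (mem s m)(regs s a := regs s r))\<rparr>)"
| exec_Rand: "exec w (Rand r) s 1
    (s\<lparr>regs := (regs s)(r := shd (tape s)), tape := stl (tape s)\<rparr>)"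
| exec_Seq: "exec w c1 s t1 s1 \<Longrightarrow> exec w c2 s1 t2 s2 \<Longrightarrow> exec w (Seq c1 c2) s (t1 + t2) s2"
| exec_Cond_True: "regs s r \<noteq> 0 \<Longrightarrow> exec w c1 s t s' \<Longrightarrow> exec w (Cond r c1 c2) s (t + 1) s'"
| exec_Cond_False: "regs s r = 0 \<Longrightarrow> exec w c2 s t s' \<Longrightarrow> exec w (Cond r c1 c2) s (t + 1) s'"
| exec_While_False: "regs s r = 0 \<Longrightarrow> exec w (While r c) s 1 s"
| exec_While_True: "regs s r \<noteq> 0 \<Longrightarrow> exec w c s t1 s1 \<Longrightarrow> exec w (While r c) s1 t2 s2 \<Longrightarrow>
    exec w (While r c) s (t1 + t2 + 1) s2"

inductive_cases exec_SkipE: "exec w Skip s t s'"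
inductive_cases exec_ConstE: "exec w (Const r k) s t s'"
inductive_cases exec_OpE: "exec w (Op f r a b) s t s'"
inductive_cases exec_LoadE: "exec w (Load r m a) s t s'"
inductive_cases exec_StoreE: "exec w (Store m a r) s t s'"
inductive_cases exec_RandE: "exec w (Rand r) s t s'"
inductive_cases exec_SeqE: "exec w (Seq c1 c2) s t s'"
inductive_cases exec_CondE: "exec w (Cond r c1 c2) s t s'"
inductive_cases exec_WhileE: "exec w (While r c) s t s'"

lemma exec_deterministic:
  assumes "exec w c s t s'" and "exec w c s u s''"
  shows "u = t \<and> s'' = s'"
  using assms
proof (induction arbitrary: u s'' rule: exec.induct)
  case (exec_Seq c1 s t1 s1 c2 t2 s2)
  obtain u1 u2 r1 where r: "u = u1 + u2" "exec w c1 s u1 r1" "exec w c2 r1 u2 s''"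
    using exec_Seq.prems by (rule exec_SeqE)
  have "u1 = t1 \<and> r1 = s1" using exec_Seq.IH(1) r(2) .
  then show ?case using exec_Seq.IH(2)[of u2 s''] r by simp
next
  case (exec_Cond_True s r c1 t s' c2)
  obtain u1 where r: "u = u1 + 1" "exec w c1 s u1 s''"
    using exec_Cond_True.prems exec_Cond_True.hyps(1) by (auto elim: exec_CondE)
  show ?case using exec_Cond_True.IH[OF r(2)] r(1) by simp
next
  case (exec_Cond_False s r c2 t s' c1)
  obtain u1 where r: "u = u1 + 1" "exec w c2 s u1 s''"
    using exec_Cond_False.prems exec_Cond_False.hyps(1) by (auto elim: exec_CondE)
  show ?case using exec_Cond_False.IH[OF r(2)] r(1) by simp
next
  case (exec_While_False s r c)
  from exec_While_False.prems show ?case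
    by (rule exec_WhileE) (use exec_While_False.hyps in simp_all)
next
  case (exec_While_True s r c t1 s1 t2 s2)
  obtain u1 u2 r1 where r: "u = u1 + u2 + 1" "exec w c s u1 r1" "exec w (While r c) r1 u2 s''"
    using exec_While_True.prems
    by (rule exec_WhileE) (use exec_While_True.hyps(1) in simp_all)
  have "u1 = t1 \<and> r1 = s1" using exec_While_True.IH(1) r(2) .
  then show ?case using exec_While_True.IH(2)[of u2 s''] r by simp
qed (auto elim: exec_SkipE exec_ConstE exec_OpE exec_LoadE exec_StoreE exec_RandE)

text \<open>
  The input is a list of words at the beginning of bank 0; everything else is 0 initially. The
  output is left in bank 1.
\<close>

definition init_state :: "nat list \<Rightarrow> nat stream \<Rightarrow> state" where
  "init_state xs \<omega> =
     \<lparr>regs = (\<lambda>_. 0), mem = (\<lambda>m a. if m = 0 \<and> a < length xs then xs ! a else 0), tape = \<omega>\<rparr>"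

definition fits :: "nat \<Rightarrow> nat list \<Rightarrow> bool" where
  "fits w xs \<longleftrightarrow> length xs \<le> 2 ^ w \<and> (\<forall>x\<in>set xs. x < 2 ^ w)"

text \<open>Independent, uniformly distributed words.\<close>

definition tape_space :: "nat \<Rightarrow> nat stream measure" where
  "tape_space w = stream_space (measure_pmf (pmf_of_set {..<2 ^ w}))"

text \<open>By determinism, the infimum is over at most one number; it is \<open>\<infinity>\<close> if \<open>c\<close> does not halt.\<close>

definition run_time :: "nat \<Rightarrow> com \<Rightarrow> state \<Rightarrow> ennreal" where
  "run_time w c s = (INF t\<in>{t. \<exists>s'. exec w c s t s'}. of_nat t)"

definition expected_time :: "nat \<Rightarrow> com \<Rightarrow> nat list \<Rightarrow> ennreal" where
  "expected_time w c xs = (\<integral>\<^sup>+ \<omega>. run_time w c (init_state xs \<omega>) \<partial>tape_space w)"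


section \<open>Problems, algorithms and lower bounds\<close>

text \<open>
  For a size parameter \<open>n\<close> and a word length \<open>w\<close>, a problem is a set of instances, each given by
  the input and the set of admissible contents of the output bank.
\<close>

type_synonym problem = "nat \<Rightarrow> nat \<Rightarrow> (nat list \<times> (nat \<Rightarrow> nat) set) set"

definition instances :: "(nat \<Rightarrow> nat) \<Rightarrow> problem \<Rightarrow> nat \<Rightarrow> (nat list \<times> (nat \<Rightarrow> nat) set) set" where
  "instances W p n = {(xs, outs) \<in> p n (W n). fits (W n) xs}"

text \<open>
  Instances with parameter \<open>n\<close> are processed on a machine with word length \<open>W n\<close>. A randomized
  algorithm halts with a correct output almost surely; only its running time is random.
\<close>

definition solves :: "(nat \<Rightarrow> nat) \<Rightarrow> problem \<Rightarrow> com \<Rightarrow> bool" where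
  "solves W p c \<longleftrightarrow> (\<forall>n. \<forall>(xs, outs)\<in>instances W p n.
     AE \<omega> in tape_space (W n). \<exists>t s'. exec (W n) c (init_state xs \<omega>) t s' \<and> mem s' 1 \<in> outs)"

definition worst_expected_time :: "(nat \<Rightarrow> nat) \<Rightarrow> problem \<Rightarrow> com \<Rightarrow> nat \<Rightarrow> ennreal" where
  "worst_expected_time W p c n = (SUP (xs, outs)\<in>instances W p n. expected_time (W n) c xs)"

text \<open>
  The following says that \<open>T\<close> is \<open>\<Omega>(g)\<close>, for \<open>T\<close> with values in \<open>[0, \<infinity>]\<close> (where the Landau
  symbols of the library are not available).
\<close>

definition lower_bound :: "(nat \<Rightarrow> ennreal) \<Rightarrow> (nat \<Rightarrow> real) \<Rightarrow> bool" where
  "lower_bound T g \<longleftrightarrow> (\<exists>k>0. eventually (\<lambda>n. ennreal (k * g n) \<le> T n) sequentially)"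

definition requires_expected_time :: "(nat \<Rightarrow> nat) \<Rightarrow> problem \<Rightarrow> (nat \<Rightarrow> real) \<Rightarrow> bool" where
  "requires_expected_time W p g \<longleftrightarrow>
     (\<forall>c. solves W p c \<longrightarrow> lower_bound (worst_expected_time W p c) g)"

text \<open>\<open>f(n) = n\<^bsup>o(1)\<^esup>\<close>\<close>

definition subpolynomial :: "(nat \<Rightarrow> real) \<Rightarrow> bool" where
  "subpolynomial f \<longleftrightarrow>
     (\<exists>e. e \<longlonglongrightarrow> 0 \<and> eventually (\<lambda>n. f n = real n powr e n) sequentially)"

text \<open>
  Words of \<open>2 log n\<close> bits suffice to address the instances below when \<open>n\<close> is large. The word
  length is otherwise arbitrary, as long as it is polynomial in \<open>n\<close>.
\<close>

definition word_length :: "(nat \<Rightarrow> nat) \<Rightarrow> bool" where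
  "word_length W \<longleftrightarrow>
     eventually (\<lambda>n. 2 * log 2 (real n) \<le> real (W n)) sequentially \<and>
     (\<exists>d::nat. (\<lambda>n. real (W n)) \<in> O(\<lambda>n. real n ^ d))"


section \<open>3XOR\<close>

text \<open>
  Bit strings of length \<open>w\<close> are identified with words; shorter strings are padded by zeros.
\<close>

definition has_xor_triple :: "nat set \<Rightarrow> bool" where
  "has_xor_triple X \<longleftrightarrow> (\<exists>a\<in>X. \<exists>b\<in>X. \<exists>c\<in>X. a XOR b = c)"

definition three_xor :: problem where
  "three_xor n w =
     {(n # xs, {out. out 0 = (if has_xor_triple (set xs) then 1 else 0)}) | xs.
        length xs = n \<and> distinct xs \<and> set xs \<subseteq> {..<2 ^ w}}"


section \<open>Offline SetDisjointness\<close>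

text \<open>
  The universe \<open>C\<close> is \<open>{..<m}\<close>. The families \<open>A\<close> and \<open>B\<close> are lists of sets, each set being given
  by a list of its elements without repetitions, in any order. A query \<open>(i, j)\<close> asks for the
  pair of the \<open>i\<close>-th set of \<open>A\<close> and the \<open>j\<close>-th set of \<open>B\<close>.
\<close>

definition sd_instance ::
  "nat \<Rightarrow> nat list list \<Rightarrow> nat list list \<Rightarrow> (nat \<times> nat) list \<Rightarrow> bool" where
  "sd_instance m A B Q \<longleftrightarrow>
     (\<forall>S\<in>set A \<union> set B. distinct S \<and> set S \<subseteq> {..<m}) \<and>
     (\<forall>(i, j)\<in>set Q. i < length A \<and> j < length B)"

definition sd_input ::
  "nat \<Rightarrow> nat list list \<Rightarrow> nat list list \<Rightarrow> (nat \<times> nat) list \<Rightarrow> nat list" where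
  "sd_input m A B Q =
     [m, length A, length B, length Q] @
     concat (map (\<lambda>S. length S # S) A) @ concat (map (\<lambda>S. length S # S) B) @
     concat (map (\<lambda>(i, j). [i, j]) Q)"

definition sd_solution ::
  "nat list list \<Rightarrow> nat list list \<Rightarrow> (nat \<times> nat) list \<Rightarrow> nat set" where
  "sd_solution A B Q =
     {k. k < length Q \<and> set (A ! fst (Q ! k)) \<inter> set (B ! snd (Q ! k)) \<noteq> {}}"

text \<open>
  The output is the number of intersecting queries, followed by an enumeration of their
  positions in \<open>Q\<close>, each exactly once, in any order.
\<close>

definition sd_outputs ::
  "nat list list \<Rightarrow> nat list list \<Rightarrow> (nat \<times> nat) list \<Rightarrow> (nat \<Rightarrow> nat) set" where
  "sd_outputs A B Q =
     {out. out 0 = card (sd_solution A B Q) \<and> bij_betw out {1..out 0} (sd_solution A B Q)}"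

text \<open>\<open>x = \<Theta>(y)\<close> with hidden constants \<open>1 / K\<close> and \<open>K\<close>\<close>

definition theta_within :: "real \<Rightarrow> real \<Rightarrow> real \<Rightarrow> bool" where
  "theta_within K x y \<longleftrightarrow> y / K \<le> x \<and> x \<le> K * y"

text \<open>
  All \<open>\<Theta>\<close> and \<open>O\<close> bounds share the hidden constant \<open>K\<close>; the set of instances grows with \<open>K\<close>. For
  small \<open>K\<close> there need not be any, so lower bounds are meant for all sufficiently large \<open>K\<close>.
\<close>

definition set_disjointness :: "real \<Rightarrow> real \<Rightarrow> problem" where
  "set_disjointness \<gamma> K n w =
     {(sd_input m A B Q, sd_outputs A B Q) | m A B Q.
        sd_instance m A B Q \<and>
        theta_within K (real m) (real n powr (2 - 2 * \<gamma>)) \<and>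
        length A = length B \<and>
        theta_within K (real (length A)) (real n * ln (real n)) \<and>
        (\<forall>S\<in>set A \<union> set B. real (card (set S)) \<le> K * real n powr (1 - \<gamma>)) \<and>
        theta_within K (real (length Q)) (real n powr (1 + \<gamma>) * ln (real n))}"

end

theory Submission
  imports Defs "HOL-Real_Asymp.Real_Asymp"
begin

text \<open>
  Let \<open>h\<close> be a random GF(2)-linear hash function with about \<open>n\<^bsup>\<gamma>\<^esup>\<close> values. If \<open>a XOR b = c\<close>, then
  \<open>h b = h a XOR h c\<close>, so \<open>c\<close> and the bucket of \<open>a\<close> determine the bucket of \<open>b\<close>. Sort \<open>X\<close> by \<open>h\<close> and
  cut it into chunks of \<open>s \<approx> n\<^bsup>1 - \<gamma>\<^esup>\<close> words. If the sum of the squares of the numbers of chunks that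
  meet a bucket is \<open>O(n\<^bsup>\<gamma>\<^esup>)\<close>, which holds with constant probability, then only \<open>O(n\<^bsup>1 + \<gamma>\<^esup>)\<close> triples of a
  word \<open>c\<close> and two chunks \<open>I\<close>, \<open>J\<close> have to be examined.

  To examine them, take a second linear function \<open>g\<close> with values below \<open>U\<^sup>2\<close>, where \<open>U = 4 s\<close>, and write
  \<open>g c = p U + q\<close>. Some \<open>a \<in> I\<close>, \<open>b \<in> J\<close> satisfy \<open>g (a XOR b XOR c) = 0\<close> if and only if the sets
  \<open>{g a XOR p U | a \<in> I}\<close> and \<open>{g b XOR q | b \<in> J}\<close> intersect. There are only \<open>U\<close> such sets for each
  chunk and each family, although they serve all \<open>c\<close>. A triple without a solution passes this test with probability at
  most \<open>s\<^sup>2 / U\<^sup>2 = 1 / 16\<close>, hence it passes \<open>O(log n)\<close> independent tests with polynomially small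
  probability. A triple that passes all of them is searched exhaustively.

  All random words are drawn before the only call of the algorithm for Offline SetDisjointness. Hence
  the expected time is an average, over finitely many words, of the expected time of that call plus
  a deterministic overhead of \<open>n\<^bsup>2 - \<Omega>(1)\<^esup>\<close>.
\<close>

section \<open>A language of bounded loops\<close>

text \<open>The notion of a solution shapes the proof. A randomized algorithm has to be correct
  almost surely, so hashing may only cost time: when it fails, cubic brute force takes over, and the
  probability of this has to be small enough to pay for it. This is why there are \<open>L\<close>
  tries of the first function and \<open>L\<close> repetitions of the second, with
  \<open>n < 2 ^ L\<close> and failure probabilities 1/8 and 1/16 each. Moreover, the given
  algorithm promises nothing on inputs of the wrong shape and might not even halt on them, so the
  sum of squares is tested before the call. Cutting into chunks, rather than using the buckets
  themselves, bounds the size of every set without exception and fixes the number of sets. The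
  number of chunks charged to a bucket is at least 1 by definition, which yields the lower bound on
  the number of queries. Finally, the time of the call has no a priori bound, not even a finite one,
  so it stays a single extended real summand and only the overhead is estimated by real
  arithmetic.\<close>

datatype exp = V nat | N "nat \<Rightarrow> nat" | B binop exp exp | Rd nat exp

text \<open>Since every loop is bounded, effect and cost are total functions of the initial state
  and termination never has to be argued. The only unbounded search happens inside the given
  algorithm.\<close>

datatype loopc =
    Nop
  | Asg nat exp           (infix "::=" 62)
  | Sto nat exp exp
  | Rnd nat
  | Sq loopc loopc        (infixr ";;" 60)
  | Ite exp loopc loopc
  | For nat exp loopc

fun eval :: "nat \<Rightarrow> exp \<Rightarrow> state \<Rightarrow> nat" where
  "eval w (V r) \<sigma> = regs \<sigma> r"
| "eval w (N k) \<sigma> = k w mod 2 ^ w"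
| "eval w (B f a b) \<sigma> = binop_val w f (eval w a \<sigma>) (eval w b \<sigma>)"
| "eval w (Rd m a) \<sigma> = mem \<sigma> m (eval w a \<sigma>)"

fun iter :: "(nat \<Rightarrow> 's \<Rightarrow> 's) \<Rightarrow> nat \<Rightarrow> 's \<Rightarrow> 's" where
  "iter f 0 \<sigma> = \<sigma>"
| "iter f (Suc n) \<sigma> = f n (iter f n \<sigma>)"

definition set_reg :: "nat \<Rightarrow> nat \<Rightarrow> state \<Rightarrow> state" where
  "set_reg r x \<sigma> = \<sigma>\<lparr>regs := (regs \<sigma>)(r := x)\<rparr>"

text \<open>The bound of a loop is evaluated once and reduced modulo \<open>2 ^ w\<close>, because
  nothing guarantees that a register holds a number below \<open>2 ^ w\<close>, and a counter modulo
  \<open>2 ^ w\<close> could never reach a larger bound. The compiled loop performs the same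
  reduction by adding 0.\<close>

primrec run :: "nat \<Rightarrow> loopc \<Rightarrow> state \<Rightarrow> state" where
  "run w Nop = (\<lambda>\<sigma>. \<sigma>)"
| "run w (r ::= e) = (\<lambda>\<sigma>. set_reg r (eval w e \<sigma>) \<sigma>)"
| "run w (Sto m a e) = (\<lambda>\<sigma>. \<sigma>\<lparr>mem := (mem \<sigma>)(m := (mem \<sigma> m)(eval w a \<sigma> := eval w e \<sigma>))\<rparr>)"
| "run w (Rnd r) = (\<lambda>\<sigma>. \<sigma>\<lparr>regs := (regs \<sigma>)(r := shd (tape \<sigma>)), tape := stl (tape \<sigma>)\<rparr>)"
| "run w (c ;; d) = (\<lambda>\<sigma>. run w d (run w c \<sigma>))"
| "run w (Ite e c d) = (\<lambda>\<sigma>. if eval w e \<sigma> \<noteq> 0 then run w c \<sigma> else run w d \<sigma>)"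
| "run w (For i e c) = (\<lambda>\<sigma>. iter (\<lambda>k \<tau>. run w c (set_reg i k \<tau>)) (eval w e \<sigma> mod 2 ^ w) \<sigma>)"

fun ecost :: "exp \<Rightarrow> nat" where
  "ecost (V r) = 1"
| "ecost (N k) = 1"
| "ecost (B f a b) = ecost a + ecost b + 1"
| "ecost (Rd m a) = ecost a + 1"

text \<open>The exact number of steps of the compiled code. The 4 steps of a loop are clearing the
  counter, reducing the bound, the first comparison and the last test; the 5 steps of an iteration
  are the test, copying the counter, loading 1, incrementing and comparing.\<close>

primrec cost :: "nat \<Rightarrow> loopc \<Rightarrow> state \<Rightarrow> nat" where
  "cost w Nop = (\<lambda>\<sigma>. 1)"
| "cost w (r ::= e) = (\<lambda>\<sigma>. ecost e + 1)"
| "cost w (Sto m a e) = (\<lambda>\<sigma>. ecost a + ecost e + 1)"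
| "cost w (Rnd r) = (\<lambda>\<sigma>. 1)"
| "cost w (c ;; d) = (\<lambda>\<sigma>. cost w c \<sigma> + cost w d (run w c \<sigma>))"
| "cost w (Ite e c d) = (\<lambda>\<sigma>. ecost e + 1 + (if eval w e \<sigma> \<noteq> 0 then cost w c \<sigma> else cost w d \<sigma>))"
| "cost w (For i e c) = (\<lambda>\<sigma>. ecost e + 4 +
     (\<Sum>k<eval w e \<sigma> mod 2 ^ w.
        5 + cost w c (set_reg i k (iter (\<lambda>k \<tau>. run w c (set_reg i k \<tau>)) k \<sigma>))))"


section \<open>Compilation\<close>

text \<open>
  Three disjoint classes of registers: variables, a stack of temporaries, and registers that are
  left to a subroutine.
\<close>

definition var :: "nat \<Rightarrow> nat" where "var r = 3 * r"

definition tmp :: "nat \<Rightarrow> nat" where "tmp j = 3 * j + 1"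

definition sub :: "nat \<Rightarrow> nat" where "sub r = 3 * r + 2"

lemma register_classes [simp]:
  "var r = var i \<longleftrightarrow> r = i" "tmp r = tmp i \<longleftrightarrow> r = i" "sub r = sub i \<longleftrightarrow> r = i"
  "var r \<noteq> tmp i" "tmp i \<noteq> var r" "var r \<noteq> sub i" "sub i \<noteq> var r" "tmp r \<noteq> sub i" "sub i \<noteq> tmp r"
  unfolding var_def tmp_def sub_def by presburger+

fun cexp :: "exp \<Rightarrow> nat \<Rightarrow> com" where
  "cexp (V r) j = Op Or (tmp j) (var r) (var r)"
| "cexp (N k) j = Const (tmp j) k"
| "cexp (B f a b) j = Seq (cexp a j) (Seq (cexp b (Suc j))
     (Op f (tmp j) (tmp j) (tmp (Suc j))))"
| "cexp (Rd m a) j = Seq (cexp a j) (Load (tmp j) m (tmp j))"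

text \<open>
  A loop keeps its bound and its counter in the temporaries \<open>j\<close> and \<open>Suc j\<close>, so that the body may
  overwrite the loop variable; the loop condition and the constant 1 are in the next two.
\<close>

primrec compile :: "loopc \<Rightarrow> nat \<Rightarrow> com" where
  "compile Nop j = Skip"
| "compile (r ::= e) j = Seq (cexp e j) (Op Or (var r) (tmp j) (tmp j))"
| "compile (Sto m a e) j = Seq (cexp a j) (Seq (cexp e (Suc j)) (Store m (tmp j) (tmp (Suc j))))"
| "compile (Rnd r) j = Rand (var r)"
| "compile (c ;; d) j = Seq (compile c j) (compile d j)"
| "compile (Ite e c d) j = Seq (cexp e j) (Cond (tmp j) (compile c j) (compile d j))"
| "compile (For i e c) j =
     Seq (cexp e j) (Seq (Const (tmp (j + 1)) (\<lambda>_. 0))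
     (Seq (Op Add (tmp j) (tmp j) (tmp (j + 1)))
     (Seq (Op Less (tmp (j + 2)) (tmp (j + 1)) (tmp j))
     (While (tmp (j + 2))
       (Seq (Op Or (var i) (tmp (j + 1)) (tmp (j + 1)))
       (Seq (compile c (j + 2))
       (Seq (Const (tmp (j + 2)) (\<lambda>_. 1))
       (Seq (Op Add (tmp (j + 1)) (tmp (j + 1)) (tmp (j + 2)))
            (Op Less (tmp (j + 2)) (tmp (j + 1)) (tmp j))))))))))"

text \<open>Temporaries below \<open>j\<close> have to survive, since enclosing expressions and
  loops keep pending values there. Registers of the class \<open>sub\<close> have to survive because
  they must still be 0 when the subroutine starts.\<close>

definition implements :: "nat \<Rightarrow> state \<Rightarrow> state \<Rightarrow> state \<Rightarrow> state \<Rightarrow> bool" where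
  "implements j \<sigma> s \<sigma>' s' \<longleftrightarrow>
     mem s' = mem \<sigma>' \<and> tape s' = tape \<sigma>' \<and> (\<forall>r. regs s' (var r) = regs \<sigma>' r) \<and>
     (\<forall>r. regs s' (sub r) = regs s (sub r)) \<and>
     (\<forall>i<j. regs s' (tmp i) = regs s (tmp i))"

definition represents :: "state \<Rightarrow> state \<Rightarrow> bool" where
  "represents s \<sigma> \<longleftrightarrow> mem s = mem \<sigma> \<and> tape s = tape \<sigma> \<and> (\<forall>r. regs s (var r) = regs \<sigma> r)"

lemma cexp_correct:
  assumes "represents s \<sigma>"
  shows "\<exists>\<rho>. exec w (cexp e j) s (ecost e) (s\<lparr>regs := \<rho>\<rparr>) \<and> \<rho> (tmp j) = eval w e \<sigma> \<and>
    (\<forall>r. (\<forall>i\<ge>j. r \<noteq> tmp i) \<longrightarrow> \<rho> r = regs s r)"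
  using assms
proof (induction e arbitrary: s j)
  case (V r)
  show ?case
  proof (rule exI, rule conjI)
    show "exec w (cexp (V r) j) s (ecost (V r))
       (s\<lparr>regs := (regs s)(tmp j := binop_val w Or (regs s (var r)) (regs s (var r)))\<rparr>)"
      unfolding cexp.simps ecost.simps by (rule exec_Op)
  qed (use V in \<open>auto simp: represents_def\<close>)
next
  case (N k)
  have "exec w (cexp (N k) j) s (ecost (N k)) (s\<lparr>regs := (regs s)(tmp j := k w mod 2 ^ w)\<rparr>)"
    unfolding cexp.simps ecost.simps by (rule exec_Const)
  then show ?case by (intro exI conjI, assumption) simp_all
next
  case (B f a b)
  obtain \<rho> where \<rho>: "exec w (cexp a j) s (ecost a) (s\<lparr>regs := \<rho>\<rparr>)" "\<rho> (tmp j) = eval w a \<sigma>"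
    "\<And>r. (\<forall>i\<ge>j. r \<noteq> tmp i) \<Longrightarrow> \<rho> r = regs s r"
    using B.IH(1)[OF B.prems, of j] by blast
  have "represents (s\<lparr>regs := \<rho>\<rparr>) \<sigma>"
    using B.prems \<rho>(3) by (auto simp: represents_def)
  from B.IH(2)[OF this, of "Suc j"] obtain \<rho>' where
    \<rho>': "exec w (cexp b (Suc j)) (s\<lparr>regs := \<rho>\<rparr>) (ecost b) (s\<lparr>regs := \<rho>'\<rparr>)"
      "\<rho>' (tmp (Suc j)) = eval w b \<sigma>"
    "\<And>r. (\<forall>i\<ge>Suc j. r \<noteq> tmp i) \<Longrightarrow> \<rho>' r = \<rho> r"
    by auto
  have 1: "\<rho>' (tmp j) = eval w a \<sigma>"
    using \<rho>'(3)[of "tmp j"] \<rho>(2) by simp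
  have "exec w (cexp (B f a b) j) s (ecost a + (ecost b + 1))
     (s\<lparr>regs := \<rho>'\<rparr>\<lparr>regs := (regs (s\<lparr>regs := \<rho>'\<rparr>))(tmp j :=
        binop_val w f (regs (s\<lparr>regs := \<rho>'\<rparr>) (tmp j)) (regs (s\<lparr>regs := \<rho>'\<rparr>) (tmp (Suc j))))\<rparr>)"
    unfolding cexp.simps by (rule exec_Seq[OF \<rho>(1) exec_Seq[OF \<rho>'(1) exec_Op]])
  then have 2: "exec w (cexp (B f a b) j) s (ecost (B f a b))
     (s\<lparr>regs := \<rho>'(tmp j := eval w (B f a b) \<sigma>)\<rparr>)"
    using 1 \<rho>'(2) by (simp add: add.assoc)
  have 3: "\<rho>' r = regs s r" if "\<forall>i\<ge>j. r \<noteq> tmp i" for r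
    using that \<rho>'(3)[of r] \<rho>(3)[of r] by auto
  show ?case by (intro exI conjI, rule 2) (use 3 in simp_all)
next
  case (Rd m a)
  obtain \<rho> where \<rho>: "exec w (cexp a j) s (ecost a) (s\<lparr>regs := \<rho>\<rparr>)" "\<rho> (tmp j) = eval w a \<sigma>"
    "\<And>r. (\<forall>i\<ge>j. r \<noteq> tmp i) \<Longrightarrow> \<rho> r = regs s r"
    using Rd.IH[OF Rd.prems, of j] by blast
  have "exec w (cexp (Rd m a) j) s (ecost a + 1)
     (s\<lparr>regs := \<rho>\<rparr>\<lparr>regs := (regs (s\<lparr>regs := \<rho>\<rparr>))(tmp j :=
        mem (s\<lparr>regs := \<rho>\<rparr>) m (regs (s\<lparr>regs := \<rho>\<rparr>) (tmp j)))\<rparr>)"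
    unfolding cexp.simps by (rule exec_Seq[OF \<rho>(1) exec_Load])
  then have 1: "exec w (cexp (Rd m a) j) s (ecost (Rd m a))
     (s\<lparr>regs := \<rho>(tmp j := eval w (Rd m a) \<sigma>)\<rparr>)"
    using Rd.prems \<rho>(2) by (simp add: represents_def)
  show ?case by (intro exI conjI, rule 1) (use \<rho>(3) in simp_all)
qed

lemma cexp_correct':
  assumes "represents s \<sigma>"
  obtains s' where "exec w (cexp e j) s (ecost e) s'" "regs s' (tmp j) = eval w e \<sigma>"
    "implements j \<sigma> s \<sigma> s'" "represents s' \<sigma>"
proof -
  obtain \<rho> where \<rho>: "exec w (cexp e j) s (ecost e) (s\<lparr>regs := \<rho>\<rparr>)" "\<rho> (tmp j) = eval w e \<sigma>"
    "\<And>r. (\<forall>i\<ge>j. r \<noteq> tmp i) \<Longrightarrow> \<rho> r = regs s r"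
    using cexp_correct[OF assms] by blast
  show thesis
    by (rule that[OF \<rho>(1)]) (use \<rho> assms in \<open>auto simp: implements_def represents_def\<close>)
qed

lemma implements_represents: "implements j \<sigma> s \<sigma>' s' \<Longrightarrow> represents s' \<sigma>'"
  by (auto simp: implements_def represents_def)

lemma implements_trans:
  "implements j \<sigma> s \<sigma>1 s1 \<Longrightarrow> implements j' \<sigma>1 s1 \<sigma>' s' \<Longrightarrow> j \<le> j' \<Longrightarrow> implements j \<sigma> s \<sigma>' s'"
  by (auto simp: implements_def)

lemma compile_correct:
  assumes "represents s \<sigma>"
  shows "\<exists>s'. exec w (compile c j) s (cost w c \<sigma>) s' \<and> implements j \<sigma> s (run w c \<sigma>) s'"
  using assms
proof (induction c arbitrary: s \<sigma> j)
  case Nop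
  have "exec w Skip s 1 s" by (rule exec_Skip)
  then show ?case using Nop by (auto simp: implements_def represents_def)
next
  case (Asg r e)
  obtain s1 where s1: "exec w (cexp e j) s (ecost e) s1" "regs s1 (tmp j) = eval w e \<sigma>"
    "implements j \<sigma> s \<sigma> s1"
    using cexp_correct'[OF Asg] by metis
  have "exec w (compile (r ::= e) j) s (ecost e + 1) (s1\<lparr>regs := (regs s1)(var r :=
      binop_val w Or (regs s1 (tmp j)) (regs s1 (tmp j)))\<rparr>)"
    unfolding compile.simps by (rule exec_Seq[OF s1(1) exec_Op])
  then show ?case using s1
    by (auto simp: implements_def set_reg_def intro!: exI)
next
  case (Sto m a e)
  obtain s1 where s1: "exec w (cexp a j) s (ecost a) s1" "regs s1 (tmp j) = eval w a \<sigma>"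
    "implements j \<sigma> s \<sigma> s1" "represents s1 \<sigma>"
    using cexp_correct'[OF Sto] by metis
  obtain s2 where s2: "exec w (cexp e (Suc j)) s1 (ecost e) s2" "regs s2 (tmp (Suc j)) = eval w e \<sigma>"
    "implements (Suc j) \<sigma> s1 \<sigma> s2" "represents s2 \<sigma>"
    using cexp_correct'[OF s1(4)] by metis
  have "exec w (compile (Sto m a e) j) s (ecost a + (ecost e + 1))
     (s2\<lparr>mem := (mem s2)(m := (mem s2 m)(regs s2 (tmp j) := regs s2 (tmp (Suc j))))\<rparr>)"
    unfolding compile.simps by (rule exec_Seq[OF s1(1) exec_Seq[OF s2(1) exec_Store]])
  moreover have "regs s2 (tmp j) = eval w a \<sigma>"
    using s1(2) s2(3) by (auto simp: implements_def)
  moreover have "implements j \<sigma> s \<sigma> s2" using s1 s2 implements_trans by (meson lessI less_imp_le)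
  ultimately show ?case using s2
    by (auto simp: implements_def add.assoc intro!: exI)
next
  case (Rnd r)
  have "exec w (compile (Rnd r) j) s 1 (s\<lparr>regs := (regs s)(var r := shd (tape s)), tape := stl (tape s)\<rparr>)"
    unfolding compile.simps by (rule exec_Rand)
  then show ?case using Rnd
    by (auto simp: implements_def represents_def intro!: exI)
next
  case (Sq c d)
  obtain s1 where s1: "exec w (compile c j) s (cost w c \<sigma>) s1" "implements j \<sigma> s (run w c \<sigma>) s1"
    using Sq.IH(1)[OF Sq.prems] by blast
  obtain s2 where s2: "exec w (compile d j) s1 (cost w d (run w c \<sigma>)) s2"
    "implements j (run w c \<sigma>) s1 (run w d (run w c \<sigma>)) s2"
    using Sq.IH(2)[OF implements_represents[OF s1(2)]] by blast
  have "exec w (compile (c ;; d) j) s (cost w c \<sigma> + cost w d (run w c \<sigma>)) s2"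
    unfolding compile.simps by (rule exec_Seq[OF s1(1) s2(1)])
  then show ?case using implements_trans[OF s1(2) s2(2)] by auto
next
  case (Ite e c d)
  obtain s1 where s1: "exec w (cexp e j) s (ecost e) s1" "regs s1 (tmp j) = eval w e \<sigma>"
    "implements j \<sigma> s \<sigma> s1" "represents s1 \<sigma>"
    using cexp_correct'[OF Ite.prems] by metis
  show ?case
  proof (cases "eval w e \<sigma> = 0")
    case True
    obtain s2 where s2: "exec w (compile d j) s1 (cost w d \<sigma>) s2" "implements j \<sigma> s1 (run w d \<sigma>) s2"
      using Ite.IH(2)[OF s1(4)] by blast
    have "exec w (compile (Ite e c d) j) s (ecost e + (cost w d \<sigma> + 1)) s2"
      unfolding compile.simps by (rule exec_Seq[OF s1(1) exec_Cond_False[OF _ s2(1)]]) (use s1 True in simp)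
    then show ?thesis using implements_trans[OF s1(3) s2(2)] True by (auto simp: add_ac)
  next
    case False
    obtain s2 where s2: "exec w (compile c j) s1 (cost w c \<sigma>) s2" "implements j \<sigma> s1 (run w c \<sigma>) s2"
      using Ite.IH(1)[OF s1(4)] by blast
    have "exec w (compile (Ite e c d) j) s (ecost e + (cost w c \<sigma> + 1)) s2"
      unfolding compile.simps by (rule exec_Seq[OF s1(1) exec_Cond_True[OF _ s2(1)]]) (use s1 False in simp)
    then show ?thesis using implements_trans[OF s1(3) s2(2)] False by (auto simp: add_ac)
  qed
next
  case (For i e c)
  define K where "K = eval w e \<sigma> mod 2 ^ w"
  define f where "f = (\<lambda>k \<tau>. run w c (set_reg i k \<tau>))"
  define body where "body = Seq (Op Or (var i) (tmp (j + 1)) (tmp (j + 1)))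
       (Seq (compile c (j + 2))
       (Seq (Const (tmp (j + 2)) (\<lambda>_. 1))
       (Seq (Op Add (tmp (j + 1)) (tmp (j + 1)) (tmp (j + 2)))
            (Op Less (tmp (j + 2)) (tmp (j + 1)) (tmp j)))))"
  \<comment> \<open>The comparison is reduced modulo \<open>2 ^ w\<close> and hence always 0 if
    \<open>w = 0\<close>. This is consistent, for then \<open>K = 0\<close> as well and the loop is
    never entered.\<close>
  define inv where "inv = (\<lambda>k s'. implements j \<sigma> s (iter f k \<sigma>) s' \<and> regs s' (tmp j) = K \<and>
      regs s' (tmp (j + 1)) = k \<and> regs s' (tmp (j + 2)) = (if k < K then 1 else 0) mod 2 ^ w)"
  define T where "T = (\<lambda>k. 5 + cost w c (set_reg i k (iter f k \<sigma>)))"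
  \<comment> \<open>\<open>T k\<close> includes the test of the loop condition, so the body alone
    takes \<open>T k - 1\<close> steps.\<close>
  have step: "\<exists>s2. exec w body s1 (T k - 1) s2 \<and> inv (Suc k) s2" if inv: "inv k s1" and "k < K" for k s1
  proof -
    define s2 where "s2 = s1\<lparr>regs := (regs s1)(var i := k)\<rparr>"
    have "exec w (Op Or (var i) (tmp (j + 1)) (tmp (j + 1))) s1 1 (s1\<lparr>regs := (regs s1)(var i :=
      binop_val w Or (regs s1 (tmp (j + 1))) (regs s1 (tmp (j + 1))))\<rparr>)"
      by (rule exec_Op)
    then have 1: "exec w (Op Or (var i) (tmp (j + 1)) (tmp (j + 1))) s1 1 s2"
      using inv by (simp add: s2_def inv_def)
    have "represents s2 (set_reg i k (iter f k \<sigma>))"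
      using inv by (auto simp: inv_def implements_def represents_def s2_def set_reg_def)
    from For.IH[OF this, of "j + 2"] obtain s3 where
      3: "exec w (compile c (j + 2)) s2 (cost w c (set_reg i k (iter f k \<sigma>))) s3"
      "implements (j + 2) (set_reg i k (iter f k \<sigma>)) s2 (iter f (Suc k) \<sigma>) s3"
      by (auto simp: f_def)
    define s4 where "s4 = s3\<lparr>regs := (regs s3)(tmp (j + 2) := 1 mod 2 ^ w)\<rparr>"
    have 4: "exec w (Const (tmp (j + 2)) (\<lambda>_. 1)) s3 1 s4"
      unfolding s4_def by (rule exec_Const)
    define s5 where "s5 = s4\<lparr>regs := (regs s4)(tmp (j + 1) :=
      binop_val w Add (regs s4 (tmp (j + 1))) (regs s4 (tmp (j + 2))))\<rparr>"
    have 5: "exec w (Op Add (tmp (j + 1)) (tmp (j + 1)) (tmp (j + 2))) s4 1 s5"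
      unfolding s5_def by (rule exec_Op)
    define s6 where "s6 = s5\<lparr>regs := (regs s5)(tmp (j + 2) :=
      binop_val w Less (regs s5 (tmp (j + 1))) (regs s5 (tmp j)))\<rparr>"
    have 6: "exec w (Op Less (tmp (j + 2)) (tmp (j + 1)) (tmp j)) s5 1 s6"
      unfolding s6_def by (rule exec_Op)
    have "K < 2 ^ w" by (simp add: K_def)
    then have lt: "Suc k < 2 ^ w" using \<open>k < K\<close> by simp
    then have "w > 0" by (cases w) auto
    have r3: "regs s3 (tmp j) = K" "regs s3 (tmp (j + 1)) = k"
      using 3(2) inv by (auto simp: implements_def inv_def s2_def)
    have r5: "regs s5 (tmp (j + 1)) = Suc k" "regs s5 (tmp j) = K"
      using r3 lt \<open>w > 0\<close> by (auto simp: s5_def s4_def)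
    have "exec w body s1 (1 + (cost w c (set_reg i k (iter f k \<sigma>)) + (1 + (1 + 1)))) s6"
      unfolding body_def by (rule exec_Seq[OF 1 exec_Seq[OF 3(1) exec_Seq[OF 4 exec_Seq[OF 5 6]]]])
    then have "exec w body s1 (T k - 1) s6" by (simp add: T_def numeral_eq_Suc)
    moreover have "inv (Suc k) s6"
      using r5 inv 3(2) unfolding inv_def
      by (auto simp: s6_def s5_def s4_def s2_def implements_def)
    ultimately show ?thesis by blast
  qed
  have loop: "inv k s1 \<Longrightarrow> k \<le> K \<Longrightarrow>
     \<exists>s2. exec w (While (tmp (j + 2)) body) s1 ((\<Sum>i=k..<K. T i) + 1) s2 \<and> inv K s2" for k s1
  proof (induction "K - k" arbitrary: k s1)
    case 0
    then have "k = K" by simp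
    have "exec w (While (tmp (j + 2)) body) s1 1 s1"
      by (rule exec_While_False) (use 0 \<open>k = K\<close> in \<open>simp add: inv_def\<close>)
    then show ?case using 0 \<open>k = K\<close> by auto
  next
    case (Suc d)
    then have "k < K" by simp
    obtain s2 where s2: "exec w body s1 (T k - 1) s2" "inv (Suc k) s2"
      using step[OF Suc.prems(1) \<open>k < K\<close>] by blast
    obtain s3 where s3: "exec w (While (tmp (j + 2)) body) s2 ((\<Sum>i=Suc k..<K. T i) + 1) s3" "inv K s3"
      using Suc(1)[of "Suc k" s2] Suc.prems Suc(2) s2(2) \<open>k < K\<close> by fastforce
    have "K < 2 ^ w" by (simp add: K_def)
    then have "(2::nat) ^ w > 1" using \<open>k < K\<close> by linarith
    then have "exec w (While (tmp (j + 2)) body) s1 ((T k - 1) + ((\<Sum>i=Suc k..<K. T i) + 1) + 1) s3"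
      by (intro exec_While_True[OF _ s2(1) s3(1)]) (use Suc.prems \<open>k < K\<close> in \<open>simp add: inv_def\<close>)
    moreover have "(T k - 1) + ((\<Sum>i=Suc k..<K. T i) + 1) + 1 = (\<Sum>i=k..<K. T i) + 1"
      using \<open>k < K\<close> by (subst (2) sum.atLeast_Suc_lessThan) (auto simp: T_def)
    ultimately show ?case using s3(2) by metis
  qed
  obtain s1 where s1: "exec w (cexp e j) s (ecost e) s1" "regs s1 (tmp j) = eval w e \<sigma>"
    "implements j \<sigma> s \<sigma> s1" "represents s1 \<sigma>"
    using cexp_correct'[OF For.prems] by metis
  define s2 where "s2 = s1\<lparr>regs := (regs s1)(tmp (j + 1) := 0 mod 2 ^ w)\<rparr>"
  have 2: "exec w (Const (tmp (j + 1)) (\<lambda>_. 0)) s1 1 s2"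
    unfolding s2_def by (rule exec_Const)
  define s3 where "s3 = s2\<lparr>regs := (regs s2)(tmp j :=
    binop_val w Add (regs s2 (tmp j)) (regs s2 (tmp (j + 1))))\<rparr>"
  have 3: "exec w (Op Add (tmp j) (tmp j) (tmp (j + 1))) s2 1 s3"
    unfolding s3_def by (rule exec_Op)
  define s4 where "s4 = s3\<lparr>regs := (regs s3)(tmp (j + 2) :=
    binop_val w Less (regs s3 (tmp (j + 1))) (regs s3 (tmp j)))\<rparr>"
  have 4: "exec w (Op Less (tmp (j + 2)) (tmp (j + 1)) (tmp j)) s3 1 s4"
    unfolding s4_def by (rule exec_Op)
  have "inv 0 s4"
    using s1(2,3) by (auto simp: inv_def s4_def s3_def s2_def implements_def K_def)
  from loop[OF this] obtain s5 where
    s5: "exec w (While (tmp (j + 2)) body) s4 ((\<Sum>i=0..<K. T i) + 1) s5" "inv K s5"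
    by auto
  have "exec w (compile (For i e c) j) s (ecost e + (1 + (1 + (1 + ((\<Sum>i=0..<K. T i) + 1))))) s5"
    unfolding compile.simps body_def[symmetric] by (rule exec_Seq[OF s1(1) exec_Seq[OF 2 exec_Seq[OF 3 exec_Seq[OF 4 s5(1)]]]])
  moreover have "implements j \<sigma> s (run w (For i e c) \<sigma>) s5"
    using s5(2) by (simp add: inv_def f_def K_def)
  moreover have "ecost e + (1 + (1 + (1 + ((\<Sum>i=0..<K. T i) + 1)))) = cost w (For i e c) \<sigma>"
    by (simp add: T_def f_def K_def lessThan_atLeast0)
  ultimately show ?case by metis
qed


section \<open>Subroutines\<close>

text \<open>Registers and banks are fixed in the instructions, so a call amounts to a renaming. It
  is injective and preserves the number of steps exactly. Banks 0 to 9 belong to the caller.\<close>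

primrec relocate :: "com \<Rightarrow> com" where
  "relocate Skip = Skip"
| "relocate (Const r k) = Const (sub r) k"
| "relocate (Op f r a b) = Op f (sub r) (sub a) (sub b)"
| "relocate (Load r m a) = Load (sub r) (m + 10) (sub a)"
| "relocate (Store m a r) = Store (m + 10) (sub a) (sub r)"
| "relocate (Rand r) = Rand (sub r)"
| "relocate (Seq c d) = Seq (relocate c) (relocate d)"
| "relocate (Cond r c d) = Cond (sub r) (relocate c) (relocate d)"
| "relocate (While r c) = While (sub r) (relocate c)"

text \<open>The tape is shared: the subroutine goes on reading where the caller stopped, so it sees
  fresh random words.\<close>

definition hosts :: "state \<Rightarrow> state \<Rightarrow> bool" where
  "hosts S s \<longleftrightarrow> (\<forall>r. regs S (sub r) = regs s r) \<and> (\<forall>m. mem S (m + 10) = mem s m) \<and> tape S = tape s"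

definition same_host :: "state \<Rightarrow> state \<Rightarrow> bool" where
  "same_host S S' \<longleftrightarrow> (\<forall>r. regs S' (var r) = regs S (var r)) \<and> (\<forall>m<10. mem S' m = mem S m)"

lemma same_host_trans: "same_host S S1 \<Longrightarrow> same_host S1 S2 \<Longrightarrow> same_host S S2"
  by (auto simp: same_host_def)

lemma relocate_correct:
  assumes "exec w c s t s'" "hosts S s"
  shows "\<exists>S'. exec w (relocate c) S t S' \<and> hosts S' s' \<and> same_host S S'"
  using assms
proof (induction arbitrary: S rule: exec.induct)
  case (exec_Skip s)
  have "exec w (relocate Skip) S 1 S" unfolding relocate.simps by (rule exec.exec_Skip)
  then show ?case by (intro exI conjI, assumption) (use exec_Skip in \<open>auto simp: same_host_def\<close>)
next
  case (exec_Const r k s)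
  have "exec w (relocate (Const r k)) S 1 (S\<lparr>regs := (regs S)(sub r := k w mod 2 ^ w)\<rparr>)"
    unfolding relocate.simps by (rule exec.exec_Const)
  then show ?case by (intro exI conjI, assumption) (use exec_Const in \<open>auto simp: hosts_def same_host_def\<close>)
next
  case (exec_Op f r a b s)
  have "exec w (relocate (Op f r a b)) S 1
    (S\<lparr>regs := (regs S)(sub r := binop_val w f (regs S (sub a)) (regs S (sub b)))\<rparr>)"
    unfolding relocate.simps by (rule exec.exec_Op)
  then show ?case by (intro exI conjI, assumption) (use exec_Op in \<open>auto simp: hosts_def same_host_def\<close>)
next
  case (exec_Load r m a s)
  have "exec w (relocate (Load r m a)) S 1
    (S\<lparr>regs := (regs S)(sub r := mem S (m + 10) (regs S (sub a)))\<rparr>)"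
    unfolding relocate.simps by (rule exec.exec_Load)
  then show ?case by (intro exI conjI, assumption) (use exec_Load in \<open>auto simp: hosts_def same_host_def\<close>)
next
  case (exec_Store m a r s)
  have "exec w (relocate (Store m a r)) S 1
    (S\<lparr>mem := (mem S)(m + 10 := (mem S (m + 10))(regs S (sub a) := regs S (sub r)))\<rparr>)"
    unfolding relocate.simps by (rule exec.exec_Store)
  then show ?case by (intro exI conjI, assumption) (use exec_Store in \<open>auto simp: hosts_def same_host_def\<close>)
next
  case (exec_Rand r s)
  have "exec w (relocate (Rand r)) S 1
    (S\<lparr>regs := (regs S)(sub r := shd (tape S)), tape := stl (tape S)\<rparr>)"
    unfolding relocate.simps by (rule exec.exec_Rand)
  then show ?case by (intro exI conjI, assumption) (use exec_Rand in \<open>auto simp: hosts_def same_host_def\<close>)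
next
  case (exec_Seq c1 s t1 s1 c2 t2 s2)
  then show ?case unfolding relocate.simps by (meson exec.exec_Seq same_host_trans)
next
  case (exec_Cond_True s r c1 t s' c2)
  then show ?case unfolding relocate.simps by (metis exec.exec_Cond_True hosts_def)
next
  case (exec_Cond_False s r c2 t s' c1)
  then show ?case unfolding relocate.simps by (metis exec.exec_Cond_False hosts_def)
next
  case (exec_While_False s r c)
  then have "exec w (relocate (While r c)) S 1 S"
    unfolding relocate.simps by (intro exec.exec_While_False) (simp add: hosts_def)
  then show ?case by (intro exI conjI, assumption) (use exec_While_False in \<open>auto simp: same_host_def\<close>)
next
  case (exec_While_True s r c t1 s1 t2 s2)
  then show ?case unfolding relocate.simps by (metis exec.exec_While_True hosts_def same_host_trans)
qed


section \<open>Reasoning about bounded loops\<close>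

primrec writes :: "loopc \<Rightarrow> nat set" where
  "writes Nop = {}"
| "writes (r ::= e) = {r}"
| "writes (Sto m a e) = {}"
| "writes (Rnd r) = {r}"
| "writes (c ;; d) = writes c \<union> writes d"
| "writes (Ite e c d) = writes c \<union> writes d"
| "writes (For i e c) = insert i (writes c)"

primrec stores :: "loopc \<Rightarrow> nat set" where
  "stores Nop = {}"
| "stores (r ::= e) = {}"
| "stores (Sto m a e) = {m}"
| "stores (Rnd r) = {}"
| "stores (c ;; d) = stores c \<union> stores d"
| "stores (Ite e c d) = stores c \<union> stores d"
| "stores (For i e c) = stores c"

primrec draws :: "loopc \<Rightarrow> bool" where
  "draws Nop = False"
| "draws (r ::= e) = False"
| "draws (Sto m a e) = False"
| "draws (Rnd r) = True"
| "draws (c ;; d) = (draws c \<or> draws d)"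
| "draws (Ite e c d) = (draws c \<or> draws d)"
| "draws (For i e c) = draws c"

text \<open>A syntactic bound on what a program changes. As it holds for every run, the proof rules
  supply it for free, and postconditions and invariants mention only what changes.\<close>

definition frame :: "loopc \<Rightarrow> state \<Rightarrow> state \<Rightarrow> bool" where
  "frame c \<sigma> \<tau> \<longleftrightarrow> (\<forall>r. r \<notin> writes c \<longrightarrow> regs \<tau> r = regs \<sigma> r) \<and>
     (\<forall>m. m \<notin> stores c \<longrightarrow> mem \<tau> m = mem \<sigma> m) \<and> (\<not> draws c \<longrightarrow> tape \<tau> = tape \<sigma>)"

lemma iter_inv:
  assumes "I 0 \<sigma>" "\<And>k \<tau>. k < n \<Longrightarrow> I k \<tau> \<Longrightarrow> I (Suc k) (f k \<tau>)"
  shows "I n (iter f n \<sigma>)"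
  using assms by (induction n) auto

lemma set_reg_simps [simp]:
  "regs (set_reg r x \<sigma>) = (regs \<sigma>)(r := x)" "mem (set_reg r x \<sigma>) = mem \<sigma>" "tape (set_reg r x \<sigma>) = tape \<sigma>"
  by (auto simp: set_reg_def)

lemma run_frame: "frame c \<sigma> (run w c \<sigma>)"
proof (induction c arbitrary: \<sigma>)
  case (Sq c d)
  from Sq(1)[of \<sigma>] Sq(2)[of "run w c \<sigma>"] show ?case by (auto simp: frame_def)
next
  case (For i e c)
  show ?case unfolding run.simps
  proof (rule iter_inv)
    fix k \<tau> assume "frame (For i e c) \<sigma> \<tau>"
    then show "frame (For i e c) \<sigma> (run w c (set_reg i k \<tau>))"
      using For[of "set_reg i k \<tau>"] by (auto simp: frame_def)
  qed (auto simp: frame_def)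
qed (auto simp: frame_def)

lemmas run_frames = run_frame[unfolded frame_def, THEN conjunct1, rule_format]
  run_frame[unfolded frame_def, THEN conjunct2, THEN conjunct1, rule_format]
  run_frame[unfolded frame_def, THEN conjunct2, THEN conjunct2, rule_format]

text \<open>A Hoare triple with a time bound, for one initial state instead of a precondition.
  Values in the initial state can therefore be used as ordinary constants in postconditions.\<close>

definition ht :: "nat \<Rightarrow> loopc \<Rightarrow> nat \<Rightarrow> state \<Rightarrow> (state \<Rightarrow> bool) \<Rightarrow> bool" where
  "ht w c T \<sigma> Q \<longleftrightarrow> cost w c \<sigma> \<le> T \<and> Q (run w c \<sigma>)"

lemma ht_mono: "ht w c T \<sigma> P \<Longrightarrow> T \<le> T' \<Longrightarrow> (\<And>\<tau>. P \<tau> \<Longrightarrow> frame c \<sigma> \<tau> \<Longrightarrow> Q \<tau>) \<Longrightarrow> ht w c T' \<sigma> Q"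
  using run_frame[of c \<sigma> w] by (auto simp: ht_def)

lemma ht_Sq:
  assumes "ht w c T1 \<sigma> P" "\<And>\<tau>. P \<tau> \<Longrightarrow> frame c \<sigma> \<tau> \<Longrightarrow> ht w d T2 \<tau> Q" "T1 + T2 \<le> T"
  shows "ht w (c ;; d) T \<sigma> Q"
  using assms(1) assms(2)[of "run w c \<sigma>"] assms(3) run_frame[of c \<sigma> w] by (auto simp: ht_def)

lemma ht_Ite:
  assumes "eval w e \<sigma> \<noteq> 0 \<Longrightarrow> ht w c T1 \<sigma> Q" "eval w e \<sigma> = 0 \<Longrightarrow> ht w d T1 \<sigma> Q" "ecost e + 1 + T1 \<le> T"
  shows "ht w (Ite e c d) T \<sigma> Q"
  using assms by (auto simp: ht_def)

text \<open>For loops with uneven iterations. When the triples are listed, only their total number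
  is under control; the largest number in a single iteration, multiplied by the number of
  iterations, would be too much.\<close>

lemma ht_For_sum:
  assumes n: "eval w e \<sigma> mod 2 ^ w = n" and "I 0 \<sigma>"
    and step: "\<And>k \<tau>. k < n \<Longrightarrow> I k \<tau> \<Longrightarrow> frame (For i e c) \<sigma> \<tau> \<Longrightarrow> ht w c (T k) (set_reg i k \<tau>) (I (Suc k))"
    and T': "(\<Sum>k<n. T k + 5) + ecost e + 4 \<le> T'"
  shows "ht w (For i e c) T' \<sigma> (I n)"
proof -
  define f where "f = (\<lambda>k \<tau>. run w c (set_reg i k \<tau>))"
  have inv: "I k (iter f k \<sigma>) \<and> frame (For i e c) \<sigma> (iter f k \<sigma>)" if "k \<le> n" for k
  proof (rule iter_inv)
    show "I 0 \<sigma> \<and> frame (For i e c) \<sigma> \<sigma>" using assms by (simp add: frame_def)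
    fix j \<tau> assume j: "j < k" "I j \<tau> \<and> frame (For i e c) \<sigma> \<tau>"
    then have "I (Suc j) (f j \<tau>)" using step[of j \<tau>] that by (auto simp: ht_def f_def)
    moreover have "frame (For i e c) \<sigma> (f j \<tau>)"
      using j run_frame[of c "set_reg i j \<tau>" w] by (auto simp: frame_def f_def)
    ultimately show "I (Suc j) (f j \<tau>) \<and> frame (For i e c) \<sigma> (f j \<tau>)" by blast
  qed
  have "(\<Sum>k<n. 5 + cost w c (set_reg i k (iter f k \<sigma>))) \<le> (\<Sum>k<n. T k + 5)"
    by (intro sum_mono) (use inv step in \<open>auto simp: ht_def\<close>)
  then have "cost w (For i e c) \<sigma> \<le> T'" using T' n by (simp add: f_def algebra_simps)
  then show ?thesis using inv[of n] n by (simp add: ht_def f_def)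
qed

lemma ht_For:
  assumes "eval w e \<sigma> mod 2 ^ w = n" "I 0 \<sigma>"
    and "\<And>k \<tau>. k < n \<Longrightarrow> I k \<tau> \<Longrightarrow> frame (For i e c) \<sigma> \<tau> \<Longrightarrow> ht w c T (set_reg i k \<tau>) (I (Suc k))"
    and "n * (T + 5) + ecost e + 4 \<le> T'"
  shows "ht w (For i e c) T' \<sigma> (I n)"
  by (rule ht_For_sum[where T = "\<lambda>_. T", OF assms(1-3)]) (use assms(4) in simp_all)

section \<open>Averages over finitely many random words\<close>

text \<open>The expectation over \<open>k\<close> independent uniform words as an iterated finite
  mean. All estimates of failure probabilities take place here, without measures.\<close>

primrec avg :: "nat \<Rightarrow> nat \<Rightarrow> (nat list \<Rightarrow> real) \<Rightarrow> real" where
  "avg q 0 f = f []"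
| "avg q (Suc k) f = (\<Sum>a<q. avg q k (\<lambda>u. f (a # u))) / real q"

definition words :: "nat \<Rightarrow> nat \<Rightarrow> nat list set" where
  "words q k = {u. length u = k \<and> set u \<subseteq> {..<q}}"

lemma avg_mono:
  "(\<And>u. u \<in> words q k \<Longrightarrow> f u \<le> g u) \<Longrightarrow> avg q k f \<le> avg q k g"
proof (induction k arbitrary: f g)
  case (Suc k)
  have "avg q k (\<lambda>u. f (a # u)) \<le> avg q k (\<lambda>u. g (a # u))" if "a < q" for a
    by (rule Suc.IH, rule Suc.prems) (use that in \<open>auto simp: words_def\<close>)
  then show ?case by (auto intro!: divide_right_mono sum_mono)
qed (simp add: words_def)

lemma avg_cong:
  "(\<And>u. u \<in> words q k \<Longrightarrow> f u = g u) \<Longrightarrow> avg q k f = avg q k g"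
  by (intro antisym avg_mono) auto

lemma avg_const [simp]: "q > 0 \<Longrightarrow> avg q k (\<lambda>_. c) = c"
  by (induction k) auto

lemma avg_add: "avg q k (\<lambda>u. f u + g u) = avg q k f + avg q k g"
  by (induction k arbitrary: f g) (auto simp: sum.distrib add_divide_distrib)

lemma avg_cmult: "avg q k (\<lambda>u. c * f u) = c * avg q k f"
  by (induction k arbitrary: f) (auto simp: sum_distrib_left[symmetric])

lemma avg_sum: "q > 0 \<Longrightarrow> avg q k (\<lambda>u. \<Sum>i\<in>I. f i u) = (\<Sum>i\<in>I. avg q k (f i))"
  by (induction I rule: infinite_finite_induct) (auto simp: avg_add)

lemma avg_nonneg: "q > 0 \<Longrightarrow> (\<And>u. u \<in> words q k \<Longrightarrow> 0 \<le> f u) \<Longrightarrow> 0 \<le> avg q k f"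
  using avg_mono[of q k "\<lambda>_. 0" f] by simp

lemma avg_le_const: "q > 0 \<Longrightarrow> (\<And>u. u \<in> words q k \<Longrightarrow> f u \<le> c) \<Longrightarrow> avg q k f \<le> c"
  using avg_mono[of q k f "\<lambda>_. c"] by simp

lemma avg_append: "avg q (j + k) f = avg q j (\<lambda>u. avg q k (\<lambda>v. f (u @ v)))"
  by (induction j arbitrary: f) auto

lemma avg_markov:
  assumes "c > 0" "q > 0" "\<And>u. g u \<ge> 0"
  shows "avg q k (\<lambda>u. of_bool (c < g u)) \<le> avg q k g / c"
proof -
  have "avg q k (\<lambda>u. of_bool (c < g u)) \<le> avg q k (\<lambda>u. (1 / c) * g u)"
    by (intro avg_mono) (use assms in \<open>auto simp: field_simps\<close>)
  then show ?thesis by (simp only: avg_cmult) simp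
qed

lemma avg_list_all:
  "avg q k (\<lambda>u. of_bool (\<forall>a\<in>set u. p a)) = (real (card {a. a < q \<and> p a}) / real q) ^ k"
proof (induction k)
  case (Suc k)
  have "avg q k (\<lambda>u. of_bool (\<forall>b\<in>set (a # u). p b)) =
      of_bool (p a) * (real (card {a. a < q \<and> p a}) / real q) ^ k" for a
    unfolding Suc.IH[symmetric] avg_cmult[symmetric] by (intro avg_cong) auto
  moreover have "(\<Sum>a<q. of_bool (p a) :: real) = real (card {a. a < q \<and> p a})"
    by (subst sum_of_bool_eq) (auto intro!: arg_cong[of _ _ card])
  ultimately show ?case by (simp add: sum_distrib_right[symmetric])
qed simp

definition block :: "nat \<Rightarrow> nat \<Rightarrow> 'a list \<Rightarrow> 'a list" where
  "block m l u = take m (drop (l * m) u)"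

text \<open>Independence of disjoint blocks: once the first block is fixed, its indicator is a
  constant factor of the average over the remaining words.\<close>

lemma avg_blocks:
  "avg q (L * m) (\<lambda>u. of_bool (\<forall>l<L. p (block m l u))) = (avg q m (\<lambda>u. of_bool (p u))) ^ L"
proof (induction L)
  case (Suc L)
  have "avg q (Suc L * m) (\<lambda>u. of_bool (\<forall>l<Suc L. p (block m l u))) =
      avg q m (\<lambda>v. avg q (L * m) (\<lambda>u. of_bool (\<forall>l<Suc L. p (block m l (v @ u)))))"
    by (simp add: avg_append)
  also have "\<dots> = avg q m (\<lambda>v. avg q (L * m) (\<lambda>u. of_bool (\<forall>l<L. p (block m l u))) * of_bool (p v))"
  proof (intro avg_cong)
    fix v assume v: "v \<in> words q m"
    have "avg q (L * m) (\<lambda>u. of_bool (\<forall>l<Suc L. p (block m l (v @ u)))) =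
          avg q (L * m) (\<lambda>u. of_bool (p v) * of_bool (\<forall>l<L. p (block m l u)))"
    proof (intro avg_cong)
      fix u assume "u \<in> words q (L * m)"
      have "block m 0 (v @ u) = v" "\<And>l. block m (Suc l) (v @ u) = block m l u"
        using v by (auto simp: block_def words_def)
      then show "of_bool (\<forall>l<Suc L. p (block m l (v @ u))) =
          (of_bool (p v) * of_bool (\<forall>l<L. p (block m l u)) :: real)"
        by (simp add: All_less_Suc2)
    qed
    then show "avg q (L * m) (\<lambda>u. of_bool (\<forall>l<Suc L. p (block m l (v @ u)))) =
        avg q (L * m) (\<lambda>u. of_bool (\<forall>l<L. p (block m l u))) * of_bool (p v)"
      by (simp add: avg_cmult)
  qed
  finally show ?case by (simp only: Suc.IH avg_cmult power_Suc2)
qed (simp add: block_def)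

section \<open>The tape\<close>

abbreviation word_measure :: "nat \<Rightarrow> nat measure" where
  "word_measure w \<equiv> measure_pmf (pmf_of_set {..<2 ^ w})"

lemma space_tape [simp]: "space (tape_space w) = UNIV"
  by (simp add: tape_space_def space_stream_space)

lemma prob_space_tape: "prob_space (tape_space w)"
  unfolding tape_space_def by (intro prob_space.prob_space_stream_space measure_pmf.prob_space_axioms)

lemma sets_tape: "sets (tape_space w) = sets (stream_space (count_space UNIV))"
  unfolding tape_space_def by (intro sets_stream_space_cong) simp

lemma measurable_tape_Cons: "(\<lambda>\<omega>. a ## \<omega>) \<in> measurable (tape_space w) (tape_space w)"
  unfolding tape_space_def by measurable

text \<open>The same mean for extended reals, since expected running times may be infinite.\<close>

primrec eavg :: "nat \<Rightarrow> nat \<Rightarrow> (nat list \<Rightarrow> ennreal) \<Rightarrow> ennreal" where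
  "eavg q 0 f = f []"
| "eavg q (Suc k) f = (\<Sum>a<q. eavg q k (\<lambda>u. f (a # u))) / of_nat q"

lemma eavg_mono:
  "(\<And>u. u \<in> words q k \<Longrightarrow> f u \<le> g u) \<Longrightarrow> eavg q k f \<le> eavg q k g"
proof (induction k arbitrary: f g)
  case (Suc k)
  have "eavg q k (\<lambda>u. f (a # u)) \<le> eavg q k (\<lambda>u. g (a # u))" if "a < q" for a
    by (rule Suc.IH, rule Suc.prems) (use that in \<open>auto simp: words_def\<close>)
  then show ?case by (auto intro!: divide_right_mono_ennreal sum_mono)
qed (simp add: words_def)

text \<open>The summand \<open>c\<close> will be the expected time of the call, possibly
  \<infinity>. Separating it from the finite part reduces everything else to the real-valued
  \<open>avg\<close>.\<close>

lemma eavg_ennreal_add: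
  assumes "q > 0" "\<And>u. g u \<ge> 0"
  shows "eavg q k (\<lambda>u. ennreal (g u) + c) = ennreal (avg q k g) + c"
  using assms(2)
proof (induction k arbitrary: g)
  case (Suc k)
  have nn: "avg q k (\<lambda>u. g (a # u)) \<ge> 0" for a
    using Suc.prems assms by (intro avg_nonneg) auto
  have "eavg q (Suc k) (\<lambda>u. ennreal (g u) + c) =
      (\<Sum>a<q. ennreal (avg q k (\<lambda>u. g (a # u))) + c) / of_nat q"
    using Suc.IH[of "\<lambda>u. g (_ # u)"] Suc.prems by simp
  also have "\<dots> = ennreal (\<Sum>a<q. avg q k (\<lambda>u. g (a # u))) / of_nat q + of_nat q * c / of_nat q"
    using nn by (simp add: sum.distrib sum_ennreal add_divide_distrib_ennreal)
  also have "ennreal (\<Sum>a<q. avg q k (\<lambda>u. g (a # u))) / of_nat q = ennreal (avg q (Suc k) g)"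
    using nn assms by (simp add: divide_ennreal sum_nonneg ennreal_of_nat_eq_real_of_nat)
  also have "of_nat q * c / of_nat q = c"
    using assms by (simp add: mult.commute ennreal_mult_divide_eq)
  finally show ?case .
qed simp

lemma nn_integral_tape_split:
  assumes "f \<in> borel_measurable (tape_space w)"
  shows "(\<integral>\<^sup>+\<omega>. f \<omega> \<partial>tape_space w) = eavg (2 ^ w) k (\<lambda>u. \<integral>\<^sup>+\<omega>. f (u @- \<omega>) \<partial>tape_space w)"
  using assms
proof (induction k arbitrary: f)
  case (Suc k)
  have meas: "(\<lambda>\<omega>. f (a ## \<omega>)) \<in> borel_measurable (tape_space w)" for a
    using measurable_compose[OF measurable_tape_Cons Suc.prems] .
  have "(\<integral>\<^sup>+\<omega>. f \<omega> \<partial>tape_space w) = (\<integral>\<^sup>+a. (\<integral>\<^sup>+\<omega>. f (a ## \<omega>) \<partial>tape_space w) \<partial>word_measure w)"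
    using Suc.prems unfolding tape_space_def by (rule prob_space.nn_integral_stream_space[OF measure_pmf.prob_space_axioms])
  also have "\<dots> = (\<Sum>a<2^w. \<integral>\<^sup>+\<omega>. f (a ## \<omega>) \<partial>tape_space w) / of_nat (2 ^ w)"
    by (subst nn_integral_pmf_of_set) (auto simp: lessThan_empty_iff)
  also have "\<dots> = eavg (2 ^ w) (Suc k) (\<lambda>u. \<integral>\<^sup>+\<omega>. f (u @- \<omega>) \<partial>tape_space w)"
    using Suc.IH[OF meas] by simp
  finally show ?case .
qed simp

text \<open>\<open>P\<close> will say that a run halts with a correct output, and no measurability
  of it is assumed. For each first word the exceptional tapes lie in a null set; avoiding the null
  set that belongs to the first word is a measurable condition and implies \<open>P\<close>.\<close>

lemma AE_tape_Cons:
  assumes "\<And>a. a < 2 ^ w \<Longrightarrow> AE \<omega> in tape_space w. P (a ## \<omega>)"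
  shows "AE \<omega> in tape_space w. P \<omega>"
proof -
  have "\<exists>A\<in>null_sets (tape_space w). {\<omega>. \<not> P (a ## \<omega>)} \<subseteq> A" if "a < 2 ^ w" for a
    using assms[OF that] by (auto simp: eventually_ae_filter)
  then obtain A where A: "\<And>a. a < 2 ^ w \<Longrightarrow> A a \<in> null_sets (tape_space w)"
    "\<And>a. a < 2 ^ w \<Longrightarrow> {\<omega>. \<not> P (a ## \<omega>)} \<subseteq> A a"
    by metis
  define Q where "Q = (\<lambda>\<omega>. \<exists>a<2 ^ w. shd \<omega> = a \<and> stl \<omega> \<notin> A a)"
  have sets: "A a \<in> sets (stream_space (word_measure w))" if "a < 2 ^ w" for a
    using A(1)[OF that] by (auto simp: tape_space_def)
  have Q: "Measurable.pred (stream_space (word_measure w)) (\<lambda>\<omega>. a < 2 ^ w \<and> shd \<omega> = a \<and> stl \<omega> \<notin> A a)" for a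
  proof (cases "a < 2 ^ w")
    case True
    then have [measurable]: "A a \<in> sets (stream_space (word_measure w))" using sets by simp
    show ?thesis by measurable
  qed simp
  have "Measurable.pred (stream_space (word_measure w)) Q"
    unfolding Q_def using Q by (intro pred_intros_countable)
  moreover have "AE a in word_measure w. AE \<omega> in stream_space (word_measure w). Q (a ## \<omega>)"
  proof (rule AE_pmfI)
    fix a assume "a \<in> set_pmf (pmf_of_set {..<2 ^ w :: nat})"
    then have a: "a < 2 ^ w" by (subst (asm) set_pmf_of_set) (auto simp: lessThan_empty_iff)
    have "AE \<omega> in stream_space (word_measure w). \<omega> \<notin> A a"
      using A(1)[OF a] by (intro AE_not_in) (simp add: tape_space_def)
    then show "AE \<omega> in stream_space (word_measure w). Q (a ## \<omega>)"
      using a by (auto simp: Q_def)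
  qed
  ultimately have "AE \<omega> in tape_space w. Q \<omega>"
    unfolding tape_space_def by (subst prob_space.AE_stream_space[OF measure_pmf.prob_space_axioms])
  moreover have "P \<omega>" if "Q \<omega>" for \<omega>
  proof -
    from that have "shd \<omega> < 2 ^ w" "stl \<omega> \<notin> A (shd \<omega>)" by (auto simp: Q_def)
    then have "P (shd \<omega> ## stl \<omega>)" using A(2)[of "shd \<omega>"] by blast
    then show ?thesis by simp
  qed
  ultimately show ?thesis by (auto elim: eventually_mono)
qed

lemma AE_tape_shift:
  assumes "\<And>u. u \<in> words (2 ^ w) k \<Longrightarrow> AE \<omega> in tape_space w. P (u @- \<omega>)"
  shows "AE \<omega> in tape_space w. P \<omega>"
  using assms
proof (induction k arbitrary: P)
  case 0
  then show ?case by (auto simp: words_def)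
next
  case (Suc k)
  show ?case
  proof (rule AE_tape_Cons)
    fix a :: nat assume a: "a < 2 ^ w"
    show "AE \<omega> in tape_space w. P (a ## \<omega>)"
    proof (rule Suc.IH)
      fix u assume "u \<in> words (2 ^ w) k"
      then have "a # u \<in> words (2 ^ w) (Suc k)" using a by (auto simp: words_def)
      from Suc.prems[OF this] show "AE \<omega> in tape_space w. P (a ## (u @- \<omega>))" by simp
    qed
  qed
qed

lemma tape_update_outside:
  "s\<lparr>tape := X, regs := \<rho>\<rparr> = s\<lparr>regs := \<rho>, tape := X\<rparr>" "s\<lparr>tape := X, mem := \<mu>\<rparr> = s\<lparr>mem := \<mu>, tape := X\<rparr>"
  for s :: state
  by (cases s; simp)+

text \<open>Each step reads at most one word, so a halting run depends on a finite prefix of the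
  tape only. This makes the running time measurable.\<close>

lemma exec_tape_prefix:
  assumes "exec w c s t s'"
  shows "\<exists>d\<le>t. tape s' = sdrop d (tape s) \<and>
    (\<forall>X. stake d X = stake d (tape s) \<longrightarrow> exec w c (s\<lparr>tape := X\<rparr>) t (s'\<lparr>tape := sdrop d X\<rparr>))"
  using assms
proof (induction rule: exec.induct)
  case (exec_Skip s)
  then show ?case using exec.exec_Skip by (intro exI[of _ 0]) auto
next
  case (exec_Const r k s)
  have "exec w (Const r k) (s\<lparr>tape := X\<rparr>) 1 (s\<lparr>regs := (regs s)(r := k w mod 2 ^ w), tape := X\<rparr>)" for X
    using exec.exec_Const[of w r k "s\<lparr>tape := X\<rparr>", unfolded tape_update_outside] by simp
  then show ?case by (intro exI[of _ 0]) auto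
next
  case (exec_Op f r a b s)
  have "exec w (Op f r a b) (s\<lparr>tape := X\<rparr>) 1
     (s\<lparr>regs := (regs s)(r := binop_val w f (regs s a) (regs s b)), tape := X\<rparr>)" for X
    using exec.exec_Op[of w f r a b "s\<lparr>tape := X\<rparr>", unfolded tape_update_outside] by simp
  then show ?case by (intro exI[of _ 0]) auto
next
  case (exec_Load r m a s)
  have "exec w (Load r m a) (s\<lparr>tape := X\<rparr>) 1
     (s\<lparr>regs := (regs s)(r := mem s m (regs s a)), tape := X\<rparr>)" for X
    using exec.exec_Load[of w r m a "s\<lparr>tape := X\<rparr>", unfolded tape_update_outside] by simp
  then show ?case by (intro exI[of _ 0]) auto
next
  case (exec_Store m a r s)
  have "exec w (Store m a r) (s\<lparr>tape := X\<rparr>) 1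
     (s\<lparr>mem := (mem s)(m := (mem s m)(regs s a := regs s r)), tape := X\<rparr>)" for X
    using exec.exec_Store[of w m a r "s\<lparr>tape := X\<rparr>", unfolded tape_update_outside] by simp
  then show ?case by (intro exI[of _ 0]) auto
next
  case (exec_Rand r s)
  have "exec w (Rand r) (s\<lparr>tape := X\<rparr>) 1
     (s\<lparr>regs := (regs s)(r := shd (tape s)), tape := sdrop 1 X\<rparr>)" if "stake 1 X = stake 1 (tape s)" for X
    using exec.exec_Rand[of w r "s\<lparr>tape := X\<rparr>"] that by simp
  then show ?case by (intro exI[of _ 1]) auto
next
  case (exec_Seq c1 s t1 s1 c2 t2 s2)
  obtain d1 where d1: "d1 \<le> t1" "tape s1 = sdrop d1 (tape s)"
    "\<And>X. stake d1 X = stake d1 (tape s) \<Longrightarrow> exec w c1 (s\<lparr>tape := X\<rparr>) t1 (s1\<lparr>tape := sdrop d1 X\<rparr>)"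
    using exec_Seq.IH(1) by blast
  obtain d2 where d2: "d2 \<le> t2" "tape s2 = sdrop d2 (tape s1)"
    "\<And>X. stake d2 X = stake d2 (tape s1) \<Longrightarrow> exec w c2 (s1\<lparr>tape := X\<rparr>) t2 (s2\<lparr>tape := sdrop d2 X\<rparr>)"
    using exec_Seq.IH(2) by blast
  show ?case
  proof (intro exI[of _ "d1 + d2"] conjI allI impI)
    fix X assume "stake (d1 + d2) X = stake (d1 + d2) (tape s)"
    then have "stake d1 X @ stake d2 (sdrop d1 X) = stake d1 (tape s) @ stake d2 (sdrop d1 (tape s))"
      by (simp only: stake_add)
    then have "stake d1 X = stake d1 (tape s)" "stake d2 (sdrop d1 X) = stake d2 (tape s1)"
      using d1(2) by (auto simp del: stake_add)
    then show "exec w (Seq c1 c2) (s\<lparr>tape := X\<rparr>) (t1 + t2) (s2\<lparr>tape := sdrop (d1 + d2) X\<rparr>)"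
      using exec.exec_Seq[OF d1(3) d2(3)] by simp
  qed (use d1 d2 in auto)
next
  case (exec_Cond_True s r c1 t s' c2)
  obtain d where d: "d \<le> t" "tape s' = sdrop d (tape s)"
    "\<And>X. stake d X = stake d (tape s) \<Longrightarrow> exec w c1 (s\<lparr>tape := X\<rparr>) t (s'\<lparr>tape := sdrop d X\<rparr>)"
    using exec_Cond_True.IH by blast
  show ?case
    by (rule exI[of _ d]) (use d exec_Cond_True.hyps(1) in \<open>auto intro!: exec.exec_Cond_True[simplified]\<close>)
next
  case (exec_Cond_False s r c2 t s' c1)
  obtain d where d: "d \<le> t" "tape s' = sdrop d (tape s)"
    "\<And>X. stake d X = stake d (tape s) \<Longrightarrow> exec w c2 (s\<lparr>tape := X\<rparr>) t (s'\<lparr>tape := sdrop d X\<rparr>)"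
    using exec_Cond_False.IH by blast
  show ?case
    by (rule exI[of _ d]) (use d exec_Cond_False.hyps(1) in \<open>auto intro!: exec.exec_Cond_False[simplified]\<close>)
next
  case (exec_While_False s r c)
  then show ?case using exec.exec_While_False by (intro exI[of _ 0]) auto
next
  case (exec_While_True s r c t1 s1 t2 s2)
  obtain d1 where d1: "d1 \<le> t1" "tape s1 = sdrop d1 (tape s)"
    "\<And>X. stake d1 X = stake d1 (tape s) \<Longrightarrow> exec w c (s\<lparr>tape := X\<rparr>) t1 (s1\<lparr>tape := sdrop d1 X\<rparr>)"
    using exec_While_True.IH(1) by blast
  obtain d2 where d2: "d2 \<le> t2" "tape s2 = sdrop d2 (tape s1)"
    "\<And>X. stake d2 X = stake d2 (tape s1) \<Longrightarrow> exec w (While r c) (s1\<lparr>tape := X\<rparr>) t2 (s2\<lparr>tape := sdrop d2 X\<rparr>)"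
    using exec_While_True.IH(2) by blast
  show ?case
  proof (intro exI[of _ "d1 + d2"] conjI allI impI)
    fix X assume "stake (d1 + d2) X = stake (d1 + d2) (tape s)"
    then have "stake d1 X @ stake d2 (sdrop d1 X) = stake d1 (tape s) @ stake d2 (sdrop d1 (tape s))"
      by (simp only: stake_add)
    then have "stake d1 X = stake d1 (tape s)" "stake d2 (sdrop d1 X) = stake d2 (tape s1)"
      using d1(2) by (auto simp del: stake_add)
    then show "exec w (While r c) (s\<lparr>tape := X\<rparr>) (t1 + t2 + 1) (s2\<lparr>tape := sdrop (d1 + d2) X\<rparr>)"
      using exec.exec_While_True[OF _ d1(3) d2(3)] exec_While_True.hyps(1) by simp
  qed (use d1 d2 in auto)
qed

lemma measurable_run_time:
  "(\<lambda>\<omega>. run_time w c (init_state xs \<omega>)) \<in> borel_measurable (tape_space w)"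
proof -
  define H where "H = (\<lambda>t. {\<omega>. \<exists>s'. exec w c (init_state xs \<omega>) t s'})"
  have H: "H t \<in> sets (tape_space w)" for t
  proof -
    \<comment> \<open>Halting after \<open>t\<close> steps is decided by the first \<open>t\<close>
      words, so the event is a union of fibers of \<open>stake t\<close>, and every set of finite
      lists is measurable.\<close>
    have "H t = stake t -` (stake t ` H t) \<inter> space (stream_space (count_space UNIV))"
    proof (intro set_eqI iffI; clarsimp simp: space_stream_space)
      fix \<omega> \<omega>' assume "stake t \<omega> = stake t \<omega>'" "\<omega>' \<in> H t"
      then obtain s' where "exec w c (init_state xs \<omega>') t s'" by (auto simp: H_def)
      from exec_tape_prefix[OF this] obtain d where d: "d \<le> t"
        "stake d \<omega> = stake d \<omega>' \<Longrightarrow> exec w c (init_state xs \<omega>'\<lparr>tape := \<omega>\<rparr>) t (s'\<lparr>tape := sdrop d \<omega>\<rparr>)"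
        by (auto simp: init_state_def)
      have "stake d \<omega> = stake d \<omega>'"
        using \<open>stake t \<omega> = stake t \<omega>'\<close> d(1) by (metis min.absorb1 take_stake)
      then show "\<omega> \<in> H t" using d(2) by (auto simp: H_def init_state_def)
    qed
    also have "\<dots> \<in> sets (stream_space (count_space UNIV))"
      by (rule measurable_sets[OF measurable_stake]) simp
    finally show ?thesis by (simp add: sets_tape)
  qed
  \<comment> \<open>With \<infinity> as the value at all other \<open>t\<close>, the index set no
    longer depends on the tape, and a countable infimum of measurable functions remains.\<close>
  have "run_time w c (init_state xs \<omega>) = (INF t. if \<omega> \<in> H t then of_nat t else \<top>)" for \<omega>
  proof (rule antisym)
    show "run_time w c (init_state xs \<omega>) \<le> (INF t. if \<omega> \<in> H t then of_nat t else \<top>)"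
      unfolding run_time_def by (rule INF_greatest) (auto simp: H_def intro: INF_lower)
    show "(INF t. if \<omega> \<in> H t then of_nat t else \<top>) \<le> run_time w c (init_state xs \<omega>)"
      unfolding run_time_def
    proof (rule INF_greatest)
      fix t assume "t \<in> {t. \<exists>s'. exec w c (init_state xs \<omega>) t s'}"
      then have "\<omega> \<in> H t" by (simp add: H_def)
      then show "(INF t. if \<omega> \<in> H t then of_nat t else \<top>) \<le> (of_nat t :: ennreal)"
        by (intro INF_lower2[of t]) auto
    qed
  qed
  moreover have "(\<lambda>\<omega>. INF t. if \<omega> \<in> H t then of_nat t else (\<top> :: ennreal)) \<in> borel_measurable (tape_space w)"
  proof (rule borel_measurable_INF)
    fix t
    have [measurable]: "H t \<in> sets (tape_space w)" by (rule H)
    show "(\<lambda>\<omega>. if \<omega> \<in> H t then of_nat t else (\<top> :: ennreal)) \<in> borel_measurable (tape_space w)"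
      by measurable
  qed simp
  ultimately show ?thesis by simp
qed

section \<open>Linear hash functions over GF(2)\<close>

text \<open>The parity of the bits of \<open>x < 2 ^ 2 ^ k\<close>, computed by folding the word \<open>k\<close> times.\<close>

primrec par :: "nat \<Rightarrow> nat \<Rightarrow> nat" where
  "par 0 x = x"
| "par (Suc k) x = par k ((x div 2 ^ (2 ^ k)) XOR (x mod 2 ^ (2 ^ k)))"

lemma xor_less_pow: "x < 2 ^ m \<Longrightarrow> y < 2 ^ m \<Longrightarrow> x XOR y < (2::nat) ^ m"
  by (simp add: take_bit_nat_eq_self_iff[symmetric])

lemma and_less_pow:
  assumes "x < 2 ^ m"
  shows "x AND y < (2::nat) ^ m"
proof -
  have "x AND mask m = x"
    using assms by (simp add: take_bit_nat_eq_self_iff[symmetric] take_bit_eq_mask)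
  then have "(x AND mask m) AND y = x AND y" by simp
  then have "take_bit m (x AND y) = x AND y"
    by (simp only: take_bit_eq_mask ac_simps)
  then show ?thesis by (metis take_bit_nat_less_exp)
qed

lemma xor_nat_cancel [simp]: "(x::nat) XOR (x XOR y) = y"
  by (simp add: xor.assoc[symmetric])

lemma xor_nat_eq_0_iff: "(x::nat) XOR y = 0 \<longleftrightarrow> x = y"
proof
  assume "x XOR y = 0"
  then have "x XOR (x XOR y) = x" by simp
  then show "x = y" by simp
qed simp

lemma par_xor: "par k (x XOR y) = par k x XOR par k y"
proof (induction k arbitrary: x y)
  case (Suc k)
  have "(x XOR y) div 2 ^ m XOR (x XOR y) mod 2 ^ m = (x div 2 ^ m XOR x mod 2 ^ m) XOR (y div 2 ^ m XOR y mod 2 ^ m)" for m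
    by (simp add: drop_bit_eq_div[symmetric] take_bit_eq_mod[symmetric] drop_bit_xor take_bit_xor ac_simps)
  then show ?case by (simp add: Suc.IH)
qed simp

lemma par_less_2: "x < 2 ^ (2 ^ k) \<Longrightarrow> par k x < 2"
proof (induction k arbitrary: x)
  case (Suc k)
  have "x < 2 ^ (2 ^ k) * 2 ^ (2 ^ k)"
    using Suc.prems by (simp add: power_add[symmetric] mult_2)
  then have "x div 2 ^ (2 ^ k) < 2 ^ (2 ^ k)" by (simp add: less_mult_imp_div_less)
  then have "x div 2 ^ (2 ^ k) XOR x mod 2 ^ (2 ^ k) < 2 ^ (2 ^ k)" by (intro xor_less_pow) auto
  then show ?case using Suc.IH by simp
qed simp

lemma par_power: "i < 2 ^ k \<Longrightarrow> par k (2 ^ i) = 1"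
proof (induction k arbitrary: i)
  case (Suc k)
  show ?case
  proof (cases "i < 2 ^ k")
    case True
    then have "(2::nat) ^ i div 2 ^ (2 ^ k) = 0" "(2::nat) ^ i mod 2 ^ (2 ^ k) = 2 ^ i" by auto
    then show ?thesis using Suc.IH[OF True] by simp
  next
    case False
    then have "(2::nat) ^ i = 2 ^ (i - 2 ^ k) * 2 ^ (2 ^ k)" by (simp add: power_add[symmetric])
    then have "(2::nat) ^ i div 2 ^ (2 ^ k) = 2 ^ (i - 2 ^ k)" "(2::nat) ^ i mod 2 ^ (2 ^ k) = 0" by auto
    then show ?thesis using Suc.IH[of "i - 2 ^ k"] False Suc.prems by simp
  qed
qed simp

lemma par_and_less_2:
  assumes "w \<le> 2 ^ k" "x < 2 ^ w"
  shows "par k (x AND a) < 2"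
proof (rule par_less_2)
  have "x AND a < 2 ^ w" using assms(2) by (rule and_less_pow)
  also have "(2::nat) ^ w \<le> 2 ^ (2 ^ k)" using assms(1) by (intro power_increasing) auto
  finally show "x AND a < 2 ^ (2 ^ k)" .
qed

text \<open>Choose a bit that is set in \<open>z\<close>. Flipping this bit of \<open>a\<close>
  changes the parity of \<open>z AND a\<close>, so words of even and of odd parity are in
  bijection.\<close>

lemma card_par_zero:
  assumes z: "z \<noteq> 0" "z < 2 ^ w" and w: "w \<le> 2 ^ k"
  shows "2 * card {a. a < 2 ^ w \<and> par k (z AND a) = 0} = 2 ^ w"
proof -
  obtain i where i: "bit z i" using z(1) by (auto simp: bit_eq_iff)
  have "i < w"
  proof (rule ccontr)
    assume "\<not> i < w"
    then have "z < 2 ^ i" using z(2) by (meson le_less_trans leI less_le_trans one_le_numeral power_increasing)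
    then show False using i by (simp add: bit_iff_odd)
  qed
  have zi: "z AND 2 ^ i = 2 ^ i" using i by (intro bit_eqI) (auto simp: bit_and_iff bit_exp_iff)
  have lt2: "par k (z AND a) < 2" for a
    using w z(2) by (rule par_and_less_2)
  have flip: "par k (z AND (a XOR 2 ^ i)) = par k (z AND a) XOR 1" for a
  proof -
    have "z AND (a XOR 2 ^ i) = (z AND a) XOR (z AND 2 ^ i)"
      by (intro bit_eqI) (auto simp: bit_and_iff bit_xor_iff)
    then show ?thesis using \<open>i < w\<close> w by (simp add: par_xor zi par_power)
  qed
  define A where "A = (\<lambda>c. {a. a < 2 ^ w \<and> par k (z AND a) = c})"
  have small: "(2::nat) ^ i < 2 ^ w" using \<open>i < w\<close> by simp
  have x1: "(0::nat) XOR 1 = 1" "(1::nat) XOR 1 = 0" by simp_all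
  have "bij_betw (\<lambda>a. a XOR 2 ^ i) (A 0) (A 1)"
    by (rule bij_betw_byWitness[where f' = "\<lambda>a. a XOR 2 ^ i"])
      (use small x1 in \<open>auto simp: A_def flip xor.assoc intro: xor_less_pow\<close>)
  then have "card (A 0) = card (A 1)" by (rule bij_betw_same_card)
  moreover have "A 0 \<union> A 1 = {..<2 ^ w}"
    using lt2 by (auto simp: A_def less_2_cases_iff)
  moreover have "finite (A c)" for c by (simp add: A_def)
  moreover have "A 0 \<inter> A 1 = {}" by (auto simp: A_def)
  ultimately have "card (A 0) + card (A 0) = 2 ^ w"
    by (metis card_Un_disjoint card_lessThan)
  then show ?thesis by (simp add: A_def)
qed

definition vanishes :: "nat \<Rightarrow> nat list \<Rightarrow> nat \<Rightarrow> bool" where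
  "vanishes k u z \<longleftrightarrow> (\<forall>a\<in>set u. par k (z AND a) = 0)"

lemma avg_vanishes:
  assumes "z \<noteq> 0" "z < 2 ^ w" "w \<le> 2 ^ k"
  shows "avg (2 ^ w) m (\<lambda>u. of_bool (vanishes k u z)) = (1 / 2) ^ m"
proof -
  have "2 * real (card {a. a < 2 ^ w \<and> par k (z AND a) = 0}) = 2 ^ w"
    using arg_cong[OF card_par_zero[OF assms], of real] by simp
  then have "real (card {a. a < 2 ^ w \<and> par k (z AND a) = 0}) / real (2 ^ w) = 1 / 2"
    by (simp add: field_simps)
  then show ?thesis unfolding vanishes_def avg_list_all by (simp only:)
qed

text \<open>The product over GF(2) of the matrix with rows \<open>a i\<close> and the bit vector
  \<open>x\<close>. Its bits are collected by Horner's rule, row 0 giving the highest one.\<close>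

primrec hsh :: "nat \<Rightarrow> (nat \<Rightarrow> nat) \<Rightarrow> nat \<Rightarrow> nat \<Rightarrow> nat" where
  "hsh k a 0 x = 0"
| "hsh k a (Suc m) x = 2 * hsh k a m x + par k (x AND a m)"

lemma double_xor:
  fixes p q x y :: nat
  assumes "p < 2" "q < 2"
  shows "(2 * x + p) XOR (2 * y + q) = 2 * (x XOR y) + (p XOR q)"
proof -
  have "p = 0 \<or> p = 1" "q = 0 \<or> q = 1" using assms by auto
  then show ?thesis
  proof (intro bit_eqI)
    fix n
    show "bit ((2 * x + p) XOR (2 * y + q)) n = bit (2 * (x XOR y) + (p XOR q)) n"
      unfolding bit_xor_iff using \<open>p = 0 \<or> p = 1\<close> \<open>q = 0 \<or> q = 1\<close>
      by (cases n) (auto simp: bit_xor_iff bit_Suc bit_0)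
  qed
qed

context
  fixes k w :: nat
  assumes w: "w \<le> 2 ^ k"
begin

lemma hsh_xor: "x < 2 ^ w \<Longrightarrow> y < 2 ^ w \<Longrightarrow> hsh k a m (x XOR y) = hsh k a m x XOR hsh k a m y"
proof (induction m)
  case (Suc m)
  have "(x XOR y) AND a m = (x AND a m) XOR (y AND a m)"
    by (intro bit_eqI) (auto simp: bit_and_iff bit_xor_iff)
  then show ?case using Suc by (simp add: double_xor par_and_less_2[OF w] par_xor)
qed simp

lemma hsh_less: "x < 2 ^ w \<Longrightarrow> hsh k a m x < 2 ^ m"
proof (induction m)
  case (Suc m)
  then have "hsh k a m x + 1 \<le> 2 ^ m" by simp
  then have "2 * hsh k a m x + 2 \<le> 2 ^ Suc m" by simp
  then show ?case using par_and_less_2[OF w Suc.prems, of "a m"] by simp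
qed simp

end

lemma hsh_eq_0_iff: "hsh k a m x = 0 \<longleftrightarrow> (\<forall>i<m. par k (x AND a i) = 0)"
  by (induction m) (auto simp: less_Suc_eq)

lemma hsh_eq_0_vanishes:
  "hsh k a m x = 0 \<longleftrightarrow> vanishes k (map a [0..<m]) x"
  by (auto simp: hsh_eq_0_iff vanishes_def)

lemma hsh_cong: "(\<And>i. i < m \<Longrightarrow> a i = b i) \<Longrightarrow> hsh k a m x = hsh k b m x"
  by (induction m) auto

section \<open>The program\<close>

lemma ht_Sq_Asg:
  assumes "ht w d T (set_reg r (eval w e \<sigma>) \<sigma>) Q" "ecost e + 1 + T \<le> T'"
  shows "ht w (r ::= e ;; d) T' \<sigma> Q"
  using assms by (simp add: ht_def)

text \<open>Naming the assigned value keeps symbolic states linear in the length of the program.\<close>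

lemma ht_Sq_Asg':
  assumes "eval w e \<sigma> = x" "ht w d T (set_reg r x \<sigma>) Q" "ecost e + 1 + T \<le> T'"
  shows "ht w (r ::= e ;; d) T' \<sigma> Q"
  using assms by (simp add: ht_def)

lemma ht_Asg':
  assumes "eval w e \<sigma> = x" "Q (set_reg r x \<sigma>)" "ecost e + 1 \<le> T'"
  shows "ht w (r ::= e) T' \<sigma> Q"
  using assms by (simp add: ht_def)

lemma ht_Asg:
  assumes "Q (set_reg r (eval w e \<sigma>) \<sigma>)" "ecost e + 1 \<le> T'"
  shows "ht w (r ::= e) T' \<sigma> Q"
  using assms by (simp add: ht_def)

definition set_mem :: "nat \<Rightarrow> nat \<Rightarrow> nat \<Rightarrow> state \<Rightarrow> state" where
  "set_mem m a x \<sigma> = \<sigma>\<lparr>mem := (mem \<sigma>)(m := (mem \<sigma> m)(a := x))\<rparr>"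

lemma set_mem_simps [simp]:
  "regs (set_mem m a x \<sigma>) = regs \<sigma>" "mem (set_mem m a x \<sigma>) = (mem \<sigma>)(m := (mem \<sigma> m)(a := x))"
  "tape (set_mem m a x \<sigma>) = tape \<sigma>"
  by (auto simp: set_mem_def)

lemma ht_Sq_Sto:
  assumes "ht w d T (set_mem m (eval w a \<sigma>) (eval w e \<sigma>) \<sigma>) Q" "ecost a + ecost e + 1 + T \<le> T'"
  shows "ht w (Sto m a e ;; d) T' \<sigma> Q"
  using assms by (simp add: ht_def set_mem_def)

lemma ht_Sto:
  assumes "Q (set_mem m (eval w a \<sigma>) (eval w e \<sigma>) \<sigma>)" "ecost a + ecost e + 1 \<le> T'"
  shows "ht w (Sto m a e) T' \<sigma> Q"
  using assms by (simp add: ht_def set_mem_def)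

lemma ht_Nop: "Q \<sigma> \<Longrightarrow> 1 \<le> T \<Longrightarrow> ht w Nop T \<sigma> Q"
  by (simp add: ht_def)

text \<open>Describes the whole bank, with 0 behind the list. Such precision is required of bank 10,
  which has to agree with an initial memory of the subroutine in every cell.\<close>

definition arr :: "nat list \<Rightarrow> nat \<Rightarrow> nat" where
  "arr xs a = (if a < length xs then xs ! a else 0)"

lemma arr_snoc: "(arr xs)(length xs := x) = arr (xs @ [x])"
  by (auto simp: arr_def fun_eq_iff nth_append)

text \<open>Allows a cell to be reserved for a length that is not known yet.\<close>

lemma arr_snoc_0: "arr (xs @ [0]) = arr xs"
  by (auto simp: arr_def fun_eq_iff nth_append)

text \<open>In contrast to \<open>arr\<close>, leaves the cells behind the list open: while bank 3
  is being refilled, it still contains words from an earlier try.\<close>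

definition holds_list :: "(nat \<Rightarrow> nat) \<Rightarrow> nat list \<Rightarrow> bool" where
  "holds_list f xs \<longleftrightarrow> (\<forall>a<length xs. f a = xs ! a)"

lemma holds_list_snoc: "holds_list f xs \<Longrightarrow> holds_list (f(length xs := x)) (xs @ [x])"
  by (auto simp: holds_list_def nth_append)

abbreviation cst :: "nat \<Rightarrow> exp" where "cst k \<equiv> N (\<lambda>_. k)"

section \<open>Computation of parities and hash values\<close>

definition klog :: "nat \<Rightarrow> nat" where "klog w = (LEAST k. w \<le> 2 ^ k)"

lemma klog: "w \<le> 2 ^ klog w" "klog w > 0 \<Longrightarrow> 2 ^ (klog w - 1) < w"
proof -
  have "w \<le> 2 ^ w" using less_exp[of w] by simp
  then show "w \<le> 2 ^ klog w" unfolding klog_def by (rule LeastI)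
  show "2 ^ (klog w - 1) < w" if "klog w > 0"
    using not_less_Least[of "klog w - 1" "\<lambda>k. w \<le> 2 ^ k"] that unfolding klog_def by simp
qed

abbreviation (input) "vn \<equiv> (2::nat)"
abbreviation (input) "vl \<equiv> (3::nat)"
abbreviation (input) "vr \<equiv> (4::nat)"
abbreviation (input) "vs \<equiv> (5::nat)"
abbreviation (input) "vR \<equiv> (6::nat)"
abbreviation (input) "vu \<equiv> (7::nat)"
abbreviation (input) "vU \<equiv> (8::nat)"
abbreviation (input) "vC \<equiv> (9::nat)"
abbreviation (input) "vL \<equiv> (10::nat)"
abbreviation (input) "vB \<equiv> (11::nat)"
abbreviation (input) "vb \<equiv> (12::nat)"
abbreviation (input) "vok \<equiv> (13::nat)"
abbreviation (input) "vpos \<equiv> (14::nat)"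
abbreviation (input) "vx \<equiv> (15::nat)"
abbreviation (input) "vbb \<equiv> (16::nat)"
abbreviation (input) "vnb \<equiv> (17::nat)"
abbreviation (input) "vh \<equiv> (18::nat)"
abbreviation (input) "vy \<equiv> (19::nat)"
abbreviation (input) "vi \<equiv> (20::nat)"
abbreviation (input) "vj \<equiv> (21::nat)"
abbreviation (input) "vt \<equiv> (22::nat)"
abbreviation (input) "vv \<equiv> (23::nat)"
abbreviation (input) "ve \<equiv> (24::nat)"
abbreviation (input) "vsum \<equiv> (25::nat)"
abbreviation (input) "vd \<equiv> (26::nat)"
abbreviation (input) "vid \<equiv> (27::nat)"
abbreviation (input) "vmul \<equiv> (28::nat)"
abbreviation (input) "vk \<equiv> (29::nat)"
abbreviation (input) "vp \<equiv> (30::nat)"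
abbreviation (input) "va \<equiv> (31::nat)"
abbreviation (input) "vnp \<equiv> (32::nat)"
abbreviation (input) "vlo1 \<equiv> (33::nat)"
abbreviation (input) "vcn1 \<equiv> (34::nat)"
abbreviation (input) "vlo2 \<equiv> (35::nat)"
abbreviation (input) "vcn2 \<equiv> (36::nat)"
abbreviation (input) "vlen \<equiv> (37::nat)"
abbreviation (input) "vcand \<equiv> (38::nat)"
abbreviation (input) "vfb \<equiv> (39::nat)"
abbreviation (input) "vq \<equiv> (40::nat)"
abbreviation (input) "vuu \<equiv> (41::nat)"

text \<open>In round j this is \<open>2 ^ (klog w - 1 - j)\<close>, half the current length of the
  word that is being folded.\<close>

definition SHIFT :: exp where
  "SHIFT = B Shl (cst 1) (B Sub (N (\<lambda>w. klog w - 1)) (V vj))"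

definition PAR :: loopc where
  "PAR = For vj (N klog)
     (vy ::= B Xor (B Shr (V vy) SHIFT) (B Mod (V vy) (B Shl (cst 1) SHIFT)))"

text \<open>Hashes the word in \<open>vx\<close> with the \<open>vnb\<close> random words in bank 2 that start at \<open>vbb\<close>.\<close>

definition HASH :: loopc where
  "HASH = vh ::= cst 0 ;; For vi (V vnb)
     (vy ::= B And (V vx) (Rd 2 (B Add (V vbb) (V vi))) ;; PAR ;;
      vh ::= B Add (B Mul (cst 2) (V vh)) (V vy))"

lemma klog_less: "w \<ge> 2 \<Longrightarrow> klog w < w"
proof -
  assume "w \<ge> 2"
  then have "w \<le> 2 ^ (w - 1)"
  proof (induction w rule: dec_induct)
    case (step m)
    then have "Suc m \<le> 2 * 2 ^ (m - 1)" by simp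
    then show ?case using step by (cases m) auto
  qed simp
  then have "klog w \<le> w - 1" unfolding klog_def by (rule Least_le)
  then show ?thesis using \<open>w \<ge> 2\<close> by simp
qed

lemma writes_PAR [simp]: "writes PAR = {vj, vy}" "stores PAR = {}" "draws PAR = False"
  by (auto simp: PAR_def)

lemma writes_HASH [simp]: "writes HASH = {vh, vi, vy, vj}" "stores HASH = {}" "draws HASH = False"
  by (auto simp: HASH_def)

lemma less_two_power: "x \<le> w \<Longrightarrow> x < 2 ^ w" for x w :: nat
  using less_exp[of w] by linarith

lemma ht_PAR:
  assumes "w \<ge> 2"
  shows "ht w PAR (klog w * 40 + 10) \<sigma> (\<lambda>\<tau>. regs \<tau> vy = par (klog w) (regs \<sigma> vy))"
proof -
  define I where "I = (\<lambda>k (\<tau>::state). par (klog w - k) (regs \<tau> vy) = par (klog w) (regs \<sigma> vy))"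
  have "ht w PAR (klog w * 40 + 10) \<sigma> (I (klog w))"
    unfolding PAR_def
  proof (rule ht_For[where T = 30])
    show "eval w (N klog) \<sigma> mod 2 ^ w = klog w"
      using less_two_power[of "klog w" w] klog_less[OF assms] by simp
    show "I 0 \<sigma>" by (simp add: I_def)
    fix k \<tau> assume k: "k < klog w" and I: "I k \<tau>"
    define j where "j = klog w - 1 - k"
    have j: "klog w - k = Suc j" "klog w - Suc k = j" using k by (auto simp: j_def)
    have "(2::nat) ^ j \<le> 2 ^ (klog w - 1)" by (intro power_increasing) (auto simp: j_def)
    \<comment> \<open>The inequality is strict because \<open>klog w\<close> is minimal. It keeps
      the modulus \<open>2 ^ 2 ^ j\<close> below \<open>2 ^ w\<close>, so that the shift does not
      overflow.\<close>
    then have lt: "2 ^ j < w" using klog(2)[of w] k by linarith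
    then have "(2::nat) ^ j < 2 ^ w" "(2::nat) ^ 2 ^ j < 2 ^ w"
      using less_two_power[of "2 ^ j" w] by auto
    moreover have "klog w - 1 < 2 ^ w" using less_two_power[of "klog w - 1" w] klog_less[OF assms] by simp
    moreover have "(klog w - 1 + (2 ^ w - k)) mod 2 ^ w = j"
    proof -
      have "k < 2 ^ w" using k \<open>klog w - 1 < 2 ^ w\<close> by linarith
      then have "klog w - 1 + (2 ^ w - k) = 2 ^ w + j" using k by (simp add: j_def)
      then show ?thesis using \<open>klog w - 1 < 2 ^ w\<close> by (simp add: j_def)
    qed
    moreover have "1 < (2::nat) ^ w" using assms by (metis one_less_numeral_iff one_less_power semiring_norm(76) not_gr0 numeral_2_eq_2 not_less_eq_eq le0)
    ultimately show "ht w (vy ::= B Xor (B Shr (V vy) SHIFT) (B Mod (V vy) (B Shl (cst 1) SHIFT)))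
        30 (set_reg vj k \<tau>) (I (Suc k))"
      using I j by (intro ht_Asg) (auto simp: I_def SHIFT_def)
  qed simp
  then show ?thesis by (simp add: I_def)
qed

text \<open>A time bound for \<open>m\<close> hash bits. Folding costs O(log w) per parity instead
  of O(w), and w may be any polynomial in n; thus hashing a word takes only O((log n)^2)
  steps.\<close>

definition HC :: "nat \<Rightarrow> nat \<Rightarrow> nat" where "HC w m = m * (klog w * 40 + 50) + 20"

text \<open>Stated together with the rest \<open>d\<close> of the program, so that symbolic
  execution continues behind the hash computation. The bound \<open>m'\<close> lets both hash
  functions be charged the same time.\<close>

lemma ht_HASH:
  assumes w: "w \<ge> 2" and x: "regs \<sigma> vx < 2 ^ w" and m: "regs \<sigma> vnb < w" and b: "regs \<sigma> vbb + regs \<sigma> vnb < 2 ^ w"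
    and post: "\<And>\<tau>. regs \<tau> vh = hsh (klog w) (\<lambda>i. mem \<sigma> 2 (regs \<sigma> vbb + i)) (regs \<sigma> vnb) (regs \<sigma> vx) \<Longrightarrow>
       frame HASH \<sigma> \<tau> \<Longrightarrow> ht w d T \<tau> Q"
    and T: "regs \<sigma> vnb \<le> m'" "HC w m' + T \<le> T'"
  shows "ht w (HASH ;; d) T' \<sigma> Q"
proof (rule ht_Sq)
  let ?m = "regs \<sigma> vnb" and ?b = "regs \<sigma> vbb" and ?x = "regs \<sigma> vx" and ?a = "\<lambda>i. mem \<sigma> 2 (regs \<sigma> vbb + i)"
  define I where "I = (\<lambda>k (\<tau>::state). regs \<tau> vh = hsh (klog w) ?a k ?x)"
  have two: "(2::nat) < 2 ^ w" if "?m > 0"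
  proof -
    have "w > 1" using m that by simp
    have "(2::nat)^1 < 2 ^ w" by (rule power_strict_increasing) (use \<open>w > 1\<close> in auto)
    then show ?thesis by simp
  qed
  show "ht w HASH (HC w ?m) \<sigma> (\<lambda>\<tau>. regs \<tau> vh = hsh (klog w) ?a ?m ?x)"
    unfolding HASH_def
  proof (rule ht_Sq_Asg)
    have "ht w (For vi (V vnb)
     (vy ::= B And (V vx) (Rd 2 (B Add (V vbb) (V vi))) ;; PAR ;;
      vh ::= B Add (B Mul (cst 2) (V vh)) (V vy))) (HC w ?m - 2) (set_reg vh (eval w (cst 0) \<sigma>) \<sigma>) (I ?m)"
    proof (rule ht_For[where T = "klog w * 40 + 30"])
      show "eval w (V vnb) (set_reg vh (eval w (cst 0) \<sigma>) \<sigma>) mod 2 ^ w = ?m"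
        using m less_two_power[of ?m w] by simp
      show "I 0 (set_reg vh (eval w (cst 0) \<sigma>) \<sigma>)" by (simp add: I_def)
      fix k \<tau> assume k: "k < ?m" and I: "I k \<tau>"
        and fr: "frame (For vi (V vnb) (vy ::= B And (V vx) (Rd 2 (B Add (V vbb) (V vi))) ;; PAR ;;
            vh ::= B Add (B Mul (cst 2) (V vh)) (V vy))) (set_reg vh (eval w (cst 0) \<sigma>) \<sigma>) \<tau>"
      have fr': "regs \<tau> vx = ?x" "regs \<tau> vbb = ?b" "mem \<tau> = mem \<sigma>"
        using fr by (auto simp: frame_def)
      have bk: "(?b + k) mod 2 ^ w = ?b + k" using b k by simp
      have "hsh (klog w) ?a (Suc k) ?x < 2 ^ Suc k" by (rule hsh_less[OF klog(1) x])
      also have "(2::nat) ^ Suc k \<le> 2 ^ w" by (rule power_increasing) (use k m in auto)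
      finally have hl: "2 * hsh (klog w) ?a k ?x + par (klog w) (?x AND mem \<sigma> 2 (?b + k)) < 2 ^ w"
        by simp
      show "ht w (vy ::= B And (V vx) (Rd 2 (B Add (V vbb) (V vi))) ;; PAR ;;
            vh ::= B Add (B Mul (cst 2) (V vh)) (V vy)) (klog w * 40 + 30) (set_reg vi k \<tau>) (I (Suc k))"
      proof (rule ht_Sq_Asg, rule ht_Sq[OF ht_PAR[OF w]])
        fix \<tau>'
        assume 1: "regs \<tau>' vy = par (klog w) (regs (set_reg vy (eval w (B And (V vx) (Rd 2 (B Add (V vbb) (V vi))))
           (set_reg vi k \<tau>)) (set_reg vi k \<tau>)) vy)"
          and 2: "frame PAR (set_reg vy (eval w (B And (V vx) (Rd 2 (B Add (V vbb) (V vi))))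
           (set_reg vi k \<tau>)) (set_reg vi k \<tau>)) \<tau>'"
        have "regs \<tau>' vy = par (klog w) (?x AND mem \<sigma> 2 (?b + k))"
          using 1 fr' bk by simp
        moreover have "regs \<tau>' vh = hsh (klog w) ?a k ?x"
          using 2 I by (simp add: frame_def I_def)
        ultimately show "ht w (vh ::= B Add (B Mul (cst 2) (V vh)) (V vy)) 10 \<tau>' (I (Suc k))"
          using hl two k by (intro ht_Asg) (auto simp: I_def)
      qed auto
    qed (simp add: HC_def algebra_simps)
    then show "ht w (For vi (V vnb)
     (vy ::= B And (V vx) (Rd 2 (B Add (V vbb) (V vi))) ;; PAR ;;
      vh ::= B Add (B Mul (cst 2) (V vh)) (V vy))) (HC w ?m - 2) (set_reg vh (eval w (cst 0) \<sigma>) \<sigma>)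
       (\<lambda>\<tau>. regs \<tau> vh = hsh (klog w) ?a ?m ?x)" by (simp add: I_def)
  qed (simp add: HC_def)
  have "HC w ?m \<le> HC w m'" using T(1) by (auto simp: HC_def intro: mult_right_mono)
  then show "HC w ?m + T \<le> T'" using T(2) by simp
qed (use post in blast)

lemma frame_HASH:
  "frame HASH \<sigma> \<tau> \<longleftrightarrow> (\<forall>r. r \<noteq> vh \<and> r \<noteq> vi \<and> r \<noteq> vy \<and> r \<noteq> vj \<longrightarrow> regs \<tau> r = regs \<sigma> r) \<and>
     mem \<tau> = mem \<sigma> \<and> tape \<tau> = tape \<sigma>"
  by (auto simp: frame_def fun_eq_iff)

section \<open>Parameters, random words and the search for a balanced hash function\<close>

definition SETUP :: "(nat \<Rightarrow> nat) \<Rightarrow> loopc" where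
  "SETUP P =
     vl ::= cst 0 ;;
     For vi (V vn) (Ite (B Shr (V vn) (B Add (V vi) (cst 1))) (vl ::= B Add (V vi) (cst 1)) Nop) ;;
     vr ::= B Div (B Mul (V vl) (N P)) (N (\<lambda>w. w)) ;;
     vs ::= B Shl (cst 1) (B Sub (V vl) (V vr)) ;;
     vR ::= B Shl (cst 1) (V vr) ;;
     vu ::= B Mul (cst 2) (B Add (B Sub (V vl) (V vr)) (cst 2)) ;;
     vU ::= B Mul (cst 4) (V vs) ;;
     vC ::= B Add (B Div (V vn) (V vs)) (cst 1) ;;
     vL ::= B Add (V vl) (cst 1) ;;
     vB ::= B Mul (cst 160) (V vR)"

text \<open>Layout of bank 2: the \<open>r\<close> words of each of the \<open>L\<close> tries come
  first, followed by the \<open>u\<close> words of each of the \<open>L\<close> repetitions. Hence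
  the first function of try \<open>t\<close> is at \<open>t * r\<close> and the second of repetition
  \<open>i\<close> at \<open>L * r + i * u\<close>. Words of tries behind the accepted one are drawn
  as well, which keeps the number of words fixed.\<close>

definition DRAW :: loopc where
  "DRAW = For vi (B Mul (V vL) (B Add (V vr) (V vu))) (Rnd vx ;; Sto 2 (V vi) (V vx))"

text \<open>Sorts the input by hash value into bank 3; bank 4 receives the positions of the buckets.\<close>

definition SORT :: loopc where
  "SORT = vpos ::= cst 0 ;;
     For vv (V vR) (Sto 4 (V vv) (V vpos) ;;
       For ve (V vn) (vx ::= Rd 0 (B Add (V ve) (cst 1)) ;; HASH ;;
         Ite (B Eq (V vh) (V vv)) (Sto 3 (V vpos) (V vx) ;; vpos ::= B Add (V vpos) (cst 1)) Nop)) ;;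
     Sto 4 (V vR) (V vpos)"

text \<open>The sum stops growing once it exceeds the bound, so that it cannot overflow.\<close>

definition SQSUM :: loopc where
  "SQSUM = vsum ::= cst 0 ;;
     For vv (V vR) (vd ::= B Add (B Sub (B Div (Rd 4 (B Add (V vv) (cst 1))) (V vs)) (B Div (Rd 4 (V vv)) (V vs))) (cst 1) ;;
       Ite (B Less (V vB) (V vsum)) Nop (vsum ::= B Add (V vsum) (B Mul (V vd) (V vd))))"

text \<open>After the first success all further iterations are idle. So \<open>vb\<close> keeps the
  offset of the first accepted function, and banks 3 and 4 keep its buckets.\<close>

definition TRIES :: loopc where
  "TRIES = vb ::= cst 0 ;; vok ::= cst 0 ;; vnb ::= V vr ;;
     For vt (V vL) (Ite (V vok) Nop
       (vbb ::= V vb ;; SORT ;; SQSUM ;;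
        Ite (B Less (V vB) (V vsum)) (vb ::= B Add (V vb) (V vr)) (vok ::= cst 1)))"

lemma writes_DRAW [simp]: "writes DRAW = {vi, vx}" "stores DRAW = {2}" "draws DRAW = True"
  by (auto simp: DRAW_def)
lemma writes_SETUP [simp]: "writes (SETUP P) = {vi, vl, vr, vs, vR, vu, vU, vC, vL, vB}" "stores (SETUP P) = {}"
  "draws (SETUP P) = False"
  by (auto simp: SETUP_def)
lemma writes_SORT [simp]: "writes SORT = {vpos, vv, ve, vx, vh, vi, vy, vj}" "stores SORT = {3, 4}" "draws SORT = False"
  by (auto simp: SORT_def)
lemma writes_SQSUM [simp]: "writes SQSUM = {vsum, vv, vd}" "stores SQSUM = {}" "draws SQSUM = False"
  by (auto simp: SQSUM_def)
lemma writes_TRIES [simp]: "writes TRIES = {vb, vok, vnb, vt, vbb, vpos, vv, ve, vx, vh, vi, vy, vj, vsum, vd}"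
  "stores TRIES = {3, 4}" "draws TRIES = False"
  by (auto simp: TRIES_def)

lemma square_less_power: "8 \<le> w \<Longrightarrow> w * w < (2::nat) ^ w"
proof (induction w rule: dec_induct)
  case (step m)
  have "8 * m \<le> m * m" using step.hyps by (intro mult_right_mono) auto
  moreover have "Suc m * Suc m = m * m + 2 * m + 1" by simp
  ultimately have "Suc m * Suc m \<le> 2 * (m * m)" using step.hyps by linarith
  also have "\<dots> < 2 * 2 ^ m" using step.IH by simp
  finally show ?case by simp
qed simp

text \<open>
  There are \<open>R\<close> buckets, \<open>NC\<close> chunks of \<open>s\<close> consecutive positions, and \<open>L\<close> tries or repetitions. The
  second hash function has \<open>u\<close> bits and values below \<open>U * U\<close>. A set of either family, of size \<open>NA\<close>, is given by
  a repetition, a chunk and a number below \<open>U\<close>. The first hash function is accepted if the sum of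
  squares is at most \<open>Bd\<close>. The last assumption ensures that no arithmetic operation overflows.
\<close>

locale params =
  fixes w n l r s R u U NC L NA Bd :: nat and xs :: "nat list" and P :: "nat \<Rightarrow> nat"
  assumes length_xs: "length xs = n" and distinct_xs: "distinct xs" and xs_words: "set xs \<subseteq> {..<2 ^ w}"
    and l: "2 ^ l \<le> n" "n < 2 * 2 ^ l" and r_le: "r \<le> l" and r: "r = l * P w div w" and P: "P w \<le> w"
    and w: "8 \<le> w"
    and s: "s = 2 ^ (l - r)" and R: "R = 2 ^ r" and u: "u = 2 * (l - r + 2)" and U: "U = 4 * s"
    and NC: "NC = n div s + 1" and L: "L = l + 1" and NA: "NA = L * NC * U" and Bd: "Bd = 160 * R"
    and limit: "4 + 2 * (NA * (s + 1)) + 2 * (n * Bd * L) + U * U + Bd + (2 * R + 2) * (2 * R + 2) + L * (r + u) + n < 2 ^ w"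
begin

lemma bounds:
  "n < 2 ^ w" "Bd < 2 ^ w" "U * U < 2 ^ w" "L * (r + u) < 2 ^ w" "n * Bd * L < 2 ^ w" "R < 2 ^ w"
  using limit by auto

lemma pos: "s > 0" "R > 0" "U > 0" "NC > 0" "L > 0" "Bd > 0" "NA > 0" "n > 0"
proof -
  have "0 < (2::nat) ^ l" by simp
  then show "n > 0" using l(1) by linarith
qed (auto simp: s R U NC L Bd NA)

lemma sR: "s * R = 2 ^ l"
  using r_le by (simp add: s R power_add[symmetric])

lemma U_less: "U < 2 ^ w" "NA < 2 ^ w" "NC < 2 ^ w"
proof -
  have "U \<le> U * U" using pos by simp
  then show "U < 2 ^ w" using bounds(3) by linarith
  have "NA \<le> NA * (s + 1)" by simp
  then show "NA < 2 ^ w" using limit by linarith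
  moreover have "NC * 1 \<le> NC * (L * U)" using pos by (intro mult_le_mono2) (simp add: Suc_le_eq)
  then have "NC \<le> NA" by (simp add: NA mult.assoc mult.left_commute)
  ultimately show "NC < 2 ^ w" by linarith
qed

lemma R_le: "R \<le> n" "s \<le> n" "l < w" "L \<le> w"
proof -
  have "s * R \<le> n" using sR l by simp
  then show "R \<le> n" "s \<le> n" using pos(1,2)
    by (metis One_nat_def Suc_leI le_trans mult.commute mult_le_mono1 nat_mult_1, metis One_nat_def Suc_leI le_trans mult.commute mult_le_mono1 nat_mult_1)
  have "(2::nat) ^ l < 2 ^ w" using l(1) bounds(1) by linarith
  then show "l < w" by simp
  then show "L \<le> w" by (simp add: L)
qed

lemma r_u_less: "r < w" "u < w"
proof -
  have "2 ^ r \<le> Bd" by (simp add: Bd R)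
  then have "(2::nat) ^ r < 2 ^ w" using bounds(2) by (rule le_less_trans)
  then show "r < w" by simp
  have "U * U = 2 ^ u" by (simp add: U s u power_add power_mult mult_2 power2_eq_square)
  then have "(2::nat) ^ u < 2 ^ w" using bounds(3) by simp
  then show "u < w" by simp
qed

lemma w_pos [simp]: "0 < w" "w \<noteq> 0" "Suc 0 \<le> w"
  using w by auto

lemma small: "256 \<le> (2::nat) ^ w"
  using power_increasing[OF w, of "2::nat"] by simp

lemma const_mod [simp]: "k \<le> 255 \<Longrightarrow> k mod 2 ^ w = (k::nat)"
  using small by simp

definition Par :: "state \<Rightarrow> bool" where
  "Par \<sigma> \<longleftrightarrow> regs \<sigma> vn = n \<and> regs \<sigma> vl = l \<and> regs \<sigma> vr = r \<and> regs \<sigma> vs = s \<and> regs \<sigma> vR = R \<and>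
     regs \<sigma> vu = u \<and> regs \<sigma> vU = U \<and> regs \<sigma> vC = NC \<and> regs \<sigma> vL = L \<and> regs \<sigma> vB = Bd \<and>
     mem \<sigma> 0 = arr (n # xs)"

lemma Par_frame:
  "Par \<sigma> \<Longrightarrow> frame c \<sigma> \<tau> \<Longrightarrow> writes c \<inter> {vn, vl, vr, vs, vR, vu, vU, vC, vL, vB} = {} \<Longrightarrow> 0 \<notin> stores c \<Longrightarrow> Par \<tau>"
  by (auto simp: Par_def frame_def)

lemma Par_set_reg [simp]:
  "v \<notin> {vn, vl, vr, vs, vR, vu, vU, vC, vL, vB} \<Longrightarrow> Par (set_reg v a \<sigma>) = Par \<sigma>"
  by (auto simp: Par_def)

lemma Par_set_mem [simp]: "m \<noteq> 0 \<Longrightarrow> Par (set_mem m a b \<sigma>) = Par \<sigma>"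
  by (auto simp: Par_def)

lemma Sub_mod: "y \<le> x \<Longrightarrow> x < 2 ^ w \<Longrightarrow> (x + (2 ^ w - y)) mod 2 ^ w = x - (y::nat)"
proof -
  assume "y \<le> x" "x < 2 ^ w"
  then have "x + (2 ^ w - y) = (x - y) + 2 ^ w" "x - y < 2 ^ w" by auto
  then show ?thesis by simp
qed

text \<open>The exponent \<gamma> enters as the fraction \<open>P w / w\<close>, so that
  \<open>r\<close> becomes approximately \<gamma> \<open>l\<close>. The product
  \<open>l * P w\<close> does not overflow, since \<open>w * w < 2 ^ w\<close>. Linear search for
  \<open>l\<close>, the integer part of the binary logarithm of \<open>n\<close>, takes O(n) steps
  and is affordable.\<close>

lemma ht_SETUP:
  assumes n: "regs \<sigma> vn = n" and mem: "mem \<sigma> 0 = arr (n # xs)"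
  shows "ht w (SETUP P) (n * 20 + 100) \<sigma> Par"
  unfolding SETUP_def
proof (rule ht_Sq_Asg)
  define \<sigma>0 where "\<sigma>0 = set_reg vl (eval w (cst 0) \<sigma>) \<sigma>"
  define I where "I = (\<lambda>k (\<tau>::state). 2 ^ regs \<tau> vl \<le> n \<and> (\<forall>i\<le>k. 2 ^ i \<le> n \<longrightarrow> i \<le> regs \<tau> vl))"
  let ?loop = "For vi (V vn) (Ite (B Shr (V vn) (B Add (V vi) (cst 1))) (vl ::= B Add (V vi) (cst 1)) Nop)"
  let ?rest = "vr ::= B Div (B Mul (V vl) (N P)) (N (\<lambda>w. w)) ;;
     vs ::= B Shl (cst 1) (B Sub (V vl) (V vr)) ;;
     vR ::= B Shl (cst 1) (V vr) ;;
     vu ::= B Mul (cst 2) (B Add (B Sub (V vl) (V vr)) (cst 2)) ;;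
     vU ::= B Mul (cst 4) (V vs) ;;
     vC ::= B Add (B Div (V vn) (V vs)) (cst 1) ;;
     vL ::= B Add (V vl) (cst 1) ;;
     vB ::= B Mul (cst 160) (V vR)"
  show "ht w (?loop ;; ?rest) (n * 20 + 90) (set_reg vl (eval w (cst 0) \<sigma>) \<sigma>) Par"
    unfolding \<sigma>0_def[symmetric]
  proof (rule ht_Sq[where P = "I n"])
    show "ht w ?loop (n * 20 + 10) \<sigma>0 (I n)"
    proof (rule ht_For[where T = "15"])
      show "eval w (V vn) \<sigma>0 mod 2 ^ w = n" using n bounds(1) by (simp add: \<sigma>0_def)
      show "I 0 \<sigma>0" using pos(8) by (auto simp: I_def \<sigma>0_def)
      fix k \<tau> assume k: "k < n" "I k \<tau>" "frame ?loop \<sigma>0 \<tau>"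
      have n': "regs \<tau> vn = n" using k(3) n by (simp add: frame_def \<sigma>0_def)
      have k1: "(k + 1) mod 2 ^ w = k + 1" using k(1) bounds(1) by simp
      have le: "n div 2 ^ (k + 1) \<noteq> 0 \<longleftrightarrow> 2 ^ (k + 1) \<le> n"
        by (simp add: div_eq_0_iff not_less del: power_Suc)
      show "ht w (Ite (B Shr (V vn) (B Add (V vi) (cst 1))) (vl ::= B Add (V vi) (cst 1)) Nop)
          15 (set_reg vi k \<tau>) (I (Suc k))"
        using k(2) n' k1 le
        by (intro ht_Ite[where ?T1.0 = 6] ht_Asg ht_Nop) (auto simp: I_def le_Suc_eq)
    qed simp
    fix \<tau> assume I: "I n \<tau>" and fr: "frame ?loop \<sigma>0 \<tau>"
    have ll: "regs \<tau> vl = l"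
    proof -
      have "l < n" using l(1) less_exp[of l] by linarith
      then have "l \<le> regs \<tau> vl" using I l(1) by (auto simp: I_def)
      moreover have "2 ^ regs \<tau> vl < (2::nat) ^ Suc l" using I l(2) by (auto simp: I_def)
      then have "regs \<tau> vl < Suc l" by (rule power_less_imp_less_exp[rotated]) simp
      ultimately show ?thesis by simp
    qed
    have other: "regs \<tau> vn = n" "mem \<tau> = mem \<sigma>" using fr n by (auto simp: frame_def \<sigma>0_def)
    have "l * P w \<le> w * w" using P R_le(3) by (intro mult_mono) auto
    then have "l * P w < 2 ^ w" using square_less_power[OF w] by linarith
    moreover have "P w mod 2 ^ w = P w" using less_two_power[OF P] by (rule mod_less)
    moreover have "w mod 2 ^ w = w" using less_exp[of w] by (rule mod_less)
    ultimately have P': "P w mod 2 ^ w = P w" "w mod 2 ^ w = w" "l * P w < 2 ^ w" by auto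
    have rw: "l * P w mod 2 ^ w div w = r" using P' r by simp
    have sub: "(l + (2 ^ w - r)) mod 2 ^ w = l - r" using Sub_mod[OF r_le] R_le(3) less_two_power[of l w] by simp
    have ss: "2 ^ (l - r) mod 2 ^ w = s" "2 ^ r mod 2 ^ w = R" "4 * s mod 2 ^ w = U"
      using bounds R_le U_less unfolding s[symmetric] R[symmetric]
      by (auto simp: U)
    have "(l - r + 2) < 2 ^ w" "2 * (l - r + 2) < 2 ^ w"
      using r_u_less(2) less_two_power[of u w] by (auto simp: u)
    then have uu: "2 * ((l - r + 2) mod 2 ^ w) mod 2 ^ w = u" by (simp add: u)
    have NC': "(n div s + 1) mod 2 ^ w = NC" using U_less(3) by (simp add: NC)
    have L': "(l + 1) mod 2 ^ w = L" using R_le(4) less_two_power[of L w] by (simp add: L)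
    have Bd': "160 * R mod 2 ^ w = Bd" using bounds(2) by (simp add: Bd)
    show "ht w ?rest 70 \<tau> Par"
      apply (rule ht_Sq_Asg'[where x = r and T = 60])
        apply (simp add: ll P' r[symmetric])
       apply (rule ht_Sq_Asg'[where x = s and T = 50])
         apply (simp add: ll sub ss)
        apply (rule ht_Sq_Asg'[where x = R and T = 45])
          apply (simp add: ss)
         apply (rule ht_Sq_Asg'[where x = u and T = 35])
           apply (simp add: ll sub uu[simplified])
          apply (rule ht_Sq_Asg'[where x = U and T = 30])
            apply (simp add: ss)
           apply (rule ht_Sq_Asg'[where x = NC and T = 20])
             apply (simp add: other NC'[simplified])
            apply (rule ht_Sq_Asg'[where x = L and T = 10])
              apply (simp add: ll L'[simplified])
             apply (rule ht_Asg'[where x = Bd])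
               apply (simp add: Bd')
              apply (simp add: Par_def other ll mem)
             apply simp_all
      done
  qed simp
qed simp

lemma ht_DRAW:
  assumes Par: "Par \<sigma>" and mem: "mem \<sigma> 2 = arr []"
  shows "ht w DRAW (L * (r + u) * 20 + 50) \<sigma>
     (\<lambda>\<tau>. mem \<tau> 2 = arr (stake (L * (r + u)) (tape \<sigma>)) \<and> tape \<tau> = sdrop (L * (r + u)) (tape \<sigma>))"
proof -
  define I where "I = (\<lambda>k (\<tau>::state). mem \<tau> 2 = arr (stake k (tape \<sigma>)) \<and> tape \<tau> = sdrop k (tape \<sigma>))"
  have "ht w DRAW (L * (r + u) * 20 + 50) \<sigma> (I (L * (r + u)))"
    unfolding DRAW_def
  proof (rule ht_For[where T = 10])
    have "r + u \<le> L * (r + u)" using pos(5) by simp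
    then have "r + u < 2 ^ w" using bounds(4) by linarith
    then show "eval w (B Mul (V vL) (B Add (V vr) (V vu))) \<sigma> mod 2 ^ w = L * (r + u)"
      using Par bounds(4) by (simp add: Par_def)
    show "I 0 \<sigma>" using mem by (simp add: I_def)
    fix k \<tau> assume I: "I k \<tau>"
    have "(arr (stake k (tape \<sigma>)))(k := tape \<sigma> !! k) = arr (stake (Suc k) (tape \<sigma>))"
      using arr_snoc[of "stake k (tape \<sigma>)"] by (simp add: stake_Suc del: stake.simps(2))
    then show "ht w (Rnd vx ;; Sto 2 (V vi) (V vx)) 10 (set_reg vi k \<tau>) (I (Suc k))"
      using I by (simp add: ht_def I_def sdrop_simps)
  qed simp
  then show ?thesis by (simp add: I_def)
qed

end

text \<open>\<open>rw\<close> is the content of bank 2. Up to the failure probabilities it is fixed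
  but arbitrary, and the analysis of the program is entirely deterministic.\<close>

locale hashing = params +
  fixes rw :: "nat \<Rightarrow> nat"
begin

definition hs :: "nat \<Rightarrow> nat \<Rightarrow> nat \<Rightarrow> nat" where
  "hs b m x = hsh (klog w) (\<lambda>i. rw (b + i)) m x"

definition buckets :: "nat \<Rightarrow> nat \<Rightarrow> nat list" where
  "buckets b v = concat (map (\<lambda>v. filter (\<lambda>x. hs b r x = v) xs) [0..<v])"

text \<open>Includes the chunk of the first position behind the bucket. This may be one chunk too
  many, but it makes the number positive even for an empty bucket.\<close>

definition cnt :: "nat \<Rightarrow> nat \<Rightarrow> nat" where
  "cnt b v = length (buckets b (Suc v)) div s - length (buckets b v) div s + 1"

definition good :: "nat \<Rightarrow> bool" where
  "good b \<longleftrightarrow> (\<Sum>v<R. (cnt b v)\<^sup>2) \<le> Bd"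

definition sorted_at :: "nat \<Rightarrow> state \<Rightarrow> bool" where
  "sorted_at b \<sigma> \<longleftrightarrow> holds_list (mem \<sigma> 3) (buckets b R) \<and> (\<forall>v\<le>R. mem \<sigma> 4 v = length (buckets b v))"

definition H :: nat where "H = HC w (r + u)"

lemma length_buckets: "length (buckets b v) = length (filter (\<lambda>x. hs b r x < v) xs)"
proof (induction v)
  case (Suc v)
  have "length (filter (\<lambda>x. hs b r x < Suc v) xs) = length (filter (\<lambda>x. hs b r x < v) xs) + length (filter (\<lambda>x. hs b r x = v) xs)"
    by (induction xs) auto
  then show ?case using Suc by (simp add: buckets_def)
qed (simp add: buckets_def)

lemma length_buckets_le: "length (buckets b v) \<le> n"
  unfolding length_buckets using length_filter_le[of _ xs] length_xs by simp

lemma buckets_Suc: "buckets b (Suc v) = buckets b v @ filter (\<lambda>x. hs b r x = v) xs"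
  by (simp add: buckets_def)

text \<open>One pass over the input for every bucket costs \<open>R * n\<close> hash computations,
  about n^(1 + \<gamma>), which is within the permitted overhead.\<close>

lemma ht_SORT:
  assumes Par: "Par \<sigma>" and rw: "mem \<sigma> 2 = rw" and b: "regs \<sigma> vbb = b" "b + r < 2 ^ w" and nb: "regs \<sigma> vnb = r"
  shows "ht w SORT (R * (n * (H + 40) + 50) + 50) \<sigma> (sorted_at b)"
proof -
  let ?body = "vx ::= Rd 0 (B Add (V ve) (cst 1)) ;; HASH ;;
         Ite (B Eq (V vh) (V vv)) (Sto 3 (V vpos) (V vx) ;; vpos ::= B Add (V vpos) (cst 1)) Nop"
  let ?inner = "For ve (V vn) (?body)"
  let ?outer = "For vv (V vR) (Sto 4 (V vv) (V vpos) ;; ?inner)"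
  define I where "I = (\<lambda>v (\<tau>::state). regs \<tau> vpos = length (buckets b v) \<and> holds_list (mem \<tau> 3) (buckets b v) \<and>
     (\<forall>v'<v. mem \<tau> 4 v' = length (buckets b v')))"
  define part where "part = (\<lambda>v e. buckets b v @ filter (\<lambda>x. hs b r x = v) (take e xs))"
  define J where "J = (\<lambda>v e (\<tau>::state). regs \<tau> vpos = length (part v e) \<and> holds_list (mem \<tau> 3) (part v e))"
  define \<sigma>0 where "\<sigma>0 = set_reg vpos 0 \<sigma>"
  have outer: "ht w ?outer (R * (n * (H + 40) + 50) + 10) \<sigma>0 (I R)"
  proof (rule ht_For[where T = "n * (H + 40) + 40"])
    show "eval w (V vR) \<sigma>0 mod 2 ^ w = R"
      using Par bounds(6) by (simp add: Par_def \<sigma>0_def)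
    show "I 0 \<sigma>0" by (simp add: I_def \<sigma>0_def buckets_def holds_list_def)
    fix v \<tau> assume v: "v < R" and I: "I v \<tau>" and fr: "frame ?outer \<sigma>0 \<tau>"
    define \<sigma>1 where "\<sigma>1 = set_mem 4 (eval w (V vv) (set_reg vv v \<tau>)) (eval w (V vpos) (set_reg vv v \<tau>)) (set_reg vv v \<tau>)"
    have P1: "Par \<sigma>1" using Par_frame[OF _ fr] Par by (simp add: \<sigma>0_def \<sigma>1_def)
    have s1: "mem \<sigma>1 2 = rw" "regs \<sigma>1 vbb = b" "regs \<sigma>1 vnb = r" "regs \<sigma>1 vv = v"
       using fr rw b nb by (auto simp: \<sigma>1_def \<sigma>0_def frame_def)
    have inner: "ht w ?inner (n * (H + 40) + 20) \<sigma>1 (J v n)"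
    proof (rule ht_For[where T = "H + 30"])
      show "eval w (V vn) \<sigma>1 mod 2 ^ w = n" using P1 bounds(1) by (simp add: Par_def)
      show "J v 0 \<sigma>1" using I by (simp add: J_def I_def part_def \<sigma>1_def)
      fix e \<tau>' assume e: "e < n" and J: "J v e \<tau>'" and fr': "frame ?inner \<sigma>1 \<tau>'"
      have P2: "Par \<tau>'" using Par_frame[OF _ fr'] P1 by simp
      have s2: "mem \<tau>' 2 = rw" "regs \<tau>' vbb = b" "regs \<tau>' vnb = r" "regs \<tau>' vv = v"
         using fr' s1 by (auto simp: frame_def)
      have x: "arr (n # xs) (Suc e) = xs ! e" using e length_xs by (simp add: arr_def)
      have e1: "Suc e mod 2 ^ w = Suc e" using e bounds(1) by simp
      have xw: "xs ! e < 2 ^ w" using e length_xs xs_words by (auto dest: nth_mem)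
      have tk: "take (Suc e) xs = take e xs @ [xs ! e]" using e length_xs by (simp add: take_Suc_conv_app_nth)
      have "length (part v (Suc e)) \<le> length (buckets b (Suc v))"
      proof -
        have "length (filter (\<lambda>x. hs b r x = v) (take (Suc e) xs @ drop (Suc e) xs)) = length (filter (\<lambda>x. hs b r x = v) xs)"
          by (simp only: append_take_drop_id)
        then have "length (filter (\<lambda>x. hs b r x = v) (take (Suc e) xs)) \<le> length (filter (\<lambda>x. hs b r x = v) xs)"
          by (metis filter_append length_append le_add1)
        then show ?thesis by (simp add: part_def buckets_Suc)
      qed
      then have len: "length (part v (Suc e)) < 2 ^ w"
        using length_buckets_le[of b "Suc v"] bounds(1) by linarith
      show "ht w ?body (H + 30) (set_reg ve e \<tau>') (J v (Suc e))"
      proof (rule ht_Sq_Asg'[where x = "xs ! e" and T = "H + 22"], goal_cases)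
        case 1
        show ?case using P2 e1 x by (simp add: Par_def)
      next
        case 2
        show ?case
        proof (rule ht_HASH[where m' = "r + u" and T = 20], goal_cases)
          case (5 \<tau>2)
          note h = 5(1) and f = 5(2)
        have h': "regs \<tau>2 vh = hs b r (xs ! e)" "regs \<tau>2 vx = xs ! e" "regs \<tau>2 vv = v" "regs \<tau>2 vpos = length (part v e)"
          "mem \<tau>2 = mem \<tau>'"
          using h f s2 P2 e1 x J by (auto simp: hs_def frame_HASH Par_def J_def)
        show ?case
        proof (cases "hs b r (xs ! e) = v")
          case True
          then have "part v (Suc e) = part v e @ [xs ! e]" by (simp add: part_def tk)
          then show ?thesis using h' True J len
            by (intro ht_Ite[where ?T1.0 = 10] ht_Sq_Sto[where T = 6] ht_Asg ht_Nop) (auto simp: J_def holds_list_snoc)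
        next
          case False
          then have "part v (Suc e) = part v e" by (simp add: part_def tk)
          then show ?thesis using h' False J
            by (intro ht_Ite[where ?T1.0 = 10] ht_Sq_Sto[where T = 6] ht_Asg ht_Nop) (auto simp: J_def)
        qed
        qed (use w s2 xw r_u_less b in \<open>simp_all add: H_def\<close>)
      qed simp
    qed (simp add: algebra_simps)
    show "ht w (Sto 4 (V vv) (V vpos) ;; ?inner) (n * (H + 40) + 40) (set_reg vv v \<tau>) (I (Suc v))"
    proof (rule ht_Sq_Sto, rule ht_mono)
      show "ht w ?inner (n * (H + 40) + 20) (set_mem 4 (eval w (V vv) (set_reg vv v \<tau>)) (eval w (V vpos) (set_reg vv v \<tau>)) (set_reg vv v \<tau>)) (J v n)"
        using inner by (simp only: \<sigma>1_def)
      fix \<tau>' assume J: "J v n \<tau>'" and fr': "frame ?inner (set_mem 4 (eval w (V vv) (set_reg vv v \<tau>)) (eval w (V vpos) (set_reg vv v \<tau>)) (set_reg vv v \<tau>)) \<tau>'"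
      have "mem \<tau>' 4 = (mem \<tau> 4)(v := regs \<tau> vpos)" using fr' by (simp add: frame_def)
      moreover have "part v n = buckets b (Suc v)" using length_xs by (simp add: part_def buckets_Suc)
      ultimately show "I (Suc v) \<tau>'" using I J by (auto simp: I_def J_def less_Suc_eq)
    qed auto
  qed (simp add: algebra_simps)
  have "ht w SORT (R * (n * (H + 40) + 50) + 50) \<sigma> (\<lambda>\<tau>. sorted_at b \<tau>)"
    unfolding SORT_def
  proof (rule ht_Sq_Asg, rule ht_Sq)
    show "ht w ?outer (R * (n * (H + 40) + 50) + 10) (set_reg vpos (eval w (cst 0) \<sigma>) \<sigma>) (I R)"
      using outer by (simp add: \<sigma>0_def)
    fix \<tau> assume I: "I R \<tau>" and fr: "frame ?outer (set_reg vpos (eval w (cst 0) \<sigma>) \<sigma>) \<tau>"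
    have "regs \<tau> vR = R" using fr Par by (simp add: frame_def Par_def)
    then show "ht w (Sto 4 (V vR) (V vpos)) 5 \<tau> (sorted_at b)"
      using I by (intro ht_Sto) (auto simp: sorted_at_def I_def)
  qed auto
  then show ?thesis .
qed

text \<open>A crude bound that holds for rejected functions too. It keeps every single square below
  \<open>2 ^ w\<close>, while the sum itself is cut off.\<close>

lemma cnt_le: "cnt b v \<le> 2 * R + 2"
proof -
  have "length (buckets b (Suc v)) div s \<le> n div s" by (intro div_le_mono length_buckets_le)
  moreover have "n div s \<le> 2 * R"
  proof -
    have "2 * R * s = 2 * (s * R)" by simp
    then have "n \<le> 2 * R * s" using l(2) by (simp only: sR)
    then have "n div s \<le> 2 * R * s div s" by (rule div_le_mono)
    then show ?thesis using pos(1) by simp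
  qed
  ultimately show ?thesis by (simp add: cnt_def)
qed

lemma ht_SUM:
  assumes Par: "Par \<sigma>" and st: "sorted_at b \<sigma>"
  shows "ht w SQSUM (R * 50 + 20) \<sigma> (\<lambda>\<tau>. regs \<tau> vsum \<le> Bd \<longleftrightarrow> good b)"
proof -
  let ?body = "vd ::= B Add (B Sub (B Div (Rd 4 (B Add (V vv) (cst 1))) (V vs)) (B Div (Rd 4 (V vv)) (V vs))) (cst 1) ;;
       Ite (B Less (V vB) (V vsum)) Nop (vsum ::= B Add (V vsum) (B Mul (V vd) (V vd)))"
  define S where "S = (\<lambda>k. \<Sum>v<k. (cnt b v)\<^sup>2)"
  define I where "I = (\<lambda>k (\<tau>::state). if S k \<le> Bd then regs \<tau> vsum = S k else regs \<tau> vsum > Bd)"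
  define \<sigma>0 where "\<sigma>0 = set_reg vsum 0 \<sigma>"
  have "ht w (For vv (V vR) ?body) (R * 50 + 10) \<sigma>0 (I R)"
  proof (rule ht_For[where T = "45"])
    show "eval w (V vR) \<sigma>0 mod 2 ^ w = R"
      using Par bounds(6) by (simp add: Par_def \<sigma>0_def)
    show "I 0 \<sigma>0" by (simp add: I_def S_def \<sigma>0_def)
    fix v \<tau> assume v: "v < R" and I: "I v \<tau>" and fr: "frame (For vv (V vR) ?body) \<sigma>0 \<tau>"
    have P1: "Par \<tau>" using Par_frame[OF _ fr] Par by (simp add: \<sigma>0_def)
    have m4: "mem \<tau> 4 v = length (buckets b v)" "mem \<tau> 4 (Suc v) = length (buckets b (Suc v))"
      using fr st v by (auto simp: frame_def sorted_at_def \<sigma>0_def)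
    have v1: "Suc v mod 2 ^ w = Suc v" using v R_le(1) bounds(1) by simp
    let ?a = "length (buckets b v) div s" and ?c = "length (buckets b (Suc v)) div s"
    have "?a \<le> ?c" by (intro div_le_mono) (simp add: buckets_Suc)
    moreover have "?c \<le> n" using length_buckets_le[of b "Suc v"] div_le_dividend le_trans by blast
    then have "?c < 2 ^ w" using bounds(1) by simp
    ultimately have sub: "(?c + (2 ^ w - ?a)) mod 2 ^ w = ?c - ?a" by (rule Sub_mod)
    have dd: "cnt b v * cnt b v \<le> (2 * R + 2) * (2 * R + 2)" using cnt_le[of b v] by (intro mult_mono) auto
    have d1: "cnt b v < 2 ^ w"
    proof -
      have "cnt b v \<le> cnt b v * cnt b v" by simp
      then show ?thesis using dd limit by linarith
    qed
    then have d2: "Suc (?c - ?a) mod 2 ^ w = cnt b v" by (simp add: cnt_def)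
    have SS: "S (Suc v) = S v + cnt b v * cnt b v" by (simp add: S_def power2_eq_square)
    have sum: "Bd + cnt b v * cnt b v < 2 ^ w" using dd limit by linarith
    show "ht w ?body 45 (set_reg vv v \<tau>) (I (Suc v))"
    proof (rule ht_Sq_Asg[where T = 20])
      have d: "eval w (B Add (B Sub (B Div (Rd 4 (B Add (V vv) (cst 1))) (V vs)) (B Div (Rd 4 (V vv)) (V vs))) (cst 1)) (set_reg vv v \<tau>) = cnt b v"
        using P1 m4 v1 sub d2 by (simp add: Par_def)
      show "ht w (Ite (B Less (V vB) (V vsum)) Nop (vsum ::= B Add (V vsum) (B Mul (V vd) (V vd)))) 20
       (set_reg vd (eval w (B Add (B Sub (B Div (Rd 4 (B Add (V vv) (cst 1))) (V vs)) (B Div (Rd 4 (V vv)) (V vs))) (cst 1)) (set_reg vv v \<tau>)) (set_reg vv v \<tau>)) (I (Suc v))"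
        unfolding d
      proof (rule ht_Ite[where ?T1.0 = 10]; (intro ht_Nop ht_Asg)?)
        assume "eval w (B Less (V vB) (V vsum)) (set_reg vd (cnt b v) (set_reg vv v \<tau>)) \<noteq> 0"
        then have "regs \<tau> vsum > Bd" using P1 by (auto simp: Par_def split: if_splits)
        then show "I (Suc v) (set_reg vd (cnt b v) (set_reg vv v \<tau>))" using I SS by (auto simp: I_def split: if_splits)
      next
        assume "eval w (B Less (V vB) (V vsum)) (set_reg vd (cnt b v) (set_reg vv v \<tau>)) = 0"
        then have "regs \<tau> vsum \<le> Bd" using P1 by (auto simp: Par_def split: if_splits)
        then have "S v \<le> Bd" "regs \<tau> vsum = S v" using I by (auto simp: I_def split: if_splits)
        then show "I (Suc v) (set_reg vsum
          (eval w (B Add (V vsum) (B Mul (V vd) (V vd))) (set_reg vd (cnt b v) (set_reg vv v \<tau>))) (set_reg vd (cnt b v) (set_reg vv v \<tau>)))"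
          using sum SS by (auto simp: I_def)
      qed auto
    qed auto
  qed simp
  then show ?thesis
    unfolding SQSUM_def
    by (intro ht_Sq_Asg[where T = "R * 50 + 10"]) (auto simp: \<sigma>0_def I_def good_def S_def ht_def split: if_splits)
qed

definition found :: "nat \<Rightarrow> state \<Rightarrow> bool" where
  "found k \<tau> \<longleftrightarrow> (regs \<tau> vok = 0 \<and> regs \<tau> vb = k * r \<and> (\<forall>t<k. \<not> good (t * r))) \<or>
     (regs \<tau> vok = 1 \<and> (\<exists>t<k. regs \<tau> vb = t * r \<and> good (t * r) \<and> (\<forall>t'<t. \<not> good (t' * r)) \<and> sorted_at (t * r) \<tau>))"

lemma ht_TRIES:
  assumes Par: "Par \<sigma>" and rw: "mem \<sigma> 2 = rw"
  shows "ht w TRIES (L * (R * (n * (H + 40) + 100) + 120) + 50) \<sigma> (found L)"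
proof -
  let ?rest = "Ite (B Less (V vB) (V vsum)) (vb ::= B Add (V vb) (V vr)) (vok ::= cst 1)"
  let ?body = "Ite (V vok) Nop (vbb ::= V vb ;; SORT ;; SQSUM ;; ?rest)"
  define \<sigma>0 where "\<sigma>0 = set_reg vnb r (set_reg vok 0 (set_reg vb 0 \<sigma>))"
  have "ht w (For vt (V vL) ?body) (L * (R * (n * (H + 40) + 100) + 120) + 20) \<sigma>0 (found L)"
  proof (rule ht_For[where T = "R * (n * (H + 40) + 100) + 110"])
    show "eval w (V vL) \<sigma>0 mod 2 ^ w = L"
      using Par R_le(4) less_two_power[of L w] by (simp add: Par_def \<sigma>0_def)
    show "found 0 \<sigma>0" by (simp add: found_def \<sigma>0_def)
    fix t \<tau> assume t: "t < L" and I: "found t \<tau>" and fr: "frame (For vt (V vL) ?body) \<sigma>0 \<tau>"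
    have P1: "Par \<tau>" using Par_frame[OF _ fr] Par by (simp add: \<sigma>0_def)
    have m: "mem \<tau> 2 = rw" using fr rw by (auto simp: frame_def \<sigma>0_def)
    have "vnb \<notin> writes (For vt (V vL) ?body)" by simp
    then have nb: "regs \<tau> vnb = r" using fr by (auto simp: frame_def \<sigma>0_def simp del: writes.simps)
    have "Suc t * r \<le> L * (r + u)" using t by (intro mult_mono) auto
    then have tr: "t * r + r < 2 ^ w" using bounds(4) by simp
    show "ht w ?body (R * (n * (H + 40) + 100) + 110) (set_reg vt t \<tau>) (found (Suc t))"
    proof (cases "regs \<tau> vok = 0")
      case False
      then have "found (Suc t) (set_reg vt t \<tau>)" using I by (auto simp: found_def sorted_at_def less_Suc_eq)
      then show ?thesis using False by (intro ht_Ite[where ?T1.0 = 10] ht_Nop) auto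
    next
      case True
      then have b: "regs \<tau> vb = t * r" "\<And>t'. t' < t \<Longrightarrow> \<not> good (t' * r)" using I by (auto simp: found_def)
      show ?thesis
      proof (rule ht_Ite[where ?T1.0 = "R * (n * (H + 40) + 100) + 105"])
        show "ht w (vbb ::= V vb ;; SORT ;; SQSUM ;; ?rest) (R * (n * (H + 40) + 100) + 105) (set_reg vt t \<tau>) (found (Suc t))"
        proof (rule ht_Sq_Asg, rule ht_Sq[OF ht_SORT])
          define \<sigma>1 where "\<sigma>1 = set_reg vbb (eval w (V vb) (set_reg vt t \<tau>)) (set_reg vt t \<tau>)"
          fix \<tau>1 assume st: "sorted_at (t * r) \<tau>1" and f1: "frame SORT (set_reg vbb (eval w (V vb) (set_reg vt t \<tau>)) (set_reg vt t \<tau>)) \<tau>1"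
          have P2: "Par \<tau>1" using Par_frame[OF _ f1] P1 by simp
          show "ht w (SQSUM ;; ?rest) (R * 50 + 40) \<tau>1 (found (Suc t))"
          proof (rule ht_Sq[OF ht_SUM[OF P2 st]])
            fix \<tau>2 assume g: "regs \<tau>2 vsum \<le> Bd \<longleftrightarrow> good (t * r)" and f2: "frame SQSUM \<tau>1 \<tau>2"
            have P3: "Par \<tau>2" using Par_frame[OF _ f2] P2 by simp
            have s3: "sorted_at (t * r) \<tau>2" "regs \<tau>2 vok = 0" "regs \<tau>2 vb = t * r"
              using f2 f1 st b True by (auto simp: frame_def sorted_at_def)
            show "ht w ?rest 20 \<tau>2 (found (Suc t))"
              using P3 s3 g b tr w
              by (intro ht_Ite[where ?T1.0 = 10] ht_Asg) (auto simp: found_def Par_def sorted_at_def less_Suc_eq split: if_splits)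
          qed auto
        qed (use P1 m nb b tr in \<open>auto simp: algebra_simps\<close>)
      qed (use True in auto)
    qed
  qed (simp add: algebra_simps)
  then show ?thesis
    unfolding TRIES_def using Par
    by (intro ht_Sq_Asg[where T = "L * (R * (n * (H + 40) + 100) + 120) + 40"]
         ht_Sq_Asg[where T = "L * (R * (n * (H + 40) + 100) + 120) + 30"]
         ht_Sq_Asg[where T = "L * (R * (n * (H + 40) + 100) + 120) + 20"]) (auto simp: \<sigma>0_def Par_def)
qed

end

section \<open>The two families of sets\<close>

text \<open>
  Appends one family of sets to bank 10. Bank 5 marks the elements of the current set by its
  identifier in \<open>vid\<close>, which removes duplicates.
\<close>

definition NSETS :: exp where "NSETS = B Mul (B Mul (V vL) (V vC)) (V vU)"

definition REPBASE :: "exp \<Rightarrow> exp" where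
  "REPBASE e = B Add (B Mul (V vL) (V vr)) (B Mul e (V vu))"

definition ELEM :: loopc where
  "ELEM = va ::= B Add (V vt) (V vp) ;;
     Ite (B Less (V va) (V vn))
       (vx ::= Rd 3 (V va) ;; HASH ;; vy ::= B Xor (V vh) (V vuu) ;;
        Ite (B Eq (Rd 5 (V vy)) (V vid)) Nop
          (Sto 5 (V vy) (V vid) ;; Sto 10 (V vpos) (V vy) ;; vpos ::= B Add (V vpos) (cst 1)))
       Nop"

definition SETS :: loopc where
  "SETS = For vk NSETS
     (vlen ::= V vpos ;; vpos ::= B Add (V vpos) (cst 1) ;; vid ::= B Add (V vid) (cst 1) ;;
      vuu ::= B Mul (B Mod (V vk) (V vU)) (V vmul) ;;
      vt ::= B Mul (B Mod (B Div (V vk) (V vU)) (V vC)) (V vs) ;;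
      vbb ::= REPBASE (B Div (B Div (V vk) (V vU)) (V vC)) ;;
      For vp (V vs) ELEM ;;
      Sto 10 (V vlen) (B Sub (B Sub (V vpos) (V vlen)) (cst 1)))"

lemma writes_ELEM [simp]: "writes ELEM = {va, vx, vh, vi, vy, vj, vpos}" "stores ELEM = {5, 10}" "draws ELEM = False"
  by (auto simp: ELEM_def)

lemma writes_SETS [simp]: "writes SETS = {vk, vlen, vpos, vid, vuu, vt, vbb, vp, va, vx, vh, vi, vy, vj}"
  "stores SETS = {5, 10}" "draws SETS = False"
  by (auto simp: SETS_def)

text \<open>Keeps the first occurrence of each element, as the program does; \<open>remdups\<close>
  keeps the last.\<close>

definition dedup :: "'a list \<Rightarrow> 'a list" where
  "dedup xs = rev (remdups (rev xs))"

lemma dedup_simps [simp]: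
  "dedup [] = []" "dedup (xs @ [x]) = (if x \<in> set xs then dedup xs else dedup xs @ [x])"
  "set (dedup xs) = set xs" "distinct (dedup xs)"
  by (auto simp: dedup_def)

lemma length_dedup: "length (dedup xs) \<le> length xs"
  by (simp add: dedup_def) (metis length_remdups_leq length_rev)

lemma arr_update: "i < length xs \<Longrightarrow> (arr xs)(i := v) = arr (xs[i := v])"
  by (auto simp: arr_def fun_eq_iff)

context hashing
begin

definition chunk :: "nat \<Rightarrow> nat \<Rightarrow> nat list" where
  "chunk b t = take s (drop (t * s) (buckets b R))"

definition rep_hash :: "nat \<Rightarrow> nat \<Rightarrow> nat" where
  "rep_hash i x = hs (L * r + i * u) u x"

text \<open>The index is \<open>(i * NC + t) * U + z\<close> for repetition \<open>i\<close>, chunk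
  \<open>t\<close> and \<open>z < U\<close>. The families differ only in \<open>mul\<close>: with
  \<open>U\<close>, the number \<open>z\<close> stands for the upper half of a hash value, with 1
  for the lower half.\<close>

definition sd_set :: "nat \<Rightarrow> nat \<Rightarrow> nat \<Rightarrow> nat list" where
  "sd_set b mul k = dedup (map (\<lambda>x. rep_hash (k div U div NC) x XOR (k mod U * mul)) (chunk b (k div U mod NC)))"

lemma length_sd_set: "length (sd_set b mul k) \<le> s"
  unfolding sd_set_def by (rule order.trans[OF length_dedup]) (simp add: chunk_def)

lemma hs_less: "x < 2 ^ w \<Longrightarrow> hs b m x < 2 ^ m"
  unfolding hs_def by (rule hsh_less[OF klog(1)])

lemma length_sorted: "length (buckets b R) = n"
proof -
  have "filter (\<lambda>x. hs b r x < R) xs = xs"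
    by (rule filter_True) (use hs_less[of _ b r] xs_words in \<open>auto simp: R\<close>)
  then show ?thesis using length_buckets[of b R] length_xs by simp
qed

lemma set_sorted: "set (buckets b R) = set xs"
  using hs_less[of _ b r] xs_words by (fastforce simp: buckets_def R)

lemma rep_base: "i < L \<Longrightarrow> L * r + i * u + u \<le> L * (r + u)"
proof -
  assume "i < L"
  then have "Suc i * u \<le> L * u" by (intro mult_right_mono) auto
  then show ?thesis by (simp add: algebra_simps)
qed

lemma rep_base_less: "i < L \<Longrightarrow> L * r + i * u + u < 2 ^ w"
  using rep_base[of i] bounds(4) by linarith

lemma index_less: "k < NA \<Longrightarrow> k div U div NC < L" "k mod U < U" "k div U mod NC < NC"
  using pos by (auto simp: NA mult_ac less_mult_imp_div_less)

text \<open>The last chunk may be incomplete. The program nevertheless computes positions in it,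
  which are below \<open>n + s\<close>, and compares them with \<open>n\<close> afterwards.\<close>

lemma n_s_less: "n + s < 2 ^ w"
proof -
  have "1 * s \<le> NA * (s + 1)" using pos(7) by (intro mult_mono) auto
  then show ?thesis using limit by linarith
qed

text \<open>Identifiers increase from set to set, so marks left by earlier sets are smaller than the
  current one and bank 5 never has to be cleared.\<close>

lemma ht_ELEM:
  assumes Par: "Par \<tau>" and rw: "mem \<tau> 2 = rw" and st: "holds_list (mem \<tau> 3) (buckets b R)"
    and regs: "regs \<tau> vt = t * s" "regs \<tau> vbb = L * r + i * u" "regs \<tau> vnb = u" "regs \<tau> vuu = z"
    and p: "p < s" and t: "t * s \<le> n" and i: "i < L"
    and cur: "\<And>p. cur p = dedup (map (\<lambda>x. rep_hash i x XOR z) (take p (chunk b t)))"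
    and vpos: "regs \<tau> vpos = length out + length (cur p)" and out: "mem \<tau> 10 = arr (out @ cur p)"
    and out_less: "length out + s + 1 < 2 ^ w"
    and id: "\<And>y. mem \<tau> 5 y \<le> regs \<tau> vid" "\<And>y. mem \<tau> 5 y = regs \<tau> vid \<longleftrightarrow> y \<in> set (cur p)"
  shows "ht w ELEM (H + 50) (set_reg vp p \<tau>) (\<lambda>\<tau>'. regs \<tau>' vpos = length out + length (cur (Suc p)) \<and>
     mem \<tau>' 10 = arr (out @ cur (Suc p)) \<and> (\<forall>y. mem \<tau>' 5 y \<le> regs \<tau> vid) \<and>
     (\<forall>y. mem \<tau>' 5 y = regs \<tau> vid \<longleftrightarrow> y \<in> set (cur (Suc p))))"
    (is "ht _ _ _ _ ?Q")
  unfolding ELEM_def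
proof (rule ht_Sq_Asg'[where x = "t * s + p" and T = "H + 45"], goal_cases)
  case 1
  have "t * s + p < 2 ^ w"
    using n_s_less p t by linarith
  then show ?case using regs by simp
next
  case 2
  show ?case
  proof (rule ht_Ite[where ?T1.0 = "H + 41"], goal_cases)
    case 1
    then have a: "t * s + p < n" using Par by (auto simp: Par_def split: if_splits)
    define y where "y = buckets b R ! (t * s + p)"
    have yw: "y < 2 ^ w"
    proof -
      have "y \<in> set (buckets b R)" unfolding y_def by (rule nth_mem) (simp add: length_sorted a)
      then show ?thesis using set_sorted xs_words by auto
    qed
    have tk: "take (Suc p) (chunk b t) = take p (chunk b t) @ [y]"
    proof -
      have "p < length (chunk b t)" using a p by (simp add: chunk_def length_sorted)
      then show ?thesis using a p by (simp add: take_Suc_conv_app_nth) (simp add: chunk_def y_def length_sorted)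
    qed
    show ?case
    proof (rule ht_Sq_Asg'[where x = y and T = "H + 36"], goal_cases)
      case 1
      show ?case using st a by (simp add: holds_list_def length_sorted y_def)
    next
      case 2
      show ?case
      proof (rule ht_HASH[where m' = "r + u" and T = 36], goal_cases)
        case (5 \<tau>1)
        have h: "regs \<tau>1 vh = rep_hash i y" using 5(1) regs rw by (simp add: rep_hash_def hs_def)
        have f: "regs \<tau>1 vuu = z" "regs \<tau>1 vid = regs \<tau> vid" "regs \<tau>1 vpos = regs \<tau> vpos" "mem \<tau>1 = mem \<tau>"
          using 5(2) regs by (auto simp: frame_HASH)
        let ?g = "rep_hash i y XOR z"
        show ?case
        proof (rule ht_Sq_Asg'[where x = ?g and T = 30], goal_cases)
          case 1
          show ?case using h f by simp
        next
          case 2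
          show ?case
          proof (cases "?g \<in> set (cur p)")
            case True
            then have c: "cur (Suc p) = cur p" using tk by (simp add: cur)
            show ?thesis
              by (rule ht_Ite[where ?T1.0 = 20]; (rule ht_Nop)?)
                (use f True id vpos out c in simp_all)
          next
            case False
            then have c: "cur (Suc p) = cur p @ [?g]" using tk by (simp add: cur)
            have "length (cur p) \<le> s"
              unfolding cur by (rule order.trans[OF length_dedup]) (use p in simp)
            then have l: "(length out + length (cur p) + 1) mod 2 ^ w = length out + length (cur p) + 1"
              using out_less by simp
            have a10: "(arr (out @ cur p))(length out + length (cur p) := ?g) = arr (out @ cur p @ [?g])"
              using arr_snoc[of "out @ cur p" ?g] by simp
            show ?thesis
            proof (rule ht_Ite[where ?T1.0 = 20], goal_cases)
              case 1
              then show ?case using f False id by simp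
            next
              case 2
              show ?case
                by (rule ht_Sq_Sto[where T = 15], rule ht_Sq_Sto[where T = 8], rule ht_Asg)
                  (use f vpos out a10 l id False c in \<open>auto simp: fun_upd_def[of "mem \<tau> 5"] split: if_splits\<close>)
            qed simp
          qed
        qed simp
      qed (use w regs yw r_u_less rep_base_less[OF i] in \<open>simp_all add: H_def\<close>)
    qed simp
  next
    case 2
    then have a: "n \<le> t * s + p" using Par by (auto simp: Par_def split: if_splits)
    then have "length (chunk b t) \<le> p" by (simp add: chunk_def length_sorted)
    then have "cur (Suc p) = cur p" by (simp add: cur)
    then show ?case using vpos out id by (intro ht_Nop) auto
  qed simp
qed simp

definition set_block :: "nat \<Rightarrow> nat \<Rightarrow> nat \<Rightarrow> nat list" where
  "set_block b mul k = length (sd_set b mul k) # sd_set b mul k"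

definition all_sets :: "nat \<Rightarrow> nat \<Rightarrow> nat \<Rightarrow> nat list" where
  "all_sets b mul k = concat (map (set_block b mul) [0..<k])"

lemma all_sets_Suc: "all_sets b mul (Suc k) = all_sets b mul k @ set_block b mul k"
  by (simp add: all_sets_def)

lemma length_all_sets: "length (all_sets b mul k) \<le> k * (s + 1)"
proof (induction k)
  case (Suc k)
  then show ?case using length_sd_set[of b mul k] by (simp add: all_sets_Suc set_block_def)
qed (simp add: all_sets_def)

lemma eval_NSETS: "Par \<sigma> \<Longrightarrow> eval w NSETS \<sigma> = NA"
proof -
  assume P: "Par \<sigma>"
  have "L * NC * 1 \<le> NA" unfolding NA using pos by (intro mult_mono) auto
  then have "L * NC < 2 ^ w" using U_less(2) by linarith
  then show ?thesis using P U_less(2) by (simp add: NSETS_def Par_def NA)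
qed

lemma eval_REPBASE:
  assumes "Par \<sigma>" "eval w e \<sigma> = i" "i < L"
  shows "eval w (REPBASE e) \<sigma> = L * r + i * u"
proof -
  have "L * r + i * u < 2 ^ w" using rep_base_less[OF assms(3)] by linarith
  then show ?thesis using assms by (simp add: REPBASE_def Par_def)
qed

lemma eval_succ: "eval w e \<sigma> = x \<Longrightarrow> x + 1 < 2 ^ w \<Longrightarrow> eval w (B Add e (cst 1)) \<sigma> = x + 1"
  by simp

lemma ht_SETS:
  assumes Par: "Par \<sigma>" and rw: "mem \<sigma> 2 = rw" and st: "holds_list (mem \<sigma> 3) (buckets b R)"
    and nb: "regs \<sigma> vnb = u" and mul: "regs \<sigma> vmul = mul" "mul \<le> U"
    and vpos: "regs \<sigma> vpos = length out" and out: "mem \<sigma> 10 = arr out"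
    and len: "length out \<le> 4 + NA * (s + 1)"
    and id: "regs \<sigma> vid = d" "d \<le> NA" "\<And>y. mem \<sigma> 5 y \<le> d"
  shows "ht w SETS (NA * (s * (H + 60) + 120) + 30) \<sigma> (\<lambda>\<tau>. regs \<tau> vpos = length (out @ all_sets b mul NA) \<and>
     mem \<tau> 10 = arr (out @ all_sets b mul NA) \<and> regs \<tau> vid = d + NA \<and> (\<forall>y. mem \<tau> 5 y \<le> d + NA))"
proof -
  define I where "I = (\<lambda>k (\<tau>::state). regs \<tau> vpos = length (out @ all_sets b mul k) \<and>
     mem \<tau> 10 = arr (out @ all_sets b mul k) \<and> regs \<tau> vid = d + k \<and> (\<forall>y. mem \<tau> 5 y \<le> d + k))"
  have "ht w SETS (NA * (s * (H + 60) + 120) + 30) \<sigma> (I NA)"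
    unfolding SETS_def
  proof (rule ht_For[where T = "s * (H + 60) + 110"], goal_cases)
    case 1
    then show ?case using eval_NSETS[OF Par] U_less(2) by simp
  next
    case 2
    then show ?case using vpos out id by (simp add: I_def all_sets_def)
  next
    case (3 k \<tau>)
    note k = 3(1) and I = 3(2) and fr = 3(3)
    have P1: "Par \<tau>" using Par_frame[OF Par fr] by simp
    have s1: "mem \<tau> 2 = rw" "mem \<tau> 3 = mem \<sigma> 3" "regs \<tau> vnb = u" "regs \<tau> vmul = mul"
      using fr rw nb mul by (simp_all add: frame_def)
    define O' where "O' = out @ all_sets b mul k"
    have O': "regs \<tau> vpos = length O'" "mem \<tau> 10 = arr O'" "regs \<tau> vid = d + k" "\<And>y. mem \<tau> 5 y \<le> d + k"
      using I by (simp_all add: I_def O'_def)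
    have "(k + 1) * (s + 1) \<le> NA * (s + 1)" using k by (intro mult_mono) auto
    then have "length O' + s + 1 \<le> 4 + NA * (s + 1) + NA * (s + 1)"
      using len length_all_sets[of b mul k] by (simp add: O'_def)
    then have lenO: "length O' + s + 2 < 2 ^ w" using limit pos(8) by linarith
    have "NA + NA \<le> 2 * (NA * (s + 1))" by simp
    then have idw: "d + k + 1 < 2 ^ w" using id(2) k limit by linarith
    define z where "z = k mod U * mul"
    define t where "t = k div U mod NC"
    define i where "i = k div U div NC"
    have tis: "i < L" "t < NC" using index_less(1)[OF k] index_less(3)[of k] by (auto simp: i_def t_def)
    have zw: "z < 2 ^ w"
    proof -
      have "z \<le> U * U" unfolding z_def using index_less(2)[of k] mul(2) by (intro mult_mono) auto
      then show ?thesis using bounds(3) by linarith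
    qed
    have ts: "t * s \<le> n"
    proof -
      have "t \<le> n div s" using tis(2) by (simp add: NC)
      then have "t * s \<le> n div s * s" by (rule mult_right_mono) simp
      also have "\<dots> \<le> n" by simp
      finally show ?thesis .
    qed
    have tw: "t * s < 2 ^ w" using ts bounds(1) by linarith
    define cur where "cur = (\<lambda>p. dedup (map (\<lambda>x. rep_hash i x XOR z) (take p (chunk b t))))"
    let ?\<sigma>1 = "set_reg vbb (L * r + i * u) (set_reg vt (t * s) (set_reg vuu z (set_reg vid (d + k + 1)
        (set_reg vpos (length O' + 1) (set_reg vlen (length O') (set_reg vk k \<tau>))))))"
    \<comment> \<open>The 0 behind \<open>O'\<close> is the cell reserved for the length of the set.
      It is overwritten once all elements have been appended.\<close>
    define J where "J = (\<lambda>p (\<tau>'::state). regs \<tau>' vpos = length (O' @ [0]) + length (cur p) \<and>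
      mem \<tau>' 10 = arr ((O' @ [0]) @ cur p) \<and> (\<forall>y. mem \<tau>' 5 y \<le> d + k + 1) \<and> (\<forall>y. mem \<tau>' 5 y = d + k + 1 \<longleftrightarrow> y \<in> set (cur p)))"
    have Ps1: "Par ?\<sigma>1" using P1 by simp
    have inner: "ht w (For vp (V vs) ELEM) (s * (H + 60) + 20) ?\<sigma>1 (J s)"
    proof (rule ht_For[where T = "H + 50"], goal_cases)
      case 1
      then show ?case using P1 R_le(2) bounds(1) by (simp add: Par_def)
    next
      case 2
      have "mem \<tau> 5 y \<noteq> Suc (d + k)" for y using O'(4)[of y] by simp
      then show ?case using O' by (simp add: J_def cur_def arr_snoc_0 le_SucI)
    next
      case (3 p \<tau>')
      note fr' = 3(3)
      have P2: "Par \<tau>'" using Par_frame[OF Ps1 fr'] by simp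
      have s2: "mem \<tau>' 2 = rw" "holds_list (mem \<tau>' 3) (buckets b R)" "regs \<tau>' vt = t * s"
        "regs \<tau>' vbb = L * r + i * u" "regs \<tau>' vnb = u" "regs \<tau>' vuu = z" "regs \<tau>' vid = d + k + 1"
        using fr' s1 st by (simp_all add: frame_def)
      have J: "regs \<tau>' vpos = length (O' @ [0]) + length (cur p)" "mem \<tau>' 10 = arr ((O' @ [0]) @ cur p)"
          "\<And>y. mem \<tau>' 5 y \<le> regs \<tau>' vid" "\<And>y. mem \<tau>' 5 y = regs \<tau>' vid \<longleftrightarrow> y \<in> set (cur p)"
        using 3(2) s2(7) by (simp_all add: J_def)
      have cur': "cur p = dedup (map (\<lambda>x. rep_hash i x XOR z) (take p (chunk b t)))" for p
        by (simp add: cur_def)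
      have "length (O' @ [0]) + s + 1 < 2 ^ w" using lenO by simp
      note ht = ht_ELEM[OF P2 s2(1-6) 3(1) ts tis(1) cur' J(1,2) this J(3,4)]
      show ?case by (rule ht_mono[OF ht]) (simp_all add: J_def s2(7))
    qed (simp add: algebra_simps)
    have last: "ht w (Sto 10 (V vlen) (B Sub (B Sub (V vpos) (V vlen)) (cst 1))) 10 \<tau>' (I (Suc k))"
      if J: "J s \<tau>'" and fr': "frame (For vp (V vs) ELEM) ?\<sigma>1 \<tau>'" for \<tau>'
    proof -
      have s2: "regs \<tau>' vlen = length O'" "regs \<tau>' vid = d + k + 1"
        using fr' by (simp_all add: frame_def)
      have c: "cur s = sd_set b mul k" by (simp add: cur_def sd_set_def i_def t_def z_def chunk_def)
      have J': "regs \<tau>' vpos = length O' + 1 + length (cur s)" "mem \<tau>' 10 = arr (O' @ 0 # cur s)"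
        "\<And>y. mem \<tau>' 5 y \<le> d + k + 1" using J by (simp_all add: J_def)
      have lc: "length (cur s) \<le> s" unfolding c by (rule length_sd_set)
      have "(length O' + 1 + length (cur s) + (2 ^ w - length O')) mod 2 ^ w = 1 + length (cur s)"
        using Sub_mod[of "length O'" "length O' + 1 + length (cur s)"] lenO lc by simp
      moreover have "(1 + length (cur s) + (2 ^ w - 1)) mod 2 ^ w = length (cur s)"
        using Sub_mod[of 1 "1 + length (cur s)"] lenO lc by simp
      ultimately have e: "eval w (B Sub (B Sub (V vpos) (V vlen)) (cst 1)) \<tau>' = length (cur s)"
        using J'(1) s2(1) by simp
      have "(arr (O' @ 0 # cur s))(length O' := length (cur s)) = arr (O' @ length (cur s) # cur s)"
        by (subst arr_update) (simp_all add: list_update_append)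
      then show ?thesis
        by (intro ht_Sto, unfold e) (use s2 J' in \<open>simp_all add: I_def all_sets_Suc set_block_def c O'_def\<close>)
    qed
    show ?case
    proof (rule ht_Sq_Asg'[where x = "length O'" and T = "s * (H + 60) + 105"], goal_cases)
      case 2 show ?case
      proof (rule ht_Sq_Asg'[where x = "length O' + 1" and T = "s * (H + 60) + 100"], goal_cases)
        case 1 show ?case by (rule eval_succ) (use O' lenO in simp_all)
      next
        case 2 show ?case
        proof (rule ht_Sq_Asg'[where x = "d + k + 1" and T = "s * (H + 60) + 95"], goal_cases)
          case 1 show ?case by (rule eval_succ) (use O' idw in simp_all)
        next
          case 2 show ?case
          proof (rule ht_Sq_Asg'[where x = z and T = "s * (H + 60) + 88"], goal_cases)
            case 1 show ?case using P1 s1 zw by (simp add: Par_def z_def)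
          next
            case 2 show ?case
            proof (rule ht_Sq_Asg'[where x = "t * s" and T = "s * (H + 60) + 78"], goal_cases)
              case 1 show ?case using P1 tw by (simp add: Par_def t_def)
            next
              case 2 show ?case
              proof (rule ht_Sq_Asg'[where x = "L * r + i * u" and T = "s * (H + 60) + 60"], goal_cases)
                case 1 show ?case by (rule eval_REPBASE) (use P1 tis in \<open>simp_all add: Par_def i_def\<close>)
              next
                case 2 show ?case by (rule ht_Sq[OF inner last]) simp_all
              qed (simp add: REPBASE_def)
            qed simp
          qed simp
        qed simp
      qed simp
    qed (use O' in simp_all)
  qed (simp add: NSETS_def algebra_simps)
  then show ?thesis by (simp add: I_def add.commute)
qed

end

section \<open>Triples of a word and two chunks, and their queries\<close>

text \<open>
  Lists in banks 6, 7, 8 all triples of an input word and two chunks whose buckets match that word.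
\<close>

definition LO :: "exp \<Rightarrow> exp" where "LO e = B Div (Rd 4 e) (V vs)"

definition PAIRS :: loopc where
  "PAIRS = vnp ::= cst 0 ;; vbb ::= V vb ;; vnb ::= V vr ;;
     For vk (B Mul (V vn) (V vR))
       (vx ::= Rd 0 (B Add (B Div (V vk) (V vR)) (cst 1)) ;; HASH ;;
        vv ::= B Mod (V vk) (V vR) ;; vlo1 ::= LO (V vv) ;;
        vcn1 ::= B Add (B Sub (LO (B Add (V vv) (cst 1))) (V vlo1)) (cst 1) ;;
        vv ::= B Xor (V vv) (V vh) ;; vlo2 ::= LO (V vv) ;;
        vcn2 ::= B Add (B Sub (LO (B Add (V vv) (cst 1))) (V vlo2)) (cst 1) ;;
        For ve (B Mul (V vcn1) (V vcn2))
          (Sto 6 (V vnp) (V vx) ;;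
           Sto 7 (V vnp) (B Add (V vlo1) (B Div (V ve) (V vcn2))) ;;
           Sto 8 (V vnp) (B Add (V vlo2) (B Mod (V ve) (V vcn2))) ;;
           vnp ::= B Add (V vnp) (cst 1)))"

text \<open>The query for repetition \<open>k mod L\<close> and the triple number \<open>k div L\<close>.\<close>

definition QINDEX :: "nat \<Rightarrow> exp \<Rightarrow> exp" where
  "QINDEX m e = B Add (B Mul (B Add (B Mul (B Mod (V vk) (V vL)) (V vC)) (Rd m (V vp))) (V vU)) e"

definition QUERIES :: loopc where
  "QUERIES = vnb ::= V vu ;;
     For vk (B Mul (V vnp) (V vL))
       (vp ::= B Div (V vk) (V vL) ;; vx ::= Rd 6 (V vp) ;; vbb ::= REPBASE (B Mod (V vk) (V vL)) ;; HASH ;;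
        Sto 10 (V vpos) (QINDEX 7 (B Div (V vh) (V vU))) ;; vpos ::= B Add (V vpos) (cst 1) ;;
        Sto 10 (V vpos) (QINDEX 8 (B Mod (V vh) (V vU))) ;; vpos ::= B Add (V vpos) (cst 1)) ;;
     Sto 10 (cst 3) (B Mul (V vnp) (V vL))"

definition BUILD :: loopc where
  "BUILD = Sto 10 (cst 0) (B Mul (V vU) (V vU)) ;; Sto 10 (cst 1) NSETS ;; Sto 10 (cst 2) NSETS ;;
     vpos ::= cst 4 ;; vid ::= cst 0 ;; vnb ::= V vu ;;
     vmul ::= V vU ;; SETS ;; vmul ::= cst 1 ;; SETS ;; PAIRS ;; QUERIES"

lemma writes_PAIRS [simp]: "writes PAIRS = {vnp, vbb, vnb, vk, vx, vh, vi, vy, vj, vv, vlo1, vcn1, vlo2, vcn2, ve}"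
  "stores PAIRS = {6, 7, 8}" "draws PAIRS = False"
  by (auto simp: PAIRS_def)

lemma writes_QUERIES [simp]: "writes QUERIES = {vnb, vk, vp, vx, vbb, vh, vi, vy, vj, vpos}"
  "stores QUERIES = {10}" "draws QUERIES = False"
  by (auto simp: QUERIES_def)

lemma writes_BUILD [simp]: "stores BUILD = {5, 6, 7, 8, 10}" "draws BUILD = False"
  "writes BUILD = {vpos, vid, vnb, vmul} \<union> writes SETS \<union> writes PAIRS \<union> writes QUERIES"
  by (auto simp: BUILD_def)

context hashing
begin

definition lo :: "nat \<Rightarrow> nat \<Rightarrow> nat" where "lo b v = length (buckets b v) div s"

definition partner :: "nat \<Rightarrow> nat \<Rightarrow> nat \<Rightarrow> nat" where "partner b x v = v XOR hs b r x"

definition bucket_pairs :: "nat \<Rightarrow> nat \<Rightarrow> nat \<Rightarrow> (nat \<times> nat \<times> nat) list" where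
  "bucket_pairs b x v = map (\<lambda>j. (x, lo b v + j div cnt b (partner b x v),
     lo b (partner b x v) + j mod cnt b (partner b x v))) [0..<cnt b v * cnt b (partner b x v)]"

definition pairs :: "nat \<Rightarrow> nat \<Rightarrow> (nat \<times> nat \<times> nat) list" where
  "pairs b k = concat (map (\<lambda>k. bucket_pairs b (xs ! (k div R)) (k mod R)) [0..<k])"

definition NP :: "nat \<Rightarrow> nat" where "NP b = length (pairs b (n * R))"

definition holds_pairs :: "state \<Rightarrow> (nat \<times> nat \<times> nat) list \<Rightarrow> bool" where
  "holds_pairs \<sigma> ps \<longleftrightarrow> (\<forall>p<length ps. (mem \<sigma> 6 p, mem \<sigma> 7 p, mem \<sigma> 8 p) = ps ! p)"

lemma pairs_Suc: "pairs b (Suc k) = pairs b k @ bucket_pairs b (xs ! (k div R)) (k mod R)"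
  by (simp add: pairs_def)

lemma length_pairs: "length (pairs b m) = (\<Sum>k<m. cnt b (k mod R) * cnt b (partner b (xs ! (k div R)) (k mod R)))"
  by (induction m) (auto simp: pairs_Suc bucket_pairs_def pairs_def)

lemma partner_less: "x < 2 ^ w \<Longrightarrow> v < R \<Longrightarrow> partner b x v < R"
  unfolding partner_def R by (intro xor_less_pow hs_less)

lemma partner_partner: "partner b x (partner b x v) = v"
  by (simp add: partner_def xor.assoc)

text \<open>Each product is at most half the sum of the two squares. For a fixed word, passing to
  the partner bucket is an involution, so both sums of squares are equal.\<close>

lemma sum_partner: "x < 2 ^ w \<Longrightarrow> (\<Sum>v<R. cnt b v * cnt b (partner b x v)) \<le> (\<Sum>v<R. (cnt b v)\<^sup>2)"
proof -
  assume x: "x < 2 ^ w"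
  have bij: "bij_betw (partner b x) {..<R} {..<R}"
    by (rule bij_betw_byWitness[where f' = "partner b x"]) (use partner_partner partner_less[OF x] in auto)
  have ineq: "2 * (a * c) \<le> a\<^sup>2 + c\<^sup>2" for a c :: nat
  proof -
    have "real (2 * (a * c)) \<le> real (a\<^sup>2 + c\<^sup>2)"
      using sum_squares_bound[of "real a" "real c"] by simp
    then show ?thesis by (simp only: of_nat_le_iff)
  qed
  have "2 * (\<Sum>v<R. cnt b v * cnt b (partner b x v)) = (\<Sum>v<R. 2 * (cnt b v * cnt b (partner b x v)))"
    by (simp add: sum_distrib_left)
  also have "\<dots> \<le> (\<Sum>v<R. (cnt b v)\<^sup>2 + (cnt b (partner b x v))\<^sup>2)" by (intro sum_mono ineq)
  also have "\<dots> = (\<Sum>v<R. (cnt b v)\<^sup>2) + (\<Sum>v<R. (cnt b (partner b x v))\<^sup>2)" by (simp add: sum.distrib)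
  also have "(\<Sum>v<R. (cnt b (partner b x v))\<^sup>2) = (\<Sum>v<R. (cnt b v)\<^sup>2)"
    by (rule sum.reindex_bij_betw[OF bij])
  finally show ?thesis by simp
qed

lemma sum_div_mod: "(\<Sum>k<m * R. f (k div R) (k mod R)) = (\<Sum>i<m. \<Sum>v<R. f i v)" for f :: "nat \<Rightarrow> nat \<Rightarrow> nat"
proof (induction m)
  case (Suc m)
  have "(\<Sum>k<Suc m * R. f (k div R) (k mod R)) = (\<Sum>k<m * R. f (k div R) (k mod R)) +
      (\<Sum>k=m * R..<m * R + R. f (k div R) (k mod R))"
    by (subst sum.atLeastLessThan_concat[symmetric, of 0 "m * R" "Suc m * R", simplified atLeast0LessThan])
      (auto simp: add.commute)
  also have "(\<Sum>k=m * R..<m * R + R. f (k div R) (k mod R)) = (\<Sum>v<R. f m v)"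
    by (rule sum.reindex_bij_witness[where i = "\<lambda>v. m * R + v" and j = "\<lambda>k. k - m * R"])
      (use pos(2) in \<open>auto simp: le_add_diff_inverse dest!: le_Suc_ex\<close>)
  finally show ?case using Suc by simp
qed simp

lemma nth_xs_less: "i < n \<Longrightarrow> xs ! i < 2 ^ w"
  using xs_words length_xs by (auto dest: nth_mem)

lemma NP_le: "good b \<Longrightarrow> NP b \<le> n * Bd"
proof -
  assume g: "good b"
  have "NP b = (\<Sum>i<n. \<Sum>v<R. cnt b v * cnt b (partner b (xs ! i) v))"
    by (simp add: NP_def length_pairs sum_div_mod[of "\<lambda>i v. cnt b v * cnt b (partner b (xs ! i) v)" n])
  also have "\<dots> \<le> (\<Sum>i<n. Bd)"
    by (intro sum_mono order.trans[OF sum_partner]) (use g nth_xs_less in \<open>auto simp: good_def\<close>)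
  finally show ?thesis by simp
qed

text \<open>Since \<open>cnt\<close> is positive, each word contributes at least one triple for each
  bucket, whatever the hash function. This is the lower half of the \<Theta> bound on the number of
  queries.\<close>

lemma NP_ge: "n * R \<le> NP b"
proof -
  have "(\<Sum>k<n * R. 1) \<le> (\<Sum>k<n * R. cnt b (k mod R) * cnt b (partner b (xs ! (k div R)) (k mod R)))"
    by (intro sum_mono) (simp add: cnt_def)
  then show ?thesis by (simp add: NP_def length_pairs)
qed

lemma length_pairs_le: "k \<le> n * R \<Longrightarrow> length (pairs b k) \<le> NP b"
  unfolding NP_def length_pairs by (intro sum_mono2) auto

lemma lo_mono: "lo b v \<le> lo b (Suc v)"
  unfolding lo_def by (intro div_le_mono) (simp add: buckets_Suc)

lemma lo_less: "lo b v < NC"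
  unfolding lo_def NC using div_le_mono[OF length_buckets_le] by (simp add: le_imp_less_Suc)

lemma cnt_lo: "cnt b v = lo b (Suc v) - lo b v + 1"
  by (simp add: cnt_def lo_def)

lemma pairs_chunks: "(c, t1, t2) \<in> set (pairs b k) \<Longrightarrow> t1 < NC \<and> t2 < NC"
proof -
  assume "(c, t1, t2) \<in> set (pairs b k)"
  then obtain v v' j where j: "t1 = lo b v + j div cnt b v'" "t2 = lo b v' + j mod cnt b v'" "j < cnt b v * cnt b v'"
    by (auto simp: pairs_def bucket_pairs_def)
  have "j div cnt b v' < cnt b v" using j(3) by (simp add: less_mult_imp_div_less)
  moreover have "j mod cnt b v' < cnt b v'" by (simp add: cnt_lo)
  ultimately show ?thesis
    using j(1,2) lo_less[of b "Suc v"] lo_less[of b "Suc v'"] lo_mono[of b v] lo_mono[of b v']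
      cnt_lo[of b v] cnt_lo[of b v'] by linarith
qed

lemma eval_cnt:
  assumes st: "sorted_at b \<sigma>" and P: "Par \<sigma>" and v: "regs \<sigma> vv = v" "v < R" and l: "regs \<sigma> y = lo b v"
  shows "eval w (B Add (B Sub (LO (B Add (V vv) (cst 1))) (V y)) (cst 1)) \<sigma> = cnt b v"
proof -
  have v1: "Suc v mod 2 ^ w = Suc v" using v R_le(1) bounds(1) by simp
  have m: "mem \<sigma> 4 (Suc v) div s = lo b (Suc v)" using st v by (simp add: sorted_at_def lo_def)
  have "lo b (Suc v) < 2 ^ w" using lo_less[of b "Suc v"] U_less(3) by linarith
  from Sub_mod[OF lo_mono this] have sub: "(lo b (Suc v) + (2 ^ w - lo b v)) mod 2 ^ w = lo b (Suc v) - lo b v" .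
  have "Suc (lo b (Suc v) - lo b v) < 2 ^ w" using lo_less[of b "Suc v"] U_less(3) by linarith
  then show ?thesis using P v v1 m sub l by (simp add: LO_def Par_def cnt_lo)
qed

lemma ht_PAIRS:
  assumes Par: "Par \<sigma>" and rw: "mem \<sigma> 2 = rw" and st: "sorted_at b \<sigma>" and b: "regs \<sigma> vb = b" "b + r < 2 ^ w"
    and g: "good b"
  shows "ht w PAIRS (n * R * (H + 120) + NP b * 60 + 50) \<sigma> (\<lambda>\<tau>. regs \<tau> vnp = NP b \<and> holds_pairs \<tau> (pairs b (n * R)))"
proof -
  let ?inner = "For ve (B Mul (V vcn1) (V vcn2))
          (Sto 6 (V vnp) (V vx) ;;
           Sto 7 (V vnp) (B Add (V vlo1) (B Div (V ve) (V vcn2))) ;;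
           Sto 8 (V vnp) (B Add (V vlo2) (B Mod (V ve) (V vcn2))) ;;
           vnp ::= B Add (V vnp) (cst 1))"
  let ?body = "vx ::= Rd 0 (B Add (B Div (V vk) (V vR)) (cst 1)) ;; HASH ;;
        vv ::= B Mod (V vk) (V vR) ;; vlo1 ::= LO (V vv) ;;
        vcn1 ::= B Add (B Sub (LO (B Add (V vv) (cst 1))) (V vlo1)) (cst 1) ;;
        vv ::= B Xor (V vv) (V vh) ;; vlo2 ::= LO (V vv) ;;
        vcn2 ::= B Add (B Sub (LO (B Add (V vv) (cst 1))) (V vlo2)) (cst 1) ;; ?inner"
  let ?outer = "For vk (B Mul (V vn) (V vR)) (?body)"
  define I where "I = (\<lambda>k (\<tau>::state). regs \<tau> vnp = length (pairs b k) \<and> holds_pairs \<tau> (pairs b k))"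
  define num where "num = (\<lambda>k. cnt b (k mod R) * cnt b (partner b (xs ! (k div R)) (k mod R)))"
  define \<sigma>0 where "\<sigma>0 = set_reg vnb r (set_reg vbb b (set_reg vnp 0 \<sigma>))"
  have NPw: "NP b < 2 ^ w"
  proof -
    have "n * Bd * 1 \<le> n * Bd * L" by (intro mult_left_mono) (simp_all add: L)
    then show ?thesis using NP_le[OF g] bounds(5) by linarith
  qed
  have "ht w ?outer (n * R * (H + 120) + NP b * 60 + 20) \<sigma>0 (I (n * R))"
  proof (rule ht_For_sum[where T = "\<lambda>k. H + 110 + num k * 60"], goal_cases)
    case 1
    have "n * R < 2 ^ w" using NP_ge[of b] NPw by linarith
    then show ?case using Par by (simp add: Par_def \<sigma>0_def)
  next
    case 2
    then show ?case by (simp add: I_def pairs_def \<sigma>0_def holds_pairs_def)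
  next
    case (3 k \<tau>)
    note k = 3(1) and I = 3(2) and fr = 3(3)
    have "Par \<sigma>0" using Par by (simp add: \<sigma>0_def)
    then have P1: "Par \<tau>" using Par_frame[OF _ fr] by (simp add: LO_def)
    have s1: "mem \<tau> 2 = rw" "regs \<tau> vnb = r" "regs \<tau> vbb = b" "sorted_at b \<tau>"
      using fr rw b st by (simp_all add: frame_def LO_def \<sigma>0_def sorted_at_def)
    define x where "x = xs ! (k div R)"
    define v where "v = k mod R"
    define v' where "v' = partner b x v"
    have kR: "k div R < n" using k by (simp add: less_mult_imp_div_less mult.commute)
    have xw: "x < 2 ^ w" using nth_xs_less[OF kR] by (simp add: x_def)
    have v: "v < R" "v' < R" using pos(2) partner_less[OF xw] by (simp_all add: v_def v'_def)
    have cw: "cnt b v * cnt b v' < 2 ^ w"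
    proof -
      have "num k \<le> NP b" using member_le_sum[of k "{..<n * R}" num] k by (simp add: NP_def length_pairs num_def)
      then show ?thesis using NPw by (simp add: num_def x_def v_def v'_def)
    qed
    let ?\<sigma>3 = "\<lambda>\<tau>1. set_reg vcn2 (cnt b v') (set_reg vlo2 (lo b v') (set_reg vv v'
       (set_reg vcn1 (cnt b v) (set_reg vlo1 (lo b v) (set_reg vv v \<tau>1)))))"
    have inner: "ht w ?inner (num k * 50 + 20) (?\<sigma>3 \<tau>1) (I (Suc k))"
      if f: "mem \<tau>1 = mem \<tau>" "regs \<tau>1 vnp = regs \<tau> vnp" "regs \<tau>1 vx = x" for \<tau>1
    proof -
      define ps where "ps = (\<lambda>j. pairs b k @ map (\<lambda>j. (x, lo b v + j div cnt b v', lo b v' + j mod cnt b v')) [0..<j])"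
      define J where "J = (\<lambda>j (\<tau>2::state). regs \<tau>2 vnp = length (ps j) \<and> holds_pairs \<tau>2 (ps j))"
      have "ht w ?inner (num k * 50 + 20) (?\<sigma>3 \<tau>1) (J (cnt b v * cnt b v'))"
      proof (rule ht_For[where T = 40], goal_cases)
        case 1
        then show ?case using cw by simp
      next
        case 2
        then show ?case using I f by (simp add: J_def I_def ps_def holds_pairs_def)
      next
        case (3 j \<tau>2)
        have r2: "regs \<tau>2 vx = x" "regs \<tau>2 vlo1 = lo b v" "regs \<tau>2 vlo2 = lo b v'" "regs \<tau>2 vcn2 = cnt b v'"
          using 3(3) f(3) by (simp_all add: frame_def)
        have e: "lo b v + j div cnt b v' < 2 ^ w" "lo b v' + j mod cnt b v' < 2 ^ w"
        proof -
          have "j div cnt b v' < cnt b v" using 3(1) by (simp add: less_mult_imp_div_less)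
          moreover have "j mod cnt b v' < cnt b v'" by (simp add: cnt_lo)
          ultimately show "lo b v + j div cnt b v' < 2 ^ w" "lo b v' + j mod cnt b v' < 2 ^ w"
            using lo_less[of b "Suc v"] lo_less[of b "Suc v'"] lo_mono[of b v] lo_mono[of b v'] U_less(3)
            unfolding cnt_lo by linarith+
        qed
        have "length (ps (Suc j)) \<le> length (pairs b (Suc k))"
          using 3(1) by (simp add: ps_def pairs_Suc bucket_pairs_def x_def v_def v'_def)
        then have "Suc (length (ps j)) \<le> NP b"
          using length_pairs_le[of "Suc k" b] k by (simp add: ps_def)
        then have lw: "Suc (length (ps j)) mod 2 ^ w = Suc (length (ps j))" using NPw by simp
        have np: "regs \<tau>2 vnp = length (ps j)" and hp: "holds_pairs \<tau>2 (ps j)" using 3(2) by (simp_all add: J_def)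
        have psS: "ps (Suc j) = ps j @ [(x, lo b v + j div cnt b v', lo b v' + j mod cnt b v')]" by (simp add: ps_def)
        let ?t1 = "lo b v + j div cnt b v'" and ?t2 = "lo b v' + j mod cnt b v'"
        let ?\<tau>3 = "set_mem 8 (length (ps j)) ?t2 (set_mem 7 (length (ps j)) ?t1 (set_mem 6 (length (ps j)) x (set_reg ve j \<tau>2)))"
        have fin: "holds_pairs (set_reg vnp (Suc (length (ps j))) ?\<tau>3) (ps (Suc j))"
          using hp by (auto simp: holds_pairs_def psS nth_append less_Suc_eq)
        show ?case
          by (rule ht_Sq_Sto[where T = 30], rule ht_Sq_Sto[where T = 20], rule ht_Sq_Sto[where T = 8],
             rule ht_Asg'[where x = "Suc (length (ps j))"])
            (use r2 e np lw fin in \<open>simp_all add: J_def psS\<close>)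
      qed (simp add: num_def x_def v_def v'_def)
      moreover have "ps (cnt b v * cnt b v') = pairs b (Suc k)"
        by (simp add: ps_def pairs_Suc bucket_pairs_def x_def v_def v'_def)
      ultimately show ?thesis by (simp add: J_def I_def)
    qed
    show ?case
    proof (rule ht_Sq_Asg'[where x = x and T = "H + 100 + num k * 60"], goal_cases)
      case 1
      have "Suc (k div R) mod 2 ^ w = Suc (k div R)" using kR bounds(1) by simp
      then show ?case using P1 kR length_xs by (simp add: Par_def x_def arr_def)
    next
      case 2
      show ?case
      proof (rule ht_HASH[where m' = "r + u" and T = "100 + num k * 60"], goal_cases)
        case (5 \<tau>1)
        have h: "regs \<tau>1 vh = hs b r x" using 5(1) s1 by (simp add: hs_def)
        have f: "regs \<tau>1 vnp = regs \<tau> vnp" "mem \<tau>1 = mem \<tau>" "regs \<tau>1 vx = x" "regs \<tau>1 vk = k"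
          using 5(2) by (simp_all add: frame_HASH)
        have P2: "Par \<tau>1" using 5(2) P1 by (simp add: frame_HASH Par_def)
        have st1: "sorted_at b \<tau>1" using s1(4) f(2) by (simp add: sorted_at_def)
        have st2: "sorted_at b (set_reg a c \<sigma>) = sorted_at b \<sigma>" for a c \<sigma> by (simp add: sorted_at_def)
        have lo_ev: "eval w (LO (V vv)) \<sigma> = lo b v0" if "sorted_at b \<sigma>" "Par \<sigma>" "regs \<sigma> vv = v0" "v0 < R" for \<sigma> v0
          using that by (simp add: LO_def sorted_at_def Par_def lo_def)
        show ?case
        proof (rule ht_Sq_Asg'[where x = v and T = "95 + num k * 60"], goal_cases)
          case 1 show ?case using P2 f by (simp add: Par_def v_def)
        next
          case 2 show ?case
          proof (rule ht_Sq_Asg'[where x = "lo b v" and T = "85 + num k * 60"], goal_cases)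
            case 1 show ?case by (rule lo_ev) (use st1 P2 v st2 in simp_all)
          next
            case 2 show ?case
            proof (rule ht_Sq_Asg'[where x = "cnt b v" and T = "70 + num k * 60"], goal_cases)
              case 1 show ?case by (rule eval_cnt) (use st1 P2 v st2 in simp_all)
            next
              case 2 show ?case
              proof (rule ht_Sq_Asg'[where x = v' and T = "65 + num k * 60"], goal_cases)
                case 1 show ?case using h by (simp add: v'_def partner_def)
              next
                case 2 show ?case
                proof (rule ht_Sq_Asg'[where x = "lo b v'" and T = "60 + num k * 60"], goal_cases)
                  case 1 show ?case by (rule lo_ev) (use st1 P2 v st2 in simp_all)
                next
                  case 2 show ?case
                  proof (rule ht_Sq_Asg'[where x = "cnt b v'" and T = "45 + num k * 60"], goal_cases)
                    case 1 show ?case by (rule eval_cnt) (use st1 P2 v st2 in simp_all)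
                  next
                    case 2 show ?case by (rule ht_mono[OF inner[OF f(2,1,3)]]) simp_all
                  qed (simp add: LO_def)
                qed (simp add: LO_def)
              qed simp
            qed (simp add: LO_def)
          qed (simp add: LO_def)
        qed simp
      qed (use w s1 b xw r_u_less in \<open>simp_all add: H_def\<close>)
    qed simp
  next
    case 4
    have "(\<Sum>k<n * R. H + 110 + num k * 60 + 5) = n * R * (H + 115) + NP b * 60"
      by (simp add: sum.distrib NP_def length_pairs num_def sum_distrib_left algebra_simps)
    then show ?case by (simp add: algebra_simps)
  qed
  then show ?thesis
    unfolding PAIRS_def using Par b
    by (intro ht_Sq_Asg'[where x = 0 and T = "n * R * (H + 120) + NP b * 60 + 40"]
         ht_Sq_Asg'[where x = b and T = "n * R * (H + 120) + NP b * 60 + 30"]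
         ht_Sq_Asg'[where x = r and T = "n * R * (H + 120) + NP b * 60 + 20"])
       (simp_all add: \<sigma>0_def Par_def I_def NP_def)
qed

definition query :: "nat \<Rightarrow> nat \<Rightarrow> nat \<times> nat" where
  "query b k = (case pairs b (n * R) ! (k div L) of (c, t1, t2) \<Rightarrow>
     let h = rep_hash (k mod L) c in
     ((k mod L * NC + t1) * U + h div U, (k mod L * NC + t2) * U + h mod U))"

definition sd_As :: "nat \<Rightarrow> nat list list" where "sd_As b = map (sd_set b U) [0..<NA]"
definition sd_Bs :: "nat \<Rightarrow> nat list list" where "sd_Bs b = map (sd_set b 1) [0..<NA]"
definition sd_Qs :: "nat \<Rightarrow> (nat \<times> nat) list" where "sd_Qs b = map (query b) [0..<NP b * L]"

definition query_words :: "nat \<Rightarrow> nat \<Rightarrow> nat list" where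
  "query_words b k = concat (map (\<lambda>k. [fst (query b k), snd (query b k)]) [0..<k])"

lemma sd_input_eq: "sd_input (U * U) (sd_As b) (sd_Bs b) (sd_Qs b) =
  [U * U, NA, NA, NP b * L] @ all_sets b U NA @ all_sets b 1 NA @ query_words b (NP b * L)"
  by (simp add: sd_input_def sd_As_def sd_Bs_def sd_Qs_def all_sets_def set_block_def[abs_def] query_words_def
      comp_def case_prod_unfold)

lemma U_power: "U * U = 2 ^ u"
  by (simp add: U s u power_add power_mult mult_2 power2_eq_square)

lemma rep_hash_less: "x < 2 ^ w \<Longrightarrow> rep_hash i x < U * U"
  unfolding rep_hash_def U_power by (rule hs_less)

lemma pairs_words: "(c, t1, t2) \<in> set (pairs b k) \<Longrightarrow> k \<le> n * R \<Longrightarrow> c \<in> set xs"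
  using length_xs by (auto simp: pairs_def bucket_pairs_def less_mult_imp_div_less mult.commute)

lemma set_index_less: "i < L \<Longrightarrow> t < NC \<Longrightarrow> z < U \<Longrightarrow> (i * NC + t) * U + z < NA"
proof -
  assume a: "i < L" "t < NC" "z < U"
  have "Suc i * NC \<le> L * NC" using a by (intro mult_right_mono) auto
  then have "i * NC + t + 1 \<le> L * NC" using a by simp
  then have "(i * NC + t + 1) * U \<le> L * NC * U" by (intro mult_right_mono) auto
  then show ?thesis using a by (simp add: NA)
qed

lemma NP_L_less: "good b \<Longrightarrow> 4 + 2 * (NA * (s + 1)) + 2 * (NP b * L) < 2 ^ w"
proof -
  assume "good b"
  then have "NP b * L \<le> n * Bd * L" using NP_le by (intro mult_right_mono) auto
  then show ?thesis using limit by linarith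
qed

text \<open>The number of queries is known only after the triples have been listed, so cell 3 of the
  header contains 0 until the end.\<close>

lemma ht_QUERIES:
  assumes Par: "Par \<sigma>" and rw: "mem \<sigma> 2 = rw" and ps: "regs \<sigma> vnp = NP b" "holds_pairs \<sigma> (pairs b (n * R))"
    and vpos: "regs \<sigma> vpos = length out" and out: "mem \<sigma> 10 = arr out" "3 < length out"
    and len: "length out \<le> 4 + 2 * (NA * (s + 1))" and g: "good b"
  shows "ht w QUERIES (NP b * L * (H + 160) + 50) \<sigma>
     (\<lambda>\<tau>. mem \<tau> 10 = arr ((out @ query_words b (NP b * L))[3 := NP b * L]))"
proof -
  let ?body = "vp ::= B Div (V vk) (V vL) ;; vx ::= Rd 6 (V vp) ;; vbb ::= REPBASE (B Mod (V vk) (V vL)) ;; HASH ;;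
        Sto 10 (V vpos) (QINDEX 7 (B Div (V vh) (V vU))) ;; vpos ::= B Add (V vpos) (cst 1) ;;
        Sto 10 (V vpos) (QINDEX 8 (B Mod (V vh) (V vU))) ;; vpos ::= B Add (V vpos) (cst 1)"
  let ?loop = "For vk (B Mul (V vnp) (V vL)) (?body)"
  define O' where "O' = (\<lambda>k. out @ query_words b k)"
  define I where "I = (\<lambda>k (\<tau>::state). regs \<tau> vpos = length (O' k) \<and> mem \<tau> 10 = arr (O' k))"
  define \<sigma>0 where "\<sigma>0 = set_reg vnb u \<sigma>"
  have NPL: "NP b * L < 2 ^ w" using NP_L_less[OF g] by linarith
  have lq: "length (query_words b k) = 2 * k" for k
    by (induction k) (auto simp: query_words_def)
  have "ht w ?loop (NP b * L * (H + 160) + 20) \<sigma>0 (I (NP b * L))"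
  proof (rule ht_For[where T = "H + 150"], goal_cases)
    case 1
    then show ?case using ps Par NPL by (simp add: Par_def \<sigma>0_def)
  next
    case 2
    then show ?case using vpos out by (simp add: I_def O'_def query_words_def \<sigma>0_def)
  next
    case (3 k \<tau>)
    note k = 3(1) and I = 3(2) and fr = 3(3)
    have "Par \<sigma>0" using Par by (simp add: \<sigma>0_def)
    then have P1: "Par \<tau>" using Par_frame[OF _ fr] by simp
    have s1: "mem \<tau> 2 = rw" "regs \<tau> vnb = u" "holds_pairs \<tau> (pairs b (n * R))"
      using fr rw ps by (simp_all add: frame_def \<sigma>0_def holds_pairs_def)
    define p where "p = k div L"
    define i where "i = k mod L"
    have i: "i < L" using pos(5) by (simp add: i_def)
    have p: "p < length (pairs b (n * R))" using k by (simp add: p_def NP_def less_mult_imp_div_less)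
    obtain c t1 t2 where ct: "pairs b (n * R) ! p = (c, t1, t2)" by (cases "pairs b (n * R) ! p")
    then have m: "mem \<tau> 6 p = c" "mem \<tau> 7 p = t1" "mem \<tau> 8 p = t2"
      using s1(3) p by (auto simp: holds_pairs_def)
    have ctp: "(c, t1, t2) \<in> set (pairs b (n * R))" using p ct by (metis nth_mem)
    then have t12: "t1 < NC" "t2 < NC" using pairs_chunks by blast+
    have cw: "c < 2 ^ w" using pairs_words[OF ctp] xs_words by auto
    define h where "h = rep_hash i c"
    have h: "h div U < U" "h mod U < U"
      using rep_hash_less[OF cw, of i] pos(3) by (simp_all add: h_def less_mult_imp_div_less)
    define q1 where "q1 = (i * NC + t1) * U + h div U"
    define q2 where "q2 = (i * NC + t2) * U + h mod U"
    have qk: "query b k = (q1, q2)" by (simp add: query_def ct[unfolded p_def] Let_def q1_def q2_def h_def i_def)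
    have qs: "O' (Suc k) = O' k @ [q1] @ [q2]" by (simp add: O'_def query_words_def qk)
    have ev: "eval w (QINDEX m e) \<sigma> = (i * NC + t) * U + z"
      if "Par \<sigma>" "regs \<sigma> vk = k" "mem \<sigma> m p = t" "regs \<sigma> vp = p" "eval w e \<sigma> = z" "t < NC" "z < U" for m e \<sigma> t z
    proof -
      have 1: "(i * NC + t) * U + z < 2 ^ w" using set_index_less[OF i that(6,7)] U_less(2) by linarith
      then have 2: "(i * NC + t) * U < 2 ^ w" by linarith
      have "(i * NC + t) * 1 \<le> (i * NC + t) * U" using pos(3) by (intro mult_left_mono) auto
      then have 3: "i * NC + t < 2 ^ w" using le_less_trans[OF _ 2, of "i * NC + t"] by simp
      then have "i * NC < 2 ^ w" by linarith
      note this 1 2 3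
      then show ?thesis using that by (simp add: QINDEX_def Par_def i_def)
    qed
    have I': "regs \<tau> vpos = length (O' k)" "mem \<tau> 10 = arr (O' k)" using I by (simp_all add: I_def)
    have "length (O' k) + 2 \<le> 4 + 2 * (NA * (s + 1)) + 2 * (NP b * L)"
      using len k by (simp add: O'_def lq)
    then have lw: "length (O' k) + 2 < 2 ^ w" using NP_L_less[OF g] by linarith
    have a1: "(arr (O' k))(length (O' k) := q1) = arr (O' k @ [q1])" by (rule arr_snoc)
    have a2: "(arr (O' k @ [q1]))(Suc (length (O' k)) := q2) = arr (O' k @ [q1] @ [q2])"
      using arr_snoc[of "O' k @ [q1]" q2] by simp
    show ?case
    proof (rule ht_Sq_Asg'[where x = p and T = "H + 140"], goal_cases)
      case 1 show ?case using P1 by (simp add: Par_def p_def)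
    next
      case 2 show ?case
      proof (rule ht_Sq_Asg'[where x = c and T = "H + 130"], goal_cases)
        case 1 show ?case using m by simp
      next
        case 2 show ?case
        proof (rule ht_Sq_Asg'[where x = "L * r + i * u" and T = "H + 110"], goal_cases)
          case 1 show ?case by (rule eval_REPBASE) (use P1 i in \<open>simp_all add: Par_def i_def\<close>)
        next
          case 2 show ?case
          proof (rule ht_HASH[where m' = "r + u" and T = 110], goal_cases)
            case (5 \<tau>1)
            have f: "regs \<tau>1 vh = h" "regs \<tau>1 vk = k" "regs \<tau>1 vp = p" "regs \<tau>1 vpos = length (O' k)" "mem \<tau>1 = mem \<tau>"
              using 5 s1 I' by (simp_all add: frame_HASH h_def rep_hash_def hs_def)
            have P2: "Par \<tau>1" using 5(2) P1 by (simp add: frame_HASH Par_def)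
            have ev1: "eval w (QINDEX 7 (B Div (V vh) (V vU))) \<tau>1 = q1"
              unfolding q1_def by (rule ev) (use P2 f m t12 h in \<open>simp_all add: Par_def\<close>)
            let ?\<tau>2 = "set_reg vpos (length (O' k) + 1) (set_mem 10 (length (O' k)) q1 \<tau>1)"
            have ev2: "eval w (QINDEX 8 (B Mod (V vh) (V vU))) ?\<tau>2 = q2"
              unfolding q2_def by (rule ev) (use P2 f m t12 h in \<open>simp_all add: Par_def\<close>)
            let ?\<tau>3 = "set_reg vpos (length (O' k) + 2) (set_mem 10 (length (O' k) + 1) q2 ?\<tau>2)"
            have fin: "I (Suc k) ?\<tau>3"
              using f I' a1 a2 by (simp add: I_def qs)
            have last: "ht w (Sto 10 (V vpos) (QINDEX 8 (B Mod (V vh) (V vU))) ;; vpos ::= B Add (V vpos) (cst 1)) 40 ?\<tau>2 (I (Suc k))"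
            proof (rule ht_Sq_Sto[where T = 10], goal_cases)
              case 1 show ?case unfolding ev2
                by (rule ht_Asg'[where x = "length (O' k) + 2"]) (use fin lw in simp_all)
            qed (simp add: QINDEX_def)
            show ?case
            proof (rule ht_Sq_Sto[where T = 60], goal_cases)
              case 1 show ?case unfolding ev1
                by (rule ht_Sq_Asg'[where x = "length (O' k) + 1" and T = 40]) (use f lw last in simp_all)
            qed (simp add: QINDEX_def)
          qed (use w s1 cw r_u_less rep_base_less[OF i] in \<open>simp_all add: H_def\<close>)
        qed (simp add: REPBASE_def)
      qed simp
    qed simp
  qed (simp add: algebra_simps)
  note loop = this
  show ?thesis
    unfolding QUERIES_def
  proof (rule ht_Sq_Asg'[where x = u and T = "NP b * L * (H + 160) + 40"], goal_cases)
    case 2 show ?case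
    proof (rule ht_Sq[where ?T2.0 = 10, OF loop[unfolded \<sigma>0_def]], goal_cases)
      case (1 \<tau>)
      have P1: "Par \<tau>" using Par_frame[OF _ 1(2)] Par by simp
      have np: "regs \<tau> vnp = NP b" using 1(2) ps by (simp add: frame_def)
      have a3: "(arr (O' (NP b * L)))(3 := NP b * L) = arr ((O' (NP b * L))[3 := NP b * L])"
        by (rule arr_update) (use out in \<open>simp add: O'_def\<close>)
      have e: "eval w (B Mul (V vnp) (V vL)) \<tau> = NP b * L" using P1 np NPL by (simp add: Par_def)
      show ?case by (intro ht_Sto[where T' = 10], unfold e) (use 1 a3 in \<open>simp_all add: I_def O'_def\<close>)
    qed simp
  qed (use Par in \<open>simp_all add: Par_def\<close>)
qed

definition built :: "nat \<Rightarrow> state \<Rightarrow> bool" where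
  "built b \<tau> \<longleftrightarrow> mem \<tau> 10 = arr (sd_input (U * U) (sd_As b) (sd_Bs b) (sd_Qs b)) \<and> regs \<tau> vnp = NP b \<and>
     holds_pairs \<tau> (pairs b (n * R)) \<and> holds_list (mem \<tau> 3) (buckets b R)"

definition T_build :: nat where
  "T_build = 2 * (NA * (s * (H + 60) + 120)) + n * R * (H + 120) + n * Bd * 60 + n * Bd * L * (H + 160) + 420"

lemma ht_BUILD:
  assumes Par: "Par \<sigma>" and rw: "mem \<sigma> 2 = rw" and st: "sorted_at b \<sigma>" and b: "regs \<sigma> vb = b" "b + r < 2 ^ w"
    and g: "good b" and zero: "mem \<sigma> 10 = arr []" "mem \<sigma> 5 = arr []"
  shows "ht w BUILD (T_build - 10) \<sigma> (built b)"
proof -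
  let ?T = "\<lambda>k. k * (NA * (s * (H + 60) + 120)) + n * R * (H + 120) + n * Bd * 60 + n * Bd * L * (H + 160)"
  define hd where "hd = [U * U, NA, NA, 0]"
  define S1 where "S1 = hd @ all_sets b U NA"
  define S2 where "S2 = S1 @ all_sets b 1 NA"
  have lenS: "length hd \<le> 4 + NA * (s + 1)" "length S1 \<le> 4 + NA * (s + 1)" "length S2 \<le> 4 + 2 * (NA * (s + 1))"
    using length_all_sets[of b U NA] length_all_sets[of b 1 NA] by (simp_all add: hd_def S1_def S2_def)
  have queries: "ht w QUERIES (n * Bd * L * (H + 160) + 50) \<tau> (built b)"
    if P: "Par \<tau>" and m: "mem \<tau> 2 = rw" "sorted_at b \<tau>" and pr: "regs \<tau> vnp = NP b" "holds_pairs \<tau> (pairs b (n * R))"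
      and o: "regs \<tau> vpos = length S2" "mem \<tau> 10 = arr S2" for \<tau>
  proof (rule ht_mono[OF ht_QUERIES[OF P m(1) pr o _ lenS(3) g]], goal_cases)
    case 1 show ?case by (simp add: S2_def S1_def hd_def)
  next
    case 2
    have "NP b * L * (H + 160) \<le> n * Bd * L * (H + 160)"
      using NP_le[OF g] by (intro mult_right_mono) auto
    then show ?case by simp
  next
    case (3 \<tau>')
    have "(S2 @ query_words b (NP b * L))[3 := NP b * L] = sd_input (U * U) (sd_As b) (sd_Bs b) (sd_Qs b)"
      unfolding sd_input_eq S2_def S1_def hd_def by (simp add: numeral_3_eq_3)
    then show ?case using 3 m pr by (simp add: built_def frame_def holds_pairs_def sorted_at_def)
  qed
  have tail: "ht w (PAIRS ;; QUERIES) (?T 0 + 120) \<tau> (built b)"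
    if P: "Par \<tau>" and m: "mem \<tau> 2 = rw" "sorted_at b \<tau>" "regs \<tau> vb = b"
      and o: "regs \<tau> vpos = length S2" "mem \<tau> 10 = arr S2" for \<tau>
  proof (rule ht_Sq[OF ht_PAIRS[OF P m b(2) g] queries], goal_cases)
    case (1 \<tau>')
    then show ?case using Par_frame[OF P 1(2)] by simp
  qed (use NP_le[OF g] m o in \<open>simp_all add: frame_def sorted_at_def holds_pairs_def\<close>)
  have sets2: "ht w (vmul ::= cst 1 ;; SETS ;; PAIRS ;; QUERIES) (?T 1 + 180) \<tau> (built b)"
    if P: "Par \<tau>" and m: "mem \<tau> 2 = rw" "sorted_at b \<tau>" "regs \<tau> vb = b" "regs \<tau> vnb = u"
      and o: "regs \<tau> vpos = length S1" "mem \<tau> 10 = arr S1" "regs \<tau> vid = NA" "\<And>y. mem \<tau> 5 y \<le> NA" for \<tau>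
  proof (rule ht_Sq_Asg'[where x = 1 and T = "?T 1 + 160"], goal_cases)
    case 2
    let ?\<tau> = "set_reg vmul 1 \<tau>"
    show ?case
    proof (rule ht_Sq[OF ht_SETS[where b = b and mul = 1 and out = S1 and d = NA] tail], goal_cases)
      case (13 \<tau>')
      show ?case using Par_frame[OF _ 13(2)] P by simp
    qed (use P m o lenS pos(3) in \<open>simp_all add: frame_def sorted_at_def S2_def\<close>)
  qed simp_all
  have sets1: "ht w (vmul ::= V vU ;; SETS ;; vmul ::= cst 1 ;; SETS ;; PAIRS ;; QUERIES) (?T 2 + 240) \<tau> (built b)"
    if P: "Par \<tau>" and m: "mem \<tau> 2 = rw" "sorted_at b \<tau>" "regs \<tau> vb = b" "regs \<tau> vnb = u"
      and o: "regs \<tau> vpos = length hd" "mem \<tau> 10 = arr hd" "regs \<tau> vid = 0" "\<And>y. mem \<tau> 5 y = 0" for \<tau>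
  proof (rule ht_Sq_Asg'[where x = U and T = "?T 2 + 230"], goal_cases)
    case 2
    show ?case
    proof (rule ht_Sq[OF ht_SETS[where b = b and mul = U and out = hd and d = 0] sets2], goal_cases)
      case (13 \<tau>')
      show ?case using Par_frame[OF _ 13(2)] P by simp
    qed (use P m o lenS pos(3) in \<open>simp_all add: frame_def sorted_at_def S1_def\<close>)
  qed (use P in \<open>simp_all add: Par_def\<close>)
  have NS: "eval w NSETS \<tau> = NA" if "Par \<tau>" for \<tau> using that by (rule eval_NSETS)
  have hd: "(arr [])(0 := U * U, Suc 0 := NA, 2 := NA) = arr hd"
    by (auto simp: arr_def hd_def fun_eq_iff nth_Cons split: nat.splits)
  show ?thesis
    unfolding BUILD_def T_build_def
  proof (rule ht_Sq_Sto[where T = "?T 2 + 350"], goal_cases)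
    case 1
    have e1: "eval w (cst 0) \<sigma> = 0" "eval w (B Mul (V vU) (V vU)) \<sigma> = U * U"
      using Par bounds(3) by (simp_all add: Par_def)
    show ?case unfolding e1
    proof (rule ht_Sq_Sto[where T = "?T 2 + 320"], goal_cases)
      case 1
      have e2: "eval w (cst 1) (set_mem 10 0 (U * U) \<sigma>) = 1" "eval w NSETS (set_mem 10 0 (U * U) \<sigma>) = NA"
        using Par NS by simp_all
      show ?case unfolding e2
      proof (rule ht_Sq_Sto[where T = "?T 2 + 290"], goal_cases)
        case 1
        let ?\<sigma>2 = "set_mem 10 1 NA (set_mem 10 0 (U * U) \<sigma>)"
        have e3: "eval w (cst 2) ?\<sigma>2 = 2" "eval w NSETS ?\<sigma>2 = NA" using Par NS by simp_all
        show ?case unfolding e3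
          by (rule ht_Sq_Asg'[where x = 4 and T = "?T 2 + 280"], simp,
              rule ht_Sq_Asg'[where x = 0 and T = "?T 2 + 270"], simp,
              rule ht_Sq_Asg'[where x = u and T = "?T 2 + 260"], use Par in \<open>simp add: Par_def\<close>,
              rule ht_mono[OF sets1])
            (use Par rw st b zero hd in \<open>simp_all add: hd_def sorted_at_def arr_def[of "[]"]\<close>)
      qed (simp add: NSETS_def)
    qed (simp add: NSETS_def)
  qed simp
qed

end

section \<open>Evaluation of the answers\<close>

text \<open>Bank 9 counts the repetitions in which the query for a triple of bank 6, 7, 8 is positive.\<close>

definition COUNT :: loopc where
  "COUNT = vcand ::= cst 0 ;; For vk (Rd 11 (cst 0))
     (vp ::= B Div (Rd 11 (B Add (V vk) (cst 1))) (V vL) ;;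
      vq ::= B Add (Rd 9 (V vp)) (cst 1) ;; Sto 9 (V vp) (V vq) ;;
      Ite (B Eq (V vq) (V vL)) (vcand ::= B Add (V vp) (cst 1)) Nop)"

definition VERIFY :: loopc where
  "VERIFY = vp ::= B Sub (V vcand) (cst 1) ;; For vk (B Mul (V vs) (V vs))
     (va ::= B Add (B Mul (Rd 7 (V vp)) (V vs)) (B Div (V vk) (V vs)) ;;
      vd ::= B Add (B Mul (Rd 8 (V vp)) (V vs)) (B Mod (V vk) (V vs)) ;;
      Ite (B And (B And (B Less (V va) (V vn)) (B Less (V vd) (V vn))) (B Eq (B Xor (Rd 3 (V va)) (Rd 3 (V vd))) (Rd 6 (V vp))))
        (vfb ::= cst 0 ;; Sto 1 (cst 0) (cst 1)) Nop)"

text \<open>A single candidate settles the matter. If no triple passes all tests, then there is no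
  solution. Otherwise the candidate recorded last is searched: if it is genuine, the answer is yes,
  and if it is not, the second hash functions were misleading, which is rare enough for brute force.
  \<open>vcand\<close> holds the number of the candidate plus 1, so that 0 means none.\<close>

definition CHECK :: loopc where
  "CHECK = COUNT ;; Ite (V vcand) (vfb ::= cst 1 ;; VERIFY) (vfb ::= cst 0)"

definition BRUTE :: loopc where
  "BRUTE = For ve (V vn) (For vv (V vn) (For vt (V vn)
     (Ite (B Eq (B Xor (Rd 0 (B Add (V ve) (cst 1))) (Rd 0 (B Add (V vv) (cst 1)))) (Rd 0 (B Add (V vt) (cst 1))))
        (Sto 1 (cst 0) (cst 1)) Nop)))"

definition POST :: loopc where
  "POST = vfb ::= cst 1 ;; Ite (V vok) CHECK Nop ;; Ite (V vfb) BRUTE Nop"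

lemma writes_COUNT [simp]: "writes COUNT = {vcand, vk, vp, vq}" "stores COUNT = {9}" "draws COUNT = False"
  by (auto simp: COUNT_def)

lemma writes_VERIFY [simp]: "writes VERIFY = {vp, vk, va, vd, vfb}" "stores VERIFY = {1}" "draws VERIFY = False"
  by (auto simp: VERIFY_def)

lemma writes_CHECK [simp]: "writes CHECK = {vcand, vk, vp, vq, va, vd, vfb}" "stores CHECK = {1, 9}" "draws CHECK = False"
  by (auto simp: CHECK_def)

definition xor_answer :: "nat list \<Rightarrow> nat" where
  "xor_answer xs = (if has_xor_triple (set xs) then 1 else 0)"

definition T_brute :: "nat \<Rightarrow> nat" where "T_brute n = n * (n * (n * 30 + 15) + 15) + 10"

lemma ht_BRUTE:
  assumes n: "length xs = n" "n < 2 ^ w" and \<sigma>: "regs \<sigma> vn = n" "mem \<sigma> 0 = arr (n # xs)" "mem \<sigma> 1 0 = 0"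
  shows "ht w BRUTE (T_brute n) \<sigma> (\<lambda>\<tau>. mem \<tau> 1 0 = xor_answer xs)"
proof -
  define M where "M = (\<lambda>i j k. xs ! i XOR xs ! j = xs ! k)"
  define E1 where "E1 = (\<lambda>i. \<exists>i'<i. \<exists>j<n. \<exists>k<n. M i' j k)"
  define E2 where "E2 = (\<lambda>i j. E1 i \<or> (\<exists>j'<j. \<exists>k<n. M i j' k))"
  define E3 where "E3 = (\<lambda>i j k. E2 i j \<or> (\<exists>k'<k. M i j k'))"
  let ?test = "Ite (B Eq (B Xor (Rd 0 (B Add (V ve) (cst 1))) (Rd 0 (B Add (V vv) (cst 1)))) (Rd 0 (B Add (V vt) (cst 1))))
        (Sto 1 (cst 0) (cst 1)) Nop"
  let ?l3 = "For vt (V vn) ?test" let ?l2 = "For vv (V vn) ?l3"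
  have "ht w (For ve (V vn) ?l2) (T_brute n) \<sigma> (\<lambda>\<tau>. mem \<tau> 1 0 = of_bool (E1 n))"
  proof (rule ht_For[where T = "n * (n * 30 + 15) + 10" and I = "\<lambda>i \<tau>. mem \<tau> 1 0 = of_bool (E1 i)"], goal_cases)
    case (3 i \<tau>1)
    have f1: "regs \<tau>1 vn = n" "mem \<tau>1 0 = arr (n # xs)" using 3(3) \<sigma> by (simp_all add: frame_def)
    have "ht w ?l2 (n * (n * 30 + 15) + 10) (set_reg ve i \<tau>1) (\<lambda>\<tau>. mem \<tau> 1 0 = of_bool (E2 i n))"
    proof (rule ht_For[where T = "n * 30 + 10" and I = "\<lambda>j \<tau>. mem \<tau> 1 0 = of_bool (E2 i j)"], goal_cases)
      case (3 j \<tau>2)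
      have f2: "regs \<tau>2 vn = n" "mem \<tau>2 0 = arr (n # xs)" "regs \<tau>2 ve = i" using 3(3) f1 by (simp_all add: frame_def)
      have "ht w ?l3 (n * 30 + 10) (set_reg vv j \<tau>2) (\<lambda>\<tau>. mem \<tau> 1 0 = of_bool (E3 i j n))"
      proof (rule ht_For[where T = 25 and I = "\<lambda>k \<tau>. mem \<tau> 1 0 = of_bool (E3 i j k)"], goal_cases)
        case (3 k \<tau>3)
        have f3: "mem \<tau>3 0 = arr (n # xs)" "regs \<tau>3 ve = i" "regs \<tau>3 vv = j" using 3(3) f2 by (simp_all add: frame_def)
        have w0: "0 < w" using n(2) 3(1) by (cases w) auto
        have "Suc i mod 2 ^ w = Suc i" "Suc j mod 2 ^ w = Suc j" "Suc k mod 2 ^ w = Suc k"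
          using n(2) \<open>i < n\<close> \<open>j < n\<close> \<open>k < n\<close> by simp_all
        then have ev: "eval w (B Eq (B Xor (Rd 0 (B Add (V ve) (cst 1))) (Rd 0 (B Add (V vv) (cst 1)))) (Rd 0 (B Add (V vt) (cst 1)))) (set_reg vt k \<tau>3) = of_bool (M i j k)"
          using w0 n(1) f3 \<open>i < n\<close> \<open>j < n\<close> \<open>k < n\<close> by (simp add: arr_def M_def)
        have E3S: "E3 i j (Suc k) \<longleftrightarrow> E3 i j k \<or> M i j k" by (auto simp: E3_def less_Suc_eq)
        show ?case
          by (rule ht_Ite[where ?T1.0 = 5]; (rule ht_Sto ht_Nop)?)
            (use ev 3(2) E3S w0 in \<open>simp_all split: if_splits\<close>)
      qed (use f2 n 3(2) in \<open>simp_all add: E3_def\<close>)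
      moreover have "E3 i j n \<longleftrightarrow> E2 i (Suc j)" by (auto simp: E3_def E2_def less_Suc_eq)
      ultimately show ?case by simp
    next
      case 4 show ?case by (simp add: algebra_simps)
    qed (use f1 n 3(2) in \<open>simp_all add: E2_def\<close>)
    moreover have "E2 i n \<longleftrightarrow> E1 (Suc i)" by (auto simp: E2_def E1_def less_Suc_eq)
    ultimately show ?case by simp
  next
    case 4 show ?case by (simp add: T_brute_def algebra_simps)
  qed (use \<sigma> n in \<open>simp_all add: E1_def\<close>)
  moreover have "E1 n \<longleftrightarrow> has_xor_triple (set xs)"
  proof
    assume "E1 n"
    then show "has_xor_triple (set xs)"
      unfolding E1_def M_def has_xor_triple_def using n(1) nth_mem by blast
  next
    assume "has_xor_triple (set xs)"
    then obtain x y where "x \<in> set xs" "y \<in> set xs" "x XOR y \<in> set xs" by (auto simp: has_xor_triple_def)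
    then obtain i j k where "i < n" "j < n" "k < n" "xs ! i = x" "xs ! j = y" "xs ! k = x XOR y"
      using n(1) by (metis in_set_conv_nth)
    then have "i < n" "j < n" "k < n" "xs ! i XOR xs ! j = xs ! k" by simp_all
    then show "E1 n" unfolding E1_def M_def by blast
  qed
  ultimately show ?thesis by (simp add: BRUTE_def xor_answer_def of_bool_def)
qed

lemma split_xor: "z = (z div 2 ^ k * 2 ^ k) XOR (z mod 2 ^ k)" for z :: nat
proof (rule bit_eqI)
  fix n
  have "z div 2 ^ k * 2 ^ k = push_bit k (drop_bit k z)" by (simp add: push_bit_eq_mult drop_bit_eq_div)
  moreover have "z mod 2 ^ k = take_bit k z" by (simp add: take_bit_eq_mod)
  ultimately show "bit z n \<longleftrightarrow> bit ((z div 2 ^ k * 2 ^ k) XOR (z mod 2 ^ k)) n"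
    by (auto simp: bit_xor_iff bit_push_bit_iff_nat bit_take_bit_iff bit_drop_bit_eq)
qed

context hashing
begin

definition genuine :: "nat \<Rightarrow> nat \<times> nat \<times> nat \<Rightarrow> bool" where
  "genuine b = (\<lambda>(c, t1, t2). \<exists>x\<in>set (chunk b t1). \<exists>y\<in>set (chunk b t2). x XOR y = c)"

definition collides :: "nat \<Rightarrow> nat \<times> nat \<times> nat \<Rightarrow> nat \<Rightarrow> bool" where
  "collides b = (\<lambda>(c, t1, t2) i. \<exists>x\<in>set (chunk b t1). \<exists>y\<in>set (chunk b t2). rep_hash i (x XOR y XOR c) = 0)"

definition candidate :: "nat \<Rightarrow> nat \<Rightarrow> bool" where
  "candidate b p \<longleftrightarrow> p < NP b \<and> (\<forall>i<L. collides b (pairs b (n * R) ! p) i)"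

definition misled :: "nat \<Rightarrow> bool" where
  "misled b \<longleftrightarrow> (\<exists>p. candidate b p \<and> \<not> genuine b (pairs b (n * R) ! p))"

lemma set_chunk: "set (chunk b t) \<subseteq> set xs"
proof -
  have "set (chunk b t) \<subseteq> set (drop (t * s) (buckets b R))" unfolding chunk_def by (rule set_take_subset)
  also have "\<dots> \<subseteq> set (buckets b R)" by (rule set_drop_subset)
  finally show ?thesis using set_sorted by simp
qed

lemma chunk_words: "x \<in> set (chunk b t) \<Longrightarrow> x < 2 ^ w"
  using set_chunk xs_words by blast

lemma U_power_half: "U = 2 ^ (l - r + 2)"
  by (simp add: U s)

lemma rep_hash_xor: "x < 2 ^ w \<Longrightarrow> y < 2 ^ w \<Longrightarrow> rep_hash i (x XOR y) = rep_hash i x XOR rep_hash i y"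
  unfolding rep_hash_def hs_def by (rule hsh_xor[OF klog(1)])

lemma xor_swap: "a XOR p = b XOR q \<longleftrightarrow> a XOR b XOR (p XOR q) = 0" for a b p q :: nat
proof -
  have "(a XOR p) XOR (b XOR q) = a XOR b XOR (p XOR q)" by (simp only: ac_simps)
  then show ?thesis using xor_nat_eq_0_iff[of "a XOR p" "b XOR q"] by simp
qed

text \<open>As \<open>U\<close> is a power of two, quotient and remainder of the hash value of the
  word occupy disjoint bits and XOR back to it. Linearity then turns an equality of two set elements
  into a zero of the hash function.\<close>

lemma query_sets_intersect:
  assumes k: "k < NP b * L"
  shows "set (sd_As b ! fst (query b k)) \<inter> set (sd_Bs b ! snd (query b k)) \<noteq> {} \<longleftrightarrow>
    collides b (pairs b (n * R) ! (k div L)) (k mod L)"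
proof -
  define i where "i = k mod L"
  have i: "i < L" using pos(5) by (simp add: i_def)
  have p: "k div L < length (pairs b (n * R))" using k by (simp add: NP_def less_mult_imp_div_less)
  obtain c t1 t2 where ct: "pairs b (n * R) ! (k div L) = (c, t1, t2)" by (cases "pairs b (n * R) ! (k div L)")
  have ctp: "(c, t1, t2) \<in> set (pairs b (n * R))" using p ct by (metis nth_mem)
  have t12: "t1 < NC" "t2 < NC" using pairs_chunks[OF ctp] by blast+
  have cw: "c < 2 ^ w" using pairs_words[OF ctp] xs_words by auto
  define h where "h = rep_hash i c"
  have h: "h div U < U" "h mod U < U"
    using rep_hash_less[OF cw, of i] pos(3) by (simp_all add: h_def less_mult_imp_div_less)
  have q: "query b k = ((i * NC + t1) * U + h div U, (i * NC + t2) * U + h mod U)"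
    by (simp add: query_def ct Let_def i_def h_def)
  have sd: "set (sd_set b mul ((i * NC + t) * U + z)) = (\<lambda>x. rep_hash i x XOR (z * mul)) ` set (chunk b t)"
    if "t < NC" "z < U" for t z mul
  proof -
    have "((i * NC + t) * U + z) div U = i * NC + t" "((i * NC + t) * U + z) mod U = z"
      using that pos(3) by simp_all
    moreover have "(i * NC + t) div NC = i" "(i * NC + t) mod NC = t" using that by simp_all
    ultimately show ?thesis by (simp add: sd_set_def)
  qed
  have A: "set (sd_As b ! fst (query b k)) = (\<lambda>x. rep_hash i x XOR (h div U * U)) ` set (chunk b t1)"
    using set_index_less[OF i t12(1) h(1)] sd[OF t12(1) h(1)] by (simp add: q sd_As_def)
  have B: "set (sd_Bs b ! snd (query b k)) = (\<lambda>x. rep_hash i x XOR (h mod U)) ` set (chunk b t2)"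
    using set_index_less[OF i t12(2) h(2)] sd[OF t12(2) h(2), of 1] by (simp add: q sd_Bs_def)
  have hh: "(h div U * U) XOR (h mod U) = h"
    using split_xor[of h "l - r + 2"] by (simp add: U_power_half)
  have "rep_hash i x XOR (h div U * U) = rep_hash i y XOR (h mod U) \<longleftrightarrow> rep_hash i (x XOR y XOR c) = 0"
    if "x \<in> set (chunk b t1)" "y \<in> set (chunk b t2)" for x y
    using chunk_words[OF that(1)] chunk_words[OF that(2)] cw
    by (simp add: xor_swap[of "rep_hash i x" _ "rep_hash i y"] hh rep_hash_xor xor_less_pow xor.assoc) (simp add: h_def)
  then show ?thesis unfolding A B ct collides_def i_def[symmetric] by (auto 4 4)
qed

lemma sd_solution_eq:
  "sd_solution (sd_As b) (sd_Bs b) (sd_Qs b) = {k. k < NP b * L \<and> collides b (pairs b (n * R) ! (k div L)) (k mod L)}"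
proof -
  have "sd_Qs b ! k = query b k" if "k < NP b * L" for k using that by (simp add: sd_Qs_def)
  moreover have "length (sd_Qs b) = NP b * L" by (simp add: sd_Qs_def)
  ultimately show ?thesis using query_sets_intersect[of _ b]
    unfolding sd_solution_def by (simp cong: conj_cong)
qed

text \<open>A member of bucket v has a position in the sorted list that is at least the start of
  bucket v and less than the start of the next one. Division by \<open>s\<close> preserves these
  inequalities, though not the strictness of the second.\<close>

lemma position:
  assumes "x \<in> set xs"
  obtains t where "x \<in> set (chunk b t)" "lo b (hs b r x) \<le> t" "t \<le> lo b (Suc (hs b r x))"
proof -
  define v where "v = hs b r x"
  have v: "v < R" unfolding v_def R using assms xs_words by (intro hs_less) auto
  have "x \<in> set (filter (\<lambda>x. hs b r x = v) xs)" using assms by (simp add: v_def)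
  then obtain j where j: "j < length (filter (\<lambda>x. hs b r x = v) xs)" "filter (\<lambda>x. hs b r x = v) xs ! j = x"
    unfolding in_set_conv_nth by blast
  define a where "a = length (buckets b v) + j"
  have a: "a < length (buckets b (Suc v))" using j(1) by (simp add: a_def buckets_Suc)
  have xa: "buckets b (Suc v) ! a = x" using j by (simp add: a_def buckets_Suc nth_append)
  obtain ys where ys: "buckets b R = buckets b (Suc v) @ ys"
  proof -
    have "[0..<R] = [0..<Suc v] @ [Suc v..<R]" using v by (metis Suc_leI le0 upt_add_eq_append le_Suc_ex)
    then show ?thesis using that by (simp add: buckets_def del: upt_Suc)
  qed
  have an: "a < n" "buckets b R ! a = x" using a xa ys length_sorted[of b] by (simp_all add: nth_append)
  have "a = a div s * s + a mod s" "a mod s < s" "a div s * s \<le> a" using pos(1) by simp_all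
  have "a div s * s \<le> length (buckets b R)"
    using an(1) length_sorted[of b] div_times_less_eq_dividend[of a s] by linarith
  from nth_drop[OF this, of "a mod s"] have "drop (a div s * s) (buckets b R) ! (a mod s) = x"
    using an(2) by simp
  with \<open>a mod s < s\<close> have "x \<in> set (chunk b (a div s))"
    unfolding chunk_def in_set_conv_nth using an length_sorted[of b]
    by (intro exI[of _ "a mod s"]) (simp add: less_diff_conv)
  moreover have "lo b v \<le> a div s" unfolding lo_def by (intro div_le_mono) (simp add: a_def)
  moreover have "a div s \<le> lo b (Suc v)" unfolding lo_def using a by (intro div_le_mono) simp
  ultimately show ?thesis using that by (simp add: v_def)
qed

lemma rep_hash_0: "rep_hash i 0 = 0"
proof -
  have "par k 0 = 0" for k by (induction k) auto
  then show ?thesis by (simp add: rep_hash_def hs_def hsh_eq_0_iff)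
qed

text \<open>The error is one-sided: for a solution, \<open>x XOR y XOR c\<close> is 0 and stays 0
  under every linear map. So whatever the random words are, the absence of candidates proves the
  absence of solutions.\<close>

lemma triple_candidate:
  assumes "has_xor_triple (set xs)"
  shows "\<exists>p. candidate b p"
proof -
  from assms obtain x y where xy: "x \<in> set xs" "y \<in> set xs" "x XOR y \<in> set xs"
    by (auto simp: has_xor_triple_def)
  define c where "c = x XOR y"
  obtain ic where ic: "ic < n" "xs ! ic = c" using xy(3) length_xs by (auto simp: in_set_conv_nth c_def)
  define v where "v = hs b r x"
  have v: "v < R" unfolding v_def R using xy xs_words by (intro hs_less) auto
  have v': "partner b c v = hs b r y"
    using xy xs_words hsh_xor[OF klog(1)] by (simp add: partner_def c_def v_def hs_def subset_iff)
  obtain t1 where t1: "x \<in> set (chunk b t1)" "lo b v \<le> t1" "t1 \<le> lo b (Suc v)"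
    using position[OF xy(1), of b] unfolding v_def by blast
  obtain t2 where t2: "y \<in> set (chunk b t2)" "lo b (partner b c v) \<le> t2" "t2 \<le> lo b (Suc (partner b c v))"
    using position[OF xy(2), of b] unfolding v' by blast
  define v2 where "v2 = partner b c v"
  define j where "j = (t1 - lo b v) * cnt b v2 + (t2 - lo b v2)"
  have d: "t1 - lo b v < cnt b v" "t2 - lo b v2 < cnt b v2" using t1 t2 by (simp_all add: cnt_lo v2_def)
  have "(t1 - lo b v + 1) * cnt b v2 \<le> cnt b v * cnt b v2" using d by (intro mult_right_mono) auto
  then have j: "j < cnt b v * cnt b v2" using d by (simp add: j_def)
  have jd: "j div cnt b v2 = t1 - lo b v" "j mod cnt b v2 = t2 - lo b v2" using d by (simp_all add: j_def)
  have "(c, t1, t2) \<in> set (bucket_pairs b c v)"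
    unfolding bucket_pairs_def v2_def[symmetric] set_map
    by (rule image_eqI[of _ _ j]) (use j jd t1 t2 in \<open>simp_all add: v2_def\<close>)
  moreover have "ic * R + v < n * R"
  proof -
    have "Suc ic * R \<le> n * R" using ic by (intro mult_right_mono) auto
    then show ?thesis using v by simp
  qed
  ultimately have "(c, t1, t2) \<in> set (pairs b (n * R))"
    using ic v by (auto simp: pairs_def intro!: bexI[of _ "ic * R + v"])
  then obtain p where p: "p < NP b" "pairs b (n * R) ! p = (c, t1, t2)" by (auto simp: in_set_conv_nth NP_def)
  have xc: "x XOR y XOR c = 0" unfolding c_def by (simp only: xor.assoc[symmetric] xor_self_eq[of "x XOR y", unfolded xor.assoc[symmetric]])
  have "collides b (c, t1, t2) i" for i
    unfolding collides_def prod.case by (intro bexI[OF _ t1(1)] bexI[OF _ t2(1)]) (simp add: xc rep_hash_0)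
  then show ?thesis using p by (auto simp: candidate_def)
qed

lemma genuine_triple: "p < NP b \<Longrightarrow> genuine b (pairs b (n * R) ! p) \<Longrightarrow> has_xor_triple (set xs)"
proof -
  assume p: "p < NP b" and g: "genuine b (pairs b (n * R) ! p)"
  obtain c t1 t2 where ct: "pairs b (n * R) ! p = (c, t1, t2)" by (cases "pairs b (n * R) ! p")
  then have "(c, t1, t2) \<in> set (pairs b (n * R))" using p by (metis NP_def nth_mem)
  then have "c \<in> set xs" using pairs_words by blast
  then show ?thesis using g set_chunk unfolding ct genuine_def has_xor_triple_def by fast
qed

definition solutions :: "nat \<Rightarrow> nat set" where
  "solutions b = sd_solution (sd_As b) (sd_Bs b) (sd_Qs b)"

lemma solutions_iff: "k \<in> solutions b \<longleftrightarrow> k < NP b * L \<and> collides b (pairs b (n * R) ! (k div L)) (k mod L)"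
  by (simp add: solutions_def sd_solution_eq)

lemma solutions_subset: "solutions b \<subseteq> {..<NP b * L}"
  by (auto simp: solutions_iff)

text \<open>The queries of triple \<open>p\<close> are the \<open>L\<close> consecutive numbers from
  \<open>p * L\<close> on. All of them have been seen as soon as \<open>L\<close> different ones
  have.\<close>

lemma card_fiber: "card {k \<in> A. k div L = p} \<le> L" "card {k \<in> A. k div L = p} = L \<Longrightarrow> i < L \<Longrightarrow> p * L + i \<in> A" for A :: "nat set"
proof -
  have sub: "{k \<in> A. k div L = p} \<subseteq> {p * L..<p * L + L}"
  proof
    fix k assume "k \<in> {k \<in> A. k div L = p}"
    then have "k = p * L + k mod L" "k mod L < L" using pos(5) div_mult_mod_eq[of k L] by auto
    then show "k \<in> {p * L..<p * L + L}" by (simp only: atLeastLessThan_iff) linarith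
  qed
  then show "card {k \<in> A. k div L = p} \<le> L" using card_mono[OF _ sub] by simp
  assume c: "card {k \<in> A. k div L = p} = L" and i: "i < L"
  have "{k \<in> A. k div L = p} = {p * L..<p * L + L}" by (rule card_subset_eq[OF _ sub]) (use c in simp_all)
  moreover have "p * L + i \<in> {p * L..<p * L + L}" using i by simp
  ultimately show "p * L + i \<in> A" by blast
qed

lemma candidate_iff: "candidate b p \<longleftrightarrow> p < NP b \<and> (\<forall>i<L. p * L + i \<in> solutions b)"
proof -
  have "p * L + i < NP b * L" if "p < NP b" "i < L" for i
  proof -
    have "Suc p * L \<le> NP b * L" using that by (intro mult_right_mono) auto
    then show ?thesis using that by simp
  qed
  then show ?thesis by (auto simp: candidate_def solutions_iff)
qed

lemma candidate_card: "candidate b p \<longleftrightarrow> p < NP b \<and> card {k \<in> solutions b. k div L = p} = L"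
proof
  assume c: "candidate b p"
  have sub: "{p * L..<p * L + L} \<subseteq> {k \<in> solutions b. k div L = p}"
  proof
    fix k assume "k \<in> {p * L..<p * L + L}"
    then obtain i where i: "k = p * L + i" "i < L" using le_iff_add by auto
    then show "k \<in> {k \<in> solutions b. k div L = p}" using c by (simp add: candidate_iff)
  qed
  have "finite (solutions b)" by (rule finite_subset[OF solutions_subset]) simp
  then have "finite {k \<in> solutions b. k div L = p}" by simp
  from card_mono[OF this sub] have "L \<le> card {k \<in> solutions b. k div L = p}" by simp
  then show "p < NP b \<and> card {k \<in> solutions b. k div L = p} = L"
    using c card_fiber(1)[of "solutions b" p] by (simp add: candidate_iff)
next
  assume "p < NP b \<and> card {k \<in> solutions b. k div L = p} = L"
  then show "candidate b p" unfolding candidate_iff using card_fiber(2) by blast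
qed

text \<open>Positive queries may be listed in any order, so the answers for a triple are scattered.
  As each is listed exactly once, its counter reaches \<open>L\<close> if and only if all its
  queries are positive.\<close>

lemma ht_COUNT:
  assumes Par: "Par \<sigma>" and zero: "\<And>p. mem \<sigma> 9 p = 0" and out: "mem \<sigma> 11 \<in> sd_outputs (sd_As b) (sd_Bs b) (sd_Qs b)"
    and g: "good b"
  shows "ht w COUNT (n * Bd * L * 50 + 20) \<sigma> (\<lambda>\<tau>. if regs \<tau> vcand = 0 then \<forall>p. \<not> candidate b p
     else candidate b (regs \<tau> vcand - 1))"
proof -
  define X where "X = mem \<sigma> 11"
  define m where "m = card (solutions b)"
  have X: "X 0 = m" "bij_betw X {1..m} (solutions b)"
    using out unfolding X_def m_def sd_outputs_def solutions_def by auto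
  have NPL: "NP b * L < 2 ^ w" "NP b * L \<le> n * Bd * L"
    using NP_L_less[OF g] NP_le[OF g] by auto
  have m: "m \<le> NP b * L" using card_mono[OF _ solutions_subset[of b]] by (simp add: m_def)
  have NPw: "NP b < 2 ^ w"
  proof -
    have "NP b * 1 \<le> NP b * L" by (intro mult_left_mono) (simp_all add: L)
    then show ?thesis using NPL(1) by linarith
  qed
  define f where "f = (\<lambda>j p. card {k \<in> X ` {1..j}. k div L = p})"
  define I where "I = (\<lambda>j (\<tau>::state). (\<forall>p. mem \<tau> 9 p = f j p) \<and>
     (if regs \<tau> vcand = 0 then \<forall>p. f j p < L else candidate b (regs \<tau> vcand - 1)))"
  let ?body = "vp ::= B Div (Rd 11 (B Add (V vk) (cst 1))) (V vL) ;;
      vq ::= B Add (Rd 9 (V vp)) (cst 1) ;; Sto 9 (V vp) (V vq) ;;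
      Ite (B Eq (V vq) (V vL)) (vcand ::= B Add (V vp) (cst 1)) Nop"
  let ?\<sigma> = "set_reg vcand 0 \<sigma>"
  have "ht w (For vk (Rd 11 (cst 0)) ?body) (n * Bd * L * 50 + 15) ?\<sigma> (I m)"
  proof (rule ht_For[where T = "45"], goal_cases)
    case 1
    then show ?case using X(1) m NPL by (simp add: X_def)
  next
    case 2
    then show ?case using zero pos(5) by (simp add: I_def f_def)
  next
    case (3 j \<tau>)
    note j = 3(1) and I = 3(2) and fr = 3(3)
    have "Par ?\<sigma>" using Par by simp
    then have P1: "Par \<tau>" using Par_frame[OF _ fr] by simp
    have X': "mem \<tau> 11 = X" using fr by (simp add: frame_def X_def)
    have j1: "Suc j mod 2 ^ w = Suc j" using j m NPL by simp
    have Xj: "X (Suc j) \<in> solutions b" using X(2) j by (auto simp: bij_betw_def)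
    define p where "p = X (Suc j) div L"
    have p: "p < NP b" using Xj by (simp add: p_def solutions_iff less_mult_imp_div_less)
    have new: "X (Suc j) \<notin> X ` {1..j}"
    proof
      assume "X (Suc j) \<in> X ` {1..j}"
      then obtain i where "i \<in> {1..j}" "X (Suc j) = X i" by auto
      then show False using inj_onD[OF bij_betw_imp_inj_on[OF X(2)], of "Suc j" i] j by auto
    qed
    have fS: "f (Suc j) q = (if q = p then Suc (f j q) else f j q)" for q
    proof -
      have im: "X ` {1..Suc j} = insert (X (Suc j)) (X ` {1..j})" by (auto simp: atLeastAtMostSuc_conv)
      have "{k \<in> insert (X (Suc j)) (X ` {1..j}). k div L = q} =
          (if q = p then insert (X (Suc j)) {k \<in> X ` {1..j}. k div L = q} else {k \<in> X ` {1..j}. k div L = q})"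
        by (auto simp: p_def)
      then show ?thesis unfolding f_def im using new by simp
    qed
    have fL: "f (Suc j) p \<le> L" unfolding f_def by (rule card_fiber)
    then have q: "(f j p + 1) mod 2 ^ w = f (Suc j) p"
      using fS[of p] R_le(4) less_two_power[of L w] by simp
    have cand: "candidate b p" if "f (Suc j) p = L"
      unfolding candidate_iff
    proof (intro conjI allI impI)
      fix i assume "i < L"
      have "X ` {1..Suc j} \<subseteq> solutions b" using X(2) j by (auto simp: bij_betw_def)
      then show "p * L + i \<in> solutions b" using card_fiber(2)[OF that[unfolded f_def] \<open>i < L\<close>] by blast
    qed (rule p)
    have I': "\<And>q. mem \<tau> 9 q = f j q" using I by (simp add: I_def)
    have p1: "Suc p mod 2 ^ w = Suc p" using p NPw by simp
    show ?case
    proof (rule ht_Sq_Asg'[where x = p and T = 38], goal_cases)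
      case 1 show ?case using P1 X' j1 by (simp add: p_def Par_def)
    next
      case 2 show ?case
      proof (rule ht_Sq_Asg'[where x = "f (Suc j) p" and T = 30], goal_cases)
        case 1 show ?case using I' q by simp
      next
        case 2 show ?case
        proof (rule ht_Sq_Sto[where T = 20], goal_cases)
          case 1
          let ?\<tau> = "set_mem 9 p (f (Suc j) p) (set_reg vq (f (Suc j) p) (set_reg vp p (set_reg vk j \<tau>)))"
          have ev: "eval w (V vp) (set_reg vq (f (Suc j) p) (set_reg vp p (set_reg vk j \<tau>))) = p"
            "eval w (V vq) (set_reg vq (f (Suc j) p) (set_reg vp p (set_reg vk j \<tau>))) = f (Suc j) p" by simp_all
          have mem9: "mem ?\<tau> 9 = f (Suc j)" using I' fS by (auto simp: fun_eq_iff)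
          have evq: "eval w (B Eq (V vq) (V vL)) ?\<tau> = of_bool (f (Suc j) p = L)"
            using P1 by (simp add: Par_def)
          have ok1: "I (Suc j) (set_reg vcand (Suc p) ?\<tau>)" if "f (Suc j) p = L"
            using mem9 cand[OF that] by (simp add: I_def)
          have ok2: "I (Suc j) ?\<tau>" if "f (Suc j) p \<noteq> L"
          proof -
            have "f (Suc j) q < L" if "\<forall>q. f j q < L" for q
              using that fS[of q] fL \<open>f (Suc j) p \<noteq> L\<close> by (cases "q = p") auto
            then show ?thesis using mem9 I by (auto simp: I_def split: if_splits)
          qed
          show ?case unfolding ev
          proof (rule ht_Ite[where ?T1.0 = 10], goal_cases)
            case 1
            then have "f (Suc j) p = L" using evq by simp
            then show ?case by (intro ht_Asg'[where x = "Suc p"]) (use p1 ok1 in simp_all)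
          next
            case 2
            then have "f (Suc j) p \<noteq> L" using evq by simp
            then show ?case by (intro ht_Nop) (use ok2 in simp_all)
          qed simp
        qed simp
      qed simp
    qed simp
  next
    case 4
    have "m \<le> n * Bd * L" using m NPL(2) by linarith
    then have "m * 50 \<le> n * Bd * L * 50" by (rule mult_right_mono) simp
    then show ?case by simp
  qed
  moreover have "if regs \<tau> vcand = 0 then \<forall>p. \<not> candidate b p else candidate b (regs \<tau> vcand - 1)" if "I m \<tau>" for \<tau>
  proof -
    have "f m p = card {k \<in> solutions b. k div L = p}" for p using X(2) by (simp add: f_def bij_betw_def)
    then have "\<not> candidate b p" if "f m p < L" for p
      using that unfolding candidate_card by (metis less_irrefl)
    then show ?thesis using that by (auto simp: I_def split: if_splits)
  qed
  ultimately have "ht w (For vk (Rd 11 (cst 0)) ?body) (n * Bd * L * 50 + 15) ?\<sigma>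
      (\<lambda>\<tau>. if regs \<tau> vcand = 0 then \<forall>p. \<not> candidate b p else candidate b (regs \<tau> vcand - 1))"
    by (blast intro: ht_mono)
  then show ?thesis
    unfolding COUNT_def by (intro ht_Sq_Asg'[where x = 0 and T = "n * Bd * L * 50 + 15"]) simp_all
qed

lemma ht_VERIFY:
  assumes Par: "Par \<sigma>" and bt: "holds_pairs \<sigma> (pairs b (n * R))" "holds_list (mem \<sigma> 3) (buckets b R)"
    and c: "regs \<sigma> vcand = Suc p" "p < NP b" and g: "good b" and fb: "regs \<sigma> vfb = 1" and z: "mem \<sigma> 1 0 = 0"
  shows "ht w VERIFY (s * s * 60 + 30) \<sigma> (\<lambda>\<tau>. if genuine b (pairs b (n * R) ! p) then regs \<tau> vfb = 0 \<and> mem \<tau> 1 0 = 1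
     else regs \<tau> vfb = 1 \<and> mem \<tau> 1 0 = 0)"
proof -
  obtain c t1 t2 where ct: "pairs b (n * R) ! p = (c, t1, t2)" by (cases "pairs b (n * R) ! p")
  have pl: "p < length (pairs b (n * R))" using c(2) by (simp add: NP_def)
  then have m: "mem \<sigma> 6 p = c" "mem \<sigma> 7 p = t1" "mem \<sigma> 8 p = t2" using bt(1) ct by (auto simp: holds_pairs_def)
  have "(c, t1, t2) \<in> set (pairs b (n * R))" using pl ct by (metis nth_mem)
  then have t12: "t1 < NC" "t2 < NC" using pairs_chunks by blast+
  have ts: "t * s + i < 2 ^ w" if "t < NC" "i < s" for t i
  proof -
    have "t * s \<le> n div s * s" using that(1) by (intro mult_right_mono) (simp_all add: NC)
    also have "\<dots> \<le> n" by simp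
    finally show ?thesis using n_s_less that(2) by linarith
  qed
  have ssw: "s * s < 2 ^ w" using bounds(3) by (simp add: U)
  have NPw: "NP b < 2 ^ w"
  proof -
    have "NP b * 1 \<le> NP b * L" by (intro mult_left_mono) (simp_all add: L)
    then show ?thesis using NP_L_less[OF g] by linarith
  qed
  let ?Y = "buckets b R"
  define hit where "hit = (\<lambda>k. t1 * s + k div s < n \<and> t2 * s + k mod s < n \<and> ?Y ! (t1 * s + k div s) XOR ?Y ! (t2 * s + k mod s) = c)"
  define I where "I = (\<lambda>k (\<tau>::state). if \<exists>j<k. hit j then regs \<tau> vfb = 0 \<and> mem \<tau> 1 0 = 1 else regs \<tau> vfb = 1 \<and> mem \<tau> 1 0 = 0)"
  let ?test = "B And (B And (B Less (V va) (V vn)) (B Less (V vd) (V vn))) (B Eq (B Xor (Rd 3 (V va)) (Rd 3 (V vd))) (Rd 6 (V vp)))"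
  let ?body = "va ::= B Add (B Mul (Rd 7 (V vp)) (V vs)) (B Div (V vk) (V vs)) ;;
      vd ::= B Add (B Mul (Rd 8 (V vp)) (V vs)) (B Mod (V vk) (V vs)) ;;
      Ite ?test (vfb ::= cst 0 ;; Sto 1 (cst 0) (cst 1)) Nop"
  let ?\<sigma> = "set_reg vp p \<sigma>"
  have loop: "ht w (For vk (B Mul (V vs) (V vs)) ?body) (s * s * 60 + 15) ?\<sigma> (I (s * s))"
  proof (rule ht_For[where T = "55"], goal_cases)
    case 1
    then show ?case using Par ssw by (simp add: Par_def)
  next
    case 2
    then show ?case using fb z by (simp add: I_def)
  next
    case (3 k \<tau>)
    note k = 3(1) and I = 3(2) and fr = 3(3)
    have "Par ?\<sigma>" using Par by simp
    then have P1: "Par \<tau>" using Par_frame[OF _ fr] by simp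
    have f: "mem \<tau> 3 = mem \<sigma> 3" "mem \<tau> 6 p = c" "mem \<tau> 7 p = t1" "mem \<tau> 8 p = t2" "regs \<tau> vp = p"
      using fr m by (simp_all add: frame_def)
    have ks: "k div s < s" "k mod s < s" using k pos(1) by (simp_all add: less_mult_imp_div_less)
    let ?a = "t1 * s + k div s" and ?d = "t2 * s + k mod s"
    have aw: "?a < 2 ^ w" "?d < 2 ^ w" using ts t12 ks by blast+
    have hS: "(\<exists>j<Suc k. hit j) \<longleftrightarrow> (\<exists>j<k. hit j) \<or> hit k" by (auto simp: less_Suc_eq)
    show ?case
    proof (rule ht_Sq_Asg'[where x = ?a and T = 46], goal_cases)
      case 1 show ?case using P1 f aw by (simp add: Par_def)
    next
      case 2 show ?case
      proof (rule ht_Sq_Asg'[where x = ?d and T = 36], goal_cases)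
        case 1 show ?case using P1 f aw by (simp add: Par_def)
      next
        case 2
        let ?\<tau> = "set_reg vd ?d (set_reg va ?a (set_reg vk k \<tau>))"
        \<comment> \<open>Positions behind the last word arise from an incomplete last chunk. There
          the comparisons with \<open>n\<close> make the conjunction 0, whatever bank 3
          contains.\<close>
        have ev: "eval w ?test ?\<tau> \<noteq> 0 \<longleftrightarrow> hit k"
        proof (cases "?a < n \<and> ?d < n")
          case True
          then have "mem \<sigma> 3 ?a = ?Y ! ?a" "mem \<sigma> 3 ?d = ?Y ! ?d"
            using bt(2) by (simp_all add: holds_list_def length_sorted)
          then show ?thesis using P1 f True by (simp add: Par_def hit_def)
        next
          case False
          then show ?thesis using P1 f by (auto simp: Par_def hit_def)
        qed
        show ?case
        proof (rule ht_Ite[where ?T1.0 = 10], goal_cases)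
          case 1
          then have h: "hit k" using ev by simp
          show ?case by (rule ht_Sq_Asg'[where x = 0 and T = 5]; (rule ht_Sto)?) (use h in \<open>auto simp: I_def hS\<close>)
        next
          case 2
          then have h: "\<not> hit k" using ev by simp
          show ?case by (rule ht_Nop) (use h I in \<open>simp_all add: I_def hS del: One_nat_def\<close>)
        qed simp
      qed simp
    qed simp
  qed simp
  have gen: "(\<exists>k<s * s. hit k) \<longleftrightarrow> genuine b (pairs b (n * R) ! p)"
  proof
    assume "\<exists>k<s * s. hit k"
    then obtain k where k: "k < s * s" "hit k" by blast
    have ks: "k div s < s" "k mod s < s" using k pos(1) by (simp_all add: less_mult_imp_div_less)
    have "?Y ! (t * s + i) \<in> set (chunk b t)" if "t * s + i < n" "i < s" for t i
      unfolding chunk_def in_set_conv_nth using that length_sorted[of b] by (intro exI[of _ i]) auto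
    then show "genuine b (pairs b (n * R) ! p)"
      using k(2) ks unfolding ct genuine_def hit_def prod.case by blast
  next
    assume "genuine b (pairs b (n * R) ! p)"
    then obtain x y where xy: "x \<in> set (chunk b t1)" "y \<in> set (chunk b t2)" "x XOR y = c"
      unfolding ct genuine_def prod.case by blast
    have ex: "\<exists>i<s. t * s + i < n \<and> ?Y ! (t * s + i) = x" if "x \<in> set (chunk b t)" for x t
    proof -
      from that obtain i where "i < length (chunk b t)" "chunk b t ! i = x" unfolding in_set_conv_nth by blast
      then show ?thesis by (intro exI[of _ i]) (auto simp: chunk_def length_sorted less_diff_conv add.commute)
    qed
    obtain i j where ij: "i < s" "t1 * s + i < n" "?Y ! (t1 * s + i) = x" "j < s" "t2 * s + j < n" "?Y ! (t2 * s + j) = y"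
      using ex[OF xy(1)] ex[OF xy(2)] by blast
    have d: "(i * s + j) div s = i" "(i * s + j) mod s = j" using ij by simp_all
    have "Suc i * s \<le> s * s" using ij by (intro mult_right_mono) auto
    then have "i * s + j < s * s" using ij by simp
    moreover have "hit (i * s + j)" unfolding hit_def d using ij xy by simp
    ultimately show "\<exists>k<s * s. hit k" by blast
  qed
  show ?thesis
    unfolding VERIFY_def
  proof (rule ht_Sq_Asg'[where x = p and T = "s * s * 60 + 15"], goal_cases)
    case 1
    have "Suc p < 2 ^ w" using c(2) NPw by simp
    from Sub_mod[of 1 "Suc p", OF _ this] show ?case using c(1) by simp
  next
    case 2 show ?case by (rule ht_mono[OF loop]) (use gen in \<open>simp_all add: I_def\<close>)
  qed simp
qed

definition T_check :: nat where "T_check = n * Bd * L * 50 + s * s * 60 + 100"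

lemma ht_CHECK:
  assumes Par: "Par \<sigma>" and bt: "holds_pairs \<sigma> (pairs b (n * R))" "holds_list (mem \<sigma> 3) (buckets b R)"
    and zero: "\<And>p. mem \<sigma> 9 p = 0" and out: "mem \<sigma> 11 \<in> sd_outputs (sd_As b) (sd_Bs b) (sd_Qs b)"
    and g: "good b" and z: "mem \<sigma> 1 0 = 0"
  shows "ht w CHECK T_check \<sigma> (\<lambda>\<tau>. regs \<tau> vfb = 0 \<and> mem \<tau> 1 0 = xor_answer xs \<or> regs \<tau> vfb = 1 \<and> mem \<tau> 1 0 = 0 \<and> misled b)"
  unfolding CHECK_def
proof (rule ht_Sq[where ?T2.0 = "s * s * 60 + 60", OF ht_COUNT[OF Par zero out g]], goal_cases)
  case (1 \<tau>)
  have P1: "Par \<tau>" using Par_frame[OF Par 1(2)] by simp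
  have bt1: "holds_pairs \<tau> (pairs b (n * R))" "holds_list (mem \<tau> 3) (buckets b R)" "mem \<tau> 1 0 = 0"
    using 1(2) bt z by (simp_all add: frame_def holds_pairs_def)
  show ?case
  proof (rule ht_Ite[where ?T1.0 = "s * s * 60 + 40"], goal_cases)
    case c: 1
    define p where "p = regs \<tau> vcand - 1"
    have p: "regs \<tau> vcand = Suc p" "candidate b p" using c 1(1) by (simp_all add: p_def)
    then have pl: "p < NP b" by (simp add: candidate_def)
    show ?case
    proof (rule ht_Sq_Asg'[where x = 1 and T = "s * s * 60 + 30"], goal_cases)
      case 2
      show ?case
      proof (rule ht_mono[OF ht_VERIFY[where p = p and b = b]], goal_cases)
        case (10 \<tau>')
        show ?case
        proof (cases "genuine b (pairs b (n * R) ! p)")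
          case True
          then show ?thesis using 10(1) genuine_triple[OF pl True] by (simp add: xor_answer_def)
        next
          case False
          then show ?thesis using 10(1) p(2) by (auto simp: misled_def)
        qed
      qed (use P1 bt1 p pl g in \<open>simp_all add: holds_pairs_def\<close>)
    qed simp_all
  next
    case c: 2
    then have "\<not> has_xor_triple (set xs)" using 1(1) triple_candidate[of b] by auto
    then show ?case by (intro ht_Asg'[where x = 0]) (use bt1 in \<open>simp_all add: xor_answer_def\<close>)
  qed simp
qed (simp add: T_check_def)

lemma ht_POST:
  assumes Par: "Par \<sigma>" and bt: "holds_pairs \<sigma> (pairs b (n * R))" "holds_list (mem \<sigma> 3) (buckets b R)"
    and zero: "\<And>p. mem \<sigma> 9 p = 0" and out: "mem \<sigma> 11 \<in> sd_outputs (sd_As b) (sd_Bs b) (sd_Qs b)"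
    and g: "good b" and z: "mem \<sigma> 1 0 = 0" and ok: "regs \<sigma> vok = 1"
  shows "ht w POST (T_check + (if misled b then T_brute n else 0) + 20) \<sigma> (\<lambda>\<tau>. mem \<tau> 1 0 = xor_answer xs)"
  unfolding POST_def
proof (rule ht_Sq_Asg'[where x = 1 and T = "T_check + (if misled b then T_brute n else 0) + 15"], goal_cases)
  case 2
  let ?P = "\<lambda>\<tau>. regs \<tau> vfb = 0 \<and> mem \<tau> 1 0 = xor_answer xs \<or> regs \<tau> vfb = 1 \<and> mem \<tau> 1 0 = 0 \<and> misled b"
  have "ht w CHECK T_check (set_reg vfb 1 \<sigma>) ?P"
    by (rule ht_CHECK) (use Par bt zero out g z in \<open>simp_all add: holds_pairs_def\<close>)
  then have check: "ht w (Ite (V vok) CHECK Nop) (T_check + 5) (set_reg vfb 1 \<sigma>) ?P"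
    by (intro ht_Ite[where ?T1.0 = T_check]) (use ok in simp_all)
  show ?case
  proof (rule ht_Sq[where ?T2.0 = "(if misled b then T_brute n else 0) + 10", OF check], goal_cases)
    case (1 \<tau>)
    have r: "regs \<tau> vn = n" "mem \<tau> 0 = arr (n # xs)" using 1(2) Par by (simp_all add: frame_def Par_def)
    show ?case
    proof (cases "regs \<tau> vfb = 0")
      case True
      then show ?thesis using 1(1)
        by (intro ht_Ite[where ?T1.0 = 1] ht_Nop) simp_all
    next
      case False
      then have "mem \<tau> 1 0 = 0" "misled b" using 1(1) by simp_all
      then show ?thesis using False ht_BRUTE[OF length_xs bounds(1) r]
        by (intro ht_Ite[where ?T1.0 = "T_brute n"]) simp_all
    qed
  qed simp
qed simp_all

end

lemma ht_POST_failed: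
  assumes n: "length xs = n" "n < 2 ^ w" and \<sigma>: "regs \<sigma> vn = n" "mem \<sigma> 0 = arr (n # xs)" "mem \<sigma> 1 0 = 0"
    and ok: "regs \<sigma> vok = 0"
  shows "ht w POST (T_brute n + 20) \<sigma> (\<lambda>\<tau>. mem \<tau> 1 0 = xor_answer xs)"
proof -
  \<comment> \<open>With word length 0 the constant 1 evaluates to 0 and brute force is skipped. But
    then the input is empty, and the output cell already holds the right answer 0.\<close>
  have "w = 0 \<Longrightarrow> xs = []" using n by simp
  then have w0: "w = 0 \<Longrightarrow> \<not> has_xor_triple (set xs)" by (simp add: has_xor_triple_def)
  have sk: "ht w (Ite (V vok) CHECK Nop) 5 \<tau> (\<lambda>\<tau>'. \<tau>' = \<tau>)" if "regs \<tau> vok = 0" for \<tau>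
    by (rule ht_Ite[where ?T1.0 = 1]; (rule ht_Nop)?) (use that in simp_all)
  show ?thesis
    unfolding POST_def
  proof (rule ht_Sq_Asg'[where x = "1 mod 2 ^ w" and T = "T_brute n + 17"], goal_cases)
    case 2
    show ?case
    proof (rule ht_Sq[where ?T2.0 = "T_brute n + 10", OF sk], goal_cases)
      case (2 \<tau>)
      have r: "regs \<tau> vn = n" "mem \<tau> 0 = arr (n # xs)" "mem \<tau> 1 0 = 0" "regs \<tau> vfb = 1 mod 2 ^ w"
        using 2(1) \<sigma> by simp_all
      show ?case
        by (rule ht_Ite[where ?T1.0 = "T_brute n"], rule ht_BRUTE[OF n r(1-3)], rule ht_Nop)
          (use w0 r in \<open>simp_all add: xor_answer_def T_brute_def\<close>)
    qed (use ok in simp_all)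
  qed simp_all
qed

section \<open>Assembling the reduction\<close>

text \<open>Inputs of size at most \<open>n0\<close> are left to brute force. The threshold is cut off to fit in a word.\<close>

definition PRE :: "nat \<Rightarrow> (nat \<Rightarrow> nat) \<Rightarrow> loopc" where
  "PRE n0 P = vn ::= Rd 0 (cst 0) ;; vok ::= cst 0 ;;
     Ite (B Less (N (\<lambda>w. min n0 (2 ^ w - 1))) (V vn))
       (SETUP P ;; DRAW ;; TRIES ;; Ite (V vok) BUILD Nop) Nop"

text \<open>Banks 0 and 1 of \<open>c\<close>, its input and its output, are relocated to banks 10 and 11.\<close>

definition reduce :: "nat \<Rightarrow> (nat \<Rightarrow> nat) \<Rightarrow> com \<Rightarrow> com" where
  "reduce n0 P c = Seq (compile (PRE n0 P) 0) (Seq (Cond (var vok) (relocate c) Skip) (compile POST 0))"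

lemma writes_PRE [simp]: "stores (PRE n0 P) = {2, 3, 4, 5, 6, 7, 8, 10}"
  by (auto simp: PRE_def)

lemma mem_init: "mem (init_state xs X) 0 = arr xs" "m \<noteq> 0 \<Longrightarrow> mem (init_state xs X) m = arr []"
  "regs (init_state xs X) = (\<lambda>_. 0)" "tape (init_state xs X) = X"
  by (auto simp: init_state_def arr_def fun_eq_iff)

lemma represents_init: "represents (init_state xs X) (init_state xs X)"
  by (simp add: represents_def init_state_def)

lemma reduce_failed:
  assumes n: "length xs = n" "n < 2 ^ w"
    and pre: "ht w (PRE n0 P) T (init_state (n # xs) X) (\<lambda>\<tau>. regs \<tau> vn = n \<and> mem \<tau> 0 = arr (n # xs) \<and> regs \<tau> vok = 0)"
  shows "\<exists>t s'. exec w (reduce n0 P c) (init_state (n # xs) X) t s' \<and> t \<le> T + T_brute n + 22 \<and> mem s' 1 0 = xor_answer xs"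
proof -
  let ?i = "init_state (n # xs) X" and ?\<sigma> = "run w (PRE n0 P) (init_state (n # xs) X)"
  obtain s1 where s1: "exec w (compile (PRE n0 P) 0) ?i (cost w (PRE n0 P) ?i) s1" "implements 0 ?i ?i ?\<sigma> s1"
    using compile_correct[OF represents_init] by blast
  have \<sigma>: "regs ?\<sigma> vn = n" "mem ?\<sigma> 0 = arr (n # xs)" "regs ?\<sigma> vok = 0" "cost w (PRE n0 P) ?i \<le> T"
    using pre by (simp_all add: ht_def)
  have "mem ?\<sigma> 1 = mem ?i 1" by (rule run_frames(2)) simp
  then have z: "mem ?\<sigma> 1 0 = 0" by (simp add: mem_init arr_def)
  have r1: "represents s1 ?\<sigma>" using implements_represents[OF s1(2)] .
  have "regs s1 (var vok) = 0" using r1 \<sigma>(3) by (simp add: represents_def)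
  then have sk: "exec w (Cond (var vok) (relocate c) Skip) s1 (1 + 1) s1"
    by (intro exec_Cond_False exec_Skip)
  obtain s2 where s2: "exec w (compile POST 0) s1 (cost w POST ?\<sigma>) s2" "implements 0 ?\<sigma> s1 (run w POST ?\<sigma>) s2"
    using compile_correct[OF r1] by blast
  have post: "cost w POST ?\<sigma> \<le> T_brute n + 20" "mem (run w POST ?\<sigma>) 1 0 = xor_answer xs"
    using ht_POST_failed[OF n \<sigma>(1,2) z \<sigma>(3)] by (simp_all add: ht_def)
  have E: "exec w (reduce n0 P c) ?i (cost w (PRE n0 P) ?i + ((1 + 1) + cost w POST ?\<sigma>)) s2"
    unfolding reduce_def by (rule exec_Seq[OF s1(1) exec_Seq[OF sk s2(1)]])
  have "mem s2 1 0 = xor_answer xs" using s2(2) post by (simp add: implements_def)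
  then have "cost w (PRE n0 P) ?i + ((1 + 1) + cost w POST ?\<sigma>) \<le> T + T_brute n + 22 \<and> mem s2 1 0 = xor_answer xs"
    using \<sigma>(4) post(1) by simp
  with E show ?thesis by blast
qed

lemma reduce_small:
  assumes n: "length xs = n" "n < 2 ^ w" "n \<le> n0"
  shows "\<exists>t s'. exec w (reduce n0 P c) (init_state (n # xs) X) t s' \<and> t \<le> T_brute n + 52 \<and> mem s' 1 0 = xor_answer xs"
proof -
  have le: "n \<le> min n0 (2 ^ w - 1)" using n by simp
  have "ht w (PRE n0 P) 30 (init_state (n # xs) X) (\<lambda>\<tau>. regs \<tau> vn = n \<and> mem \<tau> 0 = arr (n # xs) \<and> regs \<tau> vok = 0)"
    unfolding PRE_def
  proof (rule ht_Sq_Asg'[where x = n and T = 25], goal_cases)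
    case 1 show ?case by (simp add: mem_init arr_def)
  next
    case 2 show ?case
    proof (rule ht_Sq_Asg'[where x = 0 and T = 20], goal_cases)
      case 2 show ?case
      proof (rule ht_Ite[where ?T1.0 = 2], goal_cases)
        case 1
        have "min n0 (2 ^ w - 1) mod 2 ^ w = min n0 (2 ^ w - 1)" by (rule mod_less) (simp add: min_less_iff_disj)
        then show ?case using 1 le by (simp split: if_splits)
      next
        case 2 show ?case by (rule ht_Nop) (simp_all add: mem_init)
      qed simp
    qed simp_all
  qed simp
  from reduce_failed[OF n(1,2) this, of c] show ?thesis by (simp add: add.commute)
qed

context params
begin

abbreviation "good_at \<equiv> hashing.good w r s R Bd xs"
abbreviation "misled_at \<equiv> hashing.misled w n r s R u L xs"
abbreviation "As_at \<equiv> hashing.sd_As w r s R u U NC L NA xs"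
abbreviation "Bs_at \<equiv> hashing.sd_Bs w r s R u U NC L NA xs"
abbreviation "Qs_at \<equiv> hashing.sd_Qs w n r s R u U NC L xs"

definition T_pre :: nat where
  "T_pre = n * 20 + L * (r + u) * 20 + L * (R * (n * (HC w (r + u) + 40) + 100) + 120) + 300"

definition coins :: "nat stream \<Rightarrow> nat \<Rightarrow> nat" where
  "coins X = arr (stake (L * (r + u)) X)"

lemma hashing: "hashing w n l r s R u U NC L NA Bd xs P"
  by (simp add: hashing_def params_axioms)

lemma ht_PRE:
  assumes n0: "n0 < n"
  shows "ht w (PRE n0 P) (T_pre + hashing.T_build w n r s R u L NA Bd) (init_state (n # xs) X)
    (\<lambda>\<tau>. Par \<tau> \<and> tape \<tau> = sdrop (L * (r + u)) X \<and>
      (regs \<tau> vok = 0 \<and> (\<forall>t<L. \<not> good_at (coins X) (t * r)) \<or>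
       regs \<tau> vok = 1 \<and> (\<exists>t<L. good_at (coins X) (t * r) \<and>
          (\<forall>t'<t. \<not> good_at (coins X) (t' * r)) \<and>
          hashing.built w n r s R u U NC L NA xs (coins X) (t * r) \<tau>)))"
proof -
  interpret h: hashing w n l r s R u U NC L NA Bd xs P "coins X" by (rule hashing)
  let ?i = "init_state (n # xs) X"
  let ?\<sigma> = "set_reg vok 0 (set_reg vn n ?i)"
  define Q where "Q = (\<lambda>\<tau>. Par \<tau> \<and> tape \<tau> = sdrop (L * (r + u)) X \<and>
      (regs \<tau> vok = 0 \<and> (\<forall>t<L. \<not> h.good (t * r)) \<or> regs \<tau> vok = 1 \<and> (\<exists>t<L. h.good (t * r) \<and> (\<forall>t'<t. \<not> h.good (t' * r)) \<and> h.built (t * r) \<tau>)))"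
  have params_set: "ht w (SETUP P) (n * 20 + 100) ?\<sigma> Par"
    by (rule ht_SETUP) (simp_all add: mem_init)
  have rest: "ht w (DRAW ;; TRIES ;; Ite (V vok) BUILD Nop)
     (L * (r + u) * 20 + 100 + L * (R * (n * (HC w (r + u) + 40) + 100) + 120) + h.T_build) \<tau>0 Q"
    if P0: "Par \<tau>0" and f0: "frame (SETUP P) ?\<sigma> \<tau>0" for \<tau>0
  proof -
    have t0: "tape \<tau>0 = X" "\<And>m. m \<noteq> 0 \<Longrightarrow> mem \<tau>0 m = arr []" using f0 by (simp_all add: frame_def mem_init)
    have draw: "ht w DRAW (L * (r + u) * 20 + 50) \<tau>0
       (\<lambda>\<tau>. mem \<tau> 2 = arr (stake (L * (r + u)) (tape \<tau>0)) \<and> tape \<tau> = sdrop (L * (r + u)) (tape \<tau>0))"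
      by (rule ht_DRAW[OF P0]) (simp add: t0)
    show ?thesis
    proof (rule ht_Sq[where ?T2.0 = "50 + L * (R * (n * (HC w (r + u) + 40) + 100) + 120) + h.T_build", OF draw], goal_cases)
      case (1 \<tau>1)
      have P1: "Par \<tau>1" using Par_frame[OF P0 1(2)] by simp
      have t1: "mem \<tau>1 2 = coins X" "tape \<tau>1 = sdrop (L * (r + u)) X" "\<And>m. m \<noteq> 0 \<Longrightarrow> m \<noteq> 2 \<Longrightarrow> mem \<tau>1 m = arr []"
        using 1 t0 by (simp_all add: coins_def frame_def)
      have tries: "ht w TRIES (L * (R * (n * (HC w (r + u) + 40) + 100) + 120) + 50) \<tau>1 (h.found L)"
        using h.ht_TRIES[OF P1 t1(1)] by (simp add: h.H_def)
      show ?case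
      proof (rule ht_Sq[where ?T2.0 = "h.T_build", OF tries], goal_cases)
        case (1 \<tau>2)
        have P2: "Par \<tau>2" using Par_frame[OF P1 1(2)] by simp
        have t2: "mem \<tau>2 2 = coins X" "tape \<tau>2 = sdrop (L * (r + u)) X" "mem \<tau>2 10 = arr []" "mem \<tau>2 5 = arr []"
          using 1 t1 by (simp_all add: frame_def)
        show ?case
        proof (cases "regs \<tau>2 vok = 0")
          case True
          then show ?thesis using 1(1) P2 t2
            by (intro ht_Ite[where ?T1.0 = 1] ht_Nop) (simp_all add: Q_def h.found_def h.T_build_def)
        next
          case False
          then obtain t where t: "t < L" "regs \<tau>2 vb = t * r" "h.good (t * r)" "h.sorted_at (t * r) \<tau>2" "regs \<tau>2 vok = 1"
            "\<forall>t'<t. \<not> h.good (t' * r)"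
            using 1(1) by (auto simp: h.found_def)
          have "Suc t * r \<le> L * (r + u)" using t(1) by (intro mult_mono) auto
          then have tr: "t * r + r < 2 ^ w" using bounds(4) by simp
          have "ht w BUILD (h.T_build - 10) \<tau>2 (h.built (t * r))"
            by (rule h.ht_BUILD[OF P2 t2(1) t(4,2) tr t(3) t2(3,4)])
          then have "ht w BUILD (h.T_build - 10) \<tau>2 Q"
          proof (rule ht_mono, goal_cases)
            case (2 \<tau>3)
            then show ?case using t t2 Par_frame[OF P2 2(2)]
              by (auto simp: Q_def frame_def)
          qed simp
          then show ?thesis using False
            by (intro ht_Ite[where ?T1.0 = "h.T_build - 10"]) (simp_all add: h.T_build_def)
        qed
      qed simp
    qed simp
  qed
  have le: "min n0 (2 ^ w - 1) mod 2 ^ w = n0" using n0 bounds(1) by simp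
  have "ht w (PRE n0 P) (T_pre + h.T_build) ?i Q"
    unfolding PRE_def
  proof (rule ht_Sq_Asg'[where x = n and T = "T_pre + h.T_build - 10"], goal_cases)
    case 1 show ?case by (simp add: mem_init arr_def)
  next
    case 2 show ?case
    proof (rule ht_Sq_Asg'[where x = 0 and T = "T_pre + h.T_build - 20"], goal_cases)
      case 2 show ?case
      proof (rule ht_Ite[where ?T1.0 = "T_pre + h.T_build - 50"], goal_cases)
        case 1 show ?case by (rule ht_Sq[OF params_set rest]) (simp_all add: T_pre_def)
      next
        case 2 then show ?case using le n0 by simp
      qed (simp add: T_pre_def)
    qed (simp_all add: T_pre_def)
  qed (simp_all add: T_pre_def)
  then show ?thesis by (simp add: Q_def)
qed

end

section \<open>Correctness of the reduction\<close>

context hashing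
begin

lemma sd_set_props:
  assumes "mul = U \<or> mul = 1"
  shows "distinct (sd_set b mul k)" "set (sd_set b mul k) \<subseteq> {..<U * U}" "card (set (sd_set b mul k)) \<le> s"
proof -
  show "distinct (sd_set b mul k)" by (simp add: sd_set_def)
  have "k mod U < U" using pos(3) by simp
  have "k mod U * mul < U * U"
    using assms
  proof
    assume "mul = U"
    then show ?thesis using \<open>k mod U < U\<close> by simp
  next
    assume "mul = 1"
    then have "k mod U * mul = k mod U" by simp
    moreover have "U * 1 \<le> U * U" using pos(3) by (intro mult_left_mono) auto
    ultimately show ?thesis using \<open>k mod U < U\<close> by linarith
  qed
  then have "rep_hash i x XOR (k mod U * mul) < U * U" if "x \<in> set (chunk b t)" for i x t
    using rep_hash_less[OF chunk_words[OF that], of i] unfolding U_power by (rule xor_less_pow[rotated])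
  then show "set (sd_set b mul k) \<subseteq> {..<U * U}" by (auto simp: sd_set_def)
  show "card (set (sd_set b mul k)) \<le> s" using card_length length_sd_set order.trans by blast
qed

lemma query_less:
  assumes k: "k < NP b * L"
  shows "fst (query b k) < NA" "snd (query b k) < NA"
proof -
  have i: "k mod L < L" using pos(5) by simp
  have p: "k div L < length (pairs b (n * R))" using k by (simp add: NP_def less_mult_imp_div_less)
  obtain c t1 t2 where ct: "pairs b (n * R) ! (k div L) = (c, t1, t2)" by (cases "pairs b (n * R) ! (k div L)")
  have ctp: "(c, t1, t2) \<in> set (pairs b (n * R))" using p ct by (metis nth_mem)
  have t12: "t1 < NC" "t2 < NC" using pairs_chunks[OF ctp] by blast+
  have "rep_hash (k mod L) c < U * U" by (rule rep_hash_less) (use pairs_words[OF ctp] xs_words in auto)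
  then have h: "rep_hash (k mod L) c div U < U" "rep_hash (k mod L) c mod U < U"
    using pos(3) by (simp_all add: less_mult_imp_div_less)
  show "fst (query b k) < NA" "snd (query b k) < NA"
    using set_index_less[OF i t12(1) h(1)] set_index_less[OF i t12(2) h(2)] by (simp_all add: query_def ct Let_def)
qed

lemma sd_instance: "sd_instance (U * U) (sd_As b) (sd_Bs b) (sd_Qs b)"
proof -
  have "set (sd_set b U k) \<subseteq> {..<U * U}" "set (sd_set b 1 k) \<subseteq> {..<U * U}" for k
    by (intro sd_set_props(2); simp)+
  then show ?thesis
    unfolding sd_instance_def sd_As_def sd_Bs_def sd_Qs_def
    using sd_set_props(1)[of U b] sd_set_props(1)[of 1 b] query_less[of _ b]
    by (simp add: case_prod_unfold ball_Un del: One_nat_def)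
qed

lemma sd_lengths [simp]: "length (sd_As b) = NA" "length (sd_Bs b) = NA" "length (sd_Qs b) = NP b * L"
  by (simp_all add: sd_As_def sd_Bs_def sd_Qs_def)

lemma sd_sizes: "S \<in> set (sd_As b) \<union> set (sd_Bs b) \<Longrightarrow> card (set S) \<le> s"
  using sd_set_props(3)[of U b] sd_set_props(3)[of 1 b] by (auto simp: sd_As_def sd_Bs_def)

lemma fits_sd_input:
  assumes "good b"
  shows "fits w (sd_input (U * U) (sd_As b) (sd_Bs b) (sd_Qs b))"
  unfolding fits_def
proof (intro conjI ballI)
  have lq: "length (query_words b k) = 2 * k" for k
    by (induction k) (auto simp: query_words_def)
  have "length (sd_input (U * U) (sd_As b) (sd_Bs b) (sd_Qs b)) \<le> 4 + 2 * (NA * (s + 1)) + 2 * (NP b * L)"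
    unfolding sd_input_eq using length_all_sets[of b U NA] length_all_sets[of b 1 NA] lq[of "NP b * L"] by simp
  then show "length (sd_input (U * U) (sd_As b) (sd_Bs b) (sd_Qs b)) \<le> 2 ^ w" using NP_L_less[OF assms] by simp
  have sw: "s < 2 ^ w" using n_s_less by simp
  have block: "x < 2 ^ w" if "x \<in> set (all_sets b mul k)" "mul = U \<or> mul = 1" for x mul k
  proof -
    from that(1) obtain j where "x = length (sd_set b mul j) \<or> x \<in> set (sd_set b mul j)"
      by (auto simp: all_sets_def set_block_def)
    then show ?thesis
    proof
      assume "x = length (sd_set b mul j)"
      then show ?thesis using length_sd_set[of b mul j] sw by simp
    next
      assume "x \<in> set (sd_set b mul j)"
      then have "x < U * U" using sd_set_props(2)[OF that(2)] by blast
      then show ?thesis using bounds(3) by linarith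
    qed
  qed
  fix x assume "x \<in> set (sd_input (U * U) (sd_As b) (sd_Bs b) (sd_Qs b))"
  then consider "x \<in> {U * U, NA, NP b * L}" | "x \<in> set (all_sets b U NA)" | "x \<in> set (all_sets b 1 NA)"
    | "x \<in> set (query_words b (NP b * L))"
    unfolding sd_input_eq by auto
  then show "x < 2 ^ w"
  proof cases
    case 1
    then show ?thesis using bounds(3) U_less(2) NP_L_less[OF assms] by auto
  next
    case 4
    then obtain k where "k < NP b * L" "x = fst (query b k) \<or> x = snd (query b k)"
      by (auto simp: query_words_def)
    then have "x < NA" using query_less by auto
    then show ?thesis using U_less(2) by simp
  qed (use block in auto)
qed

end

context params
begin

definition T_det :: nat where
  "T_det = T_pre + hashing.T_build w n r s R u L NA Bd + hashing.T_check n s L Bd + 50"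

lemma reduce_no_split:
  assumes n0: "n0 < n" and bad: "\<forall>t<L. \<not> good_at (coins X) (t * r)"
  shows "\<exists>t s'. exec w (reduce n0 P c) (init_state (n # xs) X) t s' \<and> t \<le> T_det + T_brute n \<and> mem s' 1 0 = xor_answer xs"
proof -
  interpret h: hashing w n l r s R u U NC L NA Bd xs P "coins X" by (rule hashing)
  have "ht w (PRE n0 P) (T_pre + h.T_build) (init_state (n # xs) X)
      (\<lambda>\<tau>. regs \<tau> vn = n \<and> mem \<tau> 0 = arr (n # xs) \<and> regs \<tau> vok = 0)"
    by (rule ht_mono[OF ht_PRE[OF n0]]) (use bad in \<open>auto simp: Par_def\<close>)
  from reduce_failed[OF length_xs bounds(1) this] obtain t s' where
    "exec w (reduce n0 P c) (init_state (n # xs) X) t s'" "t \<le> T_pre + h.T_build + T_brute n + 22" "mem s' 1 0 = xor_answer xs"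
    by blast
  moreover from this(2) have "t \<le> T_det + T_brute n" by (simp add: T_det_def)
  ultimately show ?thesis by blast
qed

definition sd_call :: "(nat \<Rightarrow> nat) \<Rightarrow> nat \<Rightarrow> nat list" where
  "sd_call rw b = sd_input (U * U) (As_at rw b)
     (Bs_at rw b) (Qs_at rw b)"

text \<open>The choice of \<open>t\<close> depends only on the words drawn in advance, and its
  minimality determines it. So all tapes with the same initial words lead to a call on the same
  instance, and the call reads the independent remainder of the tape.\<close>

lemma reduce_split:
  assumes n0: "n0 < n" and good: "\<not> (\<forall>t<L. \<not> good_at (coins X) (t * r))"
  shows "\<exists>t<L. good_at (coins X) (t * r) \<and>
    (\<forall>t'<t. \<not> good_at (coins X) (t' * r)) \<and>
    (\<forall>\<tau> s1. exec w c (init_state (sd_call (coins X) (t * r)) (sdrop (L * (r + u)) X)) \<tau> s1 \<longrightarrow>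
       mem s1 1 \<in> sd_outputs (As_at (coins X) (t * r))
         (Bs_at (coins X) (t * r))
         (Qs_at (coins X) (t * r)) \<longrightarrow>
       (\<exists>t' s'. exec w (reduce n0 P c) (init_state (n # xs) X) t' s' \<and>
          t' \<le> T_det + \<tau> + (if misled_at (coins X) (t * r) then T_brute n else 0) \<and>
          mem s' 1 0 = xor_answer xs))"
proof -
  interpret h: hashing w n l r s R u U NC L NA Bd xs P "coins X" by (rule hashing)
  let ?i = "init_state (n # xs) X" and ?\<sigma> = "run w (PRE n0 P) (init_state (n # xs) X)"
  have pre: "cost w (PRE n0 P) ?i \<le> T_pre + h.T_build" "Par ?\<sigma>" "tape ?\<sigma> = sdrop (L * (r + u)) X" "regs ?\<sigma> vok = 1"
    "\<exists>t<L. h.good (t * r) \<and> (\<forall>t'<t. \<not> h.good (t' * r)) \<and> h.built (t * r) ?\<sigma>"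
    using ht_PRE[OF n0] good by (auto simp: ht_def)
  then obtain t where t: "t < L" "h.good (t * r)" "h.built (t * r) ?\<sigma>" "\<forall>t'<t. \<not> h.good (t' * r)" by blast
  obtain S1 where S1: "exec w (compile (PRE n0 P) 0) ?i (cost w (PRE n0 P) ?i) S1" "implements 0 ?i ?i ?\<sigma> S1"
    using compile_correct[OF represents_init] by blast
  have m\<sigma>: "mem ?\<sigma> m = arr []" if "m \<noteq> 0" "m \<notin> {2, 3, 4, 5, 6, 7, 8, 10}" for m
  proof -
    have "mem ?\<sigma> m = mem ?i m" by (rule run_frames(2)) (use that in simp)
    then show ?thesis using that by (simp add: mem_init)
  qed
  have "hosts S1 (init_state (sd_call (coins X) (t * r)) (sdrop (L * (r + u)) X))"
    unfolding hosts_def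
  proof (intro conjI allI)
    fix m
    show "mem S1 (m + 10) = mem (init_state (sd_call (coins X) (t * r)) (sdrop (L * (r + u)) X)) m"
    proof (cases "m = 0")
      case True
      then show ?thesis using S1(2) t(3) by (simp add: implements_def h.built_def mem_init sd_call_def)
    next
      case False
      then show ?thesis using S1(2) m\<sigma>[of "m + 10"] by (simp add: implements_def mem_init)
    qed
  qed (use S1(2) pre(3) in \<open>simp_all add: implements_def mem_init\<close>)
  note hosts = this
  show ?thesis
  proof (rule exI[of _ t], rule conjI[OF t(1)], rule conjI[OF t(2)], rule conjI[OF t(4)], intro allI impI)
    fix \<tau> s1
    assume e: "exec w c (init_state (sd_call (coins X) (t * r)) (sdrop (L * (r + u)) X)) \<tau> s1"
      and out: "mem s1 1 \<in> sd_outputs (h.sd_As (t * r)) (h.sd_Bs (t * r)) (h.sd_Qs (t * r))"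
    obtain S2 where S2: "exec w (relocate c) S1 \<tau> S2" "hosts S2 s1" "same_host S1 S2"
      using relocate_correct[OF e hosts] by blast
    have "regs S1 (var vok) = 1" using S1(2) pre(4) by (simp add: implements_def)
    then have call: "exec w (Cond (var vok) (relocate c) Skip) S1 (\<tau> + 1) S2"
      by (intro exec_Cond_True S2(1)) simp
    \<comment> \<open>The state of the caller after the call: its variables are as before, memory
      and tape are as the subroutine left them.\<close>
    define \<sigma>' where "\<sigma>' = ?\<sigma>\<lparr>mem := mem S2, tape := tape S2\<rparr>"
    have rep: "represents S2 \<sigma>'"
      using S2(3) S1(2) by (simp add: represents_def \<sigma>'_def same_host_def implements_def)
    have m': "mem \<sigma>' m = mem ?\<sigma> m" if "m < 10" for m
      using S2(3) S1(2) that by (simp add: \<sigma>'_def same_host_def implements_def)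
    have "mem S2 (1 + 10) = mem s1 1" using S2(2) unfolding hosts_def by blast
    then have m11: "mem \<sigma>' 11 = mem s1 1" by (simp add: \<sigma>'_def)
    have r': "regs \<sigma>' = regs ?\<sigma>" by (simp add: \<sigma>'_def)
    have "ht w POST (h.T_check + (if h.misled (t * r) then T_brute n else 0) + 20) \<sigma>' (\<lambda>\<tau>. mem \<tau> 1 0 = xor_answer xs)"
    proof (rule h.ht_POST[where b = "t * r"])
      show "Par \<sigma>'" using pre(2) m' r' by (simp add: Par_def)
      show "h.holds_pairs \<sigma>' (h.pairs (t * r) (n * R))" "holds_list (mem \<sigma>' 3) (h.buckets (t * r) R)"
        using t(3) m' by (simp_all add: h.built_def h.holds_pairs_def)
      show "mem \<sigma>' 9 p = 0" for p using m'[of 9] m\<sigma>[of 9] by (simp add: arr_def)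
      show "mem \<sigma>' 1 0 = 0" using m'[of 1] m\<sigma>[of 1] by (simp add: arr_def)
    qed (use out m11 t(2) pre(4) r' in simp_all)
    then have post: "cost w POST \<sigma>' \<le> h.T_check + (if h.misled (t * r) then T_brute n else 0) + 20"
      "mem (run w POST \<sigma>') 1 0 = xor_answer xs" by (simp_all add: ht_def)
    obtain S3 where S3: "exec w (compile POST 0) S2 (cost w POST \<sigma>') S3" "implements 0 \<sigma>' S2 (run w POST \<sigma>') S3"
      using compile_correct[OF rep] by blast
    have E: "exec w (reduce n0 P c) ?i (cost w (PRE n0 P) ?i + ((\<tau> + 1) + cost w POST \<sigma>')) S3"
      unfolding reduce_def by (rule exec_Seq[OF S1(1) exec_Seq[OF call S3(1)]])
    have "cost w (PRE n0 P) ?i + ((\<tau> + 1) + cost w POST \<sigma>') \<le> T_det + \<tau> + (if h.misled (t * r) then T_brute n else 0)"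
      using pre(1) post(1) unfolding T_det_def by linarith
    moreover have "mem S3 1 0 = xor_answer xs" using S3(2) post(2) by (simp add: implements_def)
    ultimately show "\<exists>t' s'. exec w (reduce n0 P c) ?i t' s' \<and>
        t' \<le> T_det + \<tau> + (if h.misled (t * r) then T_brute n else 0) \<and> mem s' 1 0 = xor_answer xs"
      using E by blast
  qed
qed

end

section \<open>Failure probabilities\<close>

lemma of_bool_le: "(P \<Longrightarrow> Q) \<Longrightarrow> (of_bool P :: real) \<le> of_bool Q"
  by (cases P) auto

lemma of_bool_ex_le: "finite I \<Longrightarrow> (of_bool (\<exists>i\<in>I. P i) :: real) \<le> (\<Sum>i\<in>I. of_bool (P i))"
proof (cases "\<exists>i\<in>I. P i")
  case True
  then obtain i where i: "i \<in> I" "P i" by blast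
  assume "finite I"
  from member_le_sum[OF i(1), of "\<lambda>i. of_bool (P i) :: real", OF _ this] i show ?thesis by auto
qed (simp add: sum_nonneg)

context hashing
begin

lemma hs_eq_iff:
  assumes "x \<in> set xs" "y \<in> set xs"
  shows "hs b r x = hs b r y \<longleftrightarrow> vanishes (klog w) (map (\<lambda>i. rw (b + i)) [0..<r]) (x XOR y)"
proof -
  have "hs b r (x XOR y) = hs b r x XOR hs b r y"
    unfolding hs_def by (rule hsh_xor[OF klog(1)]) (use assms xs_words in auto)
  then have "hs b r x = hs b r y \<longleftrightarrow> hs b r (x XOR y) = 0" by (simp add: xor_nat_eq_0_iff)
  then show ?thesis by (simp add: hs_def hsh_eq_0_vanishes)
qed

lemma rep_hash_eq_0_iff:
  "rep_hash i x = 0 \<longleftrightarrow> vanishes (klog w) (map (\<lambda>j. rw (L * r + i * u + j)) [0..<u]) x"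
  by (simp add: rep_hash_def hs_def hsh_eq_0_vanishes)

end

context params
begin

text \<open>Ordered pairs of input words with equal hash value, including the pairs with
  \<open>x = y\<close>; in other words, the sum of the squares of the bucket sizes.\<close>

definition collisions :: "nat list \<Rightarrow> real" where
  "collisions z = (\<Sum>x\<in>set xs. \<Sum>y\<in>set xs. of_bool (vanishes (klog w) z (x XOR y)))"

lemma card_xs: "card (set xs) = n"
  using distinct_card[OF distinct_xs] length_xs by simp

lemma avg_collisions: "avg (2 ^ w) r collisions \<le> real n + (real n)\<^sup>2 / real R"
proof -
  have q: "(2::nat) ^ w > 0" by simp
  have "avg (2 ^ w) r collisions = (\<Sum>x\<in>set xs. \<Sum>y\<in>set xs. avg (2 ^ w) r (\<lambda>z. of_bool (vanishes (klog w) z (x XOR y))))"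
    unfolding collisions_def by (simp only: avg_sum[OF q])
  also have "\<dots> \<le> (\<Sum>x\<in>set xs. \<Sum>y\<in>set xs. (if x = y then 1 else 0) + 1 / real R)"
  proof (intro sum_mono)
    fix x y assume xy: "x \<in> set xs" "y \<in> set xs"
    show "avg (2 ^ w) r (\<lambda>z. of_bool (vanishes (klog w) z (x XOR y))) \<le> (if x = y then 1 else 0) + 1 / real R"
    proof (cases "x = y")
      case True
      have "avg (2 ^ w) r (\<lambda>z. of_bool (vanishes (klog w) z (x XOR y))) \<le> 1" by (rule avg_le_const[OF q]) simp
      then show ?thesis using True by (simp add: add_increasing2)
    next
      case False
      have "x XOR y \<noteq> 0" "x XOR y < 2 ^ w"
        using False xy xs_words by (auto simp: xor_nat_eq_0_iff intro!: xor_less_pow)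
      from avg_vanishes[OF this klog(1)] show ?thesis using False by (simp add: R power_one_over)
    qed
  qed
  also have "\<dots> = real n + (real n)\<^sup>2 / real R"
    by (simp add: sum.distrib card_xs power2_eq_square distrib_left)
  finally show ?thesis .
qed

text \<open>The constant is (160 - 8) / 2, obtained by solving the estimate of the sum of squares
  against \<open>160 * R\<close>. Since the mean of \<open>collisions\<close> is at most
  \<open>6 * R * s^2\<close>, Markov's inequality gives 6/76, which is below 1/8. In contrast to
  \<open>good\<close>, this event is a function of the \<open>r\<close> words of one try, hence
  independent across tries.\<close>

definition crowded :: "nat list \<Rightarrow> bool" where
  "crowded z \<longleftrightarrow> 76 * real R * (real s)\<^sup>2 < collisions z"

lemma avg_crowded: "avg (2 ^ w) r (\<lambda>z. of_bool (crowded z)) \<le> 1 / 8"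
proof -
  have s1: "1 \<le> real s" and R1: "1 \<le> real R" using pos(1,2) by (simp_all add: Suc_le_eq)
  have n2: "real n \<le> 2 * real s * real R"
  proof -
    have "n \<le> 2 * (s * R)" using l(2) by (simp only: sR)
    then have "real n \<le> real (2 * (s * R))" by (simp only: of_nat_le_iff)
    then show ?thesis by simp
  qed
  have c: "76 * real R * (real s)\<^sup>2 > 0" using pos by simp
  have "(real n)\<^sup>2 \<le> (2 * real s * real R)\<^sup>2" using n2 by (intro power_mono) auto
  then have "(real n)\<^sup>2 / real R \<le> (2 * real s * real R)\<^sup>2 / real R" by (intro divide_right_mono) auto
  also have "\<dots> = 4 * real R * (real s)\<^sup>2" using R1 by (simp add: power2_eq_square)
  finally have "(real n)\<^sup>2 / real R \<le> 4 * real R * (real s)\<^sup>2" .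
  moreover have "2 * real s * real R \<le> 2 * real R * (real s)\<^sup>2"
  proof -
    have "real R * (real s * 1) \<le> real R * (real s * real s)" using s1 by (intro mult_left_mono) auto
    then show ?thesis by (simp add: power2_eq_square mult.commute mult.left_commute)
  qed
  ultimately have 6: "real n + (real n)\<^sup>2 / real R \<le> 6 * real R * (real s)\<^sup>2" using n2 by linarith
  have "avg (2 ^ w) r (\<lambda>z. of_bool (crowded z)) \<le> avg (2 ^ w) r collisions / (76 * real R * (real s)\<^sup>2)"
    unfolding crowded_def by (rule avg_markov[OF c]) (simp_all add: collisions_def sum_nonneg)
  also have "\<dots> \<le> (6 * real R * (real s)\<^sup>2) / (76 * real R * (real s)\<^sup>2)"
    using avg_collisions 6 c by (intro divide_right_mono) linarith+
  also have "\<dots> \<le> 1 / 8" using s1 R1 by simp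
  finally show ?thesis .
qed

text \<open>A bucket of k words has \<open>cnt\<close> at most \<open>k / s + 2\<close>, and
  \<open>(z + 2)^2\<close> is at most \<open>2 * z^2 + 8\<close>. The sum of the squares k^2 counts
  colliding pairs.\<close>

lemma sum_cnt_le:
  fixes rw :: "nat \<Rightarrow> nat" and b :: nat
  shows "real (\<Sum>v<R. (hashing.cnt w r s xs rw b v)\<^sup>2) \<le>
    8 * real R + 2 * collisions (map (\<lambda>i. rw (b + i)) [0..<r]) / (real s)\<^sup>2"
proof -
  interpret h: hashing w n l r s R u U NC L NA Bd xs P rw by (rule hashing)
  define k where "k = (\<lambda>v. card {x \<in> set xs. h.hs b r x = v})"
  have kl: "length (filter (\<lambda>x. h.hs b r x = v) xs) = k v" for v
    unfolding k_def using distinct_card[OF distinct_filter[OF distinct_xs], of "\<lambda>x. h.hs b r x = v"] by simp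
  have cnt: "real ((h.cnt b v)\<^sup>2) \<le> 8 + 2 * (real (k v))\<^sup>2 / (real s)\<^sup>2" for v
  proof -
    have "length (h.buckets b (Suc v)) = length (h.buckets b v) + k v" by (simp add: h.buckets_Suc kl)
    then have "h.cnt b v \<le> k v div s + 2"
      unfolding h.cnt_def using div_add1_eq[of "length (h.buckets b v)" "k v" s] pos(1)
        less_mult_imp_div_less[of "length (h.buckets b v) mod s + k v mod s" 2 s]
      by (auto simp: mult_2 add_strict_mono)
    moreover have "real (k v div s) \<le> real (k v) / real s" by (rule of_nat_div_le_of_nat)
    ultimately have c: "real (h.cnt b v) \<le> real (k v) / real s + 2" by linarith
    have "(real (h.cnt b v))\<^sup>2 \<le> (real (k v) / real s + 2)\<^sup>2" using c by (intro power_mono) auto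
    also have "\<dots> \<le> 2 * (real (k v) / real s)\<^sup>2 + 8"
    proof -
      have "(z + 2)\<^sup>2 \<le> 2 * z\<^sup>2 + 8" for z :: real
        using zero_le_power2[of "z - 2"] by (simp add: power2_eq_square algebra_simps)
      then show ?thesis .
    qed
    finally show ?thesis by (simp add: power_divide)
  qed
  have coll: "(\<Sum>v<R. (real (k v))\<^sup>2) = collisions (map (\<lambda>i. rw (b + i)) [0..<r])"
  proof -
    have kv: "real (k v) = (\<Sum>x\<in>set xs. of_bool (h.hs b r x = v))" for v
      unfolding k_def by (subst sum_of_bool_eq) (auto intro!: arg_cong[of _ _ card])
    have "(\<Sum>v<R. (real (k v))\<^sup>2) = (\<Sum>v<R. \<Sum>x\<in>set xs. \<Sum>y\<in>set xs. of_bool (h.hs b r x = v) * of_bool (h.hs b r y = v))"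
      by (simp only: kv power2_eq_square sum_product)
    also have "\<dots> = (\<Sum>x\<in>set xs. \<Sum>v<R. \<Sum>y\<in>set xs. of_bool (h.hs b r x = v) * of_bool (h.hs b r y = v))"
      by (rule sum.swap)
    also have "\<dots> = (\<Sum>x\<in>set xs. \<Sum>y\<in>set xs. \<Sum>v<R. of_bool (h.hs b r x = v) * of_bool (h.hs b r y = v))"
      by (intro sum.cong refl sum.swap)
    also have "\<dots> = collisions (map (\<lambda>i. rw (b + i)) [0..<r])"
      unfolding collisions_def
    proof (intro sum.cong refl)
      fix x y assume xy: "x \<in> set xs" "y \<in> set xs"
      have "h.hs b r x < R" unfolding R using xy xs_words by (intro h.hs_less) auto
      then have "(\<Sum>v<R. of_bool (h.hs b r x = v) * of_bool (h.hs b r y = v)) = (of_bool (h.hs b r x = h.hs b r y) :: real)"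
        by (subst sum.remove[of _ "h.hs b r x"]) (auto simp: of_bool_def)
      then show "(\<Sum>v<R. of_bool (h.hs b r x = v) * of_bool (h.hs b r y = v)) =
        (of_bool (vanishes (klog w) (map (\<lambda>i. rw (b + i)) [0..<r]) (x XOR y)) :: real)"
        using h.hs_eq_iff[OF xy, of b] by simp
    qed
    finally show ?thesis .
  qed
  have "real (\<Sum>v<R. (h.cnt b v)\<^sup>2) = (\<Sum>v<R. real ((h.cnt b v)\<^sup>2))" by simp
  also have "\<dots> \<le> (\<Sum>v<R. 8 + 2 * (real (k v))\<^sup>2 / (real s)\<^sup>2)" by (intro sum_mono cnt)
  also have "\<dots> = 8 * real R + 2 * (\<Sum>v<R. (real (k v))\<^sup>2) / (real s)\<^sup>2"
    by (simp add: sum.distrib sum_distrib_left sum_divide_distrib)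
  finally show ?thesis by (simp only: coll)
qed

lemma not_good_crowded:
  assumes "\<not> good_at rw b"
  shows "crowded (map (\<lambda>i. rw (b + i)) [0..<r])"
proof -
  interpret h: hashing w n l r s R u U NC L NA Bd xs P rw by (rule hashing)
  have "Bd < (\<Sum>v<R. (h.cnt b v)\<^sup>2)" using assms by (simp add: h.good_def)
  then have "real Bd < real (\<Sum>v<R. (h.cnt b v)\<^sup>2)" by (simp only: of_nat_less_iff)
  then have "real Bd < 8 * real R + 2 * collisions (map (\<lambda>i. rw (b + i)) [0..<r]) / (real s)\<^sup>2"
    using sum_cnt_le[of rw b] by linarith
  then have "152 * real R < 2 * collisions (map (\<lambda>i. rw (b + i)) [0..<r]) / (real s)\<^sup>2"
    by (simp add: Bd)
  then show ?thesis using pos(1) by (simp add: crowded_def field_simps)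
qed

lemma map_arr_block:
  assumes "length v = L * m" "i < L"
  shows "map (\<lambda>j. arr (v @ v') (i * m + j)) [0..<m] = block m i v"
proof (rule nth_equalityI)
  have "Suc i * m \<le> L * m" using assms(2) by (intro mult_right_mono) auto
  then show "length (map (\<lambda>j. arr (v @ v') (i * m + j)) [0..<m]) = length (block m i v)"
    using assms(1) by (simp add: block_def)
  fix j assume "j < length (map (\<lambda>j. arr (v @ v') (i * m + j)) [0..<m])"
  then have j: "j < m" by simp
  then have "i * m + j < L * m" using \<open>Suc i * m \<le> L * m\<close> by simp
  then have "i * m \<le> length v" using assms(1) by linarith
  from nth_drop[OF this, of j] \<open>i * m + j < L * m\<close> show "map (\<lambda>j. arr (v @ v') (i * m + j)) [0..<m] ! j = block m i v ! j"
    using j assms(1) by (simp add: arr_def block_def nth_append)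
qed

text \<open>Failure of every try forces each of the disjoint blocks of \<open>r\<close> words to be
  crowded. The words of the second functions are averaged out.\<close>

lemma avg_no_split:
  "avg (2 ^ w) (L * (r + u)) (\<lambda>v. of_bool (\<forall>t<L. \<not> good_at (arr v) (t * r))) \<le> (1 / 8) ^ L"
proof -
  have q: "(2::nat) ^ w > 0" by simp
  have "avg (2 ^ w) (L * r + L * u) (\<lambda>v. of_bool (\<forall>t<L. \<not> good_at (arr v) (t * r))) =
      avg (2 ^ w) (L * r) (\<lambda>v. avg (2 ^ w) (L * u) (\<lambda>v'. of_bool (\<forall>t<L. \<not> good_at (arr (v @ v')) (t * r))))"
    by (rule avg_append)
  also have "\<dots> \<le> avg (2 ^ w) (L * r) (\<lambda>v. of_bool (\<forall>t<L. crowded (block r t v)))"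
  proof (rule avg_mono, rule avg_le_const[OF q])
    fix v v' assume "v \<in> words (2 ^ w) (L * r)"
    then have len: "length v = L * r" by (simp add: words_def)
    have "crowded (block r t v)" if "t < L" "\<not> good_at (arr (v @ v')) (t * r)" for t
      using not_good_crowded[OF that(2)] map_arr_block[OF len that(1)] by simp
    then show "(of_bool (\<forall>t<L. \<not> good_at (arr (v @ v')) (t * r)) :: real) \<le> of_bool (\<forall>t<L. crowded (block r t v))"
      by (intro of_bool_le) blast
  qed
  also have "\<dots> = avg (2 ^ w) r (\<lambda>z. of_bool (crowded z)) ^ L" by (rule avg_blocks)
  also have "\<dots> \<le> (1 / 8) ^ L" by (intro power_mono avg_crowded avg_nonneg q) simp
  finally show ?thesis by (simp only: distrib_left)
qed

lemma avg_collides: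
  assumes c: "c < 2 ^ w" and I: "I \<subseteq> set xs" "card I \<le> s" and J: "J \<subseteq> set xs" "card J \<le> s"
    and no: "\<And>x y. x \<in> I \<Longrightarrow> y \<in> J \<Longrightarrow> x XOR y \<noteq> c"
  shows "avg (2 ^ w) u (\<lambda>z. of_bool (\<exists>x\<in>I. \<exists>y\<in>J. vanishes (klog w) z (x XOR y XOR c))) \<le> 1 / 16"
proof -
  have q: "(2::nat) ^ w > 0" by simp
  have fin: "finite I" "finite J" using finite_subset[OF I(1)] finite_subset[OF J(1)] by simp_all
  have "avg (2 ^ w) u (\<lambda>z. of_bool (\<exists>x\<in>I. \<exists>y\<in>J. vanishes (klog w) z (x XOR y XOR c))) \<le>
      avg (2 ^ w) u (\<lambda>z. \<Sum>x\<in>I. \<Sum>y\<in>J. of_bool (vanishes (klog w) z (x XOR y XOR c)))"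
  proof (rule avg_mono)
    fix z
    have "(of_bool (\<exists>x\<in>I. \<exists>y\<in>J. vanishes (klog w) z (x XOR y XOR c)) :: real) \<le>
        (\<Sum>x\<in>I. of_bool (\<exists>y\<in>J. vanishes (klog w) z (x XOR y XOR c)))"
      by (rule of_bool_ex_le[OF fin(1)])
    also have "\<dots> \<le> (\<Sum>x\<in>I. \<Sum>y\<in>J. of_bool (vanishes (klog w) z (x XOR y XOR c)))"
      by (intro sum_mono of_bool_ex_le[OF fin(2)])
    finally show "(of_bool (\<exists>x\<in>I. \<exists>y\<in>J. vanishes (klog w) z (x XOR y XOR c)) :: real) \<le>
        (\<Sum>x\<in>I. \<Sum>y\<in>J. of_bool (vanishes (klog w) z (x XOR y XOR c)))" .
  qed
  also have "\<dots> = (\<Sum>x\<in>I. \<Sum>y\<in>J. avg (2 ^ w) u (\<lambda>z. of_bool (vanishes (klog w) z (x XOR y XOR c))))"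
    by (simp only: avg_sum[OF q])
  also have "\<dots> = (\<Sum>x\<in>I. \<Sum>y\<in>J. (1 / 2) ^ u)"
  proof (intro sum.cong refl)
    fix x y assume xy: "x \<in> I" "y \<in> J"
    have "x XOR y < 2 ^ w" using xy I J xs_words by (intro xor_less_pow) auto
    then have "(x XOR y) XOR c < 2 ^ w" using c by (rule xor_less_pow)
    then have "x XOR y XOR c < 2 ^ w" by (simp only: xor.assoc)
    moreover have "(x XOR y) XOR c \<noteq> 0" using no[OF xy] by (simp only: xor_nat_eq_0_iff not_False_eq_True)
    then have "x XOR y XOR c \<noteq> 0" by (simp only: xor.assoc not_False_eq_True)
    ultimately show "avg (2 ^ w) u (\<lambda>z. of_bool (vanishes (klog w) z (x XOR y XOR c))) = (1 / 2) ^ u"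
      by (intro avg_vanishes klog(1))
  qed
  also have "\<dots> = real (card I * card J) * (1 / 2) ^ u" by simp
  also have "\<dots> \<le> real (s * s) * (1 / 2) ^ u"
  proof (rule mult_right_mono)
    have "card I * card J \<le> s * s" using I J by (intro mult_mono) auto
    then show "real (card I * card J) \<le> real (s * s)" by (simp only: of_nat_le_iff)
  qed simp
  also have "\<dots> = 1 / 16"
  proof -
    have "U * U = 2 ^ u" by (simp add: U s u power_add power_mult mult_2 power2_eq_square)
    then have "real (U * U) = real (2 ^ u)" by (simp only:)
    then have 2: "(2::real) ^ u = 16 * (real s * real s)" by (simp add: U)
    have "(1 / 2 :: real) ^ u = 1 / 2 ^ u" by (rule power_one_over)
    then show ?thesis using pos(1) unfolding 2 by simp
  qed
  finally show ?thesis .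
qed

text \<open>Acceptance, chunks and the list of triples depend only on the first hash function of the
  try. Its words being fixed, the second functions are tested against a fixed list of
  triples.\<close>

lemma hashing_cong:
  assumes "\<And>x. hashing.hs w rw b r x = hashing.hs w rw' b r x"
  shows "good_at rw b = good_at rw' b"
    "hashing.pairs w r s R xs rw b = hashing.pairs w r s R xs rw' b"
    "hashing.genuine w r s R xs rw b = hashing.genuine w r s R xs rw' b"
    "hashing.chunk w r s R xs rw b = hashing.chunk w r s R xs rw' b"
proof -
  interpret h: hashing w n l r s R u U NC L NA Bd xs P rw by (rule hashing)
  interpret h': hashing w n l r s R u U NC L NA Bd xs P rw' by (rule hashing)
  have bk: "h.buckets b = h'.buckets b" by (simp add: fun_eq_iff h.buckets_def h'.buckets_def assms)
  then have cnt: "h.cnt b = h'.cnt b" "h.lo b = h'.lo b" "h.partner b = h'.partner b"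
    by (simp_all add: fun_eq_iff h.cnt_def h'.cnt_def h.lo_def h'.lo_def h.partner_def h'.partner_def assms)
  then have "h.bucket_pairs b = h'.bucket_pairs b" by (simp add: fun_eq_iff h.bucket_pairs_def h'.bucket_pairs_def)
  then show "h.pairs b = h'.pairs b" by (simp add: fun_eq_iff h.pairs_def h'.pairs_def)
  show "h.good b = h'.good b" by (simp add: h.good_def h'.good_def cnt)
  show ch: "h.chunk b = h'.chunk b" by (simp add: fun_eq_iff h.chunk_def h'.chunk_def bk)
  show "h.genuine b = h'.genuine b" unfolding h.genuine_def h'.genuine_def ch ..
qed

text \<open>A union bound over the triples. Each false one passes \<open>L\<close> independent
  repetitions with probability at most \<open>(1 / 16) ^ L\<close>. The conjunction with
  \<open>good_at\<close> supplies the bound \<open>n * Bd\<close> on their number, which fails for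
  rejected functions.\<close>

lemma avg_misled:
  assumes v: "v \<in> words (2 ^ w) (L * r)" and t: "t < L"
  shows "avg (2 ^ w) (L * u) (\<lambda>v'. of_bool (good_at (arr (v @ v')) (t * r) \<and>
    misled_at (arr (v @ v')) (t * r))) \<le> real (n * Bd) * (1 / 16) ^ L"
proof -
  have q: "(2::nat) ^ w > 0" by simp
  have len: "length v = L * r" using v by (simp add: words_def)
  interpret h0: hashing w n l r s R u U NC L NA Bd xs P "arr v" by (rule hashing)
  let ?b = "t * r"
  define ps where "ps = h0.pairs ?b (n * R)"
  have same: "hashing.hs w (arr (v @ v')) ?b r x = hashing.hs w (arr v) ?b r x" for v' x
  proof -
    interpret h: hashing w n l r s R u U NC L NA Bd xs P "arr (v @ v')" by (rule hashing)
    have "Suc t * r \<le> L * r" using t by (intro mult_right_mono) auto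
    then have "arr (v @ v') (?b + i) = arr v (?b + i)" if "i < r" for i
      using that len by (simp add: arr_def nth_append)
    then show ?thesis unfolding h.hs_def h0.hs_def by (intro hsh_cong)
  qed
  define bad where "bad = (\<lambda>(c, t1, t2) z. \<exists>x\<in>set (h0.chunk ?b t1). \<exists>y\<in>set (h0.chunk ?b t2). vanishes (klog w) z (x XOR y XOR c))"
  have le: "(of_bool (good_at (arr (v @ v')) ?b \<and> misled_at (arr (v @ v')) ?b) :: real)
      \<le> (\<Sum>p<length ps. of_bool (h0.good ?b \<and> \<not> h0.genuine ?b (ps ! p)) * of_bool (\<forall>i<L. bad (ps ! p) (block u i v')))"
    if v': "v' \<in> words (2 ^ w) (L * u)" for v'
  proof -
    interpret h: hashing w n l r s R u U NC L NA Bd xs P "arr (v @ v')" by (rule hashing)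
    note eqs = hashing_cong[OF same[of v']]
    have len': "length v' = L * u" using v' by (simp add: words_def)
    have vb: "h.rep_hash i x = 0 \<longleftrightarrow> vanishes (klog w) (block u i v') x" if "i < L" for i x
    proof -
      have "arr (v @ v') (L * r + i * u + j) = arr (v' @ []) (i * u + j)" for j
        using len by (simp add: arr_def nth_append)
      then show ?thesis using map_arr_block[OF len' that, of "[]"] by (simp add: h.rep_hash_eq_0_iff)
    qed
    have "\<exists>p\<in>{..<length ps}. (h0.good ?b \<and> \<not> h0.genuine ?b (ps ! p)) \<and> (\<forall>i<L. bad (ps ! p) (block u i v'))"
      if g: "h.good ?b" and m: "h.misled ?b"
    proof -
      obtain p where p: "p < h.NP ?b" "\<forall>i<L. h.collides ?b (h.pairs ?b (n * R) ! p) i" "\<not> h.genuine ?b (h.pairs ?b (n * R) ! p)"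
        using m by (auto simp: h.misled_def h.candidate_def)
      have "h.pairs ?b (n * R) = ps" by (simp add: ps_def eqs)
      then have p': "p < length ps" "\<forall>i<L. h.collides ?b (ps ! p) i" "\<not> h0.genuine ?b (ps ! p)"
        using p by (simp_all add: h.NP_def eqs)
      moreover have "bad (ps ! p) (block u i v')" if "i < L" for i
      proof -
        have "h.collides ?b (ps ! p) i" using p'(2) that by blast
        then show ?thesis by (cases "ps ! p") (simp add: h.collides_def bad_def eqs vb[OF that])
      qed
      ultimately show ?thesis using g eqs by auto
    qed
    then have "(of_bool (h.good ?b \<and> h.misled ?b) :: real) \<le>
       of_bool (\<exists>p\<in>{..<length ps}. (h0.good ?b \<and> \<not> h0.genuine ?b (ps ! p)) \<and> (\<forall>i<L. bad (ps ! p) (block u i v')))"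
      by (intro of_bool_le) blast
    also have "\<dots> \<le> (\<Sum>p<length ps. of_bool ((h0.good ?b \<and> \<not> h0.genuine ?b (ps ! p)) \<and> (\<forall>i<L. bad (ps ! p) (block u i v'))))"
      by (rule of_bool_ex_le) simp
    finally show ?thesis by (simp only: of_bool_conj)
  qed
  have "avg (2 ^ w) (L * u) (\<lambda>v'. of_bool (good_at (arr (v @ v')) ?b \<and> misled_at (arr (v @ v')) ?b))
     \<le> avg (2 ^ w) (L * u) (\<lambda>v'. \<Sum>p<length ps. of_bool (h0.good ?b \<and> \<not> h0.genuine ?b (ps ! p)) * of_bool (\<forall>i<L. bad (ps ! p) (block u i v')))"
    by (rule avg_mono) (rule le)
  also have "\<dots> = (\<Sum>p<length ps. of_bool (h0.good ?b \<and> \<not> h0.genuine ?b (ps ! p)) * (avg (2 ^ w) u (\<lambda>z. of_bool (bad (ps ! p) z))) ^ L)"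
    unfolding avg_sum[OF q] avg_cmult avg_blocks ..
  also have "\<dots> \<le> (\<Sum>p<length ps. of_bool (h0.good ?b) * (1 / 16) ^ L)"
  proof (intro sum_mono)
    fix p assume p: "p \<in> {..<length ps}"
    show "of_bool (h0.good ?b \<and> \<not> h0.genuine ?b (ps ! p)) * (avg (2 ^ w) u (\<lambda>z. of_bool (bad (ps ! p) z))) ^ L
        \<le> of_bool (h0.good ?b) * (1 / 16) ^ L"
    proof (cases "h0.genuine ?b (ps ! p)")
      case False
      obtain c t1 t2 where ct: "ps ! p = (c, t1, t2)" by (cases "ps ! p")
      have "(c, t1, t2) \<in> set ps" using p ct by (metis lessThan_iff nth_mem)
      then have c: "c < 2 ^ w" using h0.pairs_words[of c t1 t2 ?b "n * R"] xs_words by (auto simp: ps_def)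
      have card: "card (set (h0.chunk ?b t')) \<le> s" for t'
        by (rule order.trans[OF card_length]) (simp add: h0.chunk_def)
      have "avg (2 ^ w) u (\<lambda>z. of_bool (bad (ps ! p) z)) \<le> 1 / 16"
        unfolding ct bad_def prod.case
        by (rule avg_collides[OF c h0.set_chunk card h0.set_chunk card]) (use False in \<open>auto simp: ct h0.genuine_def\<close>)
      then have "(avg (2 ^ w) u (\<lambda>z. of_bool (bad (ps ! p) z))) ^ L \<le> (1 / 16) ^ L"
        by (intro power_mono avg_nonneg q) simp_all
      then show ?thesis using False by simp
    qed simp
  qed
  also have "\<dots> = of_bool (h0.good ?b) * real (length ps) * (1 / 16) ^ L" by simp
  also have "\<dots> \<le> real (n * Bd) * (1 / 16) ^ L"
  proof (intro mult_right_mono)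
    show "of_bool (h0.good ?b) * real (length ps) \<le> real (n * Bd)"
      using h0.NP_le[of ?b] unfolding ps_def h0.NP_def[symmetric]
      by (cases "h0.good ?b") (simp_all del: of_nat_mult)
  qed simp
  finally show ?thesis .
qed

text \<open>Any good try that misleads counts as bad, even if it is not the first good one. This
  costs a factor \<open>L\<close> in the union bound, but no conditioning on the accepted try is
  required.\<close>

definition bad_coins :: "nat list \<Rightarrow> bool" where
  "bad_coins v \<longleftrightarrow> (\<forall>t<L. \<not> good_at (arr v) (t * r)) \<or>
     (\<exists>t<L. good_at (arr v) (t * r) \<and> misled_at (arr v) (t * r))"

lemma avg_bad_coins:
  "avg (2 ^ w) (L * (r + u)) (\<lambda>v. of_bool (bad_coins v)) \<le> (1 / 8) ^ L + real L * (real (n * Bd) * (1 / 16) ^ L)"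
proof -
  have q: "(2::nat) ^ w > 0" by simp
  let ?G = "\<lambda>v. of_bool (\<forall>t<L. \<not> good_at (arr v) (t * r)) :: real"
  let ?M = "\<lambda>t v. of_bool (good_at (arr v) (t * r) \<and> misled_at (arr v) (t * r)) :: real"
  have le: "of_bool (bad_coins v) \<le> ?G v + (\<Sum>t<L. ?M t v)" for v
  proof -
    have "of_bool (bad_coins v) \<le> ?G v + of_bool (\<exists>t\<in>{..<L}. good_at (arr v) (t * r) \<and> misled_at (arr v) (t * r))"
      unfolding bad_coins_def by (auto simp: of_bool_def)
    then show ?thesis
      using of_bool_ex_le[of "{..<L}" "\<lambda>t. good_at (arr v) (t * r) \<and> misled_at (arr v) (t * r)"] by simp
  qed
  have M: "avg (2 ^ w) (L * (r + u)) (?M t) \<le> real (n * Bd) * (1 / 16) ^ L" if "t < L" for t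
  proof -
    have "avg (2 ^ w) (L * r + L * u) (?M t) = avg (2 ^ w) (L * r) (\<lambda>v. avg (2 ^ w) (L * u) (\<lambda>v'. ?M t (v @ v')))"
      by (rule avg_append)
    also have "\<dots> \<le> real (n * Bd) * (1 / 16) ^ L"
      by (rule avg_le_const[OF q]) (rule avg_misled[OF _ that])
    finally show ?thesis by (simp only: distrib_left)
  qed
  have "avg (2 ^ w) (L * (r + u)) (\<lambda>v. of_bool (bad_coins v)) \<le> avg (2 ^ w) (L * (r + u)) (\<lambda>v. ?G v + (\<Sum>t<L. ?M t v))"
    by (rule avg_mono) (rule le)
  also have "\<dots> = avg (2 ^ w) (L * (r + u)) ?G + (\<Sum>t<L. avg (2 ^ w) (L * (r + u)) (?M t))"
    by (simp only: avg_add avg_sum[OF q])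
  also have "\<dots> \<le> (1 / 8) ^ L + (\<Sum>t<L. real (n * Bd) * (1 / 16) ^ L)"
    by (intro add_mono avg_no_split sum_mono M) simp
  finally show ?thesis by simp
qed

end

section \<open>The expected time of the reduction\<close>

lemma run_time_le: "exec w c s t s' \<Longrightarrow> run_time w c s \<le> of_nat t"
  unfolding run_time_def by (intro INF_lower) auto

lemma run_time_eq: "exec w c s t s' \<Longrightarrow> run_time w c s = of_nat t"
proof (rule antisym)
  assume e: "exec w c s t s'"
  then show "run_time w c s \<le> of_nat t" by (rule run_time_le)
  show "of_nat t \<le> run_time w c s"
    unfolding run_time_def by (rule INF_greatest) (use exec_deterministic[OF e] in auto)
qed

lemma eavg_le: 
  assumes "q > 0" "\<And>u. g u \<ge> 0" "\<And>u. u \<in> words q k \<Longrightarrow> f u \<le> ennreal (g u) + c"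
  shows "eavg q k f \<le> ennreal (avg q k g) + c"
  using eavg_mono[of q k f "\<lambda>u. ennreal (g u) + c"] assms eavg_ennreal_add[of q g k c] by auto

context params
begin

lemma coins_shift: "v \<in> words (2 ^ w) (L * (r + u)) \<Longrightarrow> coins (v @- X) = arr v \<and> sdrop (L * (r + u)) (v @- X) = X"
  by (auto simp: coins_def words_def stake_shift sdrop_shift)

definition sd_answers :: "(nat \<Rightarrow> nat) \<Rightarrow> nat \<Rightarrow> (nat \<Rightarrow> nat) set" where
  "sd_answers rw b = sd_outputs (As_at rw b)
     (Bs_at rw b) (Qs_at rw b)"

text \<open>For fixed initial words the call runs on a fixed instance with a fresh tape and
  contributes at most \<open>T0\<close> to the expectation; all other time is bounded by a number
  that depends on these words only. Correctness and time of \<open>c\<close> are assumed just for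
  good functions, as other instances may violate the promise.\<close>

lemma reduce_expectation:
  assumes n0: "n0 < n"
    and correct: "\<And>rw b. good_at rw b \<Longrightarrow>
      AE \<omega> in tape_space w. \<exists>\<tau> s1. exec w c (init_state (sd_call rw b) \<omega>) \<tau> s1 \<and> mem s1 1 \<in> sd_answers rw b"
    and time: "\<And>rw b. good_at rw b \<Longrightarrow> expected_time w c (sd_call rw b) \<le> T0"
  shows "AE X in tape_space w. \<exists>t s'. exec w (reduce n0 P c) (init_state (n # xs) X) t s' \<and> mem s' 1 0 = xor_answer xs"
    and "expected_time w (reduce n0 P c) (n # xs) \<le>
      ennreal (real T_det + real (T_brute n) * avg (2 ^ w) (L * (r + u)) (\<lambda>v. of_bool (bad_coins v))) + T0"
proof -
  let ?G = "\<lambda>v t. good_at (arr v) (t * r)"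
  let ?k = "L * (r + u)"
  define g where "g = (\<lambda>v. real T_det + real (T_brute n) * of_bool (bad_coins v))"
  let ?run = "\<lambda>X. run_time w (reduce n0 P c) (init_state (n # xs) X)"
  let ?ok = "\<lambda>X. \<exists>t s'. exec w (reduce n0 P c) (init_state (n # xs) X) t s' \<and> mem s' 1 0 = xor_answer xs"
  interpret T: prob_space "tape_space w" by (rule prob_space_tape)
  have main: "(AE \<omega> in tape_space w. ?ok (v @- \<omega>)) \<and> (\<integral>\<^sup>+\<omega>. ?run (v @- \<omega>) \<partial>tape_space w) \<le> ennreal (g v) + T0"
    if v: "v \<in> words (2 ^ w) ?k" for v
  proof (cases "\<forall>t<L. \<not> ?G v t")
    case True
    have *: "\<exists>t s'. exec w (reduce n0 P c) (init_state (n # xs) (v @- \<omega>)) t s' \<and> t \<le> T_det + T_brute n \<and> mem s' 1 0 = xor_answer xs" for \<omega>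
      by (rule reduce_no_split[OF n0]) (use True coins_shift[OF v] in simp)
    have "?run (v @- \<omega>) \<le> ennreal (g v)" for \<omega>
    proof -
      obtain t s' where t: "exec w (reduce n0 P c) (init_state (n # xs) (v @- \<omega>)) t s'" "t \<le> T_det + T_brute n" using * by blast
      have "bad_coins v" using True by (simp add: bad_coins_def)
      then have "real t \<le> g v" using t(2) by (simp add: g_def)
      then have "ennreal (real t) \<le> ennreal (g v)" by (rule ennreal_leI)
      then show ?thesis using run_time_le[OF t(1)] by (simp add: ennreal_of_nat_eq_real_of_nat)
    qed
    then have "(\<integral>\<^sup>+\<omega>. ?run (v @- \<omega>) \<partial>tape_space w) \<le> (\<integral>\<^sup>+\<omega>. ennreal (g v) \<partial>tape_space w)"
      by (intro nn_integral_mono)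
    also have "\<dots> = ennreal (g v)" using T.emeasure_space_1 by simp
    also have "\<dots> \<le> ennreal (g v) + T0" by simp
    finally have "(\<integral>\<^sup>+\<omega>. ?run (v @- \<omega>) \<partial>tape_space w) \<le> ennreal (g v) + T0" .
    moreover have "AE \<omega> in tape_space w. ?ok (v @- \<omega>)" by (rule AE_I2) (use * in blast)
    ultimately show ?thesis by blast
  next
    case False
    \<comment> \<open>The existential statement about a single tape yields an index that might vary
      with the tape. As the least good one it depends on \<open>v\<close> alone.\<close>
    define t where "t = (LEAST t. ?G v t)"
    have ex: "\<exists>t. ?G v t" using False by blast
    have Gt: "?G v t" unfolding t_def using ex by (rule LeastI_ex)
    have first: "t' = t" if "?G v t'" "\<forall>t''<t'. \<not> ?G v t''" for t'
      unfolding t_def using that by (metis LeastI not_less_Least nat_neq_iff)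
    have *: "\<exists>t' s'. exec w (reduce n0 P c) (init_state (n # xs) (v @- \<omega>)) t' s' \<and>
        real t' \<le> g v + real \<tau> \<and> mem s' 1 0 = xor_answer xs"
      if e: "exec w c (init_state (sd_call (arr v) (t * r)) \<omega>) \<tau> s1" and o: "mem s1 1 \<in> sd_answers (arr v) (t * r)" for \<omega> \<tau> s1
    proof -
      have cs: "coins (v @- \<omega>) = arr v" "sdrop ?k (v @- \<omega>) = \<omega>" using coins_shift[OF v] by auto
      have "\<not> (\<forall>t<L. \<not> good_at (coins (v @- \<omega>)) (t * r))" using False cs by simp
      from reduce_split[OF n0 this, of c, unfolded cs] obtain t1 where
        t1: "t1 < L" "?G v t1" "\<forall>t'<t1. \<not> ?G v t'" and
        r: "\<And>\<tau> s1. exec w c (init_state (sd_call (arr v) (t1 * r)) \<omega>) \<tau> s1 \<Longrightarrow>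
           mem s1 1 \<in> sd_answers (arr v) (t1 * r) \<Longrightarrow>
           \<exists>t' s'. exec w (reduce n0 P c) (init_state (n # xs) (v @- \<omega>)) t' s' \<and>
             t' \<le> T_det + \<tau> + (if misled_at (arr v) (t1 * r) then T_brute n else 0) \<and> mem s' 1 0 = xor_answer xs"
        unfolding sd_answers_def by blast
      have "t1 = t" using first t1 by blast
      obtain t' s' where t': "exec w (reduce n0 P c) (init_state (n # xs) (v @- \<omega>)) t' s'"
        "t' \<le> T_det + \<tau> + (if misled_at (arr v) (t1 * r) then T_brute n else 0)" "mem s' 1 0 = xor_answer xs"
        using r[of \<tau> s1] e o \<open>t1 = t\<close> by blast
      have "bad_coins v" if "misled_at (arr v) (t1 * r)"
        using t1 that unfolding bad_coins_def by blast
      then have "real t' \<le> g v + real \<tau>" using t'(2) by (auto simp: g_def split: if_splits)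
      then show ?thesis using t'(1,3) by blast
    qed
    have AE: "AE \<omega> in tape_space w. \<exists>\<tau> s1. exec w c (init_state (sd_call (arr v) (t * r)) \<omega>) \<tau> s1 \<and> mem s1 1 \<in> sd_answers (arr v) (t * r)"
      by (rule correct[OF Gt])
    then have ok: "AE \<omega> in tape_space w. ?ok (v @- \<omega>)"
      by (rule eventually_mono) (use * in blast)
    let ?inner = "\<lambda>\<omega>. run_time w c (init_state (sd_call (arr v) (t * r)) \<omega>)"
    \<comment> \<open>This comparison holds almost everywhere only, since \<open>c\<close> may run
      forever or answer wrongly on a null set of tapes.\<close>
    have "AE \<omega> in tape_space w. ?run (v @- \<omega>) \<le> ennreal (g v) + ?inner \<omega>"
    proof (rule eventually_mono[OF AE])
      fix \<omega> assume "\<exists>\<tau> s1. exec w c (init_state (sd_call (arr v) (t * r)) \<omega>) \<tau> s1 \<and> mem s1 1 \<in> sd_answers (arr v) (t * r)"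
      then obtain \<tau> s1 where e: "exec w c (init_state (sd_call (arr v) (t * r)) \<omega>) \<tau> s1" "mem s1 1 \<in> sd_answers (arr v) (t * r)" by blast
      obtain t' s' where t': "exec w (reduce n0 P c) (init_state (n # xs) (v @- \<omega>)) t' s'" "real t' \<le> g v + real \<tau>"
        using *[OF e] by blast
      have "ennreal (real t') \<le> ennreal (g v + real \<tau>)" using t'(2) by (rule ennreal_leI)
      also have "\<dots> = ennreal (g v) + ennreal (real \<tau>)" by (rule ennreal_plus) (simp_all add: g_def)
      finally show "?run (v @- \<omega>) \<le> ennreal (g v) + ?inner \<omega>"
        using run_time_le[OF t'(1)] run_time_eq[OF e(1)] by (simp add: ennreal_of_nat_eq_real_of_nat)
    qed
    then have "(\<integral>\<^sup>+\<omega>. ?run (v @- \<omega>) \<partial>tape_space w) \<le> (\<integral>\<^sup>+\<omega>. ennreal (g v) + ?inner \<omega> \<partial>tape_space w)"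
      by (rule nn_integral_mono_AE)
    also have "\<dots> = (\<integral>\<^sup>+\<omega>. ennreal (g v) \<partial>tape_space w) + (\<integral>\<^sup>+\<omega>. ?inner \<omega> \<partial>tape_space w)"
      by (rule nn_integral_add) (simp_all add: measurable_run_time)
    also have "(\<integral>\<^sup>+\<omega>. ennreal (g v) \<partial>tape_space w) = ennreal (g v)" using T.emeasure_space_1 by simp
    also have "ennreal (g v) + (\<integral>\<^sup>+\<omega>. ?inner \<omega> \<partial>tape_space w) \<le> ennreal (g v) + T0"
      using time[OF Gt] unfolding expected_time_def by (rule add_left_mono)
    finally show ?thesis using ok by blast
  qed
  show "AE X in tape_space w. ?ok X"
    by (rule AE_tape_shift[where k = ?k]) (use main in blast)
  have "expected_time w (reduce n0 P c) (n # xs) = eavg (2 ^ w) ?k (\<lambda>v. \<integral>\<^sup>+\<omega>. ?run (v @- \<omega>) \<partial>tape_space w)"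
    unfolding expected_time_def by (rule nn_integral_tape_split[OF measurable_run_time])
  also have "\<dots> \<le> ennreal (avg (2 ^ w) ?k g) + T0"
    by (rule eavg_le) (use main in \<open>auto simp: g_def\<close>)
  also have "avg (2 ^ w) ?k g = real T_det + real (T_brute n) * avg (2 ^ w) ?k (\<lambda>v. of_bool (bad_coins v))"
    unfolding g_def avg_add avg_cmult by simp
  finally show "expected_time w (reduce n0 P c) (n # xs) \<le>
      ennreal (real T_det + real (T_brute n) * avg (2 ^ w) ?k (\<lambda>v. of_bool (bad_coins v))) + T0" .
qed

end

section \<open>Choice of the parameters\<close>

text \<open>Two sources of rounding: \<open>2 ^ l\<close> lies between n / 2 and n, and
  \<open>r\<close> between \<gamma> \<open>l\<close> - 2 and \<gamma> \<open>l\<close>. Together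
  they cost at most a factor 2 * 4 = 8.\<close>

lemma parameter_bounds:
  fixes \<gamma> :: real
  assumes \<gamma>: "0 < \<gamma>" "\<gamma> < 1" and l: "2 ^ l \<le> n" "n < 2 * 2 ^ l" and a: "1 \<le> ln (real n)"
    and w: "8 \<le> w" "2 * log 2 (real n) \<le> real w" and r: "r = l * nat \<lfloor>\<gamma> * real w\<rfloor> div w"
    and s: "s = 2 ^ (l - r)" and R: "R = 2 ^ r" and NC: "NC = n div s + 1" and L: "L = l + 1"
  shows "r \<le> l" "real R \<le> real n powr \<gamma>" "real n powr \<gamma> \<le> 8 * real R"
    "real s \<le> 8 * real n powr (1 - \<gamma>)" "real n powr (1 - \<gamma>) \<le> 2 * real s"
    "ln (real n) \<le> real L" "real L \<le> 3 * ln (real n)"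
    "n \<le> NC * s" "NC * s \<le> 2 * n" "nat \<lfloor>\<gamma> * real w\<rfloor> \<le> w" "n ^ 2 \<le> 2 ^ w"
proof -
  have n0: "real n > 0" using a by (cases "n = 0") auto
  have ll: "real l \<le> log 2 (real n)" "log 2 (real n) < real l + 1"
  proof -
    have "real (2 ^ l) \<le> real n" using l(1) by (simp only: of_nat_le_iff)
    then show "real l \<le> log 2 (real n)" using n0 by (simp add: le_log_iff powr_realpow)
    have "real n < real (2 ^ (l + 1))" using l(2) by (simp only: of_nat_less_iff) simp
    then show "log 2 (real n) < real l + 1" using n0 by (simp add: log_less_iff powr_realpow powr_add)
  qed
  have w0: "real w > 0" using w by simp
  define p where "p = nat \<lfloor>\<gamma> * real w\<rfloor>"
  have p: "real p \<le> \<gamma> * real w" "\<gamma> * real w - 1 \<le> real p"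
    using \<gamma> w0 by (simp_all add: p_def)
  show pw: "nat \<lfloor>\<gamma> * real w\<rfloor> \<le> w"
  proof -
    have "\<gamma> * real w \<le> 1 * real w" using \<gamma> by (intro mult_right_mono) auto
    then show ?thesis using p(1) unfolding p_def by linarith
  qed
  have "real r \<le> real (l * p) / real w" unfolding r p_def by (rule of_nat_div_le_of_nat)
  also have "\<dots> \<le> real l * (\<gamma> * real w) / real w"
  proof (rule divide_right_mono)
    have "real l * real p \<le> real l * (\<gamma> * real w)" using p(1) by (rule mult_left_mono) simp
    then show "real (l * p) \<le> real l * (\<gamma> * real w)" by simp
  qed simp
  finally have r1: "real r \<le> \<gamma> * real l" using w0 by (simp add: mult.commute)
  show "r \<le> l"
  proof -
    have "\<gamma> * real l \<le> 1 * real l" using \<gamma> by (intro mult_right_mono) auto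
    then show ?thesis using r1 by linarith
  qed
  have lw: "real l \<le> real w" using ll(1) w(2) by linarith
  \<comment> \<open>One unit is lost in the integer division by \<open>w\<close>. The other stems
    from rounding \<gamma> \<open>w\<close> down, an error below 1 that is scaled by
    \<open>l / w\<close>, which is at most 1.\<close>
  have r2: "\<gamma> * real l - 2 \<le> real r"
  proof -
    have "real (l * p) < real (w * (l * p div w) + w)"
      using mult_div_mod_eq[of w "l * p"] mod_less_divisor[of w "l * p"] w(1)
      by (simp only: of_nat_less_iff) linarith
    then have "real l * real p < real w * (real r + 1)"
      by (simp add: r p_def algebra_simps)
    moreover have "real l * (\<gamma> * real w - 1) \<le> real l * real p" using p(2) by (intro mult_left_mono) auto
    ultimately have "real l * (\<gamma> * real w - 1) < real w * (real r + 1)" by linarith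
    then have "real w * (\<gamma> * real l) < real w * (real r + 1) + real l" by (simp add: algebra_simps)
    then have "real w * (\<gamma> * real l) < real w * (real r + 2)" using lw by (simp add: algebra_simps)
    then show ?thesis using w0 by simp
  qed
  have "real (2 ^ l) \<le> real n" "real n < real (2 * 2 ^ l)"
    using l by (simp_all only: of_nat_le_iff of_nat_less_iff)
  then have lr: "2 ^ l \<le> real n" "real n \<le> 2 * 2 ^ l" by simp_all
  have Rp: "real R = 2 powr real r" by (simp add: R powr_realpow)
  have "2 powr real r \<le> 2 powr (\<gamma> * real l)" using r1 by simp
  also have "\<dots> = (2 powr real l) powr \<gamma>" by (simp add: powr_powr mult.commute)
  also have "\<dots> \<le> real n powr \<gamma>"
    using lr(1) \<gamma> by (intro powr_mono2) (simp_all add: powr_realpow)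
  finally show R1: "real R \<le> real n powr \<gamma>" using Rp by simp
  have "real n \<le> 2 * 2 powr real l"
    using lr(2) by (simp add: powr_realpow)
  then have "real n powr \<gamma> \<le> (2 * 2 powr real l) powr \<gamma>" using \<gamma> by (intro powr_mono2) auto
  also have "\<dots> = 2 powr \<gamma> * 2 powr (\<gamma> * real l)" by (simp add: powr_mult powr_powr mult.commute)
  also have "\<dots> \<le> 2 powr 1 * (4 * 2 powr real r)"
  proof (intro mult_mono)
    have "2 powr (\<gamma> * real l) \<le> 2 powr (real r + 2)" using r2 by simp
    also have "\<dots> = 4 * 2 powr real r" by (simp add: powr_add)
    finally show "2 powr (\<gamma> * real l) \<le> 4 * 2 powr real r" .
    show "2 powr \<gamma> \<le> 2 powr (1 :: real)" using \<gamma> by (intro powr_mono) auto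
  qed auto
  finally show R2: "real n powr \<gamma> \<le> 8 * real R" using Rp by simp
  have "s * R = 2 ^ l" using \<open>r \<le> l\<close> by (simp add: s R power_add[symmetric])
  then have "real (s * R) = real (2 ^ l)" by (simp only:)
  then have sR: "real s * real R = 2 ^ l" by simp
  have np: "real n powr \<gamma> * real n powr (1 - \<gamma>) = real n" using n0 by (simp add: powr_add[symmetric])
  have pg: "real n powr \<gamma> > 0" using n0 by simp
  have "real n powr \<gamma> * real s \<le> (8 * real R) * real s" using R2 by (intro mult_right_mono) auto
  also have "\<dots> = 8 * 2 ^ l" using sR by (simp add: mult_ac)
  also have "\<dots> \<le> 8 * (real n powr \<gamma> * real n powr (1 - \<gamma>))" using lr np by simp
  finally have "real n powr \<gamma> * real s \<le> real n powr \<gamma> * (8 * real n powr (1 - \<gamma>))" by (simp add: mult_ac)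
  then show "real s \<le> 8 * real n powr (1 - \<gamma>)" using pg by simp
  have "real n powr \<gamma> * real n powr (1 - \<gamma>) \<le> 2 * (real s * real R)" using lr np sR by simp
  also have "\<dots> \<le> 2 * (real s * real n powr \<gamma>)" using R1 by (intro mult_left_mono) auto
  finally have "real n powr \<gamma> * real n powr (1 - \<gamma>) \<le> real n powr \<gamma> * (2 * real s)" by (simp add: mult_ac)
  then show "real n powr (1 - \<gamma>) \<le> 2 * real s" using pg by simp
  have ln2: "2 / 3 \<le> ln (2::real)" "ln (2::real) \<le> 1"
    using ln2_ge_two_thirds ln_le_minus_one[of "2::real"] by auto
  have lg: "log 2 (real n) * ln 2 = ln (real n)" by (simp add: log_def)
  have lg0: "log 2 (real n) \<ge> 0" using ll(1) by linarith
  have "log 2 (real n) * ln 2 \<le> log 2 (real n) * 1" using lg0 ln2 by (intro mult_left_mono) auto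
  then show "ln (real n) \<le> real L" using lg ll by (simp add: L)
  have "log 2 (real n) * (2 / 3) \<le> log 2 (real n) * ln 2" using lg0 ln2 by (intro mult_left_mono) auto
  then have "log 2 (real n) \<le> 3 / 2 * ln (real n)" using lg by simp
  then show "real L \<le> 3 * ln (real n)" using ll a by (simp add: L)
  have s0: "s > 0" by (simp add: s)
  have NCs: "NC * s = n div s * s + s" by (simp add: NC)
  have "n = n div s * s + n mod s" by (rule div_mult_mod_eq[symmetric])
  moreover have "n mod s < s" using s0 by simp
  ultimately show "n \<le> NC * s" unfolding NCs by linarith
  have "s \<le> 2 ^ l" unfolding s by (intro power_increasing) auto
  then have "s \<le> n" using l(1) by linarith
  moreover have "n div s * s \<le> n" by simp
  ultimately show "NC * s \<le> 2 * n" unfolding NCs by linarith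
  have "real n ^ 2 = 2 powr (2 * log 2 (real n))"
    using n0 by (simp add: powr_powr[symmetric] powr_numeral mult.commute[of 2] power2_eq_square powr_add[symmetric] mult_2)
  also have "\<dots> \<le> 2 powr real w" using w(2) by simp
  also have "\<dots> = real (2 ^ w)" by (simp add: powr_realpow)
  finally have "real (n ^ 2) \<le> real (2 ^ w)" by simp
  then show "n ^ 2 \<le> 2 ^ w" by (simp only: of_nat_le_iff)
qed

text \<open>\<open>M\<close> dominates every term of the overhead. The sets have total size about
  n^(2 - \<gamma>) and the triples number about n^(1 + \<gamma>); of the three logarithms, one comes
  from the \<open>L\<close> repetitions and two from the time \<open>H\<close> of hashing a word.
  The last two conclusions keep the exact orders, which the \<Theta> bounds on the instance
  demand.\<close>

lemma monomial_bounds: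
  fixes \<gamma> :: real and n l r s R u U NC L NA Bd :: nat
  assumes \<gamma>: "0 < \<gamma>" "\<gamma> < 1" and a: "1 \<le> ln (real n)"
    and bnd: "r \<le> l" "real R \<le> real n powr \<gamma>" "real s \<le> 8 * real n powr (1 - \<gamma>)" "real L \<le> 3 * ln (real n)" "NC * s \<le> 2 * n"
    and u: "u = 2 * (l - r + 2)" and U: "U = 4 * s" and L: "L = l + 1" and NA: "NA = L * NC * U" and Bd: "Bd = 160 * R"
    and M: "M = ln (real n) ^ 3 * real n powr max (1 + \<gamma>) (2 - \<gamma>)" and H: "H \<le> h * ln (real n) ^ 2" "0 \<le> H"
  shows "1 \<le> M" "real n \<le> M" "real (L * (r + u)) \<le> 36 * M" "real (n * R) \<le> M" "real (L * R) \<le> 3 * M" "real L \<le> 3 * M"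
    "real (L * (R * n)) \<le> 3 * M" "real (L * (R * n)) * H \<le> 3 * h * M" "real (NA * s) \<le> 192 * M"
    "real (NA * s) * H \<le> 192 * h * M" "real NA \<le> 24 * M" "real (n * R) * H \<le> h * M" "real (n * Bd) \<le> 160 * M"
    "real (n * Bd * L) \<le> 480 * M" "real (n * Bd * L) * H \<le> 480 * h * M" "real (s * s) \<le> 64 * M" "real (R * R) \<le> M"
    "real R \<le> M" "real (r + u) \<le> 12 * ln (real n)" "real (n * Bd * L) \<le> 480 * (ln (real n) * real n powr (1 + \<gamma>))"
    "real NA \<le> 24 * (real n * ln (real n))"
proof -
  define b where "b = ln (real n)"
  define y where "y = real n powr \<gamma>"
  define z where "z = real n powr (1 - \<gamma>)"
  define B where "B = real n powr max (1 + \<gamma>) (2 - \<gamma>)"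
  have b: "1 \<le> b" using a by (simp add: b_def)
  have n1: "1 \<le> real n" using a by (cases "n = 0") auto
  have y1: "1 \<le> y" "1 \<le> z" using n1 \<gamma> by (simp_all add: y_def z_def ge_one_powr_ge_zero)
  have yz: "y * z = real n" using n1 by (simp add: y_def z_def powr_add[symmetric])
  have ny: "real n * y \<le> B" "real n * z \<le> B" "real n * y = real n powr (1 + \<gamma>)"
  proof -
    have "real n * y = real n powr (1 + \<gamma>)" "real n * z = real n powr (2 - \<gamma>)"
      using powr_add[of "real n" 1 \<gamma>] powr_add[of "real n" 1 "1 - \<gamma>"] n1 by (simp_all add: y_def z_def)
    moreover have "real n powr (1 + \<gamma>) \<le> B" "real n powr (2 - \<gamma>) \<le> B"
      unfolding B_def by (rule powr_mono[OF max.cobounded1 n1], rule powr_mono[OF max.cobounded2 n1])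
    ultimately show "real n * y \<le> B" "real n * z \<le> B" "real n * y = real n powr (1 + \<gamma>)" by linarith+
  qed
  have nB: "real n \<le> B"
  proof -
    have "real n * 1 \<le> real n * y" using y1 by (intro mult_left_mono) auto
    then show ?thesis using ny(1) by linarith
  qed
  have B1: "1 \<le> B" using nB n1 by linarith
  have yn: "y \<le> real n" "z \<le> real n"
  proof -
    have "y * 1 \<le> y * z" "1 * z \<le> y * z" using y1 by (intro mult_left_mono mult_right_mono; linarith)+
    then show "y \<le> real n" "z \<le> real n" using yz by simp_all
  qed
  have MB: "M = b ^ 3 * B" by (simp add: M b_def B_def)
  have b0: "0 \<le> b" using b by linarith
  have pw: "1 \<le> b ^ 2" "b \<le> b ^ 3" "b ^ 2 \<le> b ^ 3" "1 \<le> b ^ 3"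
  proof -
    show "1 \<le> b ^ 2" "1 \<le> b ^ 3" by (rule one_le_power[OF b])+
    show "b \<le> b ^ 3" using power_increasing[OF _ b, of 1 3] by simp
    show "b ^ 2 \<le> b ^ 3" by (rule power_increasing[OF _ b]) simp
  qed
  have B0: "0 \<le> B" using B1 by linarith
  have BM: "B \<le> M" "b * B \<le> M" "b ^ 2 * B \<le> M"
    using mult_right_mono[OF pw(4) B0] mult_right_mono[OF pw(2) B0] mult_right_mono[OF pw(3) B0]
    unfolding MB by linarith+
  have bM: "b \<le> M" "b ^ 2 \<le> M"
  proof -
    have "b * 1 \<le> b * B" "b ^ 2 * 1 \<le> b ^ 2 * B" using B1 b0 by (intro mult_left_mono; simp)+
    then show "b \<le> M" "b ^ 2 \<le> M" using BM by linarith+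
  qed
  have h: "0 \<le> h"
  proof (rule ccontr)
    assume "\<not> 0 \<le> h"
    then have "h * b ^ 2 < 0" using pw(1) by (intro mult_neg_pos) linarith+
    then show False using H by (simp add: b_def)
  qed
  have Hb: "H \<le> h * b ^ 2" using H by (simp add: b_def)
  have Ry: "real R \<le> y" and sz: "real s \<le> 8 * z" and Lb: "real L \<le> 3 * b" using bnd by (simp_all add: y_def z_def b_def)
  show "1 \<le> M" using B1 BM by linarith
  show "real n \<le> M" using nB BM by linarith
  have nR: "real (n * R) \<le> real n * y" using Ry by (simp add: mult_left_mono)
  then have nRB: "real (n * R) \<le> B" using ny by linarith
  then show "real (n * R) \<le> M" using BM by linarith
  have "real (r + u) \<le> real (4 * L)" unfolding of_nat_le_iff using bnd(1) by (simp add: u L)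
  then have ru: "real (r + u) \<le> 12 * b" using Lb by simp
  then show "real (r + u) \<le> 12 * ln (real n)" by (simp add: b_def)
  have "real L * real (r + u) \<le> (3 * b) * (12 * b)" using Lb ru b by (intro mult_mono) auto
  then show "real (L * (r + u)) \<le> 36 * M" using bM by (simp add: power2_eq_square)
  show "real L \<le> 3 * M" using Lb bM by linarith
  have "real L * real R \<le> (3 * b) * B" using Lb Ry yn nB b by (intro mult_mono) auto
  then show "real (L * R) \<le> 3 * M" using BM by simp
  have LRn: "real (L * (R * n)) \<le> 3 * b * B"
  proof -
    have "real L * real (n * R) \<le> (3 * b) * B" using Lb nRB b by (intro mult_mono) auto
    then show ?thesis by (simp add: mult_ac)
  qed
  then show "real (L * (R * n)) \<le> 3 * M" using BM by simp
  \<comment> \<open>One logarithm in \<open>x\<close> and two in \<open>H\<close> make up the third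
    power in \<open>M\<close>.\<close>
  have HM: "x * H \<le> c * h * M" if "x \<le> c * (b * B)" "0 \<le> c" for x c
  proof -
    have "x * H \<le> (c * (b * B)) * (h * b ^ 2)"
      using that Hb H(2) h b B1 by (intro mult_mono) auto
    then show ?thesis by (simp add: MB power3_eq_cube power2_eq_square mult_ac)
  qed
  show "real (L * (R * n)) * H \<le> 3 * h * M" using HM[of "real (L * (R * n))" 3] LRn by simp
  have NCs: "real (NC * s) \<le> 2 * real n" 
  proof -
    have "real (NC * s) \<le> real (2 * n)" using bnd(5) by (simp only: of_nat_le_iff)
    then show ?thesis by simp
  qed
  have NAb: "real NA \<le> 24 * (real n * b)"
  proof -
    have "real L * real (NC * s) \<le> (3 * b) * (2 * real n)" using Lb NCs b by (intro mult_mono) auto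
    then show ?thesis by (simp add: NA U mult_ac)
  qed
  then show "real NA \<le> 24 * (real n * ln (real n))" by (simp add: b_def)
  have "real n * b \<le> B * b" using nB b by (intro mult_right_mono) auto
  then show "real NA \<le> 24 * M" using NAb BM by (simp add: mult.commute)
  have NAs: "real (NA * s) \<le> 192 * (b * B)"
  proof -
    have "real NA * real s \<le> (24 * (real n * b)) * (8 * z)" using NAb sz b by (intro mult_mono) auto
    also have "\<dots> = 192 * (b * (real n * z))" by simp
    also have "\<dots> \<le> 192 * (b * B)" using ny b by (intro mult_left_mono) auto
    finally show ?thesis by simp
  qed
  then show "real (NA * s) \<le> 192 * M" using BM by linarith
  show "real (NA * s) * H \<le> 192 * h * M" using HM[OF NAs] by simp
  have "B * 1 \<le> B * b" using b B1 by (intro mult_left_mono) auto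
  then show "real (n * R) * H \<le> h * M" using HM[of "real (n * R)" 1] nRB by (simp add: mult.commute)
  have nBd: "real (n * Bd) = 160 * real (n * R)" by (simp add: Bd)
  then show "real (n * Bd) \<le> 160 * M" using nRB BM by linarith
  have nBL: "real (n * Bd * L) \<le> 480 * (b * (real n * y))"
  proof -
    have "real (n * Bd) \<le> 160 * (real n * y)" using nBd nR by linarith
    then have "real (n * Bd) * real L \<le> (160 * (real n * y)) * (3 * b)"
      by (rule mult_mono[OF _ Lb]) (use y1 in simp_all)
    then show ?thesis by (simp add: mult_ac)
  qed
  then show "real (n * Bd * L) \<le> 480 * (ln (real n) * real n powr (1 + \<gamma>))" by (simp only: ny(3) b_def)
  have "b * (real n * y) \<le> b * B" using ny b by (intro mult_left_mono) auto
  then have nBL': "real (n * Bd * L) \<le> 480 * (b * B)" using nBL by linarith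
  then show "real (n * Bd * L) \<le> 480 * M" using BM by linarith
  show "real (n * Bd * L) * H \<le> 480 * h * M" using HM[OF nBL'] by simp
  have "real s * real s \<le> (8 * z) * (8 * z)" using sz y1 by (intro mult_mono) auto
  moreover have "z * z \<le> real n * z" using yn y1 by (intro mult_right_mono) auto
  ultimately show "real (s * s) \<le> 64 * M" using ny BM by simp
  have "real R * real R \<le> real n * y" using Ry yn y1 by (intro mult_mono) auto
  then show "real (R * R) \<le> M" using ny BM by simp
  show "real R \<le> M" using Ry yn nB BM by linarith
qed

lemma limit_bound:
  fixes M :: real and n l r s R u U NC L NA Bd :: nat
  assumes "1 \<le> M" "real n \<le> M" "real (L * (r + u)) \<le> 36 * M" "real (NA * s) \<le> 192 * M" "real NA \<le> 24 * M"
    "real (n * Bd * L) \<le> 480 * M" "real (s * s) \<le> 64 * M" "real (R * R) \<le> M" "real R \<le> M"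
    and U: "U = 4 * s" and Bd: "Bd = 160 * R" and M: "2700 * M < (real n)\<^sup>2" and w: "n ^ 2 \<le> 2 ^ w"
  shows "4 + 2 * (NA * (s + 1)) + 2 * (n * Bd * L) + U * U + Bd + (2 * R + 2) * (2 * R + 2) + L * (r + u) + n < 2 ^ w"
proof -
  have eq: "4 + 2 * (NA * (s + 1)) + 2 * (n * Bd * L) + U * U + Bd + (2 * R + 2) * (2 * R + 2) + L * (r + u) + n =
      8 + 2 * (NA * s) + 2 * NA + 2 * (n * Bd * L) + 16 * (s * s) + Bd + 4 * (R * R) + 8 * R + L * (r + u) + n"
    by (simp add: U algebra_simps)
  have "real (8 + 2 * (NA * s) + 2 * NA + 2 * (n * Bd * L) + 16 * (s * s) + Bd + 4 * (R * R) + 8 * R + L * (r + u) + n) =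
    8 + 2 * real (NA * s) + 2 * real NA + 2 * real (n * Bd * L) + 16 * real (s * s) + 160 * real R + 4 * real (R * R) +
      8 * real R + real (L * (r + u)) + real n"
    by (simp add: Bd)
  \<comment> \<open>The coefficients add up to 2633.\<close>
  also have "\<dots> \<le> 2700 * M" using assms by linarith
  also have "\<dots> < real (n ^ 2)" using M by simp
  also have "\<dots> \<le> real (2 ^ w)" using w by (simp only: of_nat_le_iff)
  finally show ?thesis unfolding eq by (simp only: of_nat_less_iff)
qed

context params
begin

text \<open>Brute force takes at most 70 n^3 steps. Because \<open>n < 2 ^ L\<close>, the factor n^3
  is cancelled by \<open>(1 / 8) ^ L\<close> and also by \<open>(1 / 16) ^ L\<close>. What remains
  of the union bound over triples and tries is proportional to \<open>n * Bd * L\<close>, which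
  \<open>M\<close> covers.\<close>

lemma expected_cost_bound:
  fixes \<gamma> h :: real
  assumes \<gamma>: "0 < \<gamma>" "\<gamma> < 1" and a: "1 \<le> ln (real n)" and bnd: "real R \<le> real n powr \<gamma>"
    "real s \<le> 8 * real n powr (1 - \<gamma>)" "real L \<le> 3 * ln (real n)" "NC * s \<le> 2 * n"
    and H: "real (HC w (r + u)) \<le> h * ln (real n) ^ 2"
  shows "real T_det + real (T_brute n) * avg (2 ^ w) (L * (r + u)) (\<lambda>v. of_bool (bad_coins v))
     \<le> (900 * h + 200000) * (ln (real n) ^ 3 * real n powr max (1 + \<gamma>) (2 - \<gamma>))"
proof -
  define M where "M = ln (real n) ^ 3 * real n powr max (1 + \<gamma>) (2 - \<gamma>)"
  note m = monomial_bounds[OF \<gamma> a r_le bnd u U L NA Bd M_def H of_nat_0_le_iff]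
  let ?H = "HC w (r + u)"
  interpret h: hashing w n l r s R u U NC L NA Bd xs P "\<lambda>_. 0" by (rule hashing)
  have h0: "0 \<le> h * M"
    using m(12) by (rule order.trans[rotated]) simp
  have "T_pre = 20 * n + 20 * (L * (r + u)) + (L * (R * n)) * ?H + 40 * (L * (R * n)) + 100 * (L * R) + 120 * L + 300"
    by (simp add: T_pre_def algebra_simps)
  then have "real T_pre = 20 * real n + 20 * real (L * (r + u)) + real (L * (R * n)) * real ?H + 40 * real (L * (R * n)) +
      100 * real (L * R) + 120 * real L + 300" by simp
  then have pre: "real T_pre \<le> 3 * (h * M) + 2000 * M" using m by linarith
  have "h.T_build = 2 * ((NA * s) * ?H) + 120 * (NA * s) + 240 * NA + (n * R) * ?H + 120 * (n * R) + 60 * (n * Bd) +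
      (n * Bd * L) * ?H + 160 * (n * Bd * L) + 420"
    by (simp add: h.T_build_def h.H_def algebra_simps)
  then have "real h.T_build = 2 * (real (NA * s) * real ?H) + 120 * real (NA * s) + 240 * real NA + real (n * R) * real ?H + 120 * real (n * R) +
      60 * real (n * Bd) + real (n * Bd * L) * real ?H + 160 * real (n * Bd * L) + 420" by simp
  then have build: "real h.T_build \<le> 865 * (h * M) + 120000 * M" using m by linarith
  have "real h.T_check = 50 * real (n * Bd * L) + 60 * real (s * s) + 100" by (simp add: h.T_check_def)
  then have check: "real h.T_check \<le> 28000 * M" using m by linarith
  have "real T_det = real T_pre + real h.T_build + real h.T_check + 50" by (simp add: T_det_def)
  then have det: "real T_det \<le> 868 * (h * M) + 150050 * M" using pre build check m(1) by linarith
  have n1: "1 \<le> n" using pos(8) by simp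
  have brute: "real (T_brute n) \<le> 70 * real n ^ 3"
  proof -
    have "n * n \<le> n * (n * n)" "n \<le> n * (n * n)" "1 \<le> n * (n * n)" using n1 by auto
    moreover have "T_brute n = 30 * (n * (n * n)) + 15 * (n * n) + 15 * n + 10" by (simp add: T_brute_def algebra_simps)
    ultimately have "T_brute n \<le> 70 * (n * (n * n))" by linarith
    then have "real (T_brute n) \<le> real (70 * (n * (n * n)))" by (simp only: of_nat_le_iff)
    then show ?thesis by (simp add: power3_eq_cube)
  qed
  have n2: "real n \<le> 2 ^ L"
  proof -
    have "n \<le> 2 ^ L" using l(2) by (simp add: L)
    then have "real n \<le> real (2 ^ L)" by (simp only: of_nat_le_iff)
    then show ?thesis by simp
  qed
  have p3: "real n ^ 3 * (1 / 8) ^ L \<le> 1"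
  proof -
    have "real n ^ 3 \<le> (2 ^ L) ^ 3" using n2 by (intro power_mono) auto
    also have "\<dots> = (8::real) ^ L" by (simp add: power_mult[symmetric] mult.commute[of L] power_mult)
    finally have "real n ^ 3 \<le> 8 ^ L" .
    then show ?thesis by (simp add: power_one_over divide_simps)
  qed
  have p4: "real n ^ 3 * (1 / 16) ^ L \<le> 1"
  proof -
    have "(1 / 16 :: real) ^ L \<le> (1 / 8) ^ L" by (intro power_mono) auto
    then have "real n ^ 3 * (1 / 16) ^ L \<le> real n ^ 3 * (1 / 8) ^ L" by (intro mult_left_mono) auto
    then show ?thesis using p3 by linarith
  qed
  let ?A = "avg (2 ^ w) (L * (r + u)) (\<lambda>v. of_bool (bad_coins v))"
  have A0: "0 \<le> ?A" by (intro avg_nonneg) auto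
  have "real (T_brute n) * ?A \<le> (70 * real n ^ 3) * ((1 / 8) ^ L + real L * (real (n * Bd) * (1 / 16) ^ L))"
    using brute avg_bad_coins A0 by (intro mult_mono) auto
  also have "\<dots> = 70 * (real n ^ 3 * (1 / 8) ^ L) + 70 * real (n * Bd * L) * (real n ^ 3 * (1 / 16) ^ L)"
    by (simp add: algebra_simps)
  also have "\<dots> \<le> 70 * 1 + 70 * real (n * Bd * L) * 1"
    using p3 p4 by (intro add_mono mult_left_mono) auto
  also have "\<dots> \<le> 40000 * M" using m by linarith
  finally have "real T_det + real (T_brute n) * ?A \<le> 868 * (h * M) + 190050 * M" using det by linarith
  also have "\<dots> \<le> 900 * (h * M) + 200000 * M" using h0 m(1) by linarith
  finally show ?thesis by (simp add: M_def algebra_simps)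
qed

end

lemma eventually_polylog_le:
  fixes \<beta> \<beta>' C \<kappa> :: real
  assumes "\<beta> < \<beta>'" "0 < \<kappa>"
  shows "eventually (\<lambda>n. C * (ln (real n) ^ 3 * real n powr \<beta>) \<le> \<kappa> * real n powr \<beta>') sequentially"
proof -
  have "((\<lambda>x. C * (ln x ^ 3 * x powr (\<beta> - \<beta>'))) \<longlongrightarrow> 0) at_top"
    using assms by real_asymp
  then have "eventually (\<lambda>x. C * (ln x ^ 3 * x powr (\<beta> - \<beta>')) < \<kappa>) at_top"
    using assms(2) by (rule order_tendstoD)
  then have "eventually (\<lambda>n. C * (ln (real n) ^ 3 * real n powr (\<beta> - \<beta>')) < \<kappa>) sequentially"
    by (rule eventually_compose_filterlim[OF _ filterlim_real_sequentially])
  then show ?thesis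
    using eventually_gt_at_top[of 0]
  proof eventually_elim
    case (elim n)
    then have "C * (ln (real n) ^ 3 * real n powr (\<beta> - \<beta>')) * real n powr \<beta>' \<le> \<kappa> * real n powr \<beta>'"
      by (intro mult_right_mono) auto
    moreover have "real n powr (\<beta> - \<beta>') * real n powr \<beta>' = real n powr \<beta>" using elim by (simp add: powr_add[symmetric])
    ultimately show ?case by (simp add: mult.assoc)
  qed
qed

text \<open>A polynomial bound on the word length makes the number of folding rounds logarithmic in
  n.\<close>

lemma word_length_klog:
  assumes "word_length W"
  obtains D where "0 \<le> D" "eventually (\<lambda>n. real (klog (W n)) \<le> D * ln (real n)) sequentially"
proof -
  obtain d where "(\<lambda>n. real (W n)) \<in> O(\<lambda>n. real n ^ d)" using assms by (auto simp: word_length_def)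
  then obtain c0 where c0: "eventually (\<lambda>n. norm (real (W n)) \<le> c0 * norm (real n ^ d)) sequentially"
    by (elim landau_o.bigE) auto
  \<comment> \<open>A constant of at least 1 has a nonnegative logarithm, so it can be absorbed into
    a multiple of \<open>ln (real n)\<close>.\<close>
  define c where "c = max c0 1"
  define D where "D = 1 + log 2 c + 3 / 2 * real d"
  have lc: "0 \<le> log 2 c" by (simp add: c_def)
  have "eventually (\<lambda>n. real (klog (W n)) \<le> D * ln (real n)) sequentially"
    using c0 eventually_ge_at_top[of 3]
  proof eventually_elim
    case (elim n)
    have n3: "real n \<ge> 3" using elim by simp
    have "exp 1 \<le> real n" using exp_le n3 by linarith
    then have a: "1 \<le> ln (real n)" using n3 by (simp add: ln_ge_iff)
    show ?case
    proof (cases "klog (W n) = 0")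
      case True
      then show ?thesis using a lc by (simp add: D_def)
    next
      case False
      then have lt: "2 ^ (klog (W n) - 1) < W n" using klog(2) by simp
      have "real (2 ^ (klog (W n) - 1)) < real (W n)" using lt by (simp only: of_nat_less_iff)
      also have "\<dots> \<le> c0 * real n ^ d" using elim by simp
      also have "\<dots> \<le> c * real n ^ d" by (intro mult_right_mono) (auto simp: c_def)
      finally have "2 powr (real (klog (W n) - 1)) < c * real n ^ d" by (simp add: powr_realpow)
      then have "log 2 (2 powr (real (klog (W n) - 1))) < log 2 (c * real n ^ d)"
        by (intro log_less) auto
      also have "log 2 (c * real n ^ d) = log 2 c + real d * log 2 (real n)"
        using n3 by (simp add: log_mult log_nat_power c_def)
      finally have k: "real (klog (W n) - 1) < log 2 c + real d * log 2 (real n)" by simp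
      have "log 2 (real n) * (2 / 3) \<le> log 2 (real n) * ln 2"
        using ln2_ge_two_thirds n3 by (intro mult_left_mono) auto
      moreover have "log 2 (real n) * ln 2 = ln (real n)" by (simp add: log_def)
      ultimately have "log 2 (real n) \<le> 3 / 2 * ln (real n)" by linarith
      then have "real d * log 2 (real n) \<le> real d * (3 / 2 * ln (real n))" by (rule mult_left_mono) simp
      moreover have "(1 + log 2 c) * 1 \<le> (1 + log 2 c) * ln (real n)" using a lc by (intro mult_left_mono) auto
      ultimately show ?thesis using k False by (simp add: D_def algebra_simps)
    qed
  qed
  moreover have "0 \<le> D" using lc by (simp add: D_def)
  ultimately show ?thesis using that by blast
qed

text \<open>Replaces a subtraction: \<open>T\<close> may be infinite, but the finite
  \<open>x\<close> that dominates the overhead can be cancelled.\<close>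

lemma add_mono_cancel_ennreal:
  fixes x :: real and T :: ennreal
  assumes "ennreal (2 * x) \<le> ennreal y + T" "y \<le> x" "0 \<le> x"
  shows "ennreal x \<le> T"
proof -
  have "ennreal x + ennreal x = ennreal (2 * x)" using assms(3) by (simp add: ennreal_plus[symmetric] del: ennreal_plus)
  also have "\<dots> \<le> ennreal x + T" using assms(1,2) by (meson add_right_mono ennreal_leI order.trans)
  finally show ?thesis by (simp add: ennreal_add_left_cancel_le)
qed

theorem theorem12:
  fixes W :: "nat \<Rightarrow> nat" and f :: "nat \<Rightarrow> real"
  assumes "word_length W"
    and "subpolynomial f"
    and "requires_expected_time W three_xor (\<lambda>n. (real n)\<^sup>2 / f n)"
  shows "\<forall>\<gamma>::real. 0 < \<gamma> \<and> \<gamma> < 1 \<longrightarrow>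
    (\<exists>K\<^sub>0\<ge>1. \<forall>K\<ge>K\<^sub>0.
      requires_expected_time W (set_disjointness \<gamma> K) (\<lambda>n. (real n)\<^sup>2 / f n))"
proof (intro allI impI, elim conjE)
  fix \<gamma> :: real
  assume \<gamma>: "0 < \<gamma>" "\<gamma> < 1"
  define \<beta> where "\<beta> = max (1 + \<gamma>) (2 - \<gamma>)"
  have \<beta>: "\<beta> < 2" using \<gamma> by (simp add: \<beta>_def)
  define M where "M = (\<lambda>n. ln (real n) ^ 3 * real n powr \<beta>)"
  define P where "P = (\<lambda>w. nat \<lfloor>\<gamma> * real w\<rfloor>)"
  obtain D where D: "0 \<le> D" "eventually (\<lambda>n. real (klog (W n)) \<le> D * ln (real n)) sequentially"
    using word_length_klog[OF assms(1)] by blast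
  have wl: "eventually (\<lambda>n. 2 * log 2 (real n) \<le> real (W n)) sequentially"
    using assms(1) by (simp add: word_length_def)
  \<comment> \<open>The constant is the one that rules out overflow. The factor 1/2 leaves room for
    the strict inequality required later.\<close>
  have "eventually (\<lambda>n. 2700 * M n \<le> 1 / 2 * real n powr 2) sequentially"
    unfolding M_def by (rule eventually_polylog_le[OF \<beta>]) simp
  with D(2) wl eventually_ge_at_top[of 16]
  have "eventually (\<lambda>n. real (klog (W n)) \<le> D * ln (real n) \<and> 2 * log 2 (real n) \<le> real (W n) \<and> 16 \<le> n \<and>
      2700 * M n \<le> 1 / 2 * real n powr 2) sequentially" by eventually_elim simp
  then obtain n0 where n0: "\<And>n. n0 \<le> n \<Longrightarrow> real (klog (W n)) \<le> D * ln (real n) \<and> 2 * log 2 (real n) \<le> real (W n) \<and> 16 \<le> n \<and>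
      2700 * M n \<le> 1 / 2 * real n powr 2" unfolding eventually_sequentially by blast
  \<comment> \<open>Hashing uses at most 12 ln n bits, each costing \<open>40 * D\<close> ln n + 50
    steps, plus 20 steps; since ln n is at least 1, the lower terms contribute 600 + 20.\<close>
  define h where "h = 480 * D + 620"
  show "\<exists>K\<^sub>0\<ge>1. \<forall>K\<ge>K\<^sub>0. requires_expected_time W (set_disjointness \<gamma> K) (\<lambda>n. (real n)\<^sup>2 / f n)"
  \<comment> \<open>The largest constant arises for the universe: \<open>U * U\<close> is 16
    \<open>s^2\<close>, and \<open>s\<close> is at most 8 n^(1 - \<gamma>), which gives 16 * 64 =
    1024.\<close>
  proof (intro exI[of _ 1024] conjI allI impI)
    fix K :: real assume K: "1024 \<le> K"
    show "requires_expected_time W (set_disjointness \<gamma> K) (\<lambda>n. (real n)\<^sup>2 / f n)"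
      unfolding requires_expected_time_def
    proof (intro allI impI)
      fix c assume c: "solves W (set_disjointness \<gamma> K) c"
      let ?T = "worst_expected_time W (set_disjointness \<gamma> K) c"
      define p where "p = reduce n0 P c"
      have large: "(AE X in tape_space (W n). \<exists>t s'. exec (W n) p (init_state (n # xs) X) t s' \<and> mem s' 1 0 = xor_answer xs) \<and>
          expected_time (W n) p (n # xs) \<le> ennreal ((900 * h + 200000) * M n) + ?T n"
        if n: "n0 < n" and xs: "length xs = n" "distinct xs" "set xs \<subseteq> {..<2 ^ W n}" for n xs
      proof -
        let ?w = "W n"
        have k: "real (klog ?w) \<le> D * ln (real n)" and w2: "2 * log 2 (real n) \<le> real ?w" and n16: "16 \<le> n"
          and Mn: "2700 * M n \<le> 1 / 2 * real n powr 2" using n0[of n] n by auto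
        have npos: "real n > 0" using n16 by simp
        have a: "1 \<le> ln (real n)"
        proof -
          have "exp 1 \<le> real n" using exp_le n16 by linarith
          then show ?thesis using npos by (simp add: ln_ge_iff)
        qed
        have w8: "8 \<le> ?w"
        proof -
          have "4 \<le> log 2 (real n)" using n16 npos by (simp add: le_log_iff powr_numeral)
          then show ?thesis using w2 by linarith
        qed
        have "1 \<le> n" using n16 by simp
        then obtain l where l: "2 ^ l \<le> n" "n < 2 * 2 ^ l" using ex_power_ivl1[of 2 n] by auto
        define r where "r = l * P ?w div ?w"
        define s where "s = (2::nat) ^ (l - r)"
        define R where "R = (2::nat) ^ r"
        define u where "u = 2 * (l - r + 2)"
        define U where "U = 4 * s"
        define NC where "NC = n div s + 1"
        define L where "L = l + 1"
        define NA where "NA = L * NC * U"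
        define Bd where "Bd = 160 * R"
        have rP: "r = l * nat \<lfloor>\<gamma> * real ?w\<rfloor> div ?w" by (simp add: r_def P_def)
        note pb = parameter_bounds[OF \<gamma> l a w8 w2 rP s_def R_def NC_def L_def]
        have HCb: "real (HC ?w (r + u)) \<le> h * ln (real n) ^ 2"
        proof -
          \<comment> \<open>The number of hash bits has to be bounded before the time of hashing, so
            the estimates are first used with 0 for this time.\<close>
          have "real (r + u) \<le> 12 * ln (real n)"
            by (rule monomial_bounds(19)[OF \<gamma> a pb(1,2,4,7,9) u_def U_def L_def NA_def Bd_def refl, of 0 0]) simp_all
          moreover have "real (klog ?w) * 40 + 50 \<le> 40 * D * ln (real n) + 50" using k by simp
          ultimately have "real (r + u) * (real (klog ?w) * 40 + 50) \<le> (12 * ln (real n)) * (40 * D * ln (real n) + 50)"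
            using a D(1) by (intro mult_mono) auto
          also have "\<dots> = 480 * D * ln (real n) ^ 2 + 600 * ln (real n)" by (simp add: algebra_simps power2_eq_square)
          finally have "real (HC ?w (r + u)) \<le> 480 * D * ln (real n) ^ 2 + 600 * ln (real n) + 20"
            by (simp add: HC_def)
          moreover have "ln (real n) * 1 \<le> ln (real n) * ln (real n)" using a by (intro mult_left_mono) auto
          ultimately show ?thesis using a unfolding h_def power2_eq_square distrib_right by linarith
        qed
        note mb = monomial_bounds[OF \<gamma> a pb(1,2,4,7,9) u_def U_def L_def NA_def Bd_def _ HCb of_nat_0_le_iff, of "M n"]
        have MM: "M n = ln (real n) ^ 3 * real n powr max (1 + \<gamma>) (2 - \<gamma>)" by (simp add: M_def \<beta>_def)
        note mb = mb[OF MM]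
        have M2: "2700 * M n < (real n)\<^sup>2"
        proof -
          have "real n powr 2 = (real n)\<^sup>2" using npos by (simp add: powr_numeral)
          moreover have "0 < (real n)\<^sup>2" using npos by simp
          ultimately show ?thesis using Mn by linarith
        qed
        have limit: "4 + 2 * (NA * (s + 1)) + 2 * (n * Bd * L) + U * U + Bd + (2 * R + 2) * (2 * R + 2) + L * (r + u) + n < 2 ^ ?w"
          by (rule limit_bound[OF mb(1,2,3,9,11,14,16,17,18) U_def Bd_def M2 pb(11)])
        interpret params ?w n l r s R u U NC L NA Bd xs P
        proof
          show "P ?w \<le> ?w" using pb(10) by (simp add: P_def)
        qed (fact xs l pb(1) r_def w8 s_def R_def u_def U_def NC_def L_def NA_def Bd_def limit)+
        \<comment> \<open>Acceptance is what puts the instance into the promised class: it bounds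
          the number of queries from above. All other sizes hold for every hash function.\<close>
        have inst: "(sd_call rw b, sd_answers rw b) \<in> instances W (set_disjointness \<gamma> K) n"
          if good: "good_at rw b" for rw b
        proof -
          interpret h: hashing ?w n l r s R u U NC L NA Bd xs P rw by (rule hashing)
          have y0: "0 \<le> real n powr x" for x by simp
          have sz: "16 * (real s * real s) = real (U * U)" by (simp add: U_def)
          have pw: "real n powr (2 - 2 * \<gamma>) = real n powr (1 - \<gamma>) * real n powr (1 - \<gamma>)"
            by (simp add: powr_add[symmetric])
          have up: "x \<le> K * y" if "x \<le> 1024 * y" "0 \<le> y" for x y :: real
          proof -
            have "1024 * y \<le> K * y" using K that(2) by (intro mult_right_mono) auto
            then show ?thesis using that(1) by linarith
          qed
          have low: "y / K \<le> x" if "y \<le> 1024 * x" "0 \<le> x" for x y :: real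
            using up[of y x] that K by (simp add: divide_le_eq mult.commute)
          have t1: "theta_within K (real (U * U)) (real n powr (2 - 2 * \<gamma>))"
            unfolding theta_within_def
          proof (intro conjI up low)
            have "real n powr (1 - \<gamma>) * real n powr (1 - \<gamma>) \<le> (2 * real s) * (2 * real s)" using pb(5) by (intro mult_mono) auto
            moreover have "0 \<le> real s * real s" by simp
            ultimately show "real n powr (2 - 2 * \<gamma>) \<le> 1024 * real (U * U)" unfolding sz[symmetric] pw by linarith
            have "real s * real s \<le> (8 * real n powr (1 - \<gamma>)) * (8 * real n powr (1 - \<gamma>))" using pb(4) by (intro mult_mono) auto
            then show "real (U * U) \<le> 1024 * real n powr (2 - 2 * \<gamma>)" unfolding sz[symmetric] pw by linarith
          qed simp_all
          have t2: "theta_within K (real NA) (real n * ln (real n))"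
            unfolding theta_within_def
          proof (intro conjI up low)
            have n0': "0 \<le> real n * ln (real n)" using a by simp
            show "real NA \<le> 1024 * (real n * ln (real n))" using mb(21) n0' by linarith
            have "ln (real n) * real n \<le> real L * real (NC * s)"
              using pb(6,8) a by (intro mult_mono) (simp_all only: of_nat_le_iff of_nat_0_le_iff)
            also have "\<dots> \<le> 1024 * real NA" by (simp add: NA_def U_def)
            finally show "real n * ln (real n) \<le> 1024 * real NA" by (simp add: mult.commute)
            show "0 \<le> real n * ln (real n)" by (rule n0')
          qed simp
          have t3: "theta_within K (real (h.NP b * L)) (real n powr (1 + \<gamma>) * ln (real n))"
            unfolding theta_within_def
          proof (intro conjI up low)
            have n1: "real n powr (1 + \<gamma>) = real n * real n powr \<gamma>" using npos by (simp add: powr_add)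
            show p0: "0 \<le> real n powr (1 + \<gamma>) * ln (real n)" using a by simp
            have "h.NP b * L \<le> n * Bd * L" using h.NP_le[OF good] by (intro mult_right_mono) auto
            then have "real (h.NP b * L) \<le> real (n * Bd * L)" by (simp only: of_nat_le_iff)
            then show "real (h.NP b * L) \<le> 1024 * (real n powr (1 + \<gamma>) * ln (real n))"
              using mb(20) p0 by (simp add: mult.commute)
            have "n * R * L \<le> h.NP b * L" using h.NP_ge by (intro mult_right_mono) auto
            then have low1: "real (n * R * L) \<le> real (h.NP b * L)" by (simp only: of_nat_le_iff)
            have "(real n * real n powr \<gamma>) * ln (real n) \<le> (real n * (8 * real R)) * real L"
              using pb(3,6) a by (intro mult_mono) auto
            also have "\<dots> = 8 * real (n * R * L)" by simp
            finally show "real n powr (1 + \<gamma>) * ln (real n) \<le> 1024 * real (h.NP b * L)"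
              using low1 of_nat_0_le_iff[of "h.NP b * L"] unfolding n1 by linarith
          qed simp
          have t4: "real (card (set S)) \<le> K * real n powr (1 - \<gamma>)" if "S \<in> set (h.sd_As b) \<union> set (h.sd_Bs b)" for S
          proof (rule up)
            have "real (card (set S)) \<le> real s" using h.sd_sizes[OF that] by (simp only: of_nat_le_iff)
            then show "real (card (set S)) \<le> 1024 * real n powr (1 - \<gamma>)" using pb(4) y0[of "1 - \<gamma>"] by linarith
          qed simp
          have "(sd_call rw b, sd_answers rw b) \<in> set_disjointness \<gamma> K n ?w"
            unfolding set_disjointness_def sd_call_def sd_answers_def
            by (rule CollectI, rule exI[of _ "U * U"], rule exI[of _ "h.sd_As b"], rule exI[of _ "h.sd_Bs b"],
                rule exI[of _ "h.sd_Qs b"]) (use h.sd_instance t1 t2 t3 t4 in simp)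
          then show ?thesis using h.fits_sd_input[OF good] by (simp add: instances_def sd_call_def)
        qed
        have correct: "AE \<omega> in tape_space ?w. \<exists>\<tau> s1. exec ?w c (init_state (sd_call rw b) \<omega>) \<tau> s1 \<and> mem s1 1 \<in> sd_answers rw b"
          if "good_at rw b" for rw b
          using c inst[OF that] unfolding solves_def by fastforce
        have time: "expected_time ?w c (sd_call rw b) \<le> ?T n" if "good_at rw b" for rw b
          unfolding worst_expected_time_def by (rule SUP_upper2[OF inst[OF that]]) simp
        note red = reduce_expectation[OF n correct time]
        have "real T_det + real (T_brute n) * avg (2 ^ ?w) (L * (r + u)) (\<lambda>v. of_bool (bad_coins v)) \<le> (900 * h + 200000) * M n"
          unfolding MM by (rule expected_cost_bound[OF \<gamma> a pb(2,4,7,9) HCb])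
        then have "expected_time ?w p (n # xs) \<le> ennreal ((900 * h + 200000) * M n) + ?T n"
          using red(2) unfolding p_def by (meson add_right_mono ennreal_leI order.trans)
        then show ?thesis using red(1) by (simp add: p_def)
      qed
      have "solves W three_xor p"
        unfolding solves_def
      proof (intro allI ballI, clarify)
        fix n ys outs assume "(ys, outs) \<in> instances W three_xor n"
        then obtain xs where xs: "ys = n # xs" "length xs = n" "distinct xs" "set xs \<subseteq> {..<2 ^ W n}"
          and fit: "fits (W n) (n # xs)" and outs: "outs = {out. out 0 = xor_answer xs}"
          by (auto simp: instances_def three_xor_def xor_answer_def)
        have "AE X in tape_space (W n). \<exists>t s'. exec (W n) p (init_state (n # xs) X) t s' \<and> mem s' 1 0 = xor_answer xs"
        \<comment> \<open>Up to the threshold the word length is related to n only by the input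
          fitting into words, so these sizes are solved by brute force.\<close>
        proof (cases "n0 < n")
          case False
          have "n < 2 ^ W n" using fit by (simp add: fits_def)
          then show ?thesis unfolding p_def using reduce_small[OF xs(2), of "W n" n0 P c] False
            by (intro AE_I2) (meson not_less)
        qed (use large xs in blast)
        then show "AE X in tape_space (W n). \<exists>t s'. exec (W n) p (init_state ys X) t s' \<and> mem s' 1 \<in> outs"
          by (simp add: xs(1) outs)
      qed
      then have "lower_bound (worst_expected_time W three_xor p) (\<lambda>n. (real n)\<^sup>2 / f n)"
        using assms(3) by (simp add: requires_expected_time_def)
      then obtain k where k: "k > 0" "eventually (\<lambda>n. ennreal (k * ((real n)\<^sup>2 / f n)) \<le> worst_expected_time W three_xor p n) sequentially"
        by (auto simp: lower_bound_def)
      obtain e where e: "e \<longlonglongrightarrow> 0" "eventually (\<lambda>n. f n = real n powr e n) sequentially"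
        using assms(2) by (auto simp: subpolynomial_def)
      \<comment> \<open>Half the gap between \<beta> and 2. The other half absorbs the logarithms of
        the overhead, while f eventually stays below n^\<epsilon>.\<close>
      define \<epsilon> where "\<epsilon> = (2 - \<beta>) / 2"
      have \<epsilon>: "0 < \<epsilon>" "\<beta> < 2 - \<epsilon>" using \<beta> by (simp_all add: \<epsilon>_def field_simps)
      have "eventually (\<lambda>n. e n < \<epsilon>) sequentially" using e(1) \<epsilon>(1) by (rule order_tendstoD)
      \<comment> \<open>The overhead may consume half of the lower bound for 3XOR; the other half
        remains for the call.\<close>
      moreover have "eventually (\<lambda>n. (900 * h + 200000) * M n \<le> k / 2 * real n powr (2 - \<epsilon>)) sequentially"
        unfolding M_def by (rule eventually_polylog_le[OF \<epsilon>(2)]) (use k in simp)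
      ultimately have "eventually (\<lambda>n. ennreal (k / 2 * ((real n)\<^sup>2 / f n)) \<le> ?T n) sequentially"
        using k(2) e(2) eventually_gt_at_top[of n0] eventually_gt_at_top[of 0]
      proof eventually_elim
        case (elim n)
        have worst: "worst_expected_time W three_xor p n \<le> ennreal ((900 * h + 200000) * M n) + ?T n"
          unfolding worst_expected_time_def[of W three_xor]
        proof (rule SUP_least, clarify)
          fix ys outs assume "(ys, outs) \<in> instances W three_xor n"
          then obtain xs where "ys = n # xs" "length xs = n" "distinct xs" "set xs \<subseteq> {..<2 ^ W n}"
            by (auto simp: instances_def three_xor_def)
          then show "expected_time (W n) p ys \<le> ennreal ((900 * h + 200000) * M n) + ?T n"
            using large[of n xs] elim by simp
        qed
        have n1: "1 \<le> real n" using elim by simp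
        have "(real n)\<^sup>2 / f n = real n powr (2 - e n)"
          using elim by (simp add: powr_diff powr_numeral)
        moreover have "real n powr (2 - \<epsilon>) \<le> real n powr (2 - e n)" using n1 elim by (intro powr_mono) auto
        ultimately have ge: "real n powr (2 - \<epsilon>) \<le> (real n)\<^sup>2 / f n" by simp
        then have "k / 2 * real n powr (2 - \<epsilon>) \<le> k / 2 * ((real n)\<^sup>2 / f n)" using k(1) by (intro mult_left_mono) auto
        then have le: "(900 * h + 200000) * M n \<le> k / 2 * ((real n)\<^sup>2 / f n)" using elim by linarith
        have nn: "0 \<le> k / 2 * ((real n)\<^sup>2 / f n)"
        proof -
          have "0 \<le> (real n)\<^sup>2 / f n" using ge by (rule order.trans[rotated]) simp
          then show ?thesis using k(1) by (intro mult_nonneg_nonneg) auto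
        qed
        have "ennreal (2 * (k / 2 * ((real n)\<^sup>2 / f n))) \<le> ennreal ((900 * h + 200000) * M n) + ?T n"
          using elim worst by (simp add: order.trans)
        then show ?case using le nn by (rule add_mono_cancel_ennreal)
      qed
      then show "lower_bound ?T (\<lambda>n. (real n)\<^sup>2 / f n)"
        unfolding lower_bound_def using k(1) by (intro exI[of _ "k / 2"]) simp
    qed
  qed simp
qed

end
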